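(* Let $q\in L^1(\mathbb{R}_+)$ be complex-valued, $\alpha\in\mathbb{C}\cup\{\infty\}$, $k>0$ and $\lambda=k^2$. Let $\Phi_1,\Phi_2$ be the $\mathbb{C}^2$-valued solutions of $-\epsilon F''+QF=\lambda F$ with Cauchy data $L_\alpha(\Phi_j)=-e_j$, $L_\alpha^\perp(\Phi_j)=0$, $j=1,2$, and for a choice of Jost solutions $\mathbf{F}_{\pm1}=\mathbf{F}_{\pm1}(\cdot,k)$, $\mathbf{F}_{\pm\mathrm{i}}=\mathbf{F}_{\pm\mathrm{i}}(\cdot,k)$ (which form a basis of the solution space) write $$\Phi_j=\gamma^{j}_{-1}\mathbf{F}_{-1}+\gamma^{j}_{+\mathrm{i}}\mathbf{F}_{+\mathrm{i}}+\gamma^{j}_{-\mathrm{i}}\mathbf{F}_{-\mathrm{i}}+\gamma^{j}_{+1}\mathbf{F}_{+1},\qquad j=1,2,$$ with complex coefficients. Below, "unambiguously defined" means independent of the choice of the Jost solutions $\mathbf{F}_{+\mathrm{i}},\mathbf{F}_{-\mathrm{i}},\mathbf{F}_{+1}$. Let $(\nu,\psi)$ be the spectral pair of $H(q,\alpha)$. (i) Assume $\lambda$ is not an eigenvalue of $\mathbf{H}$. Then $\gamma_{+1}^2=-\overline{\gamma_{+1}^1}\neq0$, and the expression $\gamma_{+1}^2\gamma_{+\mathrm{i}}^1-\gamma_{+1}^1\gamma_{+\mathrm{i}}^2$ is unambiguously defined and non-zero. Moreover, $$\frac{\mathrm{d}\nu}{\mathrm{d}\lambda}(\lambda)=\frac1{8\pi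 k}\,\frac{|\gamma_{+1}^1|^2}{|\gamma_{+1}^2\gamma_{+\mathrm{i}}^1-\gamma_{+1}^1\gamma_{+\mathrm{i}}^2|^2},\qquad \psi(\lambda)=\frac{\overline{\gamma_{+1}^1}}{\gamma_{+1}^1}.$$ (ii) Assume $\lambda$ is an eigenvalue of $\mathbf{H}$. Then $\gamma_{+1}^1=\gamma_{+1}^2=0$, the coefficients $\gamma_{\pm\mathrm{i}}^1,\gamma_{\pm\mathrm{i}}^2$ are unambiguously defined, $$|\gamma_{+\mathrm{i}}^1|=|\gamma_{-\mathrm{i}}^1|=|\gamma_{+\mathrm{i}}^2|=|\gamma_{-\mathrm{i}}^2|\neq0,\qquad \gamma_{+\mathrm{i}}^2=\overline{\gamma_{-\mathrm{i}}^1},\qquad \gamma_{-\mathrm{i}}^2=\overline{\gamma_{+\mathrm{i}}^1}.$$ The expression $\gamma_{-1}^1\gamma_{-\mathrm{i}}^2-\gamma_{-\mathrm{i}}^1\gamma_{-1}^2$ is unambiguously defined and non-zero. Moreover, $$\nu(\{\lambda\})=\frac{1}{2\|\mathbf{e}\|^2}\,\frac{|\gamma_{+\mathrm{i}}^1|^2}{|\gamma_{-1}^1\gamma_{-\mathrm{i}}^2-\gamma_{-\mathrm{i}}^1\gamma_{-1}^2|^2},\qquad \psi(\lambda)=-\frac{\gamma_{-\mathrm{i}}^2}{\gamma_{-\mathrm{i}}^1},$$ where $\mathbf{e}=\mathbf{e}(\cdot,k)$ is the scalar Jost solution and $\|\cdot\|$ is the norm of $L^2(\mathbb{R}_+)$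.
   Context: **Basic notation.** $\mathbb{R}_+=(0,\infty)$; $\overline{\infty}=\infty$; $e_1=(1,0)^T$, $e_2=(0,1)^T$, $e_+=(1,1)^T$, $e_-=(1,-1)^T$; $\epsilon=\begin{pmatrix}0&1\\1&0\end{pmatrix}$, $Q=\begin{pmatrix}0&q\\ \overline q&0\end{pmatrix}$. Solutions of differential equations are functions that together with their first derivative are locally absolutely continuous on $[0,\infty)$ and satisfy the equation a.e. **Boundary functionals.** For scalar $f$: if $\alpha\neq\infty$, $\ell_\alpha(f)=\frac{\overline\alpha f'(0)-f(0)}{\sqrt{1+|\alpha|^2}}$, $\ell_\alpha^\perp(f)=\frac{f'(0)+\alpha f(0)}{\sqrt{1+|\alpha|^2}}$; if $\alpha=\infty$, $\ell_\alpha(f)=f'(0)$, $\ell_\alpha^\perp(f)=f(0)$. For $F=(F_1,F_2)^T$: $L_\alpha(F)=(\ell_{\overline\alpha}(F_1),\ell_\alpha(F_2))^T$, $L_\alpha^\perp(F)=(\ell^\perp_{\overline\alpha}(F_1),\ell^\perp_\alpha(F_2))^T$; these act on $2\times2$ matrix-valued functions column by column. **Operators.** $H=H(q,\alpha)$ acts in $L^2(\mathbb{R}_+)$ by $Hf=-f''+qf$ on the domain of all $f\in L^2(\mathbb{R}_+)$ with $f,f'$ (locally) absolutely continuous, $-f''+qf\in L^2(\mathbb{R}_+)$ and $\ell^\perp_\alpha(f)=0$ (such $f$ extend to $C^1$ functions on $[0,\infty)$). $H$ is closed and densely defined and $H(q,\alpha)^*=H(\overline q,\overline\alpha)$. The hermitisation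 $\mathbf{H}=\begin{pmatrix}0&H\\H^*&0\end{pmatrix}$ on $\mathrm{Dom}\,H^*\oplus\mathrm{Dom}\,H$ is self-adjoint in $L^2(\mathbb{R}_+;\mathbb{C}^2)$; it acts as $\mathbf{H}F=-\epsilon F''+QF$ with boundary condition $L_\alpha^\perp(F)=0$. **Spectral pair.** Let $\Phi(\cdot,\lambda),\Theta(\cdot,\lambda)$ be the $2\times2$ matrix-valued solutions of $-\epsilon F''+QF=\lambda F$ with $L_\alpha(\Phi)=-I$, $L_\alpha^\perp(\Phi)=0$, $L_\alpha(\Theta)=0$, $L_\alpha^\perp(\Theta)=\epsilon$ (so $\Phi_1,\Phi_2$ are the columns of $\Phi$). For every $\lambda\in\mathbb{C}\setminus\mathbb{R}$ there is a unique $2\times2$ matrix $M_\alpha(\lambda)$ such that both columns of $\Theta(\cdot,\lambda)-\Phi(\cdot,\lambda)M_\alpha(\lambda)$ are in $L^2(\mathbb{R}_+;\mathbb{C}^2)$. $M_\alpha$ is a matrix Herglotz–Nevanlinna function, so $M_\alpha(\lambda)=\mathrm{Re}\,M_\alpha(\mathrm{i})+\int_{\mathbb{R}}\bigl(\frac1{t-\lambda}-\frac{t}{1+t^2}\bigr)\mathrm{d}\Sigma(t)$, $\mathrm{Im}\,\lambda>0$, with a unique $2\times2$ matrix-valued measure $\Sigma$ on $\mathbb{R}$ (here $\mathrm{Re}\,M=\frac12(M+M^* )$). It has the structure $\mathrm{d}\Sigma=\begin{pmatrix}1&\psi\\ \overline\psi&1\end{pmatrix}\mathrm{d}\nu$,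 where $\nu$ is an even positive measure on $\mathbb{R}$ and $\psi\in L^\infty(\nu)$ is odd with $|\psi|\le1$ $\nu$-a.e. The pair $(\nu,\psi)$ is the spectral pair of $H$. On $(0,\infty)$ away from the eigenvalues of $\mathbf{H}$ (which can accumulate only at $0$), $\Sigma$ is absolutely continuous with a continuous density; pointwise values of $\mathrm{d}\nu/\mathrm{d}\lambda$ and $\psi$ there refer to this continuous version, i.e. $\frac{\mathrm{d}\Sigma}{\mathrm{d}\lambda}(\lambda)=\begin{pmatrix}1&\psi(\lambda)\\ \overline{\psi(\lambda)}&1\end{pmatrix}\frac{\mathrm{d}\nu}{\mathrm{d}\lambda}(\lambda)$. **Jost solutions.** For $k>0$, a Jost solution $\mathbf{F}_{\pm1}(\cdot,k)$ is a $\mathbb{C}^2$-valued solution of $-\epsilon F''+QF=k^2F$ with $F(x)=\mathrm{e}^{\pm kx}e_-+o(\mathrm{e}^{\pm kx})$, $F'(x)=\pm k\mathrm{e}^{\pm kx}e_-+o(\mathrm{e}^{\pm kx})$ as $x\to\infty$, and a Jost solution $\mathbf{F}_{\pm\mathrm{i}}(\cdot,k)$ is a solution with $F(x)=\mathrm{e}^{\pm\mathrm{i}kx}e_++o(1)$, $F'(x)=\pm\mathrm{i}k\mathrm{e}^{\pm\mathrm{i}kx}e_++o(1)$. All four exist; $\mathbf{F}_{-1}$ is unique, while the other three are not uniquely determined by these conditions. The scalar Jost solution $\mathbf{e}(\cdot,k)$ is the unique solution of the anti-linear equation $-\mathbf{e}''+q\mathbf{e}=-k^2\overline{\mathbf{e}}$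 with $\mathbf{e}(x,k)=\mathrm{e}^{-kx}+o(\mathrm{e}^{-kx})$ as $x\to\infty$. *)

theory Defs
  imports "HOL-Analysis.Analysis" "HOL-Library.Landau_Symbols"
begin

text \<open>
  The half-line is \<open>(0,\<infinity>) = {0<..}\<close> with Lebesgue measure. Functions on it are modelled as total
  functions on \<^typ>\<open>real\<close>; their values at negative arguments are never used. Vectors in
  \<open>\<complex>\<^sup>2\<close> are of type \<^typ>\<open>complex^2\<close>, with components \<open>$ 1\<close> and \<open>$ 2\<close>.
\<close>

abbreviation halfline :: "real measure" where
  "halfline \<equiv> lebesgue_on {0<..}"

definition L2 :: "(real \<Rightarrow> 'a::real_normed_vector) set" where
  "L2 = {f. f \<in> borel_measurable halfline \<and> integrable halfline (\<lambda>x. (norm (f x))\<^sup>2)}"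

definition L2_inner :: "(real \<Rightarrow> complex) \<Rightarrow> (real \<Rightarrow> complex) \<Rightarrow> complex" where
  "L2_inner f g = (LINT x|halfline. f x * cnj (g x))"

definition L2_norm :: "(real \<Rightarrow> complex) \<Rightarrow> real" where
  "L2_norm f = sqrt (LINT x|halfline. (norm (f x))\<^sup>2)"


text \<open>
  Absolute continuity on \<open>[a,b]\<close>, by the usual \<open>\<epsilon>\<close>-\<open>\<delta>\<close> definition; a finite family of
  non-overlapping closed subintervals is a division of its union.
\<close>

definition absolutely_continuous_on_interval ::
    "real \<Rightarrow> real \<Rightarrow> (real \<Rightarrow> 'a::real_normed_vector) \<Rightarrow> bool" where
  "absolutely_continuous_on_interval a b f \<longleftrightarrow>
     (\<forall>\<epsilon>>0. \<exists>\<delta>>0. \<forall>\<D>. \<D> division_of \<Union>\<D> \<and> \<Union>\<D> \<subseteq> {a..b} \<and> (\<Sum>I\<in>\<D>. measure lborel I) < \<delta>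
        \<longrightarrow> (\<Sum>I\<in>\<D>. norm (f (Sup I) - f (Inf I))) < \<epsilon>)"

definition locally_absolutely_continuous :: "(real \<Rightarrow> 'a::real_normed_vector) \<Rightarrow> bool" where
  "locally_absolutely_continuous f \<longleftrightarrow> (\<forall>b\<ge>0. absolutely_continuous_on_interval 0 b f)"

text \<open>Derivative on \<open>[0,\<infinity>)\<close>, one-sided at \<open>0\<close>.\<close>

definition hderiv :: "(real \<Rightarrow> 'a::real_normed_vector) \<Rightarrow> real \<Rightarrow> 'a" where
  "hderiv f x = vector_derivative f (at x within {0..})"

definition regular :: "(real \<Rightarrow> 'a::real_normed_vector) \<Rightarrow> bool" where
  "regular f \<longleftrightarrow> (\<forall>x\<ge>0. f differentiable (at x within {0..})) \<and>
     locally_absolutely_continuous f \<and> locally_absolutely_continuous (hderiv f)"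


definition e_plus :: "complex^2" where "e_plus = vector [1, 1]"

definition e_minus :: "complex^2" where "e_minus = vector [1, -1]"

definition eps_mat :: "complex^2^2" where
  "eps_mat = vector [vector [0, 1], vector [1, 0]]"

definition Q_mat :: "(real \<Rightarrow> complex) \<Rightarrow> real \<Rightarrow> complex^2^2" where
  "Q_mat q x = vector [vector [0, q x], vector [cnj (q x), 0]]"

definition solution :: "(real \<Rightarrow> complex) \<Rightarrow> complex \<Rightarrow> (real \<Rightarrow> complex^2) \<Rightarrow> bool" where
  "solution q l F \<longleftrightarrow> regular F \<and>
     (AE x in halfline. \<exists>F2. (hderiv F has_vector_derivative F2) (at x) \<and>
        - (eps_mat *v F2) + Q_mat q x *v F x = l *s F x)"


text \<open>Boundary parameters: elements of \<open>\<complex> \<union> {\<infinity>}\<close>.\<close>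

datatype bparam = Fin complex | Infty

fun cnj_bparam :: "bparam \<Rightarrow> bparam" where
  "cnj_bparam (Fin a) = Fin (cnj a)"
| "cnj_bparam Infty = Infty"

fun ell :: "bparam \<Rightarrow> (real \<Rightarrow> complex) \<Rightarrow> complex" where
  "ell (Fin a) f = (cnj a * hderiv f 0 - f 0) / complex_of_real (sqrt (1 + (cmod a)\<^sup>2))"
| "ell Infty f = hderiv f 0"

fun ell_perp :: "bparam \<Rightarrow> (real \<Rightarrow> complex) \<Rightarrow> complex" where
  "ell_perp (Fin a) f = (hderiv f 0 + a * f 0) / complex_of_real (sqrt (1 + (cmod a)\<^sup>2))"
| "ell_perp Infty f = f 0"

definition L_bd :: "bparam \<Rightarrow> (real \<Rightarrow> complex^2) \<Rightarrow> complex^2" where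
  "L_bd \<alpha> F = vector [ell (cnj_bparam \<alpha>) (\<lambda>x. F x $ 1), ell \<alpha> (\<lambda>x. F x $ 2)]"

definition L_bd_perp :: "bparam \<Rightarrow> (real \<Rightarrow> complex^2) \<Rightarrow> complex^2" where
  "L_bd_perp \<alpha> F = vector [ell_perp (cnj_bparam \<alpha>) (\<lambda>x. F x $ 1), ell_perp \<alpha> (\<lambda>x. F x $ 2)]"


text \<open>
  Operators in \<open>L\<^sup>2\<close> are given by their graphs, with functions standing for their almost-everywhere
  classes. Elements of the domain of \<open>H(q,\<alpha>)\<close> are represented by their \<open>C\<^sup>1\<close> extensions to
  \<open>[0,\<infinity>)\<close>; as \<open>q\<close> is integrable, these have a derivative that is absolutely continuous up to \<open>0\<close>.
\<close>

definition H_op :: "(real \<Rightarrow> complex) \<Rightarrow> bparam \<Rightarrow> ((real \<Rightarrow> complex) \<times> (real \<Rightarrow> complex)) set" where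
  "H_op q \<alpha> = {(f, h). f \<in> L2 \<and> h \<in> L2 \<and> regular f \<and> ell_perp \<alpha> f = 0 \<and>
     (AE x in halfline. \<exists>f2. (hderiv f has_vector_derivative f2) (at x) \<and> h x = - f2 + q x * f x)}"

definition adjoint_op ::
    "((real \<Rightarrow> complex) \<times> (real \<Rightarrow> complex)) set \<Rightarrow> ((real \<Rightarrow> complex) \<times> (real \<Rightarrow> complex)) set" where
  "adjoint_op T = {(g, h). g \<in> L2 \<and> h \<in> L2 \<and> (\<forall>(f, u)\<in>T. L2_inner u g = L2_inner f h)}"

text \<open>The block operator with off-diagonal entries \<open>T\<close> and \<open>T\<^sup>*\<close>, on \<open>Dom T\<^sup>* \<oplus> Dom T\<close>.\<close>

definition hermitisation ::
    "((real \<Rightarrow> complex) \<times> (real \<Rightarrow> complex)) set \<Rightarrow> ((real \<Rightarrow> complex^2) \<times> (real \<Rightarrow> complex^2)) set" where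
  "hermitisation T = {(F, G). ((\<lambda>x. F x $ 2), (\<lambda>x. G x $ 1)) \<in> T \<and>
     ((\<lambda>x. F x $ 1), (\<lambda>x. G x $ 2)) \<in> adjoint_op T}"

definition op_eigenvalue ::
    "((real \<Rightarrow> complex^2) \<times> (real \<Rightarrow> complex^2)) set \<Rightarrow> complex \<Rightarrow> bool" where
  "op_eigenvalue T l \<longleftrightarrow>
     (\<exists>F. (F, (\<lambda>x. l *s F x)) \<in> T \<and> \<not> (AE x in halfline. F x = 0))"


text \<open>
  \<open>M\<close> is the value at the non-real point \<open>l\<close> of the matrix Weyl function. The solutions \<open>\<Phi>\<close> and \<open>\<Theta>\<close>
  are determined on \<open>[0,\<infinity>)\<close> by their Cauchy data.
\<close>

definition weyl_matrix :: "(real \<Rightarrow> complex) \<Rightarrow> bparam \<Rightarrow> complex \<Rightarrow> complex^2^2 \<Rightarrow> bool" where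
  "weyl_matrix q \<alpha> l M \<longleftrightarrow> (\<exists>\<Phi> \<Theta> :: real \<Rightarrow> complex^2^2.
     (\<forall>j. solution q l (\<lambda>x. column j (\<Phi> x)) \<and>
          L_bd \<alpha> (\<lambda>x. column j (\<Phi> x)) = - axis j 1 \<and>
          L_bd_perp \<alpha> (\<lambda>x. column j (\<Phi> x)) = 0) \<and>
     (\<forall>j. solution q l (\<lambda>x. column j (\<Theta> x)) \<and>
          L_bd \<alpha> (\<lambda>x. column j (\<Theta> x)) = 0 \<and>
          L_bd_perp \<alpha> (\<lambda>x. column j (\<Theta> x)) = column j eps_mat) \<and>
     (\<forall>j. (\<lambda>x. column j (\<Theta> x - \<Phi> x ** M)) \<in> L2))"

definition weyl_function :: "(real \<Rightarrow> complex) \<Rightarrow> bparam \<Rightarrow> (complex \<Rightarrow> complex^2^2) \<Rightarrow> bool" where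
  "weyl_function q \<alpha> M \<longleftrightarrow> (\<forall>l. l \<notin> \<real> \<longrightarrow> weyl_matrix q \<alpha> l (M l))"

definition mat_Re :: "complex^2^2 \<Rightarrow> complex^2^2" where
  "mat_Re A = (\<chi> i j. (A $ i $ j + cnj (A $ j $ i)) / 2)"

definition psi_mat :: "complex \<Rightarrow> complex^2^2" where
  "psi_mat p = vector [vector [1, p], vector [cnj p, 1]]"

text \<open>
  The matrix-valued measure \<open>d\<Sigma>\<close> of the Herglotz-Nevanlinna representation is
  \<open>psi_mat (\<psi> t) d\<nu>(t)\<close>. Integrability of \<open>1/(1+t\<^sup>2)\<close> makes all the integrals below converge.
\<close>

definition spectral_pair ::
    "(real \<Rightarrow> complex) \<Rightarrow> bparam \<Rightarrow> real measure \<Rightarrow> (real \<Rightarrow> complex) \<Rightarrow> bool" where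
  "spectral_pair q \<alpha> \<nu> \<psi> \<longleftrightarrow>
     sets \<nu> = sets borel \<and> distr \<nu> borel uminus = \<nu> \<and>
     \<psi> \<in> borel_measurable borel \<and>
     (AE t in \<nu>. \<psi> (- t) = - \<psi> t) \<and> (AE t in \<nu>. cmod (\<psi> t) \<le> 1) \<and>
     integrable \<nu> (\<lambda>t. 1 / (1 + t\<^sup>2)) \<and>
     (\<exists>M. weyl_function q \<alpha> M \<and>
        (\<forall>l. Im l > 0 \<longrightarrow> (\<forall>i j. M l $ i $ j = mat_Re (M \<i>) $ i $ j +
           (LINT t|\<nu>. (1 / (complex_of_real t - l) - complex_of_real (t / (1 + t\<^sup>2))) *
              psi_mat (\<psi> t) $ i $ j))))"

text \<open>
  Near \<open>l\<close>, the measure \<open>d\<Sigma> = psi_mat (\<psi> t) d\<nu>(t)\<close> has a continuous density with respect to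
  Lebesgue measure, whose value at \<open>l\<close> is \<open>d \<cdot> psi_mat p\<close>. So \<open>d\<close> and, for \<open>d \<noteq> 0\<close>, \<open>p\<close> are the
  pointwise values at \<open>l\<close> of the continuous versions of \<open>d\<nu>/d\<lambda>\<close> and \<open>\<psi>\<close>.
\<close>

definition has_spectral_density_at ::
    "real measure \<Rightarrow> (real \<Rightarrow> complex) \<Rightarrow> real \<Rightarrow> real \<Rightarrow> complex \<Rightarrow> bool" where
  "has_spectral_density_at \<nu> \<psi> l d p \<longleftrightarrow>
     (\<exists>U (S :: real \<Rightarrow> complex^2^2). open U \<and> l \<in> U \<and> continuous_on U S \<and>
        (\<forall>B\<in>sets borel. bounded B \<and> B \<subseteq> U \<longrightarrow> (\<forall>i j.
           set_integrable lborel B (\<lambda>t. S t $ i $ j) \<and>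
           (LINT t:B|\<nu>. psi_mat (\<psi> t) $ i $ j) = (LINT t:B|lborel. S t $ i $ j))) \<and>
        S l = d *\<^sub>R psi_mat p)"


text \<open>
  \<open>F(x) = exp(wkx) v + o(|exp(wkx)|)\<close> and \<open>F'(x) = wk exp(wkx) v + o(|exp(wkx)|)\<close> as \<open>x \<rightarrow> \<infinity>\<close>. The four kinds of Jost solutions
  are \<open>w = \<plusminus>1\<close> with \<open>v = e_minus\<close> and \<open>w = \<plusminus>\<i>\<close> with \<open>v = e_plus\<close>.
\<close>

definition jost_solution ::
    "(real \<Rightarrow> complex) \<Rightarrow> real \<Rightarrow> complex \<Rightarrow> complex^2 \<Rightarrow> (real \<Rightarrow> complex^2) \<Rightarrow> bool" where
  "jost_solution q k w v F \<longleftrightarrow> solution q (complex_of_real (k\<^sup>2)) F \<and>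
     (\<lambda>x. norm (F x - exp (w * k * x) *s v)) \<in> o[at_top](\<lambda>x. cmod (exp (w * k * x))) \<and>
     (\<lambda>x. norm (hderiv F x - (w * k * exp (w * k * x)) *s v)) \<in> o[at_top](\<lambda>x. cmod (exp (w * k * x)))"

definition jost_choice :: "(real \<Rightarrow> complex) \<Rightarrow> real \<Rightarrow> (real \<Rightarrow> complex^2) \<Rightarrow> (real \<Rightarrow> complex^2) \<Rightarrow>
    (real \<Rightarrow> complex^2) \<Rightarrow> (real \<Rightarrow> complex^2) \<Rightarrow> bool" where
  "jost_choice q k Fm1 Fpi Fmi Fp1 \<longleftrightarrow>
     jost_solution q k (-1) e_minus Fm1 \<and> jost_solution q k \<i> e_plus Fpi \<and>
     jost_solution q k (-\<i>) e_plus Fmi \<and> jost_solution q k 1 e_minus Fp1"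

definition has_coeffs :: "(real \<Rightarrow> complex^2) \<Rightarrow> (real \<Rightarrow> complex^2) \<Rightarrow> (real \<Rightarrow> complex^2) \<Rightarrow>
    (real \<Rightarrow> complex^2) \<Rightarrow> (real \<Rightarrow> complex^2) \<Rightarrow> complex \<Rightarrow> complex \<Rightarrow> complex \<Rightarrow> complex \<Rightarrow> bool" where
  "has_coeffs Fm1 Fpi Fmi Fp1 F cm1 cpi cmi cp1 \<longleftrightarrow>
     (\<forall>x\<ge>0. F x = cm1 *s Fm1 x + cpi *s Fpi x + cmi *s Fmi x + cp1 *s Fp1 x)"

definition scalar_jost :: "(real \<Rightarrow> complex) \<Rightarrow> real \<Rightarrow> (real \<Rightarrow> complex) \<Rightarrow> bool" where
  "scalar_jost q k e \<longleftrightarrow> regular e \<and>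
     (AE x in halfline. \<exists>e2. (hderiv e has_vector_derivative e2) (at x) \<and>
        - e2 + q x * e x = - complex_of_real (k\<^sup>2) * cnj (e x)) \<and>
     (\<lambda>x. cmod (e x - exp (- k * x))) \<in> o[at_top](\<lambda>x. exp (- k * x))"

end

theory Submission
  imports Defs
begin

text \<open>
  The Wronskian form \<open>W\<close> is constant on pairs of solutions at conjugate spectral parameters and takes explicit
  values on the Jost solutions, so all coefficients are values of \<open>W\<close>; the involution \<open>sharp\<close> (swap the components and
  conjugate) exchanges \<open>\<Phi> 1\<close> and \<open>\<Phi> 2\<close> and gives the symmetries.

  If \<open>\<gamma>p1 1 \<noteq> 0\<close>, solutions of type \<open>exp (- \<kappa>x)\<close> and \<open>exp (\<i>\<kappa>x)\<close>, \<open>\<kappa>\<^sup>2 = l\<close>, that are continuous in \<open>l\<close> up to the real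
  axis show that the Weyl function has continuous boundary values near \<open>k\<^sup>2\<close>. Stieltjes inversion turns them into the
  density, whose value at \<open>k\<^sup>2\<close> is a Wronskian of the limiting Weyl solutions.

  If \<open>\<gamma>p1 1 = 0\<close>, a multiple of \<open>Fm1\<close> satisfies the boundary condition. The atom at \<open>k\<^sup>2\<close> is the limit of \<open>-\<i>yM(k\<^sup>2 + \<i>y)\<close>;
  Fatou's lemma for the rescaled Weyl solutions bounds it on one side and Green's formula on the other.

  An eigenfunction is orthogonal to all functions obtained from compactly supported elements of the domain. The latter are
  built by variation of constants from the four given Jost solutions: they inherit second derivatives almost everywhere
  from these, which avoids the Lebesgue differentiation theorem. Hence an eigenfunction is a combination of \<open>\<Phi> 1\<close> and \<open>\<Phi> 2\<close>.
\<close>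

section \<open>Absolutely continuous functions as integrals\<close>

text \<open>The hypotheses speak of derivatives almost everywhere, the argument of integrals. They
  meet in \<open>ipair\<close>: a single gauge argument turns absolute continuity into an indefinite
  integral, and from then on products, exponentials and Green's formula are identities between
  integrals. The way back is needed only for functions that must lie in the domain of
  \<open>H_op\<close>. Independence of the Jost solutions has one source: two oscillating Jost
  solutions of the same type differ by a multiple of \<open>Fm1\<close>, and the oscillating
  coefficients in the claim are read off from solutions whose pairing with \<open>Fm1\<close>
  vanishes. Two obstacles shape the analysis. At real points a Weyl solution need not be square
  integrable, so its limit cannot be characterised by integrability; it is followed through families
  given by an integral equation that stays uniform up to the real axis. At an eigenvalue the
  rescaled Weyl solutions converge only pointwise and mass could escape to infinity, which is why
  one inequality is not enough.\<close>

lemma constant_by_small_increments: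
  fixes D :: "real => 'a::real_normed_vector" and M :: "real => real"
  assumes "a \<le> b"
    and inc: "\<And>e. e > 0 ==> \<exists>d>0. \<forall>s t. a \<le> s \<longrightarrow> s \<le> t \<longrightarrow> t \<le> b \<longrightarrow> t - s < d \<longrightarrow>
                 norm (D t - D s) \<le> e * (M t - M s)"
  shows "D b = D a"
proof (rule ccontr)
  assume neq: "D b \<noteq> D a"
  \<comment> \<open>Increments add up along an equidistant partition of mesh below \<open>d\<close>,
    and so do their bounds \<open>e * (M t - M s)\<close>.\<close>
  have main: "norm (D b - D a) \<le> e * (M b - M a)" if "e > 0" for e
  proof -
    obtain d where d: "d > 0" "\<And>s t. a \<le> s ==> s \<le> t ==> t \<le> b ==> t - s < d ==>
                 norm (D t - D s) \<le> e * (M t - M s)"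
      using inc[OF \<open>e > 0\<close>] by metis
    obtain n :: nat where n: "(b - a) / d < real n" using reals_Archimedean2 by blast
    have n0: "real n > 0" using n d(1) assms(1) by (smt (verit) divide_nonneg_pos)
    define p where "p i = a + (b - a) * (real i / real n)" for i
    have step: "norm (D (p i) - D a) \<le> e * (M (p i) - M a)" if "i \<le> n" for i
      using that
    proof (induction i)
      case 0 then show ?case by (simp add: p_def)
    next
      case (Suc i)
      have diff: "p (Suc i) - p i = (b - a) / real n"
        using n0 by (simp add: p_def field_simps)
      have "(b - a) / real n < d" using n n0 d(1) by (simp add: field_simps)
      moreover have "a \<le> p i" using assms(1) n0 by (simp add: p_def)
      moreover have "p i \<le> p (Suc i)" using diff assms(1) n0 by (smt (verit) divide_nonneg_pos)
      moreover have "p (Suc i) \<le> b"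
      proof -
        have "(b - a) * (real (Suc i) / real n) \<le> (b - a) * 1"
          using Suc.prems n0 assms(1) by (intro mult_left_mono) (auto simp: field_simps)
        then show ?thesis by (simp add: p_def)
      qed
      ultimately have "norm (D (p (Suc i)) - D (p i)) \<le> e * (M (p (Suc i)) - M (p i))"
        using d(2) diff by simp
      moreover have "norm (D (p (Suc i)) - D a) \<le> norm (D (p (Suc i)) - D (p i)) + norm (D (p i) - D a)"
        by (metis diff_add_cancel add_diff_eq norm_triangle_ineq)
      ultimately show ?case using Suc by (simp add: algebra_simps)
    qed
    from step[of n] show ?thesis using n0 by (simp add: p_def)
  qed
  define N where "N = norm (D b - D a)"
  have pos: "N > 0" using neq by (simp add: N_def)
  \<comment> \<open>With this divisor the estimate bounds the increment by half of itself; the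
    summand 1 covers the case \<open>M b = M a\<close>.\<close>
  have m1: "\<bar>M b - M a\<bar> + 1 > 0" by (simp add: add_nonneg_pos)
  have "N \<le> N / (2 * (\<bar>M b - M a\<bar> + 1)) * (M b - M a)"
    unfolding N_def by (rule main) (use pos m1 in \<open>simp add: N_def\<close>)
  also have "\<dots> \<le> N / (2 * (\<bar>M b - M a\<bar> + 1)) * (\<bar>M b - M a\<bar> + 1)"
    by (intro mult_left_mono) (use pos m1 in auto)
  also have "\<dots> = N / 2"
    using m1 by (metis less_numeral_extra(3) mult.commute nonzero_mult_divide_mult_cancel_right times_divide_eq_left)
  finally have "N \<le> N / 2" .
  then show False using pos by simp
qed

text \<open>Henstock's argument. At good tags the gauge is a ball on which the derivative
  approximates the increments. At tags in \<open>N\<close> it is an open set around \<open>N\<close>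
  of measure below the \<delta> of absolute continuity, so the increments over intervals tagged
  there are negligible together. Integrability of \<open>g\<close> comes out of the argument instead
  of going into it.\<close>

lemma absolutely_continuous_has_integral:
  fixes f :: "real => 'a::real_normed_vector"
  assumes ac: "absolutely_continuous_on_interval a b f" and ab: "a \<le> b"
    and N: "negligible N"
    and der: "\<And>x. x \<in> {a..b} - N ==> (f has_vector_derivative g x) (at x within {a..b})"
  shows "(g has_integral (f b - f a)) {a..b}"
proof -
  define g' where "g' x = (if x \<in> N then 0 else g x)" for x
  have "(g' has_integral (f b - f a)) {a..b}"
    unfolding has_integral_real
  proof (intro allI impI)
    fix e :: real assume e: "e > 0"
    define e1 where "e1 = e / (2 * (b - a + 1))"
    have e1: "e1 > 0" using e ab by (simp add: e1_def)
    obtain \<delta> where \<delta>: "\<delta> > 0" "\<And>\<D>. \<D> division_of \<Union>\<D> ==> \<Union>\<D> \<subseteq> {a..b} ==> (\<Sum>I\<in>\<D>. measure lborel I) < \<delta>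
        ==> (\<Sum>I\<in>\<D>. norm (f (Sup I) - f (Inf I))) < e / 2"
      using ac[unfolded absolutely_continuous_on_interval_def, rule_format, of "e / 2"] e by auto
    have Nnull: "N \<in> null_sets lebesgue" using N negligible_iff_null_sets by blast
    obtain T where T: "open T" "N \<subseteq> T" "(T - N) \<in> lmeasurable" "emeasure lebesgue (T - N) < ennreal \<delta>"
      using sets_lebesgue_outer_open[OF _ \<delta>(1)] Nnull by blast
    have TN: "T = (T - N) \<union> N" using T(2) by auto
    have Tlm: "T \<in> lmeasurable"
      using TN fmeasurable.Un[OF T(3)] negligible_imp_measurable[OF N] by metis
    have "emeasure lebesgue T = emeasure lebesgue (T - N)"
      using emeasure_Un_null_set[OF fmeasurableD[OF T(3)] Nnull] TN by simp
    then have Tm: "measure lebesgue T < \<delta>"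
      using T(4) emeasure_eq_measure2[OF Tlm] by (metis ennreal_less_iff measure_nonneg)
    have "\<exists>d>0. \<forall>y\<in>{a..b}. \<bar>y - x\<bar> < d \<longrightarrow> norm (f y - f x - (y - x) *\<^sub>R g x) \<le> e1 * \<bar>y - x\<bar>"
      if "x \<in> {a..b} - N" for x
      using der[OF that] e1 unfolding has_vector_derivative_def has_derivative_within_alt
      by (auto simp: algebra_simps)
    then obtain d where d: "\<And>x. x \<in> {a..b} - N ==> d x > 0"
      "\<And>x y. x \<in> {a..b} - N ==> y \<in> {a..b} ==> \<bar>y - x\<bar> < d x ==>
          norm (f y - f x - (y - x) *\<^sub>R g x) \<le> e1 * \<bar>y - x\<bar>"
      by metis
    define \<gamma> where "\<gamma> x = (if x \<in> N then T else if x \<in> {a..b} then ball x (d x) else ball x 1)" for x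
    have gauge: "gauge \<gamma>"
      using T(1,2) d(1) unfolding gauge_def \<gamma>_def by auto
    have approx: "norm ((\<Sum>(x,k)\<in>p. measure lborel k *\<^sub>R g' x) - (f b - f a)) < e"
      if p: "p tagged_division_of {a..b}" and fine: "\<gamma> fine p" for p
    proof -
      have finp: "finite p" using p by blast
      define p1 where "p1 = {(x,K). (x,K) \<in> p \<and> x \<in> N}"
      define p2 where "p2 = {(x,K). (x,K) \<in> p \<and> x \<notin> N}"
      have pp: "p = p1 \<union> p2" "p1 \<inter> p2 = {}" "finite p1" "finite p2" "p1 \<subseteq> p" "p2 \<subseteq> p"
        using finp by (auto simp: p1_def p2_def intro: finite_subset[OF _ finp])
      define \<Delta> where "\<Delta> K = f (Sup K) - f (Inf K)" for K
      have tele: "f b - f a = (\<Sum>(x,K)\<in>p. \<Delta> K)"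
        using additive_tagged_division_1[OF ab p, of f] by (simp add: \<Delta>_def)
      have "norm ((\<Sum>(x,k)\<in>p. measure lborel k *\<^sub>R g' x) - (f b - f a))
          = norm (\<Sum>(x,K)\<in>p. measure lborel K *\<^sub>R g' x - \<Delta> K)"
        unfolding tele by (simp add: sum_subtractf case_prod_unfold)
      also have "\<dots> \<le> (\<Sum>(x,K)\<in>p. norm (measure lborel K *\<^sub>R g' x - \<Delta> K))"
        by (rule order_trans[OF norm_sum]) (simp add: case_prod_unfold)
      also have "\<dots> = (\<Sum>(x,K)\<in>p1. norm (measure lborel K *\<^sub>R g' x - \<Delta> K)) + (\<Sum>(x,K)\<in>p2. norm (measure lborel K *\<^sub>R g' x - \<Delta> K))"
        by (subst pp(1)) (rule sum.union_disjoint[OF pp(3,4,2)])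
      also have "(\<Sum>(x,K)\<in>p1. norm (measure lborel K *\<^sub>R g' x - \<Delta> K)) = (\<Sum>(x,K)\<in>p1. norm (\<Delta> K))"
        by (rule sum.cong) (auto simp: p1_def g'_def)
      also have "(\<Sum>(x,K)\<in>p1. norm (\<Delta> K)) < e / 2"
      proof -
        have tp: "p1 tagged_partial_division_of {a..b}"
          using p pp(5) tagged_partial_division_subset unfolding tagged_division_of_def by blast
        have td: "p1 tagged_division_of \<Union>(snd ` p1)"
          using tagged_partial_division_of_Union_self[OF tp] .
        have dv: "snd ` p1 division_of \<Union>(snd ` p1)" using division_of_tagged_division[OF td] .
        have sub: "\<Union>(snd ` p1) \<subseteq> {a..b}" using tp unfolding tagged_partial_division_of_def by fastforce
        have subT: "\<Union>(snd ` p1) \<subseteq> T"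
          using fine pp(5) unfolding fine_def p1_def \<gamma>_def by fastforce
        have "(\<Sum>I\<in>snd ` p1. measure lborel I) = (\<Sum>I\<in>snd ` p1. measure lebesgue I)"
        proof (rule sum.cong[OF refl])
          fix I assume "I \<in> snd ` p1"
          then obtain u v where "I = cbox u v" using division_ofD(4)[OF dv] by blast
          then show "measure lborel I = measure lebesgue I" by simp
        qed
        also have "\<dots> = measure lebesgue (\<Union>(snd ` p1))"
          using content_division[OF dv] by simp
        also have "\<dots> \<le> measure lebesgue T"
          by (rule measure_mono_fmeasurable[OF subT _ Tlm])
            (use dv in \<open>auto intro!: sets.finite_Union dest!: division_ofD(4)[OF dv] simp: pp\<close>)
        finally have "(\<Sum>I\<in>snd ` p1. measure lborel I) < \<delta>" using Tm by simp
        from \<delta>(2)[OF dv sub this] have "(\<Sum>I\<in>snd ` p1. norm (\<Delta> I)) < e / 2" by (simp add: \<Delta>_def)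
        moreover have "(\<Sum>(x,K)\<in>p1. norm (\<Delta> K)) = (\<Sum>I\<in>snd ` p1. norm (\<Delta> I))"
        proof -
          \<comment> \<open>The passage from tagged intervals to intervals asks for a function that
            vanishes on degenerate boxes. On the empty box \<open>Sup\<close> and \<open>Inf\<close>
            carry no meaning, so the value 0 is imposed there.\<close>
          define d where "d K = (if K = {} then 0 else norm (\<Delta> K))" for K
          have ne: "K \<noteq> {}" if "(x, K) \<in> p1" for x K using tagged_division_ofD(2)[OF td that] by auto
          have "(\<Sum>(x,K)\<in>p1. d K) = (\<Sum>I\<in>snd ` p1. d I)"
          proof (rule sum.over_tagged_division_lemma[OF td])
            fix u v :: real assume "box u v = {}"
            then have "v \<le> u" by (simp add: box_real)
            then show "d (cbox u v) = 0" by (cases "u = v") (auto simp: d_def \<Delta>_def)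
          qed
          moreover have "(\<Sum>(x,K)\<in>p1. d K) = (\<Sum>(x,K)\<in>p1. norm (\<Delta> K))"
            by (rule sum.cong) (use ne in \<open>auto simp: d_def\<close>)
          moreover have "(\<Sum>I\<in>snd ` p1. d I) = (\<Sum>I\<in>snd ` p1. norm (\<Delta> I))"
            by (rule sum.cong) (use ne in \<open>auto simp: d_def\<close>)
          ultimately show ?thesis by simp
        qed
        ultimately show ?thesis by simp
      qed
      also have "(\<Sum>(x,K)\<in>p2. norm (measure lborel K *\<^sub>R g' x - \<Delta> K)) \<le> (\<Sum>(x,K)\<in>p2. measure lborel K * e1)"
      proof (rule sum_mono, clarify)
        fix x K assume xK: "(x, K) \<in> p2"
        then have xK': "(x,K) \<in> p" "x \<notin> N" by (auto simp: p2_def)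
        then obtain u v where uv: "K = {u..v}" "u \<le> x" "x \<le> v" "x \<in> {a..b}" "K \<subseteq> {a..b}"
          using tagged_division_ofD(2,3,4)[OF p xK'(1)] by (metis atLeastAtMost_iff box_real(2) subsetD)
        have x: "x \<in> {a..b} - N" using uv xK' by auto
        have "K \<subseteq> ball x (d x)" using fine xK' uv unfolding fine_def \<gamma>_def by fastforce
        moreover have "u \<in> K" "v \<in> K" using uv by auto
        ultimately have "u \<in> ball x (d x)" "v \<in> ball x (d x)" by auto
        then have "\<bar>u - x\<bar> < d x" "\<bar>v - x\<bar> < d x" by (auto simp: dist_real_def)
        moreover have "u \<in> {a..b}" "v \<in> {a..b}" using uv by auto
        ultimately have 1: "norm (f u - f x - (u - x) *\<^sub>R g x) \<le> e1 * (x - u)" "norm (f v - f x - (v - x) *\<^sub>R g x) \<le> e1 * (v - x)"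
          using d(2)[OF x, of u] d(2)[OF x, of v] uv by auto
        have "measure lborel K *\<^sub>R g' x - \<Delta> K = (f u - f x - (u - x) *\<^sub>R g x) - (f v - f x - (v - x) *\<^sub>R g x)"
          using uv xK' by (simp add: \<Delta>_def g'_def algebra_simps)
        then have "norm (measure lborel K *\<^sub>R g' x - \<Delta> K) \<le> e1 * (x - u) + e1 * (v - x)"
          by (simp only:) (rule order_trans[OF norm_triangle_ineq4], rule add_mono[OF 1])
        also have "\<dots> = measure lborel K * e1" using uv by (simp add: algebra_simps)
        finally show "norm (measure lborel K *\<^sub>R g' x - \<Delta> K) \<le> measure lborel K * e1" .
      qed
      also have "(\<Sum>(x,K)\<in>p2. measure lborel K * e1) \<le> (\<Sum>(x,K)\<in>p. measure lborel K * e1)"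
        by (rule sum_mono2[OF finp pp(6)]) (use e1 in auto)
      also have "\<dots> = (b - a) * e1"
        using additive_content_tagged_division[of p a b] p ab
        by (simp add: sum_distrib_right[symmetric] case_prod_unfold)
      also have "\<dots> \<le> e / 2"
        using ab e by (simp add: e1_def field_simps)
      finally show ?thesis by simp
    qed
    show "\<exists>\<gamma>. gauge \<gamma> \<and> (\<forall>\<D>. \<D> tagged_division_of {a..b} \<and> \<gamma> fine \<D> \<longrightarrow>
          norm ((\<Sum>(x,k)\<in>\<D>. measure lborel k *\<^sub>R g' x) - (f b - f a)) < e)"
      by (intro exI[of _ \<gamma>] conjI allI impI gauge approx) auto
  qed
  then show ?thesis
    by (rule has_integral_spike[OF N, rotated]) (auto simp: g'_def)
qed

text \<open>The integrated form of "\<open>f\<close> is absolutely continuous with derivative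
  \<open>g\<close>". The derivative is an explicit partner, fixed only up to null sets, so a
  differential equation can be handled without differentiating.\<close>

definition ipair :: "(real => 'a::euclidean_space) => (real => 'a) => bool" where
  "ipair f g \<longleftrightarrow> (\<forall>b\<ge>0. g absolutely_integrable_on {0..b} \<and> (g has_integral (f b - f 0)) {0..b})"

lemma ipair_absI: "ipair f g ==> 0 \<le> a ==> g absolutely_integrable_on {a..b}"
  unfolding ipair_def
  by (cases "0 \<le> b") (auto intro: absolutely_integrable_on_subinterval[where S = "{0..b}"])

lemma ipair_diff:
  assumes "ipair f g" "0 \<le> a" "a \<le> b"
  shows "(g has_integral (f b - f a)) {a..b}"
proof -
  have 1: "(g has_integral (f b - f 0)) {0..b}"
    and 2: "(g has_integral (f a - f 0)) {0..a}"
    using assms unfolding ipair_def by auto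
  then have int: "g integrable_on {0..b}" by blast
  have "g integrable_on {a..b}"
    using integrable_on_subinterval[OF int, of a b] assms by auto
  then obtain j where j: "(g has_integral j) {a..b}" by blast
  from has_integral_combine[OF assms(2,3) 2 j] 1 have "f a - f 0 + j = f b - f 0"
    by (rule has_integral_unique)
  then have "j = f b - f a" by (simp add: algebra_simps)
  then show ?thesis using j by simp
qed

lemma ipair_integral: "ipair f g ==> 0 \<le> a ==> a \<le> b ==> integral {a..b} g = f b - f a"
  using ipair_diff integral_unique by blast

lemma ipair_continuous_on: assumes "ipair f g" shows "continuous_on {0..} f"
proof -
  have "continuous_on {0..b} f" for b
  proof (cases "0 \<le> b")
    case True
    have "g integrable_on {0..b}" using assms True unfolding ipair_def by blast
    then have "continuous_on {0..b} (\<lambda>x. f 0 + integral {0..x} g)"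
      by (intro continuous_intros indefinite_integral_continuous_1)
    then show ?thesis
      by (rule continuous_on_eq) (use ipair_integral[OF assms, of 0] in auto)
  qed auto
  then have *: "continuous_on {0..<b} f" for b using continuous_on_subset
    by (metis atLeastLessThan_subseteq_atLeastAtMost_iff order_refl)
  show ?thesis
    unfolding continuous_on_eq_continuous_within
  proof
    fix x :: real assume x: "x \<in> {0..}"
    have "continuous (at x within {0..<x+1}) f"
      using *[of "x+1"] x by (simp add: continuous_on_eq_continuous_within)
    moreover have "at x within {0..<x+1} = at x within {0..}"
      by (rule at_within_nhd[of x "{..<x+1}"]) auto
    ultimately show "continuous (at x within {0..}) f" by simp
  qed
qed

lemma ipair_continuous_on_interval: "ipair f g ==> 0 \<le> a ==> continuous_on {a..b} f"
  by (rule continuous_on_subset[OF ipair_continuous_on]) auto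

lemma ipair_cong:
  assumes "ipair f g" "\<And>x. x \<ge> 0 ==> f' x = f x" "negligible N" "\<And>x. x > 0 ==> x \<notin> N ==> g' x = g x"
  shows "ipair f' g'"
  unfolding ipair_def
proof (intro allI impI conjI)
  fix b :: real assume b: "0 \<le> b"
  have N: "negligible (insert 0 N)" using assms(3) by simp
  have *: "g' x = g x" if "x \<in> {0..b} - insert 0 N" for x using that assms(4) by auto
  show "g' absolutely_integrable_on {0..b}"
    using assms(1) b by (intro absolutely_integrable_spike[OF _ N *]) (auto simp: ipair_def)
  show "(g' has_integral f' b - f' 0) {0..b}"
    using has_integral_spike[of _ "{0..b}" g' g, OF N *] assms(1,2) b by (auto simp: ipair_def)
qed

lemma ipair_cong': "ipair f g ==> (\<And>x. x \<ge> 0 ==> f' x = f x) ==> (\<And>x. x \<ge> 0 ==> g' x = g x) ==> ipair f' g'"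
  by (rule ipair_cong[where N="{}"]) auto

lemma ipair_linear:
  assumes "ipair f g" "bounded_linear h"
  shows "ipair (\<lambda>x. h (f x)) (\<lambda>x. h (g x))"
  using assms(1) absolutely_integrable_linear[OF _ assms(2)] has_integral_linear[OF _ assms(2)]
  unfolding ipair_def o_def by (metis bounded_linear.linear[OF assms(2)] linear_diff)

lemma ipair_add: "ipair f g ==> ipair u v ==> ipair (\<lambda>x. f x + u x) (\<lambda>x. g x + v x)"
  unfolding ipair_def
proof (intro allI impI conjI)
  fix b :: real assume b: "0 \<le> b" and *: "\<forall>b\<ge>0. g absolutely_integrable_on {0..b} \<and> (g has_integral f b - f 0) {0..b}"
    "\<forall>b\<ge>0. v absolutely_integrable_on {0..b} \<and> (v has_integral u b - u 0) {0..b}"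
  show "(\<lambda>x. g x + v x) absolutely_integrable_on {0..b}"
    using * b by (intro set_integral_add(1)) auto
  have "((\<lambda>x. g x + v x) has_integral (f b - f 0) + (u b - u 0)) {0..b}"
    using * b by (intro has_integral_add) auto
  then show "((\<lambda>x. g x + v x) has_integral f b + u b - (f 0 + u 0)) {0..b}"
    by (simp add: algebra_simps)
qed

lemma ipair_diff': "ipair f g ==> ipair u v ==> ipair (\<lambda>x. f x - u x) (\<lambda>x. g x - v x)"
  using ipair_add[of f g "\<lambda>x. - u x" "\<lambda>x. - v x"] ipair_linear[of u v "\<lambda>x. - x", OF _ bounded_linear_minus[OF bounded_linear_ident]]
  by simp

lemma ipair_const: "ipair (\<lambda>x. c) (\<lambda>x. 0)"
  unfolding ipair_def by auto

lemma ipair_cmult: fixes f :: "real => complex" shows "ipair f g ==> ipair (\<lambda>x. c * f x) (\<lambda>x. c * g x)"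
  by (rule ipair_linear[OF _ bounded_linear_mult_right])

lemma ipair_cnj: "ipair f g ==> ipair (\<lambda>x. cnj (f x)) (\<lambda>x. cnj (g x))"
  by (rule ipair_linear[OF _ bounded_linear_cnj])

lemma ipair_C1:
  assumes "\<And>x. x \<ge> 0 ==> (f has_vector_derivative g x) (at x within {0..})" "continuous_on {0..} g"
  shows "ipair f g"
  unfolding ipair_def
proof (intro allI impI conjI)
  fix b :: real assume b: "0 \<le> b"
  show "g absolutely_integrable_on {0..b}"
    by (rule absolutely_integrable_continuous_real) (rule continuous_on_subset[OF assms(2)], auto)
  show "(g has_integral f b - f 0) {0..b}"
    by (rule fundamental_theorem_of_calculus[OF b])
      (auto intro: has_vector_derivative_within_subset[OF assms(1)])
qed

lemma continuous_times_absolutely_integrable: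
  fixes f g :: "real => 'a::{euclidean_space, real_normed_algebra}"
  assumes "continuous_on {a..b} f" "g absolutely_integrable_on {a..b}"
  shows "(\<lambda>x. f x * g x) absolutely_integrable_on {a..b}"
  by (rule absolutely_integrable_bounded_measurable_product[OF iffD2[OF bilinear_conv_bounded_bilinear bounded_bilinear_mult]])
    (use assms in \<open>auto intro: compact_imp_bounded compact_continuous_image continuous_imp_measurable_on_sets_lebesgue\<close>)

text \<open>With one factor frozen at each end, \<open>f t * u t - f s * u s\<close> is the integral
  of \<open>g x * u t + f s * v x\<close> over \<open>{s..t}\<close>. By uniform continuity the
  error against the claimed integrand is at most \<open>e * m x\<close> on short intervals, as
  \<open>constant_by_small_increments\<close> requires.\<close>

lemma ipair_mult:
  fixes f g u v :: "real => complex"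
  assumes fg: "ipair f g" and uv: "ipair u v"
  shows "ipair (\<lambda>x. f x * u x) (\<lambda>x. g x * u x + f x * v x)"
  unfolding ipair_def
proof (intro allI impI conjI)
  fix b :: real assume b: "0 \<le> b"
  define h where "h = (\<lambda>x. g x * u x + f x * v x)"
  define m where "m x = cmod (g x) + cmod (v x)" for x
  have fc: "continuous_on {s..t} f" and uc: "continuous_on {s..t} u" if "0 \<le> s" for s t
    using fg uv that ipair_continuous_on_interval by auto
  have ga: "g absolutely_integrable_on {s..t}" and va: "v absolutely_integrable_on {s..t}" if "0 \<le> s" for s t
    using fg uv that ipair_absI by auto
  have ha: "h absolutely_integrable_on {s..t}" if "0 \<le> s" for s t
    unfolding h_def
    by (intro set_integral_add continuous_times_absolutely_integrable[OF fc va] that)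
      (use continuous_times_absolutely_integrable[OF uc ga] that in \<open>simp add: mult.commute\<close>)
  have ma: "m absolutely_integrable_on {s..t}" if "0 \<le> s" for s t
    unfolding m_def by (intro set_integral_add absolutely_integrable_norm[unfolded o_def] ga va that)
  show "(\<lambda>x. g x * u x + f x * v x) absolutely_integrable_on {0..b}" using ha[of 0] by (simp add: h_def)
  define D where "D t = f t * u t - integral {0..t} h" for t
  define M where "M t = integral {0..t} m" for t
  have comb: "integral {0..t} w - integral {0..s} w = integral {s..t} w"
    if "0 \<le> s" "s \<le> t" "w integrable_on {0..t}" for s t and w :: "real => 'b::euclidean_space"
    using Henstock_Kurzweil_Integration.integral_combine[OF that] by (simp add: algebra_simps)
  have "D b = D 0"
  proof (rule constant_by_small_increments[where M = M, OF b])
    fix e :: real assume e: "e > 0"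
    obtain d1 where d1: "d1 > 0" "\<And>s t. s \<in> {0..b} ==> t \<in> {0..b} ==> dist t s < d1 ==> dist (f t) (f s) < e"
      using compact_uniformly_continuous[OF fc[of 0 b]] e unfolding uniformly_continuous_on_def
      by (metis compact_Icc order_refl)
    obtain d2 where d2: "d2 > 0" "\<And>s t. s \<in> {0..b} ==> t \<in> {0..b} ==> dist t s < d2 ==> dist (u t) (u s) < e"
      using compact_uniformly_continuous[OF uc[of 0 b]] e unfolding uniformly_continuous_on_def
      by (metis compact_Icc order_refl)
    show "\<exists>d>0. \<forall>s t. 0 \<le> s \<longrightarrow> s \<le> t \<longrightarrow> t \<le> b \<longrightarrow> t - s < d \<longrightarrow> norm (D t - D s) \<le> e * (M t - M s)"
    proof (intro exI[of _ "min d1 d2"] conjI allI impI)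
      show "min d1 d2 > 0" using d1 d2 by simp
      fix s t assume st: "0 \<le> s" "s \<le> t" "t \<le> b" "t - s < min d1 d2"
      have hi: "(h has_integral integral {s..t} h) {s..t}"
        using ha[OF st(1), of t] by (simp add: integrable_integral set_lebesgue_integral_eq_integral(1))
      have i1: "((\<lambda>x. g x * u t) has_integral (f t - f s) * u t) {s..t}"
        by (rule has_integral_mult_left[OF ipair_diff[OF fg st(1,2)]])
      have i2: "((\<lambda>x. f s * v x) has_integral f s * (u t - u s)) {s..t}"
        by (rule has_integral_mult_right[OF ipair_diff[OF uv st(1,2)]])
      have D: "D t - D s = (f t - f s) * u t + f s * (u t - u s) - integral {s..t} h"
        using comb[OF st(1,2), of h] ha[of 0 t] unfolding D_def
        by (simp add: set_lebesgue_integral_eq_integral(1) algebra_simps)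
      have "((\<lambda>x. g x * u t + f s * v x - h x) has_integral (D t - D s)) {s..t}"
        unfolding D by (intro has_integral_diff has_integral_add i1 i2 hi)
      moreover have "((\<lambda>x. e * m x) has_integral e * integral {s..t} m) {s..t}"
        using ma[OF st(1), of t]
        by (intro has_integral_mult_right integrable_integral) (simp add: set_lebesgue_integral_eq_integral(1))
      moreover have "norm (g x * u t + f s * v x - h x) \<le> e * m x" if x: "x \<in> {s..t}" for x
      proof -
        have "dist (u t) (u x) < e" "dist (f s) (f x) < e"
          using d1(2)[of x s] d2(2)[of x t] x st by (auto simp: dist_real_def)
        then have *: "cmod (u t - u x) \<le> e" "cmod (f s - f x) \<le> e" by (auto simp: dist_norm)
        have "g x * u t + f s * v x - h x = g x * (u t - u x) + (f s - f x) * v x"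
          by (simp add: h_def algebra_simps)
        then have "norm (g x * u t + f s * v x - h x) \<le> cmod (g x) * cmod (u t - u x) + cmod (f s - f x) * cmod (v x)"
          by (metis norm_mult norm_triangle_ineq)
        also have "\<dots> \<le> cmod (g x) * e + e * cmod (v x)"
          by (intro add_mono mult_left_mono mult_right_mono *) auto
        finally show ?thesis by (simp add: m_def algebra_simps)
      qed
      ultimately have "norm (D t - D s) \<le> e * integral {s..t} m"
        by (metis (no_types, lifting) integral_norm_bound_integral integral_unique has_integral_integrable)
      then show "norm (D t - D s) \<le> e * (M t - M s)"
        using comb[OF st(1,2), of m] ma[of 0 t] by (simp add: M_def set_lebesgue_integral_eq_integral(1))
    qed
  qed
  then have "integral {0..b} h = f b * u b - f 0 * u 0" by (simp add: D_def algebra_simps)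
  moreover have "h integrable_on {0..b}" using ha[of 0 b] by (simp add: set_lebesgue_integral_eq_integral(1))
  ultimately show "((\<lambda>x. g x * u x + f x * v x) has_integral f b * u b - f 0 * u 0) {0..b}"
    unfolding h_def by (metis integrable_integral)
qed

text \<open>The scheme of \<open>ipair_mult\<close>, with the mean value theorem writing the
  increment as \<open>exp z\<close> times that of \<open>f\<close>. It supplies the exponential
  weights in \<open>gronwall\<close> and in the contraction estimate for the integral
  equation.\<close>

lemma ipair_exp:
  fixes f g :: "real => real"
  assumes fg: "ipair f g"
  shows "ipair (\<lambda>x. exp (f x)) (\<lambda>x. exp (f x) * g x)"
  unfolding ipair_def
proof (intro allI impI conjI)
  fix b :: real assume b: "0 \<le> b"
  define h where "h = (\<lambda>x. exp (f x) * g x)"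
  have ec: "continuous_on {s..t} (\<lambda>x. exp (f x))" if "0 \<le> s" for s t
    using fg that by (intro continuous_intros) (auto intro: ipair_continuous_on_interval)
  have ga: "g absolutely_integrable_on {s..t}" if "0 \<le> s" for s t
    using fg that ipair_absI by auto
  have ha: "h absolutely_integrable_on {s..t}" if "0 \<le> s" for s t
    unfolding h_def by (intro continuous_times_absolutely_integrable ec ga that)
  have na: "(\<lambda>x. \<bar>g x\<bar>) absolutely_integrable_on {s..t}" if "0 \<le> s" for s t
    using absolutely_integrable_norm[OF ga[OF that]] by (simp add: o_def)
  have comb: "integral {0..t} w - integral {0..s} w = integral {s..t} w"
    if "0 \<le> s" "s \<le> t" "w integrable_on {0..t}" for s t and w :: "real => real"
    using Henstock_Kurzweil_Integration.integral_combine[OF that] by (simp add: algebra_simps)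
  show "(\<lambda>x. exp (f x) * g x) absolutely_integrable_on {0..b}" using ha[of 0] by (simp add: h_def)
  define D where "D t = exp (f t) - integral {0..t} h" for t
  have "D b = D 0"
  proof (rule constant_by_small_increments[where M = "\<lambda>t. integral {0..t} (\<lambda>x. \<bar>g x\<bar>)", OF b])
    fix e :: real assume e: "e > 0"
    obtain d where d: "d > 0" "\<And>s t. s \<in> {0..b} ==> t \<in> {0..b} ==> dist t s < d ==> dist (exp (f t)) (exp (f s)) < e"
      using compact_uniformly_continuous[OF ec[of 0 b]] e unfolding uniformly_continuous_on_def
      by (metis compact_Icc order_refl)
    show "\<exists>d>0. \<forall>s t. 0 \<le> s \<longrightarrow> s \<le> t \<longrightarrow> t \<le> b \<longrightarrow> t - s < d \<longrightarrow>
        norm (D t - D s) \<le> e * (integral {0..t} (\<lambda>x. \<bar>g x\<bar>) - integral {0..s} (\<lambda>x. \<bar>g x\<bar>))"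
    proof (intro exI[of _ d] conjI allI impI d(1))
      fix s t assume st: "0 \<le> s" "s \<le> t" "t \<le> b" "t - s < d"
      have "\<exists>z. exp (f t) - exp (f s) = exp z * (f t - f s) \<and>
          min (f s) (f t) \<le> z \<and> z \<le> max (f s) (f t)"
      proof (cases "f s" "f t" rule: linorder_cases)
        case less
        then obtain z where "f s < z" "z < f t" "exp (f t) - exp (f s) = (f t - f s) * exp z"
          using MVT2[of "f s" "f t" exp exp] by (auto intro: DERIV_exp)
        then show ?thesis by (intro exI[of _ z]) auto
      next
        case greater
        then obtain z where "f t < z" "z < f s" "exp (f s) - exp (f t) = (f s - f t) * exp z"
          using MVT2[of "f t" "f s" exp exp] by (auto intro: DERIV_exp)
        then show ?thesis by (intro exI[of _ z]) (auto simp: algebra_simps)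
      qed auto
      then obtain z where z: "exp (f t) - exp (f s) = exp z * (f t - f s)"
        "min (f s) (f t) \<le> z" "z \<le> max (f s) (f t)" by blast
      have hi: "(h has_integral integral {s..t} h) {s..t}"
        using ha[OF st(1), of t] by (simp add: integrable_integral set_lebesgue_integral_eq_integral(1))
      have "((\<lambda>x. exp z * g x - h x) has_integral (exp z * (f t - f s) - integral {s..t} h)) {s..t}"
        by (intro has_integral_diff hi has_integral_mult_right[OF ipair_diff[OF fg st(1,2)]])
      moreover have "D t - D s = exp z * (f t - f s) - integral {s..t} h"
        using comb[OF st(1,2), of h] ha[of 0 t] z(1) unfolding D_def
        by (simp add: set_lebesgue_integral_eq_integral(1) algebra_simps)
      ultimately have i: "((\<lambda>x. exp z * g x - h x) has_integral (D t - D s)) {s..t}" by simp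
      have j: "((\<lambda>x. e * \<bar>g x\<bar>) has_integral e * integral {s..t} (\<lambda>x. \<bar>g x\<bar>)) {s..t}"
        using na[OF st(1), of t]
        by (intro has_integral_mult_right integrable_integral) (simp add: set_lebesgue_integral_eq_integral(1))
      have "norm (exp z * g x - h x) \<le> e * \<bar>g x\<bar>" if x: "x \<in> {s..t}" for x
      proof -
        have "\<bar>exp (f s) - exp (f x)\<bar> < e" "\<bar>exp (f t) - exp (f x)\<bar> < e"
          using d(2)[of x s] d(2)[of x t] x st by (auto simp: dist_real_def)
        moreover have "min (exp (f s)) (exp (f t)) \<le> exp z" "exp z \<le> max (exp (f s)) (exp (f t))"
          using z(2,3) by (auto simp: min_le_iff_disj le_max_iff_disj)
        ultimately have "\<bar>exp z - exp (f x)\<bar> \<le> e" by linarith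
        then have "\<bar>exp z - exp (f x)\<bar> * \<bar>g x\<bar> \<le> e * \<bar>g x\<bar>" by (rule mult_right_mono) auto
        then show ?thesis by (simp add: h_def flip: abs_mult left_diff_distrib)
      qed
      with i j have "norm (D t - D s) \<le> e * integral {s..t} (\<lambda>x. \<bar>g x\<bar>)"
        by (metis (no_types, lifting) integral_norm_bound_integral integral_unique has_integral_integrable)
      then show "norm (D t - D s) \<le> e * (integral {0..t} (\<lambda>x. \<bar>g x\<bar>) - integral {0..s} (\<lambda>x. \<bar>g x\<bar>))"
        using comb[OF st(1,2), of "\<lambda>x. \<bar>g x\<bar>"] na[of 0 t] by (simp add: set_lebesgue_integral_eq_integral(1))
    qed
  qed
  then have "integral {0..b} h = exp (f b) - exp (f 0)" by (simp add: D_def algebra_simps)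
  moreover have "h integrable_on {0..b}" using ha[of 0 b] by (simp add: set_lebesgue_integral_eq_integral(1))
  ultimately show "((\<lambda>x. exp (f x) * g x) has_integral exp (f b) - exp (f 0)) {0..b}"
    unfolding h_def by (metis integrable_integral)
qed

lemma ipair_from_integrable:
  assumes "\<And>b. b \<ge> 0 ==> g absolutely_integrable_on {0..b}"
  shows "ipair (\<lambda>x. integral {0..x} g) g"
  unfolding ipair_def using assms by (auto intro: integrable_integral simp: set_lebesgue_integral_eq_integral(1))

text \<open>Let \<open>S\<close> be the maximum of \<open>X / E\<close>, attained at
  \<open>z\<close>. Since \<open>m * E\<close> integrates to \<open>(E z - 1) / 2\<close>, the
  hypothesis gives \<open>S * E z \<le> a + S / 2 * (E z - 1)\<close> and hence
  \<open>S \<le> 2 * a\<close>. The doubled exponent leaves half of the left side over.\<close>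

lemma gronwall:
  fixes X m :: "real => real"
  assumes M: "ipair M m" and m: "\<And>x. m x \<ge> 0" and X: "continuous_on {0..b} X" and b: "b \<ge> 0"
    and X0: "\<And>x. x \<in> {0..b} ==> X x \<ge> 0" and a: "a \<ge> 0"
    and le: "\<And>x. x \<in> {0..b} ==> X x \<le> a + integral {0..x} (\<lambda>t. m t * X t)"
    and y: "y \<in> {0..b}"
  shows "X y \<le> 2 * a * exp (2 * (M y - M 0))"
proof -
  define E where "E x = exp (2 * (M x - M 0))" for x
  have M2: "ipair (\<lambda>x. 2 * (M x - M 0)) (\<lambda>x. 2 * m x)"
    using ipair_linear[OF ipair_diff'[OF M ipair_const[of "M 0"]] bounded_linear_mult_right[of 2]]
    by simp
  have E: "ipair E (\<lambda>x. E x * (2 * m x))" using ipair_exp[OF M2] by (simp add: E_def[abs_def])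
  have Epos: "E x > 0" for x by (simp add: E_def)
  have Ec: "continuous_on {0..b} E" using ipair_continuous_on_interval[OF E] by simp
  have "continuous_on {0..b} (\<lambda>x. X x / E x)"
    by (intro continuous_intros X Ec) (use Epos in \<open>auto simp: less_imp_neq[symmetric]\<close>)
  then obtain z where z: "z \<in> {0..b}" "\<And>x. x \<in> {0..b} ==> X x / E x \<le> X z / E z"
    using continuous_attains_sup[of "{0..b}" "\<lambda>x. X x / E x"] b by auto
  define S where "S = X z / E z"
  have S0: "S \<ge> 0" using X0[OF z(1)] Epos[of z] by (simp add: S_def)
  have XS: "X x \<le> S * E x" if "x \<in> {0..b}" for x
    using z(2)[OF that] Epos[of x] by (simp add: S_def field_simps)
  have mi: "m absolutely_integrable_on {0..z}" using ipair_absI[OF M] by simp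
  have i1: "(\<lambda>t. m t * X t) integrable_on {0..z}"
    using continuous_times_absolutely_integrable[OF continuous_on_subset[OF X] mi] z(1)
    by (simp add: mult.commute set_lebesgue_integral_eq_integral(1))
  have "((\<lambda>x. (S / 2) * (E x * (2 * m x))) has_integral (S / 2) * (E z - E 0)) {0..z}"
    by (rule has_integral_mult_right, rule ipair_diff[OF E]) (use z(1) in auto)
  then have i2: "((\<lambda>x. m x * (S * E x)) has_integral (S / 2) * (E z - 1)) {0..z}"
    by (simp add: E_def algebra_simps)
  have "integral {0..z} (\<lambda>t. m t * X t) \<le> integral {0..z} (\<lambda>x. m x * (S * E x))"
    by (rule integral_le[OF i1 has_integral_integrable[OF i2]]) (use XS m z(1) in \<open>auto intro!: mult_left_mono\<close>)
  then have "X z \<le> a + (S / 2) * (E z - 1)"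
    using le[OF z(1)] integral_unique[OF i2] by simp
  moreover have "X z = S * E z" using Epos[of z] by (simp add: S_def)
  moreover have "(S / 2) * (E z - 1) = (S * E z) / 2 - S / 2" by (simp add: field_simps)
  ultimately have "S * E z \<le> 2 * a - S" by linarith
  moreover have "E z \<ge> 1"
  proof -
    have "0 \<le> M z - M 0"
      using has_integral_nonneg[OF ipair_diff[OF M, of 0 z]] m z(1) by auto
    then show ?thesis by (simp add: E_def)
  qed
  then have "S \<le> S * E z" using S0 by (simp add: mult_le_cancel_left1)
  ultimately have "S \<le> 2 * a" using S0 by linarith
  then have "S * E y \<le> 2 * a * E y" using Epos[of y] by (intro mult_right_mono) auto
  then have "X y \<le> 2 * a * E y" using XS[OF y] by linarith
  then show ?thesis unfolding E_def .
qed

section \<open>Averages over unit intervals and decay at infinity\<close>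

lemma tail_integral_tendsto_0:
  fixes f :: "real => 'a::euclidean_space"
  assumes "f absolutely_integrable_on {0..}"
  shows "((\<lambda>x. integral {x..x+1} f) \<longlongrightarrow> 0) at_top"
proof -
  have "((\<lambda>b. LINT x:{0..b}|lebesgue. f x) \<longlongrightarrow> (LINT x:{0..}|lebesgue. f x)) at_top"
    by (rule tendsto_set_lebesgue_integral_at_top) (use assms in auto)
  then have t: "((\<lambda>b. integral {0..b} f) \<longlongrightarrow> (LINT x:{0..}|lebesgue. f x)) at_top"
    by (rule Lim_transform_eventually)
      (auto intro!: always_eventually set_lebesgue_integral_eq_integral(2) set_integrable_subset[OF assms])
  have "filterlim (\<lambda>x. x + 1) at_top (at_top :: real filter)"
    by (rule filterlim_at_top_mono[OF filterlim_ident]) (auto intro: always_eventually)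
  from tendsto_diff[OF filterlim_compose[OF t this] t]
  have "((\<lambda>x. integral {0..x+1} f - integral {0..x} f) \<longlongrightarrow> 0) at_top" by simp
  then show ?thesis
  proof (rule Lim_transform_eventually)
    show "\<forall>\<^sub>F x in at_top. integral {0..x+1} f - integral {0..x} f = integral {x..x+1} f"
    proof (rule eventually_at_top_linorderI[of 0])
      fix x :: real assume "0 \<le> x"
      moreover have "f integrable_on {0..x+1}"
        by (rule set_lebesgue_integral_eq_integral(1)) (rule set_integrable_subset[OF assms], auto)
      ultimately show "integral {0..x+1} f - integral {0..x} f = integral {x..x+1} f"
        using Henstock_Kurzweil_Integration.integral_combine[of 0 x "x+1" f] by (simp add: algebra_simps)
    qed
  qed
qed

lemma exists_le_average:
  fixes f :: "real => 'a::real_normed_vector"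
  assumes "continuous_on {a..b} f" "a < b"
  shows "\<exists>s\<in>{a..b}. (b - a) * norm (f s) \<le> integral {a..b} (\<lambda>x. norm (f x))"
proof -
  have c: "continuous_on {a..b} (\<lambda>x. norm (f x))" by (intro continuous_intros assms)
  obtain s where s: "s \<in> {a..b}" "\<And>y. y \<in> {a..b} ==> norm (f s) \<le> norm (f y)"
    using continuous_attains_inf[OF _ _ c] assms(2) by auto
  have "integral {a..b} (\<lambda>x. norm (f s)) \<le> integral {a..b} (\<lambda>x. norm (f x))"
    by (rule integral_le) (use s in \<open>auto intro: integrable_continuous_real c\<close>)
  then show ?thesis using s(1) assms(2) by auto
qed

text \<open>An interpolation estimate. In each outer third there is a point where \<open>F\<close>
  has norm at most \<open>3 * L\<close>, so the mean of \<open>G\<close> between them is at most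
  \<open>18 * L\<close>. The oscillation of \<open>G\<close> is at most
  \<open>D \<le> A / 2 + H\<close> with \<open>A\<close> the maximal norm of \<open>F\<close>, and
  can be absorbed. Hence 42 = 2 * 21 and 39 = 18 + 21.\<close>

lemma unit_interval_bound:
  fixes F G w :: "real => 'a::euclidean_space"
  assumes FG: "ipair F G" and Gw: "ipair G w" and x: "x \<ge> 0"
    and p: "p integrable_on {x..x+1}" and h: "h integrable_on {x..x+1}" and p0: "\<And>t. p t \<ge> 0" and h0: "\<And>t. h t \<ge> 0"
    and w: "\<And>t. t \<in> {x..x+1} ==> norm (w t) \<le> p t * norm (F t) + h t"
    and small: "integral {x..x+1} p \<le> 1/2" and r: "r \<in> {x..x+1}"
  shows "norm (F r) \<le> 42 * integral {x..x+1} (\<lambda>t. norm (F t)) + 2 * integral {x..x+1} h"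
    and "norm (G r) \<le> 39 * integral {x..x+1} (\<lambda>t. norm (F t)) + 2 * integral {x..x+1} h"
proof -
  have Fc: "continuous_on {x..x+1} F" and Gc: "continuous_on {x..x+1} G"
    using FG Gw x ipair_continuous_on_interval by auto
  define L where "L = integral {x..x+1} (\<lambda>t. norm (F t))"
  define H where "H = integral {x..x+1} h"
  obtain z where z: "z \<in> {x..x+1}" "\<And>y. y \<in> {x..x+1} ==> norm (F y) \<le> norm (F z)"
    using continuous_attains_sup[of "{x..x+1}" "\<lambda>t. norm (F t)", OF _ _ continuous_on_norm[OF Fc]] by auto
  define A where "A = norm (F z)"
  define D where "D = integral {x..x+1} p * A + H"
  have L0: "L \<ge> 0" unfolding L_def by (rule integral_nonneg) (auto intro!: integrable_continuous_real continuous_intros Fc)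
  have H0: "H \<ge> 0" unfolding H_def by (rule integral_nonneg[OF h]) (use h0 in auto)
  have A0: "A \<ge> 0" by (simp add: A_def)
  have wD: "integral {x..x+1} (\<lambda>t. norm (w t)) \<le> D"
  proof -
    have "((\<lambda>t. p t * A + h t) has_integral (integral {x..x+1} p * A + H)) {x..x+1}"
      unfolding H_def by (intro has_integral_add has_integral_mult_left integrable_integral p h)
    moreover have "(\<lambda>t. norm (w t)) integrable_on {x..x+1}"
      using absolutely_integrable_norm[OF ipair_absI[OF Gw x]]
      by (simp add: o_def set_lebesgue_integral_eq_integral(1))
    moreover have "norm (w t) \<le> p t * A + h t" if "t \<in> {x..x+1}" for t
      using w[OF that] mult_left_mono[OF z(2)[OF that] p0[of t]] by (simp add: A_def)
    ultimately show ?thesis unfolding D_def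
      by (metis (no_types, lifting) has_integral_integrable integral_le integral_unique)
  qed
  have Gd0: "norm (G v - G u) \<le> D" if "x \<le> u" "u \<le> v" "v \<le> x + 1" for u v
  proof -
    have "norm (G v - G u) = norm (integral {u..v} w)"
      using ipair_integral[OF Gw] that x by simp
    also have "\<dots> \<le> integral {u..v} (\<lambda>t. norm (w t))"
      using absolutely_integrable_norm[OF ipair_absI[OF Gw, of u v]] ipair_absI[OF Gw, of u v] that x
      by (intro integral_norm_bound_integral) (auto simp: o_def set_lebesgue_integral_eq_integral(1))
    also have "\<dots> \<le> integral {x..x+1} (\<lambda>t. norm (w t))"
      using absolutely_integrable_norm[OF ipair_absI[OF Gw, of u v]] absolutely_integrable_norm[OF ipair_absI[OF Gw, of x "x+1"]] that x
      by (intro integral_subset_le) (auto simp: o_def set_lebesgue_integral_eq_integral(1))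
    finally show ?thesis using wD by simp
  qed
  have Gd: "norm (G v - G u) \<le> D" if "u \<in> {x..x+1}" "v \<in> {x..x+1}" for u v
    using Gd0[of u v] Gd0[of v u] that by (cases "u \<le> v") (auto simp: norm_minus_commute)
  obtain s where s: "s \<in> {x..x+1/3}" "(1/3) * norm (F s) \<le> integral {x..x+1/3} (\<lambda>x. norm (F x))"
    using exists_le_average[of x "x+1/3" F] continuous_on_subset[OF Fc] by auto
  obtain t where t: "t \<in> {x+2/3..x+1}" "(1/3) * norm (F t) \<le> integral {x+2/3..x+1} (\<lambda>x. norm (F x))"
    using exists_le_average[of "x+2/3" "x+1" F] continuous_on_subset[OF Fc] by auto
  have sub: "integral {u..v} (\<lambda>x. norm (F x)) \<le> L" if "{u..v} \<subseteq> {x..x+1}" for u v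
    unfolding L_def using that
    by (intro integral_subset_le) (auto intro!: integrable_continuous_real continuous_intros Fc continuous_on_subset[OF Fc])
  have Fs: "norm (F s) \<le> 3 * L" using s sub[of x "x+1/3"] by simp
  have Ft: "norm (F t) \<le> 3 * L" using t sub[of "x+2/3" "x+1"] by simp
  have Gr: "norm (G r) \<le> 18 * L + D" if r: "r \<in> {x..x+1}" for r
  proof -
    have i: "((\<lambda>u. G u - G r) has_integral (F t - F s) - (t - s) *\<^sub>R G r) {s..t}"
      using has_integral_diff[OF ipair_diff[OF FG, of s t] has_integral_const_real[of "G r" s t]] s t x by simp
    have D0: "0 \<le> D" using order_trans[OF norm_ge_zero Gd[OF r r]] .
    have "norm ((F t - F s) - (t - s) *\<^sub>R G r) \<le> D * (t - s)"
      using has_integral_bound_real[OF D0 _ i, of "{}"] Gd[OF r] s t by auto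
    moreover have "norm ((t - s) *\<^sub>R G r) \<le> norm ((F t - F s) - (t - s) *\<^sub>R G r) + norm (F t - F s)"
      by (metis norm_minus_commute norm_triangle_sub add.commute)
    ultimately have "(t - s) * norm (G r) \<le> D * (t - s) + 6 * L"
      using norm_triangle_ineq4[of "F t" "F s"] Fs Ft s t by simp
    also have "6 * L \<le> 18 * L * (t - s)"
    proof -
      have "1/3 \<le> t - s" using s t by auto
      from mult_left_mono[OF this, of "18 * L"] L0 show ?thesis by simp
    qed
    finally have "(t - s) * norm (G r) \<le> (t - s) * (18 * L + D)" by (simp add: algebra_simps)
    then show ?thesis using s t by (simp add: mult_le_cancel_left_pos)
  qed
  have Fr: "norm (F r) \<le> 21 * L + D" if r: "r \<in> {x..x+1}" for r
  proof -
    have B0: "0 \<le> 18 * L + D" using order_trans[OF norm_ge_zero Gr[OF r]] .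
    have *: "norm (F v - F u) \<le> 18 * L + D" if "x \<le> u" "u \<le> v" "v \<le> x+1" for u v
    proof -
      have "norm (F v - F u) \<le> (18 * L + D) * (v - u)"
        using has_integral_bound_real[OF B0 _ ipair_diff[OF FG, of u v], of "{}"] Gr that x by auto
      also have "\<dots> \<le> (18 * L + D) * 1" using B0 that by (intro mult_left_mono) auto
      finally show ?thesis by simp
    qed
    have "norm (F r - F s) \<le> 18 * L + D"
      using *[of r s] *[of s r] r s by (cases "r \<le> s") (auto simp: norm_minus_commute)
    then show ?thesis using Fs norm_triangle_sub[of "F r" "F s"] by linarith
  qed
  have "A \<le> 21 * L + D" using Fr[OF z(1)] by (simp add: A_def)
  moreover have "D \<le> A / 2 + H"
    using mult_right_mono[OF small A0] by (simp add: D_def)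
  ultimately have "A \<le> 42 * L + 2 * H" "D \<le> 21 * L + 2 * H" by linarith+
  then show "norm (F r) \<le> 42 * integral {x..x+1} (\<lambda>t. norm (F t)) + 2 * integral {x..x+1} h"
    and "norm (G r) \<le> 39 * integral {x..x+1} (\<lambda>t. norm (F t)) + 2 * integral {x..x+1} h"
    using z(2)[OF r] Gr[OF r] L0 H0 unfolding A_def[symmetric] L_def[symmetric] H_def[symmetric] by linarith+
qed

text \<open>\<open>p\<close> is the size of the potential, \<open>h\<close> collects the other terms
  of the second derivative. The hypothesis concerns averages because these are what square
  integrability controls directly.\<close>

lemma tendsto_0_of_averages:
  fixes F G w :: "real => 'a::euclidean_space"
  assumes FG: "ipair F G" and Gw: "ipair G w"
    and p: "\<And>x. x \<ge> 0 ==> p integrable_on {x..x+1}" and h: "\<And>x. x \<ge> 0 ==> h integrable_on {x..x+1}"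
    and p0: "\<And>t. p t \<ge> 0" and h0: "\<And>t. h t \<ge> 0"
    and w: "\<And>t. t \<ge> 0 ==> norm (w t) \<le> p t * norm (F t) + h t"
    and pl: "((\<lambda>x. integral {x..x+1} p) \<longlongrightarrow> 0) at_top"
    and hl: "((\<lambda>x. integral {x..x+1} h) \<longlongrightarrow> 0) at_top"
    and Fl: "((\<lambda>x. integral {x..x+1} (\<lambda>t. norm (F t))) \<longlongrightarrow> 0) at_top"
  shows "(F \<longlongrightarrow> 0) at_top" "(G \<longlongrightarrow> 0) at_top"
proof -
  have small: "\<forall>\<^sub>F x in at_top. integral {x..x+1} p < 1/2" by (rule order_tendstoD(2)[OF pl]) simp
  have ev: "\<forall>\<^sub>F x in at_top. norm (F x) \<le> 42 * integral {x..x+1} (\<lambda>t. norm (F t)) + 2 * integral {x..x+1} h \<and>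
        norm (G x) \<le> 39 * integral {x..x+1} (\<lambda>t. norm (F t)) + 2 * integral {x..x+1} h"
    using small eventually_ge_at_top[of 0]
  proof eventually_elim
    case (elim x)
    show ?case
      using unit_interval_bound[OF FG Gw elim(2) p[OF elim(2)] h[OF elim(2)] p0 h0 w, of x] elim by auto
  qed
  have l: "((\<lambda>x. c * integral {x..x+1} (\<lambda>t. norm (F t)) + 2 * integral {x..x+1} h) \<longlongrightarrow> 0) at_top" for c
    using tendsto_add[OF tendsto_mult_left[OF Fl, of c] tendsto_mult_left[OF hl, of 2]] by simp
  show "(F \<longlongrightarrow> 0) at_top"
    by (rule Lim_null_comparison[OF _ l[of 42]]) (use ev in \<open>auto elim: eventually_mono\<close>)
  show "(G \<longlongrightarrow> 0) at_top"
    by (rule Lim_null_comparison[OF _ l[of 39]]) (use ev in \<open>auto elim: eventually_mono\<close>)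
qed

section \<open>The differential system and its Wronskian\<close>

lemma AE_halfline_iff:
  "(AE x in halfline. P x) \<longleftrightarrow> (\<exists>N. negligible N \<and> (\<forall>x>0. x \<notin> N \<longrightarrow> P x))"
proof
  assume "AE x in halfline. P x"
  then have "AE x in lebesgue. x \<in> {0<..} \<longrightarrow> P x" by (simp add: AE_restrict_space_iff)
  then obtain N where "N \<in> null_sets lebesgue" "{x. \<not> (x \<in> {0<..} \<longrightarrow> P x)} \<subseteq> N"
    unfolding eventually_ae_filter by auto
  then show "\<exists>N. negligible N \<and> (\<forall>x>0. x \<notin> N \<longrightarrow> P x)"
    by (intro exI[of _ N]) (auto simp: negligible_iff_null_sets)
next
  assume "\<exists>N. negligible N \<and> (\<forall>x>0. x \<notin> N \<longrightarrow> P x)"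
  then obtain N where N: "negligible N" "\<And>x. x > 0 ==> x \<notin> N ==> P x" by blast
  have "AE x in lebesgue. x \<in> {0<..} \<longrightarrow> P x"
    unfolding eventually_ae_filter
    by (intro bexI[of _ N]) (use N in \<open>auto simp: negligible_iff_null_sets\<close>)
  then show "AE x in halfline. P x" by (simp add: AE_restrict_space_iff)
qed

lemma integrable_halfline_iff:
  fixes f :: "real => 'a::euclidean_space"
  shows "integrable halfline f \<longleftrightarrow> f absolutely_integrable_on {0..}"
proof -
  have "integrable halfline f \<longleftrightarrow> f absolutely_integrable_on {0<..}"
    by (simp add: integrable_restrict_space set_integrable_def)
  also have "\<dots> \<longleftrightarrow> f absolutely_integrable_on {0..}"
  proof (rule absolutely_integrable_spike_set_eq)
    show "negligible {x \<in> {0<..} - {0..}. f x \<noteq> 0}" by (rule negligible_subset[of "{0}"]) auto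
    show "negligible {x \<in> {0..} - {0<..}. f x \<noteq> 0}" by (rule negligible_subset[of "{0}"]) auto
  qed
  finally show ?thesis .
qed

lemma integral_halfline_eq:
  fixes f :: "real => 'a::euclidean_space"
  assumes "f absolutely_integrable_on {0..}"
  shows "(LINT x|halfline. f x) = integral {0..} f"
proof -
  have "(LINT x|halfline. f x) = (LINT x:{0<..}|lebesgue. f x)"
    by (simp add: integral_restrict_space set_lebesgue_integral_def)
  also have "\<dots> = integral {0<..} f"
    by (rule set_lebesgue_integral_eq_integral(2)) (rule set_integrable_subset[OF assms], auto)
  also have "\<dots> = integral {0..} f"
    by (rule integral_spike_set) (auto intro: negligible_subset[of "{0}"])
  finally show ?thesis .
qed

lemma exhaust_two: "(\<forall>i::2. P i) \<longleftrightarrow> P 1 \<and> P 2"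
  using exhaust_2 by metis

lemma vec2_eq_iff: "(u::'a^2) = v \<longleftrightarrow> u $ 1 = v $ 1 \<and> u $ 2 = v $ 2"
  by (simp add: vec_eq_iff exhaust_two)

lemma norm_le_sum2: "norm (u::complex^2) \<le> cmod (u $ 1) + cmod (u $ 2)"
  using L2_set_le_sum[of "UNIV::2 set" "\<lambda>i. norm (u $ i)"] by (simp add: norm_vec_def UNIV_2)

lemma norm_sq2: "(norm (u::complex^2))\<^sup>2 = (cmod (u $ 1))\<^sup>2 + (cmod (u $ 2))\<^sup>2"
  by (simp add: norm_vec_def L2_set_def UNIV_2)

lemma bounded_linear_axis: "bounded_linear (axis i :: complex => complex^2)"
proof (rule bounded_linear_intro[of _ 1])
  show "norm (axis i x :: complex^2) \<le> norm x * 1" for x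
    using exhaust_2[of i] by (auto simp: norm_vec_def L2_set_def UNIV_2 axis_def)
qed (auto simp: axis_def vec_eq_iff)

lemma ipair_component: "ipair F G ==> ipair (\<lambda>x. F x $ i) (\<lambda>x. G x $ i :: complex)"
  by (rule ipair_linear[OF _ bounded_linear_vec_nth])

lemma ipair_vec2:
  fixes F G :: "real => complex^2"
  assumes "ipair (\<lambda>x. F x $ 1) (\<lambda>x. G x $ 1)" "ipair (\<lambda>x. F x $ 2) (\<lambda>x. G x $ 2)"
  shows "ipair F G"
  by (rule ipair_cong'[OF ipair_add[OF ipair_linear[OF assms(1) bounded_linear_axis[of 1]] ipair_linear[OF assms(2) bounded_linear_axis[of 2]]]])
    (auto simp: vec2_eq_iff axis_def)

text \<open>The system solved for \<open>F''\<close>: \<open>eps_mat\<close> is its own inverse, so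
  \<open>F''\<close> is \<open>eps_mat\<close> applied to \<open>Q F - l F\<close>.\<close>

definition rhs :: "(real => complex) => complex => (real => complex^2) => real => complex^2" where
  "rhs q l F x = vector [cnj (q x) * F x $ 1 - l * F x $ 2, q x * F x $ 2 - l * F x $ 1]"

lemma rhs_nth [simp]:
  "rhs q l F x $ 1 = cnj (q x) * F x $ 1 - l * F x $ 2"
  "rhs q l F x $ 2 = q x * F x $ 2 - l * F x $ 1"
  by (simp_all add: rhs_def)

text \<open>\<open>G\<close> is the derivative of \<open>F\<close>; with it explicit, linear
  combinations and limits of solutions never pass through \<open>hderiv\<close>.\<close>

definition isol :: "(real => complex) => complex => (real => complex^2) => (real => complex^2) => bool" where
  "isol q l F G \<longleftrightarrow> ipair F G \<and> ipair G (rhs q l F)"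

lemma ipair_has_vector_derivative:
  assumes "ipair F G" "continuous_on {0..} G" "x \<ge> 0"
  shows "(F has_vector_derivative G x) (at x within {0..})"
proof -
  have "((\<lambda>u. F 0 + integral {0..u} G) has_vector_derivative 0 + G x) (at x within {0..x+1})"
    by (intro has_vector_derivative_add has_vector_derivative_const integral_has_vector_derivative)
      (use assms in \<open>auto intro: continuous_on_subset\<close>)
  then have d: "((\<lambda>u. F 0 + integral {0..u} G) has_vector_derivative G x) (at x within {0..x+1})" by simp
  have "(F has_vector_derivative G x) (at x within {0..x+1})"
    by (rule has_vector_derivative_transform[OF _ _ d])
      (use assms ipair_integral[OF assms(1), of 0] in auto)
  moreover have "at x within {0..x+1} = at x within {0..}"
    by (rule at_within_nhd[of x "{..<x+1}"]) auto
  ultimately show ?thesis by simp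
qed

lemma hderiv_eq:
  assumes "(F has_vector_derivative d) (at x within {0..})" "x \<ge> 0"
  shows "hderiv F x = d"
proof -
  have "at x within {0..} \<noteq> bot"
  proof -
    have "x islimpt {0..}" by (rule islimpt_subset[of x "{x..x+1}"]) (use assms(2) in auto)
    then show ?thesis by (simp add: trivial_limit_within)
  qed
  then show ?thesis unfolding hderiv_def using vector_derivative_within assms(1) by blast
qed

lemma isol_deriv:
  assumes "isol q l F G" "x \<ge> 0"
  shows "(F has_vector_derivative G x) (at x within {0..})" "hderiv F x = G x"
proof -
  show *: "(F has_vector_derivative G x) (at x within {0..})"
    by (rule ipair_has_vector_derivative) (use assms in \<open>auto simp: isol_def dest: ipair_continuous_on\<close>)
  show "hderiv F x = G x" by (rule hderiv_eq[OF * assms(2)])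
qed

lemma isol_cong: "isol q l F G ==> (\<And>x. x \<ge> 0 ==> F' x = F x) ==> (\<And>x. x \<ge> 0 ==> G' x = G x) ==> isol q l F' G'"
  unfolding isol_def by (auto intro: ipair_cong' simp: rhs_def)

lemma isol_lincomb:
  assumes "isol q l F G" "isol q l H K"
  shows "isol q l (\<lambda>x. a *s F x + b *s H x) (\<lambda>x. a *s G x + b *s K x)"
proof -
  have 1: "ipair (\<lambda>x. a *s F x + b *s H x) (\<lambda>x. a *s G x + b *s K x)"
    by (rule ipair_vec2) (use assms in \<open>auto simp: isol_def intro!: ipair_add ipair_cmult ipair_component\<close>)
  have "ipair (\<lambda>x. a * G x $ i + b * K x $ i) (\<lambda>x. a * rhs q l F x $ i + b * rhs q l H x $ i)" for i
    using assms by (auto simp only: isol_def intro!: ipair_add ipair_cmult ipair_component)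
  from this[of 1] this[of 2]
  have 2: "ipair (\<lambda>x. a *s G x + b *s K x) (rhs q l (\<lambda>x. a *s F x + b *s H x))"
    by (intro ipair_vec2) (auto simp: algebra_simps)
  show ?thesis using 1 2 by (simp add: isol_def)
qed

lemma isol_sub: "isol q l F G ==> isol q l H K ==> isol q l (\<lambda>x. F x - H x) (\<lambda>x. G x - K x)"
  using isol_lincomb[of q l F G H K 1 "-1"] by simp

text \<open>The passage from derivatives almost everywhere to integrals. Absolute continuity makes
  \<open>hderiv f\<close> an integral and therefore continuous, after which the ordinary fundamental
  theorem applies to \<open>f\<close>.\<close>

lemma regular_ipair:
  assumes reg: "regular f" and r: "\<And>b. r absolutely_integrable_on {0..b}"
    and ae: "AE x in halfline. (hderiv f has_vector_derivative r x) (at x)"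
  shows "ipair f (hderiv f)" "ipair (hderiv f) r"
proof -
  have fd: "(f has_vector_derivative hderiv f x) (at x within {0..})" if "x \<ge> 0" for x
    using reg that unfolding regular_def hderiv_def by (auto simp: vector_derivative_works)
  obtain N where N: "negligible N" "\<And>x. x > 0 ==> x \<notin> N ==> (hderiv f has_vector_derivative r x) (at x)"
    using ae unfolding AE_halfline_iff by blast
  have G: "(r has_integral (hderiv f b - hderiv f 0)) {0..b}" if "b \<ge> 0" for b
  proof (intro absolutely_continuous_has_integral[where N = "insert 0 N"])
    show "absolutely_continuous_on_interval 0 b (hderiv f)"
      using reg that unfolding regular_def locally_absolutely_continuous_def by blast
  qed (use N that in \<open>auto intro: has_vector_derivative_at_within\<close>)
  show GP: "ipair (hderiv f) r" unfolding ipair_def using G r by auto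
  show "ipair f (hderiv f)" by (rule ipair_C1[OF fd ipair_continuous_on[OF GP]])
qed

lemma regular_continuous_on: "regular f ==> continuous_on {0..} f"
  unfolding continuous_on_eq_continuous_within regular_def by (auto intro: differentiable_imp_continuous_within)

lemma solution_isol:
  assumes q: "integrable halfline q" and s: "solution q l F"
  shows "isol q l F (hderiv F)"
proof -
  have qi: "q absolutely_integrable_on {0..b}" for b
    using q by (auto simp: integrable_halfline_iff intro: set_integrable_subset)
  have reg: "regular F" using s by (simp add: solution_def)
  have Fc: "continuous_on {0..} F" by (rule regular_continuous_on[OF reg])
  have Fc': "continuous_on {0..b} (\<lambda>x. F x $ i)" for b i
    by (intro continuous_intros continuous_on_subset[OF Fc]) auto
  have cq: "(\<lambda>x. cnj (q x)) absolutely_integrable_on {0..b}" for b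
    using absolutely_integrable_linear[OF qi bounded_linear_cnj] by (simp add: o_def)
  have comp: "(\<lambda>x. rhs q l F x $ i) absolutely_integrable_on {0..b}" for b i
  proof -
    have "(\<lambda>x. F x $ 1 * cnj (q x) - l * F x $ 2) absolutely_integrable_on {0..b}"
      by (intro set_integral_diff(1) continuous_times_absolutely_integrable cq Fc'
          absolutely_integrable_continuous_real continuous_intros)
    moreover have "(\<lambda>x. F x $ 2 * q x - l * F x $ 1) absolutely_integrable_on {0..b}"
      by (intro set_integral_diff(1) continuous_times_absolutely_integrable qi Fc'
          absolutely_integrable_continuous_real continuous_intros)
    ultimately show ?thesis using exhaust_2[of i] by (auto simp: mult.commute)
  qed
  have ri: "rhs q l F absolutely_integrable_on {0..b}" for b
  proof -
    have "(\<lambda>x. axis 1 (rhs q l F x $ 1) + axis 2 (rhs q l F x $ 2) :: complex^2) absolutely_integrable_on {0..b}"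
      using absolutely_integrable_linear[OF comp bounded_linear_axis]
      by (intro set_integral_add(1)) (auto simp: o_def simp del: rhs_nth)
    moreover have "(\<lambda>x. axis 1 (rhs q l F x $ 1) + axis 2 (rhs q l F x $ 2) :: complex^2) = rhs q l F"
      by (auto simp: vec2_eq_iff axis_def)
    ultimately show ?thesis by simp
  qed
  have "AE x in halfline. (hderiv F has_vector_derivative rhs q l F x) (at x)"
    using s[unfolded solution_def, THEN conjunct2]
  proof eventually_elim
    case (elim x)
    then obtain F2 where F2: "(hderiv F has_vector_derivative F2) (at x)" "- (eps_mat *v F2) + Q_mat q x *v F x = l *s F x"
      by blast
    have "F2 = rhs q l F x"
      using F2(2) by (auto simp: vec2_eq_iff eps_mat_def Q_mat_def matrix_vector_mult_def UNIV_2 algebra_simps)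
    then show ?case using F2 by simp
  qed
  then show ?thesis unfolding isol_def using regular_ipair[OF reg ri] by blast
qed

text \<open>The sesquilinear Wronskian \<open><eps F', H> - <eps F, H'>\<close>, with values
  \<open>u\<close>, \<open>h\<close> and derivatives \<open>v\<close>, \<open>k\<close>. The
  conjugation lets the hermitian matrix \<open>Q\<close> cancel, so its derivative is
  \<open>(cnj m - l) <F, H>\<close>.\<close>

definition W :: "complex^2 => complex^2 => complex^2 => complex^2 => complex" where
  "W u v h k = cnj (h $ 1) * v $ 2 + cnj (h $ 2) * v $ 1 - cnj (k $ 1) * u $ 2 - cnj (k $ 2) * u $ 1"

lemma ipair_W:
  assumes "isol q l F G" "isol q m H K"
  shows "ipair (\<lambda>x. W (F x) (G x) (H x) (K x))
     (\<lambda>x. (cnj m - l) * (F x $ 1 * cnj (H x $ 1) + F x $ 2 * cnj (H x $ 2)))"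
proof -
  have F: "ipair (\<lambda>x. F x $ i) (\<lambda>x. G x $ i)" and G: "ipair (\<lambda>x. G x $ i) (\<lambda>x. rhs q l F x $ i)"
    and H: "ipair (\<lambda>x. H x $ i) (\<lambda>x. K x $ i)" and K: "ipair (\<lambda>x. K x $ i) (\<lambda>x. rhs q m H x $ i)" for i
    using assms by (auto simp: isol_def intro: ipair_component)
  have *: "ipair (\<lambda>x. cnj (H x $ i) * G x $ j - cnj (K x $ i) * F x $ j)
     (\<lambda>x. (cnj (K x $ i) * G x $ j + cnj (H x $ i) * rhs q l F x $ j) - (cnj (rhs q m H x $ i) * F x $ j + cnj (K x $ i) * G x $ j))" for i j
    by (intro ipair_diff' ipair_mult ipair_cnj F G H K)
  show ?thesis
    by (rule ipair_cong'[OF ipair_add[OF *[of 1 2] *[of 2 1]]]) (auto simp: W_def algebra_simps)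
qed

lemma W_const:
  assumes "isol q l F G" "isol q (cnj l) H K" "x \<ge> 0"
  shows "W (F x) (G x) (H x) (K x) = W (F 0) (G 0) (H 0) (K 0)"
  using ipair_diff[OF ipair_W[OF assms(1,2)] _ assms(3)] by (simp add: has_integral_0_eq)

lemma W_lin:
  "W (u + u') (v + v') h k = W u v h k + W u' v' h k"
  "W (c *s u) (c *s v) h k = c * W u v h k"
  "W (u - u') (v - v') h k = W u v h k - W u' v' h k"
  "W u v (h + h') (k + k') = W u v h k + W u v h' k'"
  "W u v (h - h') (k - k') = W u v h k - W u v h' k'"
  "W u v (c *s h) (c *s k) = cnj c * W u v h k"
  by (simp_all add: W_def algebra_simps)

lemma W_cnj: "cnj (W u v h k) = - W h k u v"
  by (simp add: W_def algebra_simps)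

section \<open>Boundary data at 0 and uniqueness of solutions\<close>

fun ell0 :: "bparam => complex => complex => complex" where
  "ell0 (Fin a) f f' = (cnj a * f' - f) / complex_of_real (sqrt (1 + (cmod a)\<^sup>2))"
| "ell0 Infty f f' = f'"

fun ell1 :: "bparam => complex => complex => complex" where
  "ell1 (Fin a) f f' = (f' + a * f) / complex_of_real (sqrt (1 + (cmod a)\<^sup>2))"
| "ell1 Infty f f' = f"

definition bL :: "bparam => complex^2 => complex^2 => complex^2" where
  "bL \<alpha> u v = vector [ell0 (cnj_bparam \<alpha>) (u $ 1) (v $ 1), ell0 \<alpha> (u $ 2) (v $ 2)]"

definition bLp :: "bparam => complex^2 => complex^2 => complex^2" where
  "bLp \<alpha> u v = vector [ell1 (cnj_bparam \<alpha>) (u $ 1) (v $ 1), ell1 \<alpha> (u $ 2) (v $ 2)]"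

lemma ell_eq:
  assumes "(f has_vector_derivative d) (at 0 within {0..})"
  shows "ell \<alpha> f = ell0 \<alpha> (f 0) d" "ell_perp \<alpha> f = ell1 \<alpha> (f 0) d"
  using hderiv_eq[OF assms] by (cases \<alpha>; simp)+

lemma L_bd_eq:
  assumes "(F has_vector_derivative d) (at 0 within {0..})"
  shows "L_bd \<alpha> F = bL \<alpha> (F 0) d" "L_bd_perp \<alpha> F = bLp \<alpha> (F 0) d"
proof -
  have "((\<lambda>x. F x $ i) has_vector_derivative (d $ i)) (at 0 within {0..})" for i
    using bounded_linear.has_vector_derivative[OF bounded_linear_vec_nth assms] .
  note * = ell_eq[OF this[of 1]] ell_eq[OF this[of 2]]
  then show "L_bd \<alpha> F = bL \<alpha> (F 0) d" "L_bd_perp \<alpha> F = bLp \<alpha> (F 0) d"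
    by (simp_all add: L_bd_def L_bd_perp_def bL_def bLp_def *)
qed

lemma isol_L_bd:
  assumes "isol q l F G"
  shows "L_bd \<alpha> F = bL \<alpha> (F 0) (G 0)" "L_bd_perp \<alpha> F = bLp \<alpha> (F 0) (G 0)"
  using L_bd_eq[OF isol_deriv(1)[OF assms, of 0]] by auto

lemma ell_lin:
  "ell0 \<alpha> (a + b) (a' + b') = ell0 \<alpha> a a' + ell0 \<alpha> b b'"
  "ell1 \<alpha> (a + b) (a' + b') = ell1 \<alpha> a a' + ell1 \<alpha> b b'"
  "ell0 \<alpha> (a - b) (a' - b') = ell0 \<alpha> a a' - ell0 \<alpha> b b'"
  "ell1 \<alpha> (a - b) (a' - b') = ell1 \<alpha> a a' - ell1 \<alpha> b b'"
  "ell0 \<alpha> (c * a) (c * a') = c * ell0 \<alpha> a a'"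
  "ell1 \<alpha> (c * a) (c * a') = c * ell1 \<alpha> a a'"
  "ell0 \<alpha> 0 0 = 0" "ell1 \<alpha> 0 0 = 0"
  by (cases \<alpha>; simp add: algebra_simps add_divide_distrib diff_divide_distrib)+

lemma bL_lin:
  "bL \<alpha> (u + u') (v + v') = bL \<alpha> u v + bL \<alpha> u' v'"
  "bLp \<alpha> (u + u') (v + v') = bLp \<alpha> u v + bLp \<alpha> u' v'"
  "bL \<alpha> (u - u') (v - v') = bL \<alpha> u v - bL \<alpha> u' v'"
  "bLp \<alpha> (u - u') (v - v') = bLp \<alpha> u v - bLp \<alpha> u' v'"
  "bL \<alpha> (c *s u) (c *s v) = c *s bL \<alpha> u v"
  "bLp \<alpha> (c *s u) (c *s v) = c *s bLp \<alpha> u v"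
  by (simp_all add: bL_def bLp_def vec2_eq_iff ell_lin)

lemma ell_cnj: "cnj (ell0 (cnj_bparam \<alpha>) f f') = ell0 \<alpha> (cnj f) (cnj f')"
  "cnj (ell1 (cnj_bparam \<alpha>) f f') = ell1 \<alpha> (cnj f) (cnj f')"
  by (cases \<alpha>; simp)+

lemma cnj_bparam_cnj [simp]: "cnj_bparam (cnj_bparam \<alpha>) = \<alpha>"
  by (cases \<alpha>) auto

text \<open>The change from \<open>(f', f)\<close> to the two functionals has determinant
  \<open>(1 + a * cnj a) / s^2 = 1\<close>, so it preserves the bilinear Wronskian.\<close>

lemma ell_wronskian:
  "f * g' - f' * g = ell1 \<alpha> f f' * ell0 \<alpha> g g' - ell0 \<alpha> f f' * ell1 \<alpha> g g'"
proof (cases \<alpha>)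
  case (Fin a)
  define s where "s = complex_of_real (sqrt (1 + (cmod a)\<^sup>2))"
  have ss: "s * s = 1 + a * cnj a"
    unfolding s_def by (simp flip: of_real_mult add: complex_norm_square[symmetric])
  have s0: "s \<noteq> 0" by (simp add: s_def add_nonneg_eq_0_iff)
  have "(f' + a * f) * (cnj a * g' - g) - (cnj a * f' - f) * (g' + a * g) = (f * g' - f' * g) * (s * s)"
    unfolding ss by (simp add: algebra_simps)
  then show ?thesis using s0 unfolding Fin ell0.simps ell1.simps s_def[symmetric]
    by (simp add: divide_simps)
qed simp

text \<open>Conjugating the data of the first component replaces \<open>cnj_bparam \<alpha>\<close>
  by \<alpha>, the parameter of the second component of the other solution. This crosswise match is
  the reason for conjugate parameters in the two components.\<close>

lemma W_boundary:
  "W u v h k = cnj (bLp \<alpha> h k $ 1) * bL \<alpha> u v $ 2 + cnj (bLp \<alpha> h k $ 2) * bL \<alpha> u v $ 1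
     - cnj (bL \<alpha> h k $ 1) * bLp \<alpha> u v $ 2 - cnj (bL \<alpha> h k $ 2) * bLp \<alpha> u v $ 1"
proof -
  have "cnj (h $ 1) * v $ 2 - cnj (k $ 1) * u $ 2 = cnj (bLp \<alpha> h k $ 1) * bL \<alpha> u v $ 2 - cnj (bL \<alpha> h k $ 1) * bLp \<alpha> u v $ 2"
    using ell_wronskian[of "cnj (h $ 1)" "v $ 2" "cnj (k $ 1)" "u $ 2" \<alpha>]
    by (simp add: bL_def bLp_def ell_cnj)
  moreover have "cnj (h $ 2) * v $ 1 - cnj (k $ 2) * u $ 1 = cnj (bLp \<alpha> h k $ 2) * bL \<alpha> u v $ 1 - cnj (bL \<alpha> h k $ 2) * bLp \<alpha> u v $ 1"
    using ell_wronskian[of "cnj (h $ 2)" "v $ 1" "cnj (k $ 2)" "u $ 1" "cnj_bparam \<alpha>"] ell_cnj[of "cnj_bparam \<alpha>"]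
    by (simp add: bL_def bLp_def)
  ultimately show ?thesis unfolding W_def by (simp add: algebra_simps)
qed

text \<open>The Wronskian form is nondegenerate and can be expressed by boundary data; testing it
  with unit vectors recovers \<open>u\<close> and \<open>v\<close>.\<close>

lemma boundary_data_inj:
  assumes "bL \<alpha> u v = 0" "bLp \<alpha> u v = 0"
  shows "u = 0" "v = 0"
proof -
  have W0: "W u v h k = 0" for h k using W_boundary[of u v h k \<alpha>] assms by simp
  from W0[of "axis 1 1" 0] W0[of "axis 2 1" 0] W0[of 0 "axis 1 1"] W0[of 0 "axis 2 1"]
  show "u = 0" "v = 0" by (auto simp: W_def axis_def vec2_eq_iff)
qed

lemma integrable_q:
  fixes q :: "real => complex"
  assumes "integrable halfline q" "a \<ge> 0"
  shows "q absolutely_integrable_on {a..b}"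
  by (rule set_integrable_subset[of lebesgue "{0..}"]) (use assms integrable_halfline_iff[of q] in auto)

lemma norm_rhs_diff:
  "norm (rhs q l F x - rhs q m H x) \<le> 2 * (cmod (q x) + cmod l) * norm (F x - H x) + 2 * cmod (l - m) * norm (H x)"
proof -
  let ?d = "F x - H x"
  have n: "cmod (v $ i) \<le> norm v" for v :: "complex^2" and i by (rule Finite_Cartesian_Product.norm_nth_le)
  have 1: "cmod ((rhs q l F x - rhs q m H x) $ 1) \<le> cmod (q x) * norm ?d + cmod l * norm ?d + cmod (l - m) * norm (H x)"
  proof -
    have "(rhs q l F x - rhs q m H x) $ 1 = cnj (q x) * ?d $ 1 - l * ?d $ 2 - (l - m) * H x $ 2"
      by (simp add: algebra_simps)
    also have "cmod \<dots> \<le> cmod (cnj (q x) * ?d $ 1) + cmod (l * ?d $ 2) + cmod ((l - m) * H x $ 2)"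
      by (intro order_trans[OF norm_triangle_ineq4] add_right_mono norm_triangle_ineq4)
    also have "\<dots> \<le> cmod (q x) * norm ?d + cmod l * norm ?d + cmod (l - m) * norm (H x)"
      unfolding norm_mult complex_mod_cnj by (intro add_mono mult_left_mono n) auto
    finally show ?thesis .
  qed
  have 2: "cmod ((rhs q l F x - rhs q m H x) $ 2) \<le> cmod (q x) * norm ?d + cmod l * norm ?d + cmod (l - m) * norm (H x)"
  proof -
    have "(rhs q l F x - rhs q m H x) $ 2 = q x * ?d $ 2 - l * ?d $ 1 - (l - m) * H x $ 1"
      by (simp add: algebra_simps)
    also have "cmod \<dots> \<le> cmod (q x * ?d $ 2) + cmod (l * ?d $ 1) + cmod ((l - m) * H x $ 1)"
      by (intro order_trans[OF norm_triangle_ineq4] add_right_mono norm_triangle_ineq4)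
    also have "\<dots> \<le> cmod (q x) * norm ?d + cmod l * norm ?d + cmod (l - m) * norm (H x)"
      unfolding norm_mult by (intro add_mono mult_left_mono n) auto
    finally show ?thesis .
  qed
  show ?thesis
    using norm_le_sum2[of "rhs q l F x - rhs q m H x"] 1 2 by (simp add: algebra_simps)
qed

text \<open>Gronwall for the difference together with its derivative. A change of the spectral
  parameter acts as a source of size \<open>2 * cmod (l - m) * B\<close>, where \<open>B\<close>
  bounds the reference solution \<open>H\<close>; with \<open>l = m\<close> this is uniqueness, with
  \<open>l\<close> tending to \<open>m\<close> continuous dependence.\<close>

lemma isol_close:
  assumes q: "integrable halfline q" and FG: "isol q l F G" and HK: "isol q m H K" and b: "b \<ge> 0"
    and B: "\<And>t. t \<in> {0..b} ==> norm (H t) \<le> B" and x: "x \<in> {0..b}"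
  shows "norm (F x - H x) + norm (G x - K x) \<le>
    2 * (norm (F 0 - H 0) + norm (G 0 - K 0) + 2 * cmod (l - m) * B * b) *
      exp (2 * integral {0..x} (\<lambda>t. 1 + 2 * (cmod (q t) + cmod l)))"
proof -
  define mm where "mm t = 1 + 2 * (cmod (q t) + cmod l)" for t
  define X where "X t = norm (F t - H t) + norm (G t - K t)" for t
  define a where "a = norm (F 0 - H 0) + norm (G 0 - K 0) + 2 * cmod (l - m) * B * b"
  have B0: "B \<ge> 0" using order_trans[OF norm_ge_zero B[of 0]] b by auto
  have FG': "ipair F G" "ipair G (rhs q l F)" and HK': "ipair H K" "ipair K (rhs q m H)"
    using FG HK by (auto simp: isol_def)
  have D: "ipair (\<lambda>t. F t - H t) (\<lambda>t. G t - K t)" "ipair (\<lambda>t. G t - K t) (\<lambda>t. rhs q l F t - rhs q m H t)"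
    by (intro ipair_diff' FG' HK')+
  have qn: "(\<lambda>t. cmod (q t)) absolutely_integrable_on {0..y}" for y
    using absolutely_integrable_norm[OF integrable_q[OF q]] by (simp add: o_def)
  have mm: "mm absolutely_integrable_on {0..y}" for y
    unfolding mm_def by (intro set_integral_add(1) set_integrable_mult_right qn absolutely_integrable_continuous_real continuous_intros)
  have M: "ipair (\<lambda>x. integral {0..x} mm) mm" by (rule ipair_from_integrable[OF mm])
  have Xc: "continuous_on {0..y} X" for y
    unfolding X_def
    by (intro continuous_on_add continuous_on_norm ipair_continuous_on_interval[OF D(1)] ipair_continuous_on_interval[OF D(2)]) auto
  have int: "(\<lambda>t. mm t * X t) integrable_on {0..y}" for y
    using continuous_times_absolutely_integrable[OF Xc[of y] mm[of y]]
    by (simp add: mult.commute set_lebesgue_integral_eq_integral(1))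
  have "X x \<le> 2 * a * exp (2 * (integral {0..x} mm - integral {0..0} mm))"
  proof (rule gronwall[OF M _ Xc b _ _ _ x])
    show "0 \<le> mm t" for t by (simp add: mm_def)
    show "0 \<le> X t" for t by (simp add: X_def)
    show "a \<ge> 0" using B0 b by (simp add: a_def)
    fix y assume y: "y \<in> {0..b}"
    have i1: "((\<lambda>t. G t - K t) has_integral (F y - H y) - (F 0 - H 0)) {0..y}"
      and i2: "((\<lambda>t. rhs q l F t - rhs q m H t) has_integral (G y - K y) - (G 0 - K 0)) {0..y}"
      using ipair_diff[OF D(1), of 0 y] ipair_diff[OF D(2), of 0 y] y by auto
    have n1: "(\<lambda>t. norm (G t - K t)) integrable_on {0..y}"
      and n2: "(\<lambda>t. norm (rhs q l F t - rhs q m H t)) integrable_on {0..y}"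
      using absolutely_integrable_norm[OF ipair_absI[OF D(1), of 0 y]] absolutely_integrable_norm[OF ipair_absI[OF D(2), of 0 y]]
      by (auto simp: o_def set_lebesgue_integral_eq_integral(1))
    have "norm (F y - H y) \<le> norm (F 0 - H 0) + integral {0..y} (\<lambda>t. norm (G t - K t))"
    proof -
      have "norm ((F y - H y) - (F 0 - H 0)) \<le> integral {0..y} (\<lambda>t. norm (G t - K t))"
        using integral_norm_bound_integral[OF has_integral_integrable[OF i1] n1] integral_unique[OF i1] by auto
      then show ?thesis using norm_triangle_sub[of "F y - H y" "F 0 - H 0"] by linarith
    qed
    moreover have "norm (G y - K y) \<le> norm (G 0 - K 0) + integral {0..y} (\<lambda>t. norm (rhs q l F t - rhs q m H t))"
    proof -
      have "norm ((G y - K y) - (G 0 - K 0)) \<le> integral {0..y} (\<lambda>t. norm (rhs q l F t - rhs q m H t))"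
        using integral_norm_bound_integral[OF has_integral_integrable[OF i2] n2] integral_unique[OF i2] by auto
      then show ?thesis using norm_triangle_sub[of "G y - K y" "G 0 - K 0"] by linarith
    qed
    ultimately have "X y \<le> norm (F 0 - H 0) + norm (G 0 - K 0) +
        integral {0..y} (\<lambda>t. norm (G t - K t) + norm (rhs q l F t - rhs q m H t))"
      unfolding X_def Henstock_Kurzweil_Integration.integral_add[OF n1 n2] by linarith
    also have "integral {0..y} (\<lambda>t. norm (G t - K t) + norm (rhs q l F t - rhs q m H t))
        \<le> integral {0..y} (\<lambda>t. mm t * X t + 2 * cmod (l - m) * B)"
    proof (rule integral_le)
      show "(\<lambda>t. norm (G t - K t) + norm (rhs q l F t - rhs q m H t)) integrable_on {0..y}"
        by (intro integrable_add n1 n2)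
      show "(\<lambda>t. mm t * X t + 2 * cmod (l - m) * B) integrable_on {0..y}"
        by (intro integrable_add int integrable_const_ivl)
      fix t assume t: "t \<in> {0..y}"
      have "norm (rhs q l F t - rhs q m H t) \<le> 2 * (cmod (q t) + cmod l) * norm (F t - H t) + 2 * cmod (l - m) * B"
        using norm_rhs_diff[of q l F t m H] mult_left_mono[OF B[of t], of "2 * cmod (l - m)"] t y by auto
      moreover have "mm t * X t = norm (F t - H t) + norm (G t - K t) + 2 * (cmod (q t) + cmod l) * norm (F t - H t)
          + 2 * (cmod (q t) + cmod l) * norm (G t - K t)"
        by (simp add: mm_def X_def algebra_simps)
      moreover have "2 * (cmod (q t) + cmod l) * norm (G t - K t) \<ge> 0" by simp
      moreover have "norm (F t - H t) \<ge> 0" by simp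
      ultimately show "norm (G t - K t) + norm (rhs q l F t - rhs q m H t) \<le> mm t * X t + 2 * cmod (l - m) * B"
        by linarith
    qed
    also have "\<dots> = integral {0..y} (\<lambda>t. mm t * X t) + 2 * cmod (l - m) * B * y"
      using y by (subst Henstock_Kurzweil_Integration.integral_add[OF int]) auto
    also have "2 * cmod (l - m) * B * y \<le> 2 * cmod (l - m) * B * b"
      using y B0 by (intro mult_left_mono) auto
    finally show "X y \<le> a + integral {0..y} (\<lambda>t. mm t * X t)" by (simp add: a_def)
  qed
  then show ?thesis by (simp add: X_def a_def mm_def[abs_def])
qed

lemma isol_unique:
  assumes q: "integrable halfline q" and FG: "isol q l F G" and HK: "isol q l H K"
    and "F 0 = H 0" "G 0 = K 0" and x: "x \<ge> 0"
  shows "F x = H x" "G x = K x"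
proof -
  have "continuous_on {0..x} (\<lambda>t. norm (H t))"
    using HK by (intro continuous_on_norm) (auto simp: isol_def intro: ipair_continuous_on_interval)
  then obtain z where z: "\<And>t. t \<in> {0..x} ==> norm (H t) \<le> norm (H z)"
    using continuous_attains_sup[of "{0..x}" "\<lambda>t. norm (H t)"] x by (metis atLeastatMost_empty_iff compact_Icc)
  from isol_close[OF q FG HK x z, of x] assms(4-) have "norm (F x - H x) + norm (G x - K x) \<le> 0" by simp
  then have "norm (F x - H x) = 0" "norm (G x - K x) = 0"
    using norm_ge_zero[of "F x - H x"] norm_ge_zero[of "G x - K x"] by linarith+
  then show "F x = H x" "G x = K x" by auto
qed

lemma isol_unique_boundary:
  assumes q: "integrable halfline q" and FG: "isol q l F G" and HK: "isol q l H K"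
    and "bL \<alpha> (F 0) (G 0) = bL \<alpha> (H 0) (K 0)" "bLp \<alpha> (F 0) (G 0) = bLp \<alpha> (H 0) (K 0)" and x: "x \<ge> 0"
  shows "F x = H x" "G x = K x"
proof -
  have z: "bL \<alpha> (F 0 - H 0) (G 0 - K 0) = 0" "bLp \<alpha> (F 0 - H 0) (G 0 - K 0) = 0"
    using assms(4,5) by (simp_all only: bL_lin) auto
  have "F 0 - H 0 = 0" "G 0 - K 0 = 0"
    using boundary_data_inj[OF z] by auto
  then show "F x = H x" "G x = K x" using isol_unique[OF q FG HK] x by auto
qed

section \<open>Decay of solutions and vanishing Wronskians\<close>

lemma isol_zero: "isol q l (\<lambda>x. 0) (\<lambda>x. 0)"
  unfolding isol_def by (auto intro: ipair_const ipair_cong'[OF ipair_const[of 0]] simp: vec2_eq_iff)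

lemma norm_rhs: "norm (rhs q l F x) \<le> (2 * cmod (q x)) * norm (F x) + 2 * cmod l * norm (F x)"
proof -
  have "rhs q l (\<lambda>x. 0) x = 0" by (simp add: vec2_eq_iff)
  then show ?thesis using norm_rhs_diff[of q l F x l "\<lambda>x. 0"] by (simp add: algebra_simps)
qed

text \<open>The term with \<open>l\<close> plays the role of \<open>h\<close>, so its averages
  vanish along with those of \<open>F\<close>; the averages of the potential vanish because it is
  integrable.\<close>

lemma isol_tendsto_0:
  assumes q: "integrable halfline q" and FG: "isol q l F G"
    and avg: "((\<lambda>x. integral {x..x+1} (\<lambda>t. norm (F t))) \<longlongrightarrow> 0) at_top"
  shows "(F \<longlongrightarrow> 0) at_top" "(G \<longlongrightarrow> 0) at_top"
proof -
  have F: "ipair F G" "ipair G (rhs q l F)" using FG by (auto simp: isol_def)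
  have Fi: "(\<lambda>t. norm (F t)) integrable_on {x..x+1}" if "x \<ge> 0" for x
    by (intro integrable_continuous_real continuous_on_norm ipair_continuous_on_interval[OF F(1) that])
  have q': "(\<lambda>t. 2 * cmod (q t)) absolutely_integrable_on {0..}"
    using q by (auto simp: integrable_halfline_iff intro: set_integrable_mult_right absolutely_integrable_norm[unfolded o_def])
  have qi: "(\<lambda>t. 2 * cmod (q t)) integrable_on {x..x+1}" if "x \<ge> 0" for x
    by (rule set_lebesgue_integral_eq_integral(1)) (rule set_integrable_subset[OF q'], use that in auto)
  have hl: "((\<lambda>x. integral {x..x+1} (\<lambda>t. 2 * cmod l * norm (F t))) \<longlongrightarrow> 0) at_top"
    using tendsto_mult_left[OF avg, of "2 * cmod l"] by simp
  have hi: "(\<lambda>t. 2 * cmod l * norm (F t)) integrable_on {x..x+1}" if "x \<ge> 0" for x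
    using integrable_on_cmult_left[OF Fi[OF that], of "2 * cmod l"] by (simp add: o_def)
  show "(F \<longlongrightarrow> 0) at_top" "(G \<longlongrightarrow> 0) at_top"
    using tendsto_0_of_averages[OF F qi hi _ _ norm_rhs tail_integral_tendsto_0[OF q'] hl avg] by auto
qed

lemma average_tendsto_0:
  fixes f :: "real => real"
  assumes f: "(f \<longlongrightarrow> 0) at_top" and c: "continuous_on {0..} f"
  shows "((\<lambda>x. integral {x..x+1} f) \<longlongrightarrow> 0) at_top"
proof (rule tendstoI)
  fix e :: real assume e: "e > 0"
  have "\<forall>\<^sub>F x in at_top. dist (f x) 0 < e/2" using f e by (intro tendstoD) auto
  then obtain N where N: "\<And>x. x \<ge> N ==> \<bar>f x\<bar> < e/2" by (auto simp: eventually_at_top_linorder)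
  show "\<forall>\<^sub>F x in at_top. dist (integral {x..x+1} f) 0 < e"
  proof (rule eventually_at_top_linorderI[of "max N 0"])
    fix x assume x: "x \<ge> max N 0"
    have "norm (integral {x..x+1} f) \<le> integral {x..x+1} (\<lambda>t. e/2)"
      by (rule integral_norm_bound_integral)
        (use x N in \<open>auto intro!: integrable_continuous_real continuous_on_subset[OF c] intro: less_imp_le\<close>)
    then show "dist (integral {x..x+1} f) 0 < e" using e by simp
  qed
qed

lemma isol_deriv_tendsto_0:
  assumes q: "integrable halfline q" and FG: "isol q l F G" and F0: "(F \<longlongrightarrow> 0) at_top"
  shows "(G \<longlongrightarrow> 0) at_top"
proof (rule isol_tendsto_0(2)[OF q FG])
  have "continuous_on {0..} F" using FG by (auto simp: isol_def dest: ipair_continuous_on)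
  then show "((\<lambda>x. integral {x..x+1} (\<lambda>t. norm (F t))) \<longlongrightarrow> 0) at_top"
    by (intro average_tendsto_0 continuous_on_norm tendsto_norm_zero F0)
qed

lemma L2_average_tendsto_0:
  fixes F :: "real => 'a::euclidean_space"
  assumes c: "continuous_on {0..} F" and L2: "(\<lambda>x. (norm (F x))\<^sup>2) absolutely_integrable_on {0..}"
  shows "((\<lambda>x. integral {x..x+1} (\<lambda>t. norm (F t))) \<longlongrightarrow> 0) at_top"
proof (rule tendstoI)
  fix e :: real assume e: "e > 0"
  have "\<forall>\<^sub>F x in at_top. dist (integral {x..x+1} (\<lambda>x. (norm (F x))\<^sup>2)) 0 < e * e"
    by (rule tendstoD[OF tail_integral_tendsto_0[OF L2]]) (use e in simp)
  then show "\<forall>\<^sub>F x in at_top. dist (integral {x..x+1} (\<lambda>t. norm (F t))) 0 < e"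
    using eventually_ge_at_top[of 0]
  proof eventually_elim
    case (elim x)
    have ci: "continuous_on {x..x+1} F" by (rule continuous_on_subset[OF c]) (use elim in auto)
    have i1: "(\<lambda>t. norm (F t)) integrable_on {x..x+1}" by (intro integrable_continuous_real continuous_intros ci)
    have i2: "(\<lambda>t. (norm (F t))\<^sup>2) integrable_on {x..x+1}" by (intro integrable_continuous_real continuous_intros ci)
    have "integral {x..x+1} (\<lambda>t. norm (F t)) \<le> integral {x..x+1} (\<lambda>t. e / 2 + (norm (F t))\<^sup>2 * (1 / (2 * e)))"
    proof (rule integral_le[OF i1])
      show "(\<lambda>t. e / 2 + (norm (F t))\<^sup>2 * (1 / (2 * e))) integrable_on {x..x+1}"
        by (intro integrable_continuous_real continuous_intros ci) (use e in auto)
      fix t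
      have "0 \<le> (e - norm (F t))\<^sup>2" by simp
      then have "2 * e * norm (F t) \<le> e * e + (norm (F t))\<^sup>2" by (simp add: power2_eq_square algebra_simps)
      then show "norm (F t) \<le> e / 2 + (norm (F t))\<^sup>2 * (1 / (2 * e))" using e by (simp add: field_simps)
    qed
    also have "\<dots> = e / 2 + integral {x..x+1} (\<lambda>t. (norm (F t))\<^sup>2) * (1 / (2 * e))"
      by (subst Henstock_Kurzweil_Integration.integral_add)
        (use e in \<open>auto intro!: integrable_continuous_real continuous_intros ci\<close>)
    also have "\<dots> < e / 2 + (e * e) * (1 / (2 * e))"
      using elim e by (intro add_strict_left_mono mult_strict_right_mono) auto
    also have "\<dots> = e" using e by simp
    finally show ?case using integral_nonneg[OF i1] by simp
  qed
qed

lemma isol_L2_tendsto_0: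
  assumes q: "integrable halfline q" and FG: "isol q l F G" and L2: "(\<lambda>x. (norm (F x))\<^sup>2) absolutely_integrable_on {0..}"
  shows "(F \<longlongrightarrow> 0) at_top" "(G \<longlongrightarrow> 0) at_top"
proof -
  have c: "continuous_on {0..} F" using FG by (auto simp: isol_def dest: ipair_continuous_on)
  show "(F \<longlongrightarrow> 0) at_top" "(G \<longlongrightarrow> 0) at_top"
    using isol_tendsto_0[OF q FG L2_average_tendsto_0[OF c L2]] by auto
qed

lemma tendsto_W:
  assumes "(F \<longlongrightarrow> u) A" "(G \<longlongrightarrow> v) A" "(H \<longlongrightarrow> h) A" "(K \<longlongrightarrow> k) A"
  shows "((\<lambda>x. W (F x) (G x) (H x) (K x)) \<longlongrightarrow> W u v h k) A"
  unfolding W_def using assms by (intro tendsto_intros)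

lemma norm_W_le: "cmod (W u v h k) \<le> 4 * (norm u + norm v) * (norm h + norm k)"
proof -
  have n: "cmod (x $ i) \<le> norm x" for x :: "complex^2" and i by (rule Finite_Cartesian_Product.norm_nth_le)
  have "cmod (W u v h k) \<le> cmod (cnj (h $ 1) * v $ 2) + cmod (cnj (h $ 2) * v $ 1) + cmod (cnj (k $ 1) * u $ 2) + cmod (cnj (k $ 2) * u $ 1)"
    unfolding W_def by (intro order_trans[OF norm_triangle_ineq4] add_right_mono norm_triangle_ineq)
  also have "\<dots> \<le> norm h * norm v + norm h * norm v + norm k * norm u + norm k * norm u"
    unfolding norm_mult complex_mod_cnj by (intro add_mono mult_mono n) auto
  also have "\<dots> \<le> 4 * (norm u + norm v) * (norm h + norm k)"
  proof -
    have "0 \<le> norm h * norm v" "0 \<le> norm k * norm u" "0 \<le> norm h * norm u" "0 \<le> norm k * norm v" by auto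
    then show ?thesis by (simp add: algebra_simps)
  qed
  finally show ?thesis .
qed

lemma W_eq_0_of_decay:
  assumes FG: "isol q l F G" and HK: "isol q (cnj l) H K"
    and F: "(F \<longlongrightarrow> 0) at_top" "(G \<longlongrightarrow> 0) at_top"
    and B: "\<forall>\<^sub>F x in at_top. norm (H x) + norm (K x) \<le> B" and x: "x \<ge> 0"
  shows "W (F x) (G x) (H x) (K x) = 0"
proof -
  have "((\<lambda>x. 4 * (norm (F x) + norm (G x)) * B) \<longlongrightarrow> 4 * (0 + 0) * B) at_top"
    by (intro tendsto_intros tendsto_norm_zero F)
  then have l: "((\<lambda>x. 4 * (norm (F x) + norm (G x)) * B) \<longlongrightarrow> 0) at_top" by simp
  have "((\<lambda>x. W (F x) (G x) (H x) (K x)) \<longlongrightarrow> 0) at_top"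
  proof (rule Lim_null_comparison[OF _ l])
    show "\<forall>\<^sub>F x in at_top. cmod (W (F x) (G x) (H x) (K x)) \<le> 4 * (norm (F x) + norm (G x)) * B"
      using B
    proof eventually_elim
      case (elim x)
      show ?case by (rule order_trans[OF norm_W_le]) (rule mult_left_mono[OF elim], simp)
    qed
  qed
  moreover have "((\<lambda>x. W (F x) (G x) (H x) (K x)) \<longlongrightarrow> W (F 0) (G 0) (H 0) (K 0)) at_top"
    by (rule Lim_transform_eventually[OF tendsto_const], rule eventually_at_top_linorderI[of 0],
        rule W_const[OF FG HK, symmetric])
  ultimately have "W (F 0) (G 0) (H 0) (K 0) = 0" by (rule tendsto_unique[OF trivial_limit_at_top_linorder, rotated])
  then show ?thesis using W_const[OF FG HK x] by simp
qed

section \<open>Jost solutions\<close>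

lemma isol_hderiv: "isol q l F G ==> isol q l F (hderiv F)"
  by (rule isol_cong) (auto simp: isol_deriv(2))

text \<open>Conjugation turns \<open>Q\<close> into its transpose and the swap of components undoes
  this. \<open>e_plus\<close> is fixed and \<open>e_minus\<close> changes sign.\<close>

definition sharp :: "complex^2 => complex^2" where
  "sharp u = vector [cnj (u $ 2), cnj (u $ 1)]"

lemma sharp_nth [simp]: "sharp u $ 1 = cnj (u $ 2)" "sharp u $ 2 = cnj (u $ 1)"
  by (simp_all add: sharp_def)

lemma isol_sharp:
  assumes "isol q l F G"
  shows "isol q (cnj l) (\<lambda>x. sharp (F x)) (\<lambda>x. sharp (G x))"
proof -
  have F: "ipair (\<lambda>x. F x $ i) (\<lambda>x. G x $ i)" and G: "ipair (\<lambda>x. G x $ i) (\<lambda>x. rhs q l F x $ i)" for i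
    using assms by (auto simp: isol_def intro: ipair_component)
  have 1: "ipair (\<lambda>x. sharp (F x)) (\<lambda>x. sharp (G x))"
    by (rule ipair_vec2) (auto intro: ipair_cnj F)
  have 2: "ipair (\<lambda>x. sharp (G x)) (rhs q (cnj l) (\<lambda>x. sharp (F x)))"
    by (rule ipair_vec2) (use ipair_cnj[OF G[of 1]] ipair_cnj[OF G[of 2]] in simp_all)
  show ?thesis using 1 2 by (simp add: isol_def)
qed

lemma W_sharp: "W (sharp u) (sharp v) (sharp h) (sharp k) = cnj (W u v h k)"
  by (simp add: W_def)

lemma bL_sharp: "bL \<alpha> (sharp u) (sharp v) = sharp (bL \<alpha> u v)"
  "bLp \<alpha> (sharp u) (sharp v) = sharp (bLp \<alpha> u v)"
  using ell_cnj[of \<alpha>] ell_cnj[of "cnj_bparam \<alpha>"] by (simp_all add: bL_def bLp_def vec2_eq_iff)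

lemma exp_decay_integrable:
  fixes f :: "real => real"
  assumes c: "continuous_on {0..} f" and a: "a > 0" and f: "\<forall>\<^sub>F x in at_top. \<bar>f x\<bar> \<le> B * exp (- a * x)"
  shows "f absolutely_integrable_on {0..}"
proof -
  obtain N where N: "N \<ge> 0" "\<And>x. x \<ge> N ==> \<bar>f x\<bar> \<le> B * exp (- a * x)"
  proof -
    obtain M where M: "\<And>x. x \<ge> M ==> \<bar>f x\<bar> \<le> B * exp (- a * x)"
      using f by (auto simp: eventually_at_top_linorder)
    show ?thesis by (rule that[of "max 0 M"]) (use M in auto)
  qed
  have e: "(\<lambda>x. B * exp (- a * x)) absolutely_integrable_on {N..}"
  proof -
    have "(\<lambda>x. exp (- a * x)) absolutely_integrable_on {N..}"
      using has_integral_exp_minus_to_infinity[OF a] by (intro nonnegative_absolutely_integrable_1) auto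
    then show ?thesis by (rule set_integrable_mult_right)
  qed
  have "f absolutely_integrable_on {N..}"
  proof (rule measurable_bounded_by_integrable_imp_absolutely_integrable)
    show "f \<in> borel_measurable (lebesgue_on {N..})"
      by (intro continuous_imp_measurable_on_sets_lebesgue continuous_on_subset[OF c]) (use N in auto)
    show "(\<lambda>x. B * exp (- a * x)) integrable_on {N..}" using e set_lebesgue_integral_eq_integral(1) by blast
  qed (use N in auto)
  moreover have "f absolutely_integrable_on {0..N}"
    by (intro absolutely_integrable_continuous_real continuous_on_subset[OF c]) auto
  ultimately have "f absolutely_integrable_on ({0..N} \<union> {N..})"
    by (intro set_integrable_Un) auto
  moreover have "{0..N} \<union> {N..} = {0..}" using N(1) by auto
  ultimately show ?thesis by simp
qed

lemma norm_scale2: "norm (c *s u) = cmod c * norm (u :: complex^2)"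
proof -
  have "(norm (c *s u))\<^sup>2 = (cmod c * norm u)\<^sup>2"
    unfolding norm_sq2 power_mult_distrib by (simp add: norm_mult power_mult_distrib distrib_left)
  then show ?thesis by (simp add: power2_eq_iff_nonneg)
qed

lemma jost_asymptotics:
  assumes "jost_solution q k w v F"
  obtains R S where "(R \<longlongrightarrow> 0) at_top" "(S \<longlongrightarrow> 0) at_top"
    "\<And>x::real. F x = exp (w * k * x) *s (v + R x)"
    "\<And>x. hderiv F x = exp (w * k * x) *s ((w * k) *s v + S x)"
proof -
  define E where "E x = exp (w * complex_of_real k * complex_of_real x)" for x :: real
  have E0: "E x \<noteq> 0" for x by (simp add: E_def)
  define R where "R x = inverse (E x) *s (F x - E x *s v)" for x
  define S where "S x = inverse (E x) *s (hderiv F x - (w * k * E x) *s v)" for x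
  have lim: "(T \<longlongrightarrow> 0) at_top" if "(\<lambda>x. norm (f x)) \<in> o[at_top](\<lambda>x. cmod (E x))" "\<And>x. T x = inverse (E x) *s f x" for T f :: "real => complex^2"
  proof -
    have "((\<lambda>x. norm (f x) / cmod (E x)) \<longlongrightarrow> 0) at_top" using that(1) by (rule smalloD_tendsto)
    then have "((\<lambda>x. norm (T x)) \<longlongrightarrow> 0) at_top"
      unfolding that(2) norm_scale2 by (simp add: norm_inverse divide_inverse mult.commute)
    then show ?thesis by (rule tendsto_norm_zero_cancel)
  qed
  have "(R \<longlongrightarrow> 0) at_top" "(S \<longlongrightarrow> 0) at_top"
    using assms unfolding jost_solution_def E_def[symmetric]
    by (auto intro: lim simp: R_def S_def)
  moreover have "F x = E x *s (v + R x)" for x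
    using E0[of x] by (simp add: R_def vec2_eq_iff algebra_simps)
  moreover have "hderiv F x = E x *s ((w * k) *s v + S x)" for x
    using E0[of x] by (simp add: S_def vec2_eq_iff algebra_simps)
  ultimately show ?thesis using that unfolding E_def by blast
qed

lemma scale_mult_tendsto_0:
  fixes R :: "'a => complex^2"
  assumes "(f \<longlongrightarrow> 0) A" "(R \<longlongrightarrow> v) A"
  shows "((\<lambda>x. f x *s R x) \<longlongrightarrow> 0) A"
proof (rule tendsto_norm_zero_cancel)
  have "((\<lambda>x. cmod (f x) * norm (R x)) \<longlongrightarrow> 0 * norm v) A"
    using assms by (intro tendsto_mult tendsto_norm_zero tendsto_norm)
  then show "((\<lambda>x. norm (f x *s R x)) \<longlongrightarrow> 0) A" by (simp add: norm_scale2)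
qed

locale jost_basis =
  fixes q :: "real => complex" and k :: real and Fm1 Fpi Fmi Fp1 :: "real => complex^2"
  assumes q: "integrable halfline q" and k: "k > 0" and jc: "jost_choice q k Fm1 Fpi Fmi Fp1"
begin

definition "sol F \<longleftrightarrow> isol q (complex_of_real (k\<^sup>2)) F (hderiv F)"

text \<open>At the real parameter \<open>k^2\<close> the Wronskian of two solutions is constant, so
  the value at 0 is also the limit at infinity.\<close>

definition "w F H = W (F 0) (hderiv F 0) (H 0) (hderiv H 0)"

lemma solI: "isol q (complex_of_real (k\<^sup>2)) F G ==> sol F"
  by (simp add: sol_def isol_hderiv)

lemma sol_solution: "solution q (complex_of_real (k\<^sup>2)) F ==> sol F"
  unfolding sol_def by (rule solution_isol[OF q])

lemma sol_cong: "sol F ==> (\<And>x. x \<ge> 0 ==> F' x = F x) ==> sol F'"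
  unfolding sol_def by (rule isol_hderiv[OF isol_cong[where G' = "hderiv F"]]) auto

lemma sol_hderiv_cong: "sol F ==> (\<And>x. x \<ge> 0 ==> F' x = F x) ==> x \<ge> 0 ==> hderiv F' x = hderiv F x"
  unfolding sol_def by (rule isol_deriv(2)[OF isol_cong[where G' = "hderiv F"]]) auto

lemma sol_lincomb: "sol F ==> sol H ==> sol (\<lambda>x. a *s F x + b *s H x)"
  unfolding sol_def by (rule isol_hderiv[OF isol_lincomb])

lemma hderiv_lincomb: "sol F ==> sol H ==> x \<ge> 0 ==> hderiv (\<lambda>x. a *s F x + b *s H x) x = a *s hderiv F x + b *s hderiv H x"
  unfolding sol_def by (rule isol_deriv(2)[OF isol_lincomb])

lemma w_lincomb:
  assumes "sol F" "sol H"
  shows "w (\<lambda>x. a *s F x + b *s H x) K = a * w F K + b * w H K"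
    "w K (\<lambda>x. a *s F x + b *s H x) = cnj a * w K F + cnj b * w K H"
  using hderiv_lincomb[OF assms, of 0] by (simp_all add: w_def W_lin)

lemma w_cnj: "cnj (w F H) = - w H F" by (simp add: w_def W_cnj)

lemma w_cong:
  assumes "sol F" "\<And>x. x \<ge> 0 ==> F' x = F x"
  shows "w F' H = w F H" "w H F' = w H F"
  using sol_hderiv_cong[OF assms, of 0] assms(2)[of 0] by (simp_all add: w_def)

lemma w_const:
  assumes "sol F" "sol H" "x \<ge> 0"
  shows "W (F x) (hderiv F x) (H x) (hderiv H x) = w F H"
  unfolding w_def by (rule W_const[of q "of_real (k\<^sup>2)"]) (use assms in \<open>auto simp: sol_def\<close>)

lemma sol_sharp:
  assumes "sol F"
  shows "sol (\<lambda>x. sharp (F x))" "\<And>x. x \<ge> 0 ==> hderiv (\<lambda>x. sharp (F x)) x = sharp (hderiv F x)"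
  using isol_sharp[OF assms[unfolded sol_def]] by (auto intro: solI simp: isol_deriv(2))

lemma w_sharp: "sol F ==> sol H ==> w (\<lambda>x. sharp (F x)) (\<lambda>x. sharp (H x)) = cnj (w F H)"
  by (simp add: w_def sol_sharp(2) W_sharp)

lemma jost_sols:
  "jost_solution q k (-1) e_minus Fm1" "jost_solution q k \<i> e_plus Fpi"
  "jost_solution q k (-\<i>) e_plus Fmi" "jost_solution q k 1 e_minus Fp1"
  using jc by (auto simp: jost_choice_def)

lemma jost_sol: "jost_solution q k z v F ==> sol F"
  by (auto simp: jost_solution_def intro: sol_solution)

lemma sol_jost [simp]: "sol Fm1" "sol Fpi" "sol Fmi" "sol Fp1"
  using jost_sols jost_sol by blast+

text \<open>The pairing equals \<open>exp ((a + cnj b) * k * x) * Z x\<close>, where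
  \<open>Z\<close> converges to the Wronskian of the leading terms. Being constant in
  \<open>x\<close>, it is this limit if the exponent vanishes, and 0 if the exponential decays or if
  it stays bounded while the limit of \<open>Z\<close> is 0.\<close>

lemma w_jost:
  assumes F: "jost_solution q k a v F" and H: "jost_solution q k b u H"
    and le: "Re (a + cnj b) \<le> 0"
    and or: "a + cnj b = 0 \<or> Re (a + cnj b) < 0 \<or> W v ((a * k) *s v) u ((b * k) *s u) = 0"
  shows "w F H = (if a + cnj b = 0 then W v ((a * k) *s v) u ((b * k) *s u) else 0)"
proof -
  define L where "L = W v ((a * k) *s v) u ((b * k) *s u)"
  obtain R S where RS: "(R \<longlongrightarrow> 0) at_top" "(S \<longlongrightarrow> 0) at_top"
    "\<And>x::real. F x = exp (a * k * x) *s (v + R x)" "\<And>x. hderiv F x = exp (a * k * x) *s ((a * k) *s v + S x)"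
    using jost_asymptotics[OF F] by metis
  obtain R' S' where RS': "(R' \<longlongrightarrow> 0) at_top" "(S' \<longlongrightarrow> 0) at_top"
    "\<And>x::real. H x = exp (b * k * x) *s (u + R' x)" "\<And>x. hderiv H x = exp (b * k * x) *s ((b * k) *s u + S' x)"
    using jost_asymptotics[OF H] by metis
  define Z where "Z x = W (v + R x) ((a * k) *s v + S x) (u + R' x) ((b * k) *s u + S' x)" for x
  have "(Z \<longlongrightarrow> W (v + 0) ((a * k) *s v + 0) (u + 0) ((b * k) *s u + 0)) at_top"
    unfolding Z_def by (intro tendsto_W tendsto_add tendsto_const RS RS')
  then have Z: "(Z \<longlongrightarrow> L) at_top" by (simp add: L_def)
  have eq: "w F H = exp ((a + cnj b) * k * x) * Z x" if "x \<ge> 0" for x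
  proof -
    have "w F H = W (F x) (hderiv F x) (H x) (hderiv H x)"
      using w_const[OF jost_sol[OF F] jost_sol[OF H] that] by simp
    also have "\<dots> = exp (a * k * x) * (cnj (exp (b * k * x)) * Z x)"
      by (simp only: RS(3,4) RS'(3,4) W_lin(2,6) Z_def) (rule mult.left_commute)
    also have "exp (a * k * x) * (cnj (exp (b * k * x)) * Z x) = exp ((a + cnj b) * k * x) * Z x"
      by (simp add: exp_cnj algebra_simps flip: exp_add)
    finally show ?thesis .
  qed
  have lim: "((\<lambda>x. exp ((a + cnj b) * k * x) * Z x) \<longlongrightarrow> w F H) at_top"
    by (rule Lim_transform_eventually[OF tendsto_const], rule eventually_at_top_linorderI[of 0], rule eq)
  show ?thesis
  proof (cases "a + cnj b = 0")
    case True
    then have "(Z \<longlongrightarrow> w F H) at_top" using lim by simp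
    then show ?thesis using Z True tendsto_unique[OF trivial_limit_at_top_linorder] unfolding L_def by auto
  next
    case False
    have n: "cmod (exp ((a + cnj b) * complex_of_real k * complex_of_real x)) = exp (Re (a + cnj b) * k * x)" for x :: real
      by (simp add: norm_exp_eq_Re)
    have "((\<lambda>x. exp ((a + cnj b) * k * x) * Z x) \<longlongrightarrow> 0) at_top"
    proof (cases "Re (a + cnj b) < 0")
      case True
      have "((\<lambda>x. exp (Re (a + cnj b) * k * x)) \<longlongrightarrow> 0) at_top"
        using filterlim_tendsto_neg_mult_at_bot[OF tendsto_const, of "Re (a + cnj b) * k" "\<lambda>x. x" at_top] True k
        by (intro filterlim_compose[OF exp_at_bot]) (auto simp: mult_neg_pos filterlim_ident)
      then have "((\<lambda>x. exp ((a + cnj b) * complex_of_real k * complex_of_real x)) \<longlongrightarrow> 0) at_top"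
        unfolding n[symmetric] by (rule tendsto_norm_zero_cancel)
      from tendsto_mult[OF this Z] show ?thesis by simp
    next
      case nz: False
      with or False have "L = 0" by (simp add: L_def)
      with Z have Z0: "((\<lambda>x. cmod (Z x)) \<longlongrightarrow> 0) at_top" using tendsto_norm_zero by auto
      show ?thesis
      proof (rule Lim_null_comparison[OF _ Z0], rule eventually_at_top_linorderI[of 0])
        fix x :: real assume "0 \<le> x"
        then have "exp (Re (a + cnj b) * k * x) \<le> 1"
          using le nz by auto
        then show "cmod (exp ((a + cnj b) * k * x) * Z x) \<le> cmod (Z x)"
          unfolding norm_mult n by (rule mult_left_le_one_le[rotated 2]) auto
      qed
    qed
    with lim False show ?thesis using tendsto_unique[OF trivial_limit_at_top_linorder] by auto
  qed
qed

text \<open>Stated for arbitrary representatives, so that it applies to every choice of Jost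
  solutions. Pairings of the growing solution with itself or with the oscillating ones are absent:
  the asymptotics do not determine them.\<close>

lemma w_vals:
  assumes "jost_solution q k \<i> e_plus F" "jost_solution q k (-\<i>) e_plus H" "jost_solution q k 1 e_minus P"
  shows "w Fm1 Fm1 = 0" "w Fm1 F = 0" "w Fm1 H = 0" "w F Fm1 = 0" "w H Fm1 = 0"
    "w F F = 4 * \<i> * k" "w H H = - 4 * \<i> * k" "w F H = 0" "w H F = 0" "w P Fm1 = - 4 * k"
proof -
  show "w Fm1 Fm1 = 0" "w Fm1 F = 0" "w Fm1 H = 0"
    using w_jost[OF jost_sols(1) jost_sols(1)] w_jost[OF jost_sols(1) assms(1)] w_jost[OF jost_sols(1) assms(2)]
    by (auto simp: complex_eq_iff)
  then show "w F Fm1 = 0" "w H Fm1 = 0" using w_cnj[of Fm1 F] w_cnj[of Fm1 H] by auto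
  show "w F F = 4 * \<i> * k" using w_jost[OF assms(1,1)] by (simp add: W_def e_plus_def)
  show "w H H = - 4 * \<i> * k" using w_jost[OF assms(2,2)] by (simp add: W_def e_plus_def)
  show FH: "w F H = 0" using w_jost[OF assms(1,2)] by (simp add: W_def e_plus_def)
  then show "w H F = 0" using w_cnj[of F H] by simp
  show "w P Fm1 = - 4 * k" using w_jost[OF assms(3) jost_sols(1)] by (simp add: W_def e_minus_def)
qed

lemmas w_vals0 = w_vals[OF jost_sols(2-4)]

lemma Fp1_Fm1: "w Fm1 Fp1 = 4 * k"
  using w_cnj[of Fp1 Fm1] w_vals0(10) by (simp add: complex_eq_iff)

end

lemma tendsto_scale2: "(R \<longlongrightarrow> r) A ==> ((\<lambda>x. c *s R x) \<longlongrightarrow> c *s (r::complex^2)) A"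
  by (intro vec_tendstoI) (auto intro!: tendsto_intros simp: vector_scalar_mult_def)

lemma tendsto_sharp: "(R \<longlongrightarrow> r) A ==> ((\<lambda>x. sharp (R x)) \<longlongrightarrow> sharp r) A"
proof (intro vec_tendstoI)
  fix i assume "(R \<longlongrightarrow> r) A"
  then show "((\<lambda>x. sharp (R x) $ i) \<longlongrightarrow> sharp r $ i) A"
    using exhaust_2[of i] by (elim disjE; simp add: tendsto_cnj tendsto_vec_nth)
qed

lemma bounded_scale_tendsto_0:
  fixes R :: "real => complex^2"
  assumes "(R \<longlongrightarrow> 0) A" "\<And>x. cmod (f x) \<le> 1"
  shows "((\<lambda>x. f x *s R x) \<longlongrightarrow> 0) A"
proof (rule Lim_null_comparison[OF _ tendsto_norm_zero[OF assms(1)]], rule always_eventually, rule allI)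
  fix x show "norm (f x *s R x) \<le> norm (R x)"
    unfolding norm_scale2 by (rule mult_left_le_one_le) (use assms(2) in auto)
qed

lemma scale2_cancel: "c \<noteq> 0 ==> c *s u = c *s v ==> u = (v :: complex^2)"
  by (simp add: vec2_eq_iff)

lemma sharp_0 [simp]: "sharp 0 = 0"
  by (simp add: vec2_eq_iff)

context jost_basis begin

definition comb where "comb A B C a b c d x = a *s Fm1 x + b *s A x + c *s B x + d *s C x"

lemma comb_eq:
  "comb A B C a b c d = (\<lambda>x. 1 *s (a *s Fm1 x + b *s A x) + 1 *s (c *s B x + d *s C x))"
  by (auto simp: comb_def algebra_simps)

lemma sol_comb: "sol A ==> sol B ==> sol C ==> sol (comb A B C a b c d)"
  unfolding comb_eq by (intro sol_lincomb sol_jost)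

lemma hderiv_comb:
  assumes "sol A" "sol B" "sol C" "x \<ge> 0"
  shows "hderiv (comb A B C a b c d) x = a *s hderiv Fm1 x + b *s hderiv A x + c *s hderiv B x + d *s hderiv C x"
  unfolding comb_eq
  by (subst hderiv_lincomb, (intro sol_lincomb sol_jost assms)+)
    (simp add: hderiv_lincomb assms)

lemma w_comb:
  assumes "sol A" "sol B" "sol C"
  shows "w (comb A B C a b c d) K = a * w Fm1 K + b * w A K + c * w B K + d * w C K"
    "w K (comb A B C a b c d) = cnj a * w K Fm1 + cnj b * w K A + cnj c * w K B + cnj d * w K C"
  by (simp_all add: w_def comb_def hderiv_comb assms W_lin)

lemma has_coeffs_iff:
  "has_coeffs Fm1 A B C F a b c d \<longleftrightarrow> (\<forall>x\<ge>0. F x = comb A B C a b c d x)"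
  by (simp add: has_coeffs_def comb_def)

text \<open>Pairing with \<open>Fm1\<close> sees the growing coefficient alone. Once that is 0, the
  oscillating solutions are orthogonal to each other and to \<open>Fm1\<close>, so each of their
  coefficients is a pairing too.\<close>

lemma coeffs_w:
  assumes "jost_choice q k Fm1 A B C" "has_coeffs Fm1 A B C F a b c d"
  shows "sol F" "w F K = a * w Fm1 K + b * w A K + c * w B K + d * w C K"
    "w K F = cnj a * w K Fm1 + cnj b * w K A + cnj c * w K B + cnj d * w K C"
    "w F Fm1 = - 4 * complex_of_real k * d" "d = 0 ==> w F A = 4 * \<i> * k * b" "d = 0 ==> w F B = - 4 * \<i> * k * c"
proof -
  have js: "jost_solution q k \<i> e_plus A" "jost_solution q k (-\<i>) e_plus B" "jost_solution q k 1 e_minus C"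
    using assms(1) by (auto simp: jost_choice_def)
  then have s: "sol A" "sol B" "sol C" using jost_sol by auto
  have F: "F x = comb A B C a b c d x" if "x \<ge> 0" for x using assms(2) that by (simp add: has_coeffs_iff)
  show "sol F" by (rule sol_cong[OF sol_comb[OF s] F])
  show w1: "w F K = a * w Fm1 K + b * w A K + c * w B K + d * w C K" for K
    using w_cong(1)[OF sol_comb[OF s] F] w_comb[OF s] by simp
  show "w K F = cnj a * w K Fm1 + cnj b * w K A + cnj c * w K B + cnj d * w K C"
    using w_cong(2)[OF sol_comb[OF s] F] w_comb[OF s] by simp
  show "w F Fm1 = - 4 * complex_of_real k * d" "d = 0 ==> w F A = 4 * \<i> * k * b" "d = 0 ==> w F B = - 4 * \<i> * k * c"
    unfolding w1 using w_vals[OF js] by auto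
qed

lemmas coeffs_w0 = coeffs_w[OF jc]

lemma coeffs_zero:
  assumes "has_coeffs Fm1 Fpi Fmi Fp1 F a b c d" "\<And>x. x \<ge> 0 ==> F x = 0"
  shows "a = 0" "b = 0" "c = 0" "d = 0"
proof -
  have z: "sol (\<lambda>x. 0)" "hderiv (\<lambda>x. 0 :: complex^2) 0 = 0"
    using isol_zero isol_deriv(2)[OF isol_zero] by (auto intro: solI)
  have wz: "w F K = 0" for K using w_cong(1)[OF z(1) assms(2)] z(2) by (simp add: w_def W_def)
  show d: "d = 0" using coeffs_w0(4)[OF assms(1)] wz k by simp
  show b: "b = 0" using coeffs_w0(5)[OF assms(1) d] wz k by simp
  show c: "c = 0" using coeffs_w0(6)[OF assms(1) d] wz k by simp
  show "a = 0" using coeffs_w0(2)[OF assms(1), of Fp1] wz b c d k Fp1_Fm1 by simp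
qed

lemma coeffs_unique:
  assumes "has_coeffs Fm1 Fpi Fmi Fp1 F a b c d" "has_coeffs Fm1 Fpi Fmi Fp1 F a' b' c' d'"
  shows "a = a'" "b = b'" "c = c'" "d = d'"
proof -
  have "has_coeffs Fm1 Fpi Fmi Fp1 (\<lambda>x. F x - F x) (a - a') (b - b') (c - c') (d - d')"
    unfolding has_coeffs_def
  proof (intro allI impI)
    fix x :: real assume "0 \<le> x"
    then have "F x = a *s Fm1 x + b *s Fpi x + c *s Fmi x + d *s Fp1 x"
      "F x = a' *s Fm1 x + b' *s Fpi x + c' *s Fmi x + d' *s Fp1 x"
      using assms by (auto simp: has_coeffs_def)
    then show "F x - F x = (a - a') *s Fm1 x + (b - b') *s Fpi x + (c - c') *s Fmi x + (d - d') *s Fp1 x"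
      by (simp add: vec2_eq_iff algebra_simps)
  qed
  from coeffs_zero[OF this] show "a = a'" "b = b'" "c = c'" "d = d'" by auto
qed

text \<open>The map from coefficients to Cauchy data at 0 is an injective real-linear endomorphism
  of a finite-dimensional space, hence onto; uniqueness for the initial value problem does the
  rest.\<close>

lemma coeffs_exist:
  assumes F: "sol F"
  obtains a b c d where "has_coeffs Fm1 Fpi Fmi Fp1 F a b c d"
proof -
  define g where "g p = comb Fpi Fmi Fp1 (fst p $ 1) (fst p $ 2) (snd p $ 1) (snd p $ 2)" for p :: "(complex^2) \<times> (complex^2)"
  define T where "T p = (g p 0, hderiv (g p) 0)" for p
  have T: "T p = (fst p $ 1 *s Fm1 0 + fst p $ 2 *s Fpi 0 + snd p $ 1 *s Fmi 0 + snd p $ 2 *s Fp1 0,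
     fst p $ 1 *s hderiv Fm1 0 + fst p $ 2 *s hderiv Fpi 0 + snd p $ 1 *s hderiv Fmi 0 + snd p $ 2 *s hderiv Fp1 0)" for p
    by (simp add: T_def g_def hderiv_comb comb_def)
  have lin: "linear T"
    by (rule linearI) (auto simp: T vec2_eq_iff algebra_simps scaleR_conv_of_real[where 'a = complex])
  have "inj T"
  proof (subst linear_injective_0[OF lin], intro allI impI)
    fix p assume p: "T p = 0"
    have "sol (g p)" by (simp add: g_def sol_comb)
    moreover have "g p 0 = 0" "hderiv (g p) 0 = 0" using p by (simp_all add: T_def zero_prod_def)
    ultimately have z: "g p x = 0" if "x \<ge> 0" for x
      using isol_unique(1)[OF q, of _ "g p" _ "\<lambda>x. 0" "\<lambda>x. 0" x] isol_zero that unfolding sol_def by auto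
    have "has_coeffs Fm1 Fpi Fmi Fp1 (g p) (fst p $ 1) (fst p $ 2) (snd p $ 1) (snd p $ 2)"
      by (simp add: has_coeffs_iff g_def)
    from coeffs_zero[OF this z] show "p = 0" by (simp add: prod_eq_iff vec2_eq_iff)
  qed
  then have "surj T" using linear_injective_imp_surjective[OF lin] by blast
  then obtain p where p: "T p = (F 0, hderiv F 0)" by (metis surjD)
  have sg: "sol (g p)" unfolding g_def by (intro sol_comb sol_jost)
  have "F x = g p x" if "x \<ge> 0" for x
    by (rule isol_unique(1)[OF q F[unfolded sol_def] sg[unfolded sol_def] _ _ that])
      (use p in \<open>auto simp: T_def\<close>)
  then have "has_coeffs Fm1 Fpi Fmi Fp1 F (fst p $ 1) (fst p $ 2) (snd p $ 1) (snd p $ 2)"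
    by (simp add: has_coeffs_iff g_def)
  then show ?thesis by (rule that)
qed

text \<open>A decaying solution pairs to 0 with every bounded one, in particular with
  \<open>Fm1\<close>, \<open>Fpi\<close> and \<open>Fmi\<close>. This removes the growing and the
  two oscillating coefficients.\<close>

lemma decay_multiple:
  assumes F: "sol F" and F0: "(F \<longlongrightarrow> 0) at_top"
  obtains a where "\<And>x. x \<ge> 0 ==> F x = a *s Fm1 x"
proof -
  obtain a b c d where cf: "has_coeffs Fm1 Fpi Fmi Fp1 F a b c d" using coeffs_exist[OF F] .
  have G0: "(hderiv F \<longlongrightarrow> 0) at_top" using isol_deriv_tendsto_0[OF q _ F0] F by (simp add: sol_def)
  have zero: "w F H = 0" if js: "jost_solution q k z v H" and z: "Re z \<le> 0" for z v H
  proof -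
    obtain R S where RS: "(R \<longlongrightarrow> 0) at_top" "(S \<longlongrightarrow> 0) at_top"
      "\<And>x::real. H x = exp (z * k * x) *s (v + R x)" "\<And>x. hderiv H x = exp (z * k * x) *s ((z * k) *s v + S x)"
      using jost_asymptotics[OF js] by metis
    have "((\<lambda>x. norm (v + R x) + norm ((z * k) *s v + S x)) \<longlongrightarrow> norm (v + 0) + norm ((z * k) *s v + 0)) at_top"
      by (intro tendsto_intros RS)
    then have "\<forall>\<^sub>F x in at_top. norm (v + R x) + norm ((z * k) *s v + S x) < norm (v + 0) + norm ((z * k) *s v + 0) + 1"
      by (rule order_tendstoD) simp
    then have "\<forall>\<^sub>F x in at_top. norm (H x) + norm (hderiv H x) \<le> norm (v + 0) + norm ((z * k) *s v + 0) + 1"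
      using eventually_ge_at_top[of 0]
    proof eventually_elim
      case (elim x)
      have "cmod (exp (z * k * x)) \<le> 1"
        using z k elim by (simp add: norm_exp_eq_Re mult_nonpos_nonneg)
      then have "norm (H x) \<le> norm (v + R x)" "norm (hderiv H x) \<le> norm ((z * k) *s v + S x)"
        unfolding RS(3,4) norm_scale2 by (auto intro!: mult_left_le_one_le)
      then show ?case using elim by linarith
    qed
    from W_eq_0_of_decay[OF _ _ F0 G0 this, of q "of_real (k\<^sup>2)" 0] F jost_sol[OF js]
    show ?thesis by (simp add: sol_def w_def)
  qed
  have d: "d = 0" using zero[OF jost_sols(1)] coeffs_w0(4)[OF cf] k by simp
  have b: "b = 0" using zero[OF jost_sols(2)] coeffs_w0(5)[OF cf d] k by simp
  have c: "c = 0" using zero[OF jost_sols(3)] coeffs_w0(6)[OF cf d] k by simp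
  show ?thesis using that cf b c d by (auto simp: has_coeffs_def)
qed

lemma Fm1_asymptotics:
  obtains R where "(R \<longlongrightarrow> 0) at_top" "\<And>x. Fm1 x = exp (- (complex_of_real k * complex_of_real x)) *s (e_minus + R x)"
proof (rule jost_asymptotics[OF jost_sols(1)])
  fix R S assume "(R \<longlongrightarrow> 0) at_top"
    "\<And>x. Fm1 x = exp (- 1 * complex_of_real k * complex_of_real x) *s (e_minus + R x)"
  then show ?thesis by (intro that[of R]) auto
qed

lemma Fm1_multiple_unique:
  assumes F: "\<And>x::real. x \<ge> 0 ==> F x = exp (- (complex_of_real k * complex_of_real x)) *s (v + R x)" and R: "(R \<longlongrightarrow> 0) at_top"
    and a: "\<And>x. x \<ge> 0 ==> F x = a *s Fm1 x"
  shows "v = a *s e_minus"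
proof -
  obtain R1 where RS: "(R1 \<longlongrightarrow> 0) at_top"
    "\<And>x. Fm1 x = exp (- (complex_of_real k * complex_of_real x)) *s (e_minus + R1 x)"
    by (rule Fm1_asymptotics) blast
  have eq: "v + R x = a *s (e_minus + R1 x)" if "x \<ge> 0" for x
  proof -
    have "exp (- (complex_of_real k * x)) *s (v + R x) = exp (- (complex_of_real k * x)) *s (a *s (e_minus + R1 x))"
      using F[OF that] a[OF that] RS(2)[of x] by (simp add: vec2_eq_iff algebra_simps)
    then show ?thesis by (rule scale2_cancel[rotated]) simp
  qed
  have "((\<lambda>x. v + R x) \<longlongrightarrow> v + 0) at_top" by (intro tendsto_intros R)
  moreover have "((\<lambda>x. v + R x) \<longlongrightarrow> a *s (e_minus + 0)) at_top"
    by (rule Lim_transform_eventually[OF tendsto_scale2[OF tendsto_add[OF tendsto_const RS(1)]]],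
        rule eventually_at_top_linorderI[of 0], rule eq[symmetric])
  ultimately show ?thesis using tendsto_unique[OF trivial_limit_at_top_linorder] by fastforce
qed

lemma exp_mk_tendsto_0: "((\<lambda>x. exp (- (complex_of_real k * complex_of_real x))) \<longlongrightarrow> 0) at_top"
proof (rule tendsto_norm_zero_cancel)
  have "((\<lambda>x. exp (- k * x)) \<longlongrightarrow> 0) at_top"
    using filterlim_tendsto_neg_mult_at_bot[OF tendsto_const, of "- k" "\<lambda>x. x" at_top] k
    by (intro filterlim_compose[OF exp_at_bot]) (auto simp: filterlim_ident)
  then show "((\<lambda>x. cmod (exp (- (complex_of_real k * complex_of_real x)))) \<longlongrightarrow> 0) at_top"
    by (simp add: norm_exp_eq_Re)
qed

lemma Fm1_tendsto_0: "(Fm1 \<longlongrightarrow> 0) at_top"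
proof -
  obtain R1 where RS: "(R1 \<longlongrightarrow> 0) at_top"
    "\<And>x. Fm1 x = exp (- (complex_of_real k * complex_of_real x)) *s (e_minus + R1 x)"
    by (rule Fm1_asymptotics) blast
  have "((\<lambda>x. exp (- (complex_of_real k * complex_of_real x)) *s (e_minus + R1 x)) \<longlongrightarrow> 0) at_top"
    by (rule scale_mult_tendsto_0[OF exp_mk_tendsto_0 tendsto_add[OF tendsto_const RS(1)]])
  then show ?thesis unfolding RS(2)[symmetric] .
qed

lemma Fm1_nonzero: assumes "\<And>x. x \<ge> 0 ==> a *s Fm1 x = 0" shows "a = 0"
proof -
  have "has_coeffs Fm1 Fpi Fmi Fp1 (\<lambda>x. 0) a 0 0 0" using assms by (auto simp: has_coeffs_def)
  from coeffs_zero(1)[OF this] show ?thesis by simp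
qed

text \<open>The image decays as well and is therefore a multiple of \<open>Fm1\<close>; comparing
  leading terms, \<open>sharp e_minus = - e_minus\<close> fixes the factor.\<close>

lemma sharp_Fm1: "x \<ge> 0 ==> sharp (Fm1 x) = - Fm1 x"
proof -
  have "((\<lambda>x. sharp (Fm1 x)) \<longlongrightarrow> sharp 0) at_top" by (rule tendsto_sharp[OF Fm1_tendsto_0])
  then have "((\<lambda>x. sharp (Fm1 x)) \<longlongrightarrow> 0) at_top" by simp
  then obtain a where a: "\<And>x. x \<ge> 0 ==> sharp (Fm1 x) = a *s Fm1 x"
    using decay_multiple[OF sol_sharp(1)[of Fm1]] by (metis sol_jost(1))
  obtain R1 where RS: "(R1 \<longlongrightarrow> 0) at_top"
    "\<And>x. Fm1 x = exp (- (complex_of_real k * complex_of_real x)) *s (e_minus + R1 x)"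
    by (rule Fm1_asymptotics) blast
  have "sharp e_minus = a *s e_minus"
  proof (rule Fm1_multiple_unique[OF _ _ a])
    show "((\<lambda>x. sharp (R1 x)) \<longlongrightarrow> 0) at_top"
      using tendsto_sharp[OF RS(1)] by simp
    show "sharp (Fm1 x) = exp (- (complex_of_real k * complex_of_real x)) *s (sharp e_minus + sharp (R1 x))" for x
      unfolding RS(2) by (simp add: vec2_eq_iff exp_cnj algebra_simps)
  qed
  then have "a = - 1" by (simp add: vec2_eq_iff e_minus_def)
  then show "x \<ge> 0 ==> sharp (Fm1 x) = - Fm1 x" using a[of x] by (simp add: vec2_eq_iff)
qed

text \<open>Equal oscillating leading terms leave a decaying difference. This describes the whole
  freedom in the oscillating Jost solutions.\<close>

lemma jost_osc_diff:
  assumes "jost_solution q k z v F" "sol H" "\<And>x::real. x \<ge> 0 ==> H x = exp (z * k * x) *s (v + R x)"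
    "(R \<longlongrightarrow> 0) at_top" and z: "Re z = 0"
  obtains a where "\<And>x. x \<ge> 0 ==> H x = F x + a *s Fm1 x"
proof -
  obtain R1 S1 where RS: "(R1 \<longlongrightarrow> 0) at_top" "(S1 \<longlongrightarrow> 0) at_top"
    "\<And>x::real. F x = exp (z * k * x) *s (v + R1 x)" "\<And>x. hderiv F x = exp (z * k * x) *s ((z * k) *s v + S1 x)"
    using jost_asymptotics[OF assms(1)] by metis
  have s: "sol (\<lambda>x. 1 *s H x + (-1) *s F x)" by (intro sol_lincomb assms jost_sol[OF assms(1)])
  have "((\<lambda>x. R x - R1 x) \<longlongrightarrow> 0 - 0) at_top" by (intro tendsto_intros assms RS)
  then have "((\<lambda>x. exp (z * k * complex_of_real x) *s (R x - R1 x)) \<longlongrightarrow> 0) at_top"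
    by (intro bounded_scale_tendsto_0) (auto simp: norm_exp_eq_Re z)
  then have "((\<lambda>x. 1 *s H x + (-1) *s F x) \<longlongrightarrow> 0) at_top"
    by (rule Lim_transform_eventually)
      (use assms(3) RS(3) in \<open>auto intro!: eventually_at_top_linorderI[of 0] simp: vec2_eq_iff algebra_simps\<close>)
  from decay_multiple[OF s this] obtain a where a: "\<And>x. x \<ge> 0 ==> 1 *s H x + (-1) *s F x = a *s Fm1 x" by metis
  show ?thesis by (rule that[of a]) (use a in \<open>auto simp: vec2_eq_iff algebra_simps\<close>)
qed

text \<open>The mechanism behind "unambiguously defined": for \<open>K\<close> orthogonal to
  \<open>Fm1\<close>, the freedom in the oscillating solutions is invisible.\<close>

lemma w_osc:
  assumes "\<And>x. x \<ge> 0 ==> H x = F x + a *s Fm1 x" "sol F" "w K Fm1 = 0"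
  shows "w K H = w K F"
proof -
  have "w K H = w K (\<lambda>x. 1 *s F x + a *s Fm1 x)"
    by (rule w_cong(2)[OF sol_lincomb[OF assms(2) sol_jost(1)]]) (use assms(1) in auto)
  then show ?thesis using assms(3) w_lincomb(2)[OF assms(2) sol_jost(1), of K 1 a] by simp
qed

end

section \<open>Solutions satisfying the boundary condition\<close>

locale jost_phi = jost_basis +
  fixes \<alpha> :: bparam and \<Phi> :: "2 => real => complex^2" and \<gamma>m1 \<gamma>pi \<gamma>mi \<gamma>p1 :: "2 => complex"
  assumes \<Phi>: "\<And>j. solution q (complex_of_real (k\<^sup>2)) (\<Phi> j)" "\<And>j. L_bd \<alpha> (\<Phi> j) = - axis j 1" "\<And>j. L_bd_perp \<alpha> (\<Phi> j) = 0"
    and cf: "\<And>j. has_coeffs Fm1 Fpi Fmi Fp1 (\<Phi> j) (\<gamma>m1 j) (\<gamma>pi j) (\<gamma>mi j) (\<gamma>p1 j)"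
begin

lemma sol_\<Phi>: "sol (\<Phi> j)" using \<Phi>(1) by (rule sol_solution)

lemma \<Phi>_data: "bL \<alpha> (\<Phi> j 0) (hderiv (\<Phi> j) 0) = - axis j 1" "bLp \<alpha> (\<Phi> j 0) (hderiv (\<Phi> j) 0) = 0"
  using isol_L_bd[OF sol_\<Phi>[unfolded sol_def]] \<Phi>(2,3) by metis+

text \<open>The columns have vanishing perpendicular data and unit data otherwise, so pairing with
  them reads off the perpendicular data of \<open>F\<close>, crosswise.\<close>

lemma w_\<Phi>: "w F (\<Phi> 1) = bLp \<alpha> (F 0) (hderiv F 0) $ 2" "w F (\<Phi> 2) = bLp \<alpha> (F 0) (hderiv F 0) $ 1"
  unfolding w_def by (simp_all add: W_boundary[of _ _ _ _ \<alpha>] \<Phi>_data axis_def)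

text \<open>The solutions satisfying the boundary condition form an isotropic plane for the
  Wronskian form. Most identities between the coefficients come from this and from
  \<open>sharp\<close>.\<close>

lemma w_\<Phi>_\<Phi>: "w (\<Phi> i) (\<Phi> j) = 0"
  using exhaust_2[of j] by (auto simp: w_\<Phi> \<Phi>_data)

definition \<Phi>c where "\<Phi>c a b x = a *s \<Phi> 1 x + b *s \<Phi> 2 x"

lemma sol_\<Phi>c: "sol (\<Phi>c a b)"
  unfolding \<Phi>c_def[abs_def] by (intro sol_lincomb sol_\<Phi>)

lemma hderiv_\<Phi>c: "x \<ge> 0 ==> hderiv (\<Phi>c a b) x = a *s hderiv (\<Phi> 1) x + b *s hderiv (\<Phi> 2) x"
  unfolding \<Phi>c_def[abs_def] by (intro hderiv_lincomb sol_\<Phi>)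

lemma w_\<Phi>c: "w (\<Phi>c a b) K = a * w (\<Phi> 1) K + b * w (\<Phi> 2) K"
  "w K (\<Phi>c a b) = cnj a * w K (\<Phi> 1) + cnj b * w K (\<Phi> 2)"
  unfolding \<Phi>c_def[abs_def] by (intro w_lincomb sol_\<Phi>)+

lemma \<Phi>c_data: "bL \<alpha> (\<Phi>c a b 0) (hderiv (\<Phi>c a b) 0) = vector [- a, - b]"
  "bLp \<alpha> (\<Phi>c a b 0) (hderiv (\<Phi>c a b) 0) = 0"
  by (simp_all add: \<Phi>c_def hderiv_\<Phi>c bL_lin \<Phi>_data vec2_eq_iff axis_def)

lemma \<Phi>c_zero:
  assumes "\<And>x. x \<ge> 0 ==> \<Phi>c a b x = 0"
  shows "a = 0" "b = 0"
proof -
  have z: "sol (\<lambda>x. 0)" "hderiv (\<lambda>x. 0 :: complex^2) 0 = 0"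
    using isol_zero isol_deriv(2)[OF isol_zero] by (auto intro: solI)
  have "hderiv (\<Phi>c a b) 0 = 0" using sol_hderiv_cong[OF z(1) assms order_refl] z(2) by simp
  moreover have "bL \<alpha> 0 0 = 0" by (simp add: bL_def vec2_eq_iff ell_lin)
  ultimately have "vector [- a, - b] = (0 :: complex^2)" using \<Phi>c_data(1)[of a b] assms[of 0] by simp
  then show "a = 0" "b = 0" by (auto simp: vec2_eq_iff)
qed

lemma coeffs_\<Phi>c:
  "has_coeffs Fm1 A B C (\<Phi> 1) a1 b1 c1 d1 ==> has_coeffs Fm1 A B C (\<Phi> 2) a2 b2 c2 d2 ==>
   has_coeffs Fm1 A B C (\<Phi>c a b) (a * a1 + b * a2) (a * b1 + b * b2) (a * c1 + b * c2) (a * d1 + b * d2)"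
  unfolding has_coeffs_def \<Phi>c_def by (auto simp: vec2_eq_iff algebra_simps)

lemma sharp_\<Phi>: "x \<ge> 0 ==> \<Phi> 2 x = sharp (\<Phi> 1 x)"
proof -
  assume x: "x \<ge> 0"
  have s: "isol q (complex_of_real (k\<^sup>2)) (\<lambda>x. sharp (\<Phi> 1 x)) (\<lambda>x. sharp (hderiv (\<Phi> 1) x))"
    using isol_sharp[OF sol_\<Phi>[unfolded sol_def], of 1] by simp
  show ?thesis
    by (rule isol_unique_boundary(1)[OF q sol_\<Phi>[unfolded sol_def] s _ _ x, where \<alpha> = \<alpha>])
      (simp_all add: bL_sharp \<Phi>_data vec2_eq_iff axis_def)
qed

lemma w_sharp_\<Phi>: "sol H ==> w (\<Phi> 2) (\<lambda>x. sharp (H x)) = cnj (w (\<Phi> 1) H)"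
  using w_sharp[OF sol_\<Phi>] w_cong(1)[OF sol_sharp(1)[OF sol_\<Phi>[of 1]] sharp_\<Phi>] by metis

lemma w_\<Phi>_Fm1: "w (\<Phi> j) Fm1 = - 4 * complex_of_real k * \<gamma>p1 j"
  by (rule coeffs_w0(4)[OF cf])

text \<open>Apply \<open>sharp\<close> to the pairing of the first column with \<open>Fm1\<close>:
  it exchanges the columns and changes the sign of \<open>Fm1\<close>.\<close>

lemma p1_symmetry: "\<gamma>p1 2 = - cnj (\<gamma>p1 1)"
proof -
  have "w (\<Phi> 2) (\<lambda>x. sharp (Fm1 x)) = w (\<Phi> 2) (\<lambda>x. (-1) *s Fm1 x + 0 *s Fm1 x)"
    by (rule w_cong(2)[OF sol_lincomb[OF sol_jost(1) sol_jost(1)]]) (simp add: sharp_Fm1 vec2_eq_iff)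
  also have "\<dots> = - w (\<Phi> 2) Fm1" using w_lincomb(2)[OF sol_jost(1) sol_jost(1), of "\<Phi> 2" "-1" 0] by simp
  finally have "- w (\<Phi> 2) Fm1 = cnj (w (\<Phi> 1) Fm1)" using w_sharp_\<Phi>[of Fm1] by simp
  then have "complex_of_real (4 * k) * \<gamma>p1 2 = complex_of_real (4 * k) * (- cnj (\<gamma>p1 1))"
    unfolding w_\<Phi>_Fm1 by simp
  then show ?thesis using k by (subst (asm) mult_left_cancel) auto
qed

lemma jost_osc_change:
  assumes "jost_solution q k z e_plus F" "jost_solution q k z e_plus H" "Re z = 0"
  obtains a where "\<And>x. x \<ge> 0 ==> H x = F x + a *s Fm1 x"
proof -
  obtain R S where RS: "(R \<longlongrightarrow> 0) at_top" "(S \<longlongrightarrow> 0) at_top"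
    "\<And>x::real. H x = exp (z * k * x) *s (e_plus + R x)" "\<And>x. hderiv H x = exp (z * k * x) *s ((z * k) *s e_plus + S x)"
    using jost_asymptotics[OF assms(2)] by metis
  obtain a where "\<And>x. x \<ge> 0 ==> H x = F x + a *s Fm1 x"
    using jost_osc_diff[OF assms(1) jost_sol[OF assms(2)] RS(3) RS(1) assms(3)] by blast
  then show ?thesis by (rule that)
qed

lemma jost_choice_sols:
  assumes "jost_choice q k Fm1 A B C"
  shows "jost_solution q k \<i> e_plus A" "jost_solution q k (-\<i>) e_plus B" "jost_solution q k 1 e_minus C"
  using assms by (auto simp: jost_choice_def)

lemma p1_unambiguous:
  assumes "jost_choice q k Fm1 A B C" "has_coeffs Fm1 A B C (\<Phi> j) a b c d"
  shows "d = \<gamma>p1 j"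
  using coeffs_w(4)[OF assms] w_\<Phi>_Fm1[of j] k by simp

text \<open>The combination of the two columns of \<open>\<Phi>\<close> in which the growing Jost solution cancels.\<close>

definition "\<xi> = \<Phi>c (\<gamma>p1 2) (- \<gamma>p1 1)"
definition "\<xi>i = \<gamma>p1 2 * \<gamma>pi 1 - \<gamma>p1 1 * \<gamma>pi 2"

lemma coeffs_\<xi>:
  assumes "jost_choice q k Fm1 A B C" "\<And>j. has_coeffs Fm1 A B C (\<Phi> j) (a j) (b j) (c j) (d j)"
  shows "has_coeffs Fm1 A B C \<xi> (\<gamma>p1 2 * a 1 - \<gamma>p1 1 * a 2) (\<gamma>p1 2 * b 1 - \<gamma>p1 1 * b 2) (\<gamma>p1 2 * c 1 - \<gamma>p1 1 * c 2) 0"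
proof -
  have "d 1 = \<gamma>p1 1" "d 2 = \<gamma>p1 2" using p1_unambiguous[OF assms(1) assms(2)] by auto
  then show ?thesis using coeffs_\<Phi>c[OF assms(2) assms(2), of "\<gamma>p1 2" "- \<gamma>p1 1"]
    unfolding \<xi>_def by (simp add: mult.commute)
qed

text \<open>The growing coefficient of \<xi> is 0, so \<xi> is orthogonal to \<open>Fm1\<close> and
  \<open>w_osc\<close> covers every oscillating solution \<open>A\<close> of this type.\<close>

lemma w_\<xi>: assumes "jost_solution q k \<i> e_plus A" shows "w \<xi> A = 4 * \<i> * k * \<xi>i"
proof -
  obtain a where a: "\<And>x. x \<ge> 0 ==> A x = Fpi x + a *s Fm1 x"
    using jost_osc_change[OF jost_sols(2) assms] by (auto)
  have "w \<xi> Fm1 = 0" using coeffs_w0(4)[OF coeffs_\<xi>[OF jc cf]] by simp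
  then have "w \<xi> A = w \<xi> Fpi" using w_osc[OF a] by simp
  then show ?thesis using coeffs_w0(5)[OF coeffs_\<xi>[OF jc cf]] by (simp add: \<xi>i_def)
qed

lemma \<xi>i_unambiguous:
  assumes "jost_choice q k Fm1 A B C" "\<And>j. has_coeffs Fm1 A B C (\<Phi> j) (a j) (b j) (c j) (d j)"
  shows "d 2 * b 1 - d 1 * b 2 = \<xi>i"
proof -
  have d: "d 1 = \<gamma>p1 1" "d 2 = \<gamma>p1 2" using p1_unambiguous[OF assms(1) assms(2)] by auto
  have "4 * \<i> * k * \<xi>i = 4 * \<i> * k * (d 2 * b 1 - d 1 * b 2)"
    using w_\<xi>[OF jost_choice_sols(1)[OF assms(1)]] coeffs_w(5)[OF assms(1) coeffs_\<xi>[OF assms]] d by auto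
  then show ?thesis using k by simp
qed

text \<open>Isotropy of \<xi> says that its two oscillating coefficients have equal modulus, so if
  one vanishes then \<xi> is \<open>a\<close> times \<open>Fm1\<close>. Isotropy against the first
  column gives \<open>a = 0\<close>, and \<xi> would be zero although its Cauchy data are
  not.\<close>

lemma \<xi>i_nonzero: assumes "\<gamma>p1 1 \<noteq> 0" shows "\<xi>i \<noteq> 0"
proof
  assume z: "\<xi>i = 0"
  note c = coeffs_\<xi>[OF jc cf]
  define m where "m = \<gamma>p1 2 * \<gamma>mi 1 - \<gamma>p1 1 * \<gamma>mi 2"
  define a where "a = \<gamma>p1 2 * \<gamma>m1 1 - \<gamma>p1 1 * \<gamma>m1 2"
  have "w \<xi> \<xi> = 0" by (simp add: \<xi>_def w_\<Phi>c w_\<Phi>_\<Phi>)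
  then have "m * cnj m * (4 * \<i> * k) = 0"
    using coeffs_w0(3)[OF c, of \<xi>] coeffs_w0(4,5,6)[OF c] z by (auto simp add: \<xi>i_def m_def)
  then have m: "m = 0" using k by simp
  have xa: "\<xi> x = a *s Fm1 x" if "x \<ge> 0" for x
    using c that z m by (simp add: has_coeffs_def \<xi>i_def m_def a_def)
  have "w (\<Phi> 1) \<xi> = 0" by (simp add: \<xi>_def w_\<Phi>c w_\<Phi>_\<Phi>)
  moreover have "w (\<Phi> 1) \<xi> = w (\<Phi> 1) (\<lambda>x. a *s Fm1 x + 0 *s Fm1 x)"
    by (rule w_cong(2)[OF sol_lincomb]) (use xa in auto)
  ultimately have "cnj a * w (\<Phi> 1) Fm1 = 0" using w_lincomb(2)[OF sol_jost(1) sol_jost(1), of "\<Phi> 1" a 0] by simp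
  then have "a = 0" using w_\<Phi>_Fm1 assms k by simp
  then have "\<Phi>c (\<gamma>p1 2) (- \<gamma>p1 1) x = 0" if "x \<ge> 0" for x using xa[OF that] by (simp add: \<xi>_def)
  from \<Phi>c_zero(2)[OF this] assms show False by simp
qed

text \<open>Such a solution is a nonzero multiple of \<open>Fm1\<close>, and isotropy then forces
  the pairing of the first column with \<open>Fm1\<close>, that is the growing coefficient, to
  vanish.\<close>

lemma decaying_bc_solution:
  assumes lim: "(\<Phi>c a b \<longlongrightarrow> 0) at_top" and nz: "a \<noteq> 0 \<or> b \<noteq> 0"
  shows "\<gamma>p1 1 = 0"
proof -
  obtain c where c: "\<And>x. x \<ge> 0 ==> \<Phi>c a b x = c *s Fm1 x" using decay_multiple[OF sol_\<Phi>c lim] by metis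
  have "c \<noteq> 0" using \<Phi>c_zero[of a b] c nz by auto
  have "w (\<Phi> 1) (\<Phi>c a b) = 0" by (simp add: w_\<Phi>c w_\<Phi>_\<Phi>)
  moreover have "w (\<Phi> 1) (\<Phi>c a b) = w (\<Phi> 1) (\<lambda>x. c *s Fm1 x + 0 *s Fm1 x)"
    by (rule w_cong(2)[OF sol_lincomb]) (use c in auto)
  ultimately have "cnj c * w (\<Phi> 1) Fm1 = 0" using w_lincomb(2)[OF sol_jost(1) sol_jost(1), of "\<Phi> 1" c 0] by simp
  then show ?thesis using \<open>c \<noteq> 0\<close> w_\<Phi>_Fm1 k by simp
qed

text \<open>At an eigenvalue this is the factor between \<open>Fm1\<close> and the eigenfunction
  with coefficients \<open>\<gamma>mi 2\<close>, \<open>- \<gamma>mi 1\<close> in the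
  columns.\<close>

definition "D = \<gamma>m1 1 * \<gamma>mi 2 - \<gamma>mi 1 * \<gamma>m1 2"

section \<open>Vanishing growing coefficient: the oscillating coefficients\<close>

context
  assumes eig: "\<gamma>p1 1 = 0"
begin

lemma p1_zero: "\<gamma>p1 j = 0"
  using eig p1_symmetry exhaust_2[of j] by auto

lemma w_\<Phi>_Fpi: "jost_choice q k Fm1 A B C ==> has_coeffs Fm1 A B C (\<Phi> j) a b c d ==> w (\<Phi> j) A = 4 * \<i> * k * b"
  "jost_choice q k Fm1 A B C ==> has_coeffs Fm1 A B C (\<Phi> j) a b c d ==> w (\<Phi> j) B = - 4 * \<i> * k * c"
  by (metis coeffs_w(5) p1_unambiguous p1_zero) (metis coeffs_w(6) p1_unambiguous p1_zero)

lemma w_\<Phi>_Fm1_0: "w (\<Phi> j) Fm1 = 0" by (simp add: w_\<Phi>_Fm1 p1_zero)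

lemma osc_unambiguous:
  assumes "jost_choice q k Fm1 A B C" "has_coeffs Fm1 A B C (\<Phi> j) a b c d"
  shows "b = \<gamma>pi j" "c = \<gamma>mi j"
proof -
  obtain u where u: "\<And>x. x \<ge> 0 ==> A x = Fpi x + u *s Fm1 x"
    using jost_osc_change[OF jost_sols(2) jost_choice_sols(1)[OF assms(1)]] by auto
  have "w (\<Phi> j) A = w (\<Phi> j) Fpi" using w_osc[OF u] w_\<Phi>_Fm1_0 by simp
  then show "b = \<gamma>pi j" using w_\<Phi>_Fpi(1)[OF assms] w_\<Phi>_Fpi(1)[OF jc cf, of j] k by simp
  obtain v where v: "\<And>x. x \<ge> 0 ==> B x = Fmi x + v *s Fm1 x"
    using jost_osc_change[OF jost_sols(3) jost_choice_sols(2)[OF assms(1)]] by auto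
  have "w (\<Phi> j) B = w (\<Phi> j) Fmi" using w_osc[OF v] w_\<Phi>_Fm1_0 by simp
  then show "c = \<gamma>mi j" using w_\<Phi>_Fpi(2)[OF assms] w_\<Phi>_Fpi(2)[OF jc cf, of j] k by simp
qed

text \<open>Since \<open>sharp e_plus = e_plus\<close>, the image of \<open>F\<close> is a Jost
  solution with the conjugate exponent and hence \<open>H\<close> up to a multiple of
  \<open>Fm1\<close>, which the columns do not see here.\<close>

lemma osc_symmetry_aux:
  assumes "jost_solution q k z e_plus F" "jost_solution q k (cnj z) e_plus H" "Re z = 0"
  shows "w (\<Phi> 2) H = cnj (w (\<Phi> 1) F)"
proof -
  obtain R S where RS: "(R \<longlongrightarrow> 0) at_top" "(S \<longlongrightarrow> 0) at_top"
    "\<And>x::real. F x = exp (z * k * x) *s (e_plus + R x)" "\<And>x. hderiv F x = exp (z * k * x) *s ((z * k) *s e_plus + S x)"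
    using jost_asymptotics[OF assms(1)] by metis
  obtain u where u: "\<And>x. x \<ge> 0 ==> sharp (F x) = H x + u *s Fm1 x"
  proof (rule jost_osc_diff[OF assms(2) sol_sharp(1)[OF jost_sol[OF assms(1)]]])
    show "sharp (F x) = exp (cnj z * k * x) *s (e_plus + sharp (R x))" for x
      unfolding RS(3) by (simp add: vec2_eq_iff exp_cnj algebra_simps e_plus_def)
    show "((\<lambda>x. sharp (R x)) \<longlongrightarrow> 0) at_top" using tendsto_sharp[OF RS(1)] by simp
  qed (use assms(3) in auto)
  have "w (\<Phi> 2) (\<lambda>x. sharp (F x)) = w (\<Phi> 2) H"
    by (rule w_osc[OF u jost_sol[OF assms(2)] w_\<Phi>_Fm1_0])
  then show ?thesis using w_sharp_\<Phi>[OF jost_sol[OF assms(1)]] by simp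
qed

lemma osc_symmetry: "\<gamma>pi 2 = cnj (\<gamma>mi 1)" "\<gamma>mi 2 = cnj (\<gamma>pi 1)"
proof -
  have "w (\<Phi> 2) Fpi = cnj (w (\<Phi> 1) Fmi)" by (rule osc_symmetry_aux[OF jost_sols(3)]) (use jost_sols(2) in auto)
  then show "\<gamma>pi 2 = cnj (\<gamma>mi 1)" using w_\<Phi>_Fpi[OF jc cf] k by simp
  have "w (\<Phi> 2) Fmi = cnj (w (\<Phi> 1) Fpi)" by (rule osc_symmetry_aux[OF jost_sols(2)]) (use jost_sols(3) in auto)
  then show "\<gamma>mi 2 = cnj (\<gamma>pi 1)" using w_\<Phi>_Fpi[OF jc cf] k by simp
qed

text \<open>Isotropy of the first column, written in coefficients: the two oscillating solutions
  contribute with opposite signs.\<close>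

lemma osc_cmod: "cmod (\<gamma>pi 1) = cmod (\<gamma>mi 1)"
proof -
  have "w (\<Phi> 1) (\<Phi> 1) = 0" by (rule w_\<Phi>_\<Phi>)
  moreover have "w (\<Phi> 1) (\<Phi> 1) = (\<gamma>pi 1 * cnj (\<gamma>pi 1) - \<gamma>mi 1 * cnj (\<gamma>mi 1)) * (4 * \<i> * k)"
    using coeffs_w0(3)[OF cf, of "\<Phi> 1" 1] w_\<Phi>_Fpi[OF jc cf, of 1] w_\<Phi>_Fm1_0 p1_zero by (simp add: algebra_simps)
  ultimately have "\<gamma>pi 1 * cnj (\<gamma>pi 1) = \<gamma>mi 1 * cnj (\<gamma>mi 1)" using k by simp
  then have "(cmod (\<gamma>pi 1))\<^sup>2 = (cmod (\<gamma>mi 1))\<^sup>2" by (metis complex_norm_square of_real_eq_iff)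
  then show ?thesis by (simp add: power2_eq_iff_nonneg)
qed

text \<open>Otherwise all oscillating coefficients vanish and both columns are multiples of the
  single solution \<open>Fm1\<close>, against their independent Cauchy data.\<close>

lemma osc_nonzero: "\<gamma>mi 1 \<noteq> 0"
proof
  assume "\<gamma>mi 1 = 0"
  then have z: "\<gamma>pi 1 = 0" "\<gamma>pi 2 = 0" "\<gamma>mi 2 = 0" "\<gamma>mi 1 = 0" using osc_cmod osc_symmetry by auto
  have \<Phi>m: "\<Phi> j x = \<gamma>m1 j *s Fm1 x" if "x \<ge> 0" for j x
    using cf[of j] that z p1_zero exhaust_2[of j] by (auto simp: has_coeffs_def)
  have "\<Phi>c (\<gamma>m1 2) (- \<gamma>m1 1) x = 0" if "x \<ge> 0" for x
    using \<Phi>m[OF that] by (simp add: \<Phi>c_def vec2_eq_iff)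
  from \<Phi>c_zero(2)[OF this] have "\<gamma>m1 1 = 0" by simp
  then have "\<Phi>c 1 0 x = 0" if "x \<ge> 0" for x using \<Phi>m[OF that] by (simp add: \<Phi>c_def)
  from \<Phi>c_zero(1)[OF this] show False by simp
qed

text \<open>The coefficients of the columns are chosen to cancel the \<open>B\<close> part. The
  \<open>A\<close> part then cancels as well, because by \<open>osc_symmetry\<close> its coefficient
  is the difference of the squared moduli in \<open>osc_cmod\<close>.\<close>

lemma eigenfunction_coeffs:
  assumes "jost_choice q k Fm1 A B C" "\<And>j. has_coeffs Fm1 A B C (\<Phi> j) (a j) (b j) (c j) (d j)" "x \<ge> 0"
  shows "\<Phi>c (\<gamma>mi 2) (- \<gamma>mi 1) x = (a 1 * c 2 - c 1 * a 2) *s Fm1 x"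
proof -
  have e: "b j = \<gamma>pi j" "c j = \<gamma>mi j" "d j = 0" for j
    using osc_unambiguous[OF assms(1,2)] p1_unambiguous[OF assms(1,2)] p1_zero by auto
  have "\<gamma>mi 2 * \<gamma>pi 1 - \<gamma>mi 1 * \<gamma>pi 2 = 0"
    using osc_cmod unfolding osc_symmetry by (metis complex_norm_square diff_self mult.commute)
  then have z: "\<gamma>mi 2 * \<gamma>pi 1 = \<gamma>mi 1 * \<gamma>pi 2" by simp
  have c: "has_coeffs Fm1 A B C (\<Phi>c (\<gamma>mi 2) (- \<gamma>mi 1)) (\<gamma>mi 2 * a 1 + - \<gamma>mi 1 * a 2) (\<gamma>mi 2 * b 1 + - \<gamma>mi 1 * b 2)
      (\<gamma>mi 2 * c 1 + - \<gamma>mi 1 * c 2) (\<gamma>mi 2 * d 1 + - \<gamma>mi 1 * d 2)"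
    by (rule coeffs_\<Phi>c[OF assms(2,2)])
  then show ?thesis using assms(3) z unfolding has_coeffs_def e by (simp add: mult.commute)
qed

lemma eigenfunction: "x \<ge> 0 ==> \<Phi>c (\<gamma>mi 2) (- \<gamma>mi 1) x = D *s Fm1 x"
  using eigenfunction_coeffs[OF jc cf] by (simp add: D_def)

lemma D_unambiguous:
  assumes "jost_choice q k Fm1 A B C" "\<And>j. has_coeffs Fm1 A B C (\<Phi> j) (a j) (b j) (c j) (d j)"
  shows "a 1 * c 2 - c 1 * a 2 = D"
proof -
  have "(a 1 * c 2 - c 1 * a 2 - D) *s Fm1 x = 0" if "x \<ge> 0" for x
    using eigenfunction_coeffs[OF assms that] eigenfunction[OF that] by (simp add: vec2_eq_iff algebra_simps)
  from Fm1_nonzero[OF this] show ?thesis by simp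
qed

lemma D_nonzero: "D \<noteq> 0"
proof
  assume "D = 0"
  then have "\<Phi>c (\<gamma>mi 2) (- \<gamma>mi 1) x = 0" if "x \<ge> 0" for x using eigenfunction[OF that] by simp
  from \<Phi>c_zero(2)[OF this] osc_nonzero show False by simp
qed

end

end

section \<open>Stieltjes inversion\<close>

text \<open>The densities are complex, so the Dynkin induction runs on the integrals themselves.
  Intersecting with \<open>V\<close>, where both densities are integrable, makes complements a
  subtraction from the integral over \<open>V\<close>.\<close>

lemma set_integral_eq_on_borel:
  fixes f g :: "real => complex"
  assumes M: "sets borel \<subseteq> sets M" and N: "sets borel \<subseteq> sets N" and V: "V \<in> sets borel"
    and f: "set_integrable M V f" and g: "set_integrable N V g"
    and int: "\<And>a b. (LINT t:{a<..<b} \<inter> V|M. f t) = (LINT t:{a<..<b} \<inter> V|N. g t)"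
    and all: "(LINT t:V|M. f t) = (LINT t:V|N. g t)"
    and B: "B \<in> sets borel"
  shows "(LINT t:B \<inter> V|M. f t) = (LINT t:B \<inter> V|N. g t)"
proof -
  define G where "G = range (\<lambda>(a, b). {a<..<b :: real})"
  have fB: "set_integrable M (A \<inter> V) f" and gB: "set_integrable N (A \<inter> V) g" if "A \<in> sets borel" for A
    using that V M N by (auto intro: set_integrable_subset[OF f] set_integrable_subset[OF g])
  have bor: "sets borel = sigma_sets UNIV G"

  proof -
    have b: "borel = sigma UNIV G" using borel_eq_box[where 'a = real] unfolding G_def by (simp add: box_real case_prod_unfold)
    show ?thesis by (subst b) (simp add: sets_measure_of)
  qed
  have B': "B \<in> sigma_sets UNIV G" using B bor by simp
  show ?thesis
  proof (rule sigma_sets_induct_disjoint[OF _ _ B'])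
    show "Int_stable G"
    proof (rule Int_stableI)
      fix A A' assume "A \<in> G" "A' \<in> G"
      then obtain a b a' b' where "A = {a<..<b}" "A' = {a'<..<b'}" by (auto simp: G_def)
      then have "A \<inter> A' = {max a a'<..<min b b'}" by auto
      then show "A \<inter> A' \<in> G" by (auto simp: G_def)
    qed
    show "G \<subseteq> Pow UNIV" by auto
    show "(LINT t:A \<inter> V|M. f t) = (LINT t:A \<inter> V|N. g t)" if "A \<in> G" for A
      using that int by (auto simp: G_def)
    show "(LINT t:{} \<inter> V|M. f t) = (LINT t:{} \<inter> V|N. g t)"
      by (simp add: set_lebesgue_integral_def)
    show "(LINT t:(UNIV - A) \<inter> V|M. f t) = (LINT t:(UNIV - A) \<inter> V|N. g t)"
      if A: "A \<in> sigma_sets UNIV G" and eq: "(LINT t:A \<inter> V|M. f t) = (LINT t:A \<inter> V|N. g t)" for A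
    proof -
      have A1: "A \<in> sets borel" using A unfolding bor .
      then have A': "A \<in> sets borel" "UNIV - A \<in> sets borel" using sets.compl_sets[OF A1] by simp_all
      have V: "A \<inter> V \<union> (UNIV - A) \<inter> V = V" by auto
      have "(LINT t:V|M. f t) = (LINT t:A \<inter> V|M. f t) + (LINT t:(UNIV - A) \<inter> V|M. f t)"
        "(LINT t:V|N. g t) = (LINT t:A \<inter> V|N. g t) + (LINT t:(UNIV - A) \<inter> V|N. g t)"
        using set_integral_Un[OF _ fB[OF A'(1)] fB[OF A'(2)]] set_integral_Un[OF _ gB[OF A'(1)] gB[OF A'(2)]]
        unfolding V by auto
      then show ?thesis using all eq by simp
    qed
    show "(LINT t:(\<Union>(range A)) \<inter> V|M. f t) = (LINT t:(\<Union>(range A)) \<inter> V|N. g t)"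
      if d: "disjoint_family A" and A: "range A \<subseteq> sigma_sets UNIV G"
        and eq: "\<And>i. (LINT t:A i \<inter> V|M. f t) = (LINT t:A i \<inter> V|N. g t)" for A :: "nat => real set"
    proof -
      have A': "A i \<in> sets borel" for i using A unfolding bor by blast
      then have U: "\<Union>(range A) \<in> sets borel" by auto
      have e: "(\<Union>(range A)) \<inter> V = (\<Union>i. A i \<inter> V)" by auto
      have dj: "i \<noteq> j ==> (A i \<inter> V) \<inter> (A j \<inter> V) = {}" for i j using d unfolding disjoint_family_on_def by auto
      have AV: "A i \<inter> V \<in> sets M" "A i \<inter> V \<in> sets N" for i using A'[of i] V M N by blast+
      have "(LINT t:(\<Union>i. A i \<inter> V)|M. f t) = (\<Sum>i. (LINT t:A i \<inter> V|M. f t))"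
        by (rule lebesgue_integral_countable_add[OF AV(1) dj fB[OF U, unfolded e]])
      moreover have "(LINT t:(\<Union>i. A i \<inter> V)|N. g t) = (\<Sum>i. (LINT t:A i \<inter> V|N. g t))"
        by (rule lebesgue_integral_countable_add[OF AV(2) dj gB[OF U, unfolded e]])
      ultimately show ?thesis unfolding e using eq by simp
    qed
  qed
qed

lemma scaleR_of_real_times: "c *\<^sub>R (complex_of_real a * z) = complex_of_real (c * a) * z"
  by (simp add: scaleR_conv_of_real)

section \<open>The Herglotz kernel, atoms and Poisson integrals\<close>

definition nker :: "complex => real => complex" where
  "nker l t = 1 / (complex_of_real t - l) - complex_of_real (t / (1 + t\<^sup>2))"

text \<open>The kernel equals \<open>(l + (1 + l^2) / (t - l)) / (1 + t^2)\<close>. The factored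
  weight is the one against which the spectral measure is known to be finite.\<close>

lemma nker_bound:
  assumes "Im l \<noteq> 0"
  shows "cmod (nker l t) \<le> (cmod l + cmod (1 + l\<^sup>2) / \<bar>Im l\<bar>) * (1 / (1 + t\<^sup>2))"
proof -
  let ?t = "complex_of_real t"
  have tl: "?t - l \<noteq> 0" using assms by (auto simp: complex_eq_iff)
  have t0: "1 + ?t\<^sup>2 \<noteq> 0"
    by (metis add_nonneg_eq_0_iff of_real_1 of_real_add of_real_eq_0_iff of_real_power zero_le_one zero_le_power2 zero_neq_one)
  have e: "nker l t = (l + (1 + l\<^sup>2) / (?t - l)) * (1 / (1 + ?t\<^sup>2))"
    using tl t0 unfolding nker_def by (simp add: divide_simps power2_eq_square) (simp add: algebra_simps)
  have "\<bar>Im l\<bar> \<le> cmod (?t - l)" using abs_Im_le_cmod[of "?t - l"] by simp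
  then have "cmod ((1 + l\<^sup>2) / (?t - l)) \<le> cmod (1 + l\<^sup>2) / \<bar>Im l\<bar>"
    using assms by (simp add: norm_divide frac_le)
  then have "cmod (l + (1 + l\<^sup>2) / (?t - l)) \<le> cmod l + cmod (1 + l\<^sup>2) / \<bar>Im l\<bar>"
    using norm_triangle_ineq order_trans by (meson add_left_mono)
  moreover have "cmod (1 / (1 + ?t\<^sup>2)) = 1 / (1 + t\<^sup>2)"
  proof -
    have "1 / (1 + ?t\<^sup>2) = complex_of_real (1 / (1 + t\<^sup>2))" by simp
    then show ?thesis by (simp only: norm_of_real) (simp add: abs_of_pos add_pos_nonneg)
  qed
  ultimately show ?thesis unfolding e norm_mult by (simp only:) (rule mult_right_mono, simp_all)
qed

lemma nker_measurable [measurable]: "nker l \<in> borel_measurable borel"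
  unfolding nker_def[abs_def] by measurable

locale herglotz_measure =
  fixes \<nu> :: "real measure" and g :: "real => complex"
  assumes sets [measurable_cong, simp]: "sets \<nu> = sets borel"
    and fin: "integrable \<nu> (\<lambda>t. 1 / (1 + t\<^sup>2))"
    and g [measurable]: "g \<in> borel_measurable borel" and g1: "\<And>t. cmod (g t) \<le> 1"
begin

lemma space [simp]: "space \<nu> = UNIV"
  using sets_eq_imp_space_eq[OF sets] by simp

lemma integrable_dominated:
  fixes f :: "real => 'b::{banach, second_countable_topology}"
  assumes "f \<in> borel_measurable borel" "\<And>t. norm (f t) \<le> C * (1 / (1 + t\<^sup>2))"
  shows "integrable \<nu> f"
proof (rule Bochner_Integration.integrable_bound)
  show "integrable \<nu> (\<lambda>t. C * (1 / (1 + t\<^sup>2)))" using fin by (rule integrable_mult_right)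
  show "f \<in> borel_measurable \<nu>" using assms(1) measurable_cong_sets[OF sets refl] by blast
  show "AE t in \<nu>. norm (f t) \<le> norm (C * (1 / (1 + t\<^sup>2)))"
  proof (rule AE_I2)
    show "norm (f t) \<le> norm (C * (1 / (1 + t\<^sup>2)))" for t
      using assms(2)[of t] abs_ge_self[of "C * (1 / (1 + t\<^sup>2))"] unfolding real_norm_def by linarith
  qed
qed

lemma emeasure_bounded_finite:
  assumes "A \<in> sets borel" "A \<subseteq> {-R..R}"
  shows "emeasure \<nu> A < \<infinity>"
proof -
  have "integrable \<nu> (\<lambda>t. indicator A t :: real)"
  proof (rule integrable_dominated[where C = "1 + R\<^sup>2"])
    fix t show "norm (indicator A t :: real) \<le> (1 + R\<^sup>2) * (1 / (1 + t\<^sup>2))"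
    proof (cases "t \<in> A")
      case True
      then have "t \<in> {-R..R}" using assms(2) by blast
      then have "\<bar>t\<bar> \<le> R" by (simp add: abs_le_iff)
      then have "t\<^sup>2 \<le> R\<^sup>2" by (metis abs_ge_zero power2_abs power_mono)
      then show ?thesis using True by (simp add: divide_simps add_pos_nonneg)
    qed simp
  qed (use assms in measurable)
  then show ?thesis using assms(1) by (simp add: integrable_indicator_iff)
qed

lemma integrable_nker: "Im l \<noteq> 0 ==> integrable \<nu> (\<lambda>t. nker l t * g t)"
proof (rule integrable_dominated)
  fix t assume "Im l \<noteq> 0"
  then show "norm (nker l t * g t) \<le> (cmod l + cmod (1 + l\<^sup>2) / \<bar>Im l\<bar>) * (1 / (1 + t\<^sup>2))"
    unfolding norm_mult using mult_mono[OF nker_bound[of l t] g1[of t]] by simp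
qed measurable

text \<open>The factor \<open>y\<close> cancels \<open>1 / Im l\<close> in
  \<open>nker_bound\<close>, which leaves a majorant uniform in \<open>y \<le> 1\<close>; pointwise
  the rescaled kernel tends to the indicator of \<open>{l}\<close>.\<close>

lemma atom_limit:
  assumes y: "\<And>n. y n > 0" "y \<longlonglongrightarrow> 0" "\<And>n. y n \<le> 1"
  shows "(\<lambda>n. - \<i> * y n * (LINT t|\<nu>. nker (Complex l (y n)) t * g t)) \<longlonglongrightarrow> g l * measure \<nu> {l}"
proof -
  have fl: "emeasure \<nu> {l} < \<infinity>" by (rule emeasure_bounded_finite[of _ "\<bar>l\<bar>"]) auto
  define C where "C = \<bar>l\<bar> + 1 + (1 + (\<bar>l\<bar> + 1)\<^sup>2)"
  have "(\<lambda>n. LINT t|\<nu>. - \<i> * y n * (nker (Complex l (y n)) t * g t)) \<longlonglongrightarrow> (LINT t|\<nu>. indicator {l} t *\<^sub>R g l)"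
  proof (rule integral_dominated_convergence[where w = "\<lambda>t. C * (1 / (1 + t\<^sup>2))"])
    show "(\<lambda>t. indicator {l} t *\<^sub>R g l) \<in> borel_measurable \<nu>" by measurable
    show "(\<lambda>t. - \<i> * y n * (nker (Complex l (y n)) t * g t)) \<in> borel_measurable \<nu>" for n by measurable
    show "integrable \<nu> (\<lambda>t. C * (1 / (1 + t\<^sup>2)))" using fin by (rule integrable_mult_right)
    show "AE t in \<nu>. norm (- \<i> * y n * (nker (Complex l (y n)) t * g t)) \<le> C * (1 / (1 + t\<^sup>2))" for n
    proof (rule AE_I2)
      fix t
      let ?l = "Complex l (y n)"
      have l: "cmod ?l \<le> \<bar>l\<bar> + 1" using cmod_le[of ?l] y(1,3)[of n] by simp
      have "cmod (1 + ?l\<^sup>2) \<le> 1 + (cmod ?l)\<^sup>2" by (metis norm_one norm_power norm_triangle_ineq)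
      also have "\<dots> \<le> 1 + (\<bar>l\<bar> + 1)\<^sup>2" using l by (simp add: power_mono)
      finally have l2: "cmod (1 + ?l\<^sup>2) \<le> 1 + (\<bar>l\<bar> + 1)\<^sup>2" .
      have "norm (- \<i> * y n * (nker ?l t * g t)) = y n * (cmod (nker ?l t) * cmod (g t))"
        using y(1)[of n] by (simp add: norm_mult)
      also have "\<dots> \<le> y n * (((cmod ?l + cmod (1 + ?l\<^sup>2) / \<bar>Im ?l\<bar>) * (1 / (1 + t\<^sup>2))) * 1)"
        using y(1)[of n] by (intro mult_left_mono mult_mono nker_bound g1) auto
      also have "\<dots> = (y n * cmod ?l + cmod (1 + ?l\<^sup>2)) * (1 / (1 + t\<^sup>2))"
        using y(1)[of n] by (simp add: distrib_right distrib_left)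
      also have "\<dots> \<le> C * (1 / (1 + t\<^sup>2))"
      proof (rule mult_right_mono)
        have "y n * cmod ?l \<le> 1 * (\<bar>l\<bar> + 1)" using y[of ] l y(1)[of n] y(3)[of n] by (intro mult_mono) auto
        then show "y n * cmod ?l + cmod (1 + ?l\<^sup>2) \<le> C" using l2 by (simp add: C_def)
      qed simp
      finally show "norm (- \<i> * y n * (nker ?l t * g t)) \<le> C * (1 / (1 + t\<^sup>2))" .
    qed
    show "AE t in \<nu>. (\<lambda>n. - \<i> * y n * (nker (Complex l (y n)) t * g t)) \<longlonglongrightarrow> indicator {l} t *\<^sub>R g l"
    proof (rule AE_I2)
      fix t
      have yc: "(\<lambda>n. complex_of_real (y n)) \<longlonglongrightarrow> 0" using tendsto_of_real[OF y(2)] by simp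
      have lc: "Complex l (y n) = l + \<i> * y n" for n by (simp add: complex_eq_iff)
      show "(\<lambda>n. - \<i> * y n * (nker (Complex l (y n)) t * g t)) \<longlonglongrightarrow> indicator {l} t *\<^sub>R g l"
      proof (cases "t = l")
        case True
        have "- \<i> * y n * (nker (Complex l (y n)) t * g t) = g l + \<i> * y n * complex_of_real (l / (1 + l\<^sup>2)) * g l" for n
          using y(1)[of n] True unfolding nker_def lc by (simp add: algebra_simps)
        moreover have "(\<lambda>n. g l + \<i> * y n * complex_of_real (l / (1 + l\<^sup>2)) * g l) \<longlonglongrightarrow> g l + \<i> * 0 * complex_of_real (l / (1 + l\<^sup>2)) * g l"
          by (intro tendsto_intros yc)
        ultimately show ?thesis using True by simp
      next
        case False
        have "(\<lambda>n. - \<i> * y n * ((1 / (complex_of_real t - (l + \<i> * y n)) - complex_of_real (t / (1 + t\<^sup>2))) * g t))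
          \<longlonglongrightarrow> - \<i> * 0 * ((1 / (complex_of_real t - (l + \<i> * 0)) - complex_of_real (t / (1 + t\<^sup>2))) * g t)"
          by (intro tendsto_intros yc) (use False in simp)
        then show ?thesis using False unfolding nker_def lc by simp
      qed
    qed
  qed
  moreover have "(LINT t|\<nu>. indicator {l} t *\<^sub>R g l) = g l * measure \<nu> {l}"
    using fl by (simp add: scaleR_conv_of_real)
  ultimately show ?thesis by simp
qed

lemma nker_diff_cnj:
  assumes "y \<noteq> 0"
  shows "(nker (Complex x y) t - cnj (nker (Complex x y) t)) / (2 * \<i>) = complex_of_real (y / ((t - x)\<^sup>2 + y\<^sup>2))"
proof -
  let ?z = "complex_of_real t - Complex x y"
  have z: "?z \<noteq> 0" "cnj ?z \<noteq> 0" using assms by (auto simp: complex_eq_iff)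
  have zz: "?z * cnj ?z = complex_of_real ((t - x)\<^sup>2 + y\<^sup>2)"
    by (simp add: complex_eq_iff power2_eq_square algebra_simps)
  have "nker (Complex x y) t - cnj (nker (Complex x y) t) = 1 / ?z - 1 / cnj ?z"
    by (simp add: nker_def)
  also have "\<dots> = (cnj ?z - ?z) / (?z * cnj ?z)" using z by (simp add: divide_simps)
  also have "cnj ?z - ?z = 2 * \<i> * y" by (simp add: complex_eq_iff)
  finally show ?thesis unfolding zz by (simp add: field_simps)
qed

text \<open>The kernel is the imaginary part of \<open>nker\<close>; for complex \<open>g\<close>
  the integral is not the imaginary part of the transform. The factor \<open>1 / pi\<close> is left
  out and returns as the limit of the arctangent differences.\<close>

definition poisson :: "real => real => complex" where
  "poisson x y = (LINT s|\<nu>. complex_of_real (y / ((s - x)\<^sup>2 + y\<^sup>2)) * g s)"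

lemma poisson_integral:
  assumes ab: "a \<le> b" and y: "y > 0"
  shows "(LINT x:{a..b}|lborel. poisson x y) = (LINT s|\<nu>. complex_of_real (arctan ((b - s) / y) - arctan ((a - s) / y)) * g s)"
    and "(\<lambda>x. poisson x y) \<in> borel_measurable borel"
proof -
  \<comment> \<open>The measure may be infinite. Moving the weight into it gives a finite measure
    and leaves an integrand that is bounded for \<open>x\<close> in \<open>{a..b}\<close>, so Fubini
    applies.\<close>
  define M2 where "M2 = density \<nu> (\<lambda>s. ennreal (1 / (1 + s\<^sup>2)))"
  define f where "f x s = complex_of_real (y * (1 + s\<^sup>2) / ((s - x)\<^sup>2 + y\<^sup>2)) * g s" for x s
  have [measurable_cong, simp]: "sets M2 = sets borel" by (simp add: M2_def)
  have sp: "space M2 = UNIV" by (simp add: M2_def)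
  have M2m: "emeasure M2 UNIV < \<infinity>"
  proof -
    have "emeasure M2 UNIV = (\<integral>\<^sup>+ s. ennreal (1 / (1 + s\<^sup>2)) \<partial>\<nu>)"
      unfolding M2_def by (subst emeasure_density) auto
    also have "\<dots> < \<infinity>" using fin by (simp add: integrable_iff_bounded)
    finally show ?thesis .
  qed
  then interpret M2: finite_measure M2 by (intro finite_measureI) (auto simp: sp)
  interpret P: pair_sigma_finite lborel M2 ..
  have meas [measurable]: "(\<lambda>(x, s). f x s) \<in> borel_measurable (lborel \<Otimes>\<^sub>M M2)"
    unfolding f_def by measurable
  have pois: "(LINT s|M2. f x s) = poisson x y" for x
  proof -
    have "(LINT s|M2. f x s) = (LINT s|\<nu>. (1 / (1 + s\<^sup>2)) *\<^sub>R f x s)"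
      unfolding M2_def by (subst integral_density) (auto simp: f_def)
    also have "\<dots> = poisson x y"
      unfolding poisson_def
    proof (rule Bochner_Integration.integral_cong[OF refl])
      fix s :: real
      have "1 + s\<^sup>2 \<noteq> 0" by (metis add_nonneg_eq_0_iff zero_le_one zero_le_power2 zero_neq_one)
      then have "(1 / (1 + s\<^sup>2)) * (y * (1 + s\<^sup>2) / ((s - x)\<^sup>2 + y\<^sup>2)) = y / ((s - x)\<^sup>2 + y\<^sup>2)" by simp
      then show "(1 / (1 + s\<^sup>2)) *\<^sub>R f x s = complex_of_real (y / ((s - x)\<^sup>2 + y\<^sup>2)) * g s"
        unfolding f_def scaleR_of_real_times by (simp only:)
    qed
    finally show ?thesis .
  qed
  have "(\<lambda>x. LINT s|M2. f x s) \<in> borel_measurable lborel"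
    using M2.borel_measurable_lebesgue_integral[OF meas] by simp
  then show "(\<lambda>x. poisson x y) \<in> borel_measurable borel" unfolding pois by simp
  define m where "m = max \<bar>a\<bar> \<bar>b\<bar>"
  have bound: "cmod (f x s) \<le> y * (2 + (1 + 2 * m\<^sup>2) / y\<^sup>2)" if x: "x \<in> {a..b}" for x s
  proof -
    have "\<bar>x\<bar> \<le> m" using x by (auto simp: m_def)
    then have xm: "x\<^sup>2 \<le> m\<^sup>2" by (metis abs_ge_zero power2_abs power_mono)
    \<comment> \<open>Equivalent to \<open>s^2 \<le> 2 * (s - x)^2 + 2 * x^2\<close>.\<close>
    have "0 \<le> (s - 2 * x)\<^sup>2" by simp
    then have s2: "1 + s\<^sup>2 \<le> 2 * (s - x)\<^sup>2 + (1 + 2 * m\<^sup>2)"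
      using xm by (simp add: power2_eq_square algebra_simps)
    have y2: "y\<^sup>2 > 0" using y by simp
    have pos: "(s - x)\<^sup>2 + y\<^sup>2 > 0" using y by (simp add: add_nonneg_pos)
    have "1 + s\<^sup>2 \<le> (2 + (1 + 2 * m\<^sup>2) / y\<^sup>2) * ((s - x)\<^sup>2 + y\<^sup>2)"
    proof -
      have "(2 + (1 + 2 * m\<^sup>2) / y\<^sup>2) * ((s - x)\<^sup>2 + y\<^sup>2) = 2 * (s - x)\<^sup>2 + (1 + 2 * m\<^sup>2) + (2 * y\<^sup>2 + (1 + 2 * m\<^sup>2) / y\<^sup>2 * (s - x)\<^sup>2)"
        using y2 by (simp add: field_simps)
      moreover have "0 \<le> 2 * y\<^sup>2 + (1 + 2 * m\<^sup>2) / y\<^sup>2 * (s - x)\<^sup>2" by simp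
      ultimately show ?thesis using s2 by linarith
    qed
    then have q: "(1 + s\<^sup>2) / ((s - x)\<^sup>2 + y\<^sup>2) \<le> 2 + (1 + 2 * m\<^sup>2) / y\<^sup>2"
      using pos by (simp add: pos_divide_le_eq)
    have "cmod (f x s) = y * ((1 + s\<^sup>2) / ((s - x)\<^sup>2 + y\<^sup>2)) * cmod (g s)"
      unfolding f_def norm_mult norm_of_real using y pos by simp
    also have "\<dots> \<le> y * ((1 + s\<^sup>2) / ((s - x)\<^sup>2 + y\<^sup>2)) * 1"
      using y pos by (intro mult_left_mono g1) (simp add: add_nonneg_nonneg)
    also have "\<dots> \<le> y * (2 + (1 + 2 * m\<^sup>2) / y\<^sup>2)"
      unfolding mult_1_right by (rule mult_left_mono[OF q]) (use y in simp)
    finally show ?thesis .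
  qed
  have int: "integrable (lborel \<Otimes>\<^sub>M M2) (\<lambda>(x, s). indicator {a..b} x *\<^sub>R f x s)"
  proof (rule integrableI_bounded_set[where A = "{a..b} \<times> UNIV" and B = "y * (2 + (1 + 2 * m\<^sup>2) / y\<^sup>2)"])
    show "{a..b} \<times> UNIV \<in> sets (lborel \<Otimes>\<^sub>M M2)" by (intro pair_measureI) auto
    show "(\<lambda>(x, s). indicator {a..b} x *\<^sub>R f x s) \<in> borel_measurable (lborel \<Otimes>\<^sub>M M2)" by measurable
    show "emeasure (lborel \<Otimes>\<^sub>M M2) ({a..b} \<times> UNIV) < \<infinity>"
      using M2m ab by (subst M2.emeasure_pair_measure_Times) (auto simp: ennreal_mult_less_top)
    show "AE p in lborel \<Otimes>\<^sub>M M2. p \<in> {a..b} \<times> UNIV \<longrightarrow> norm (case p of (x, s) => indicator {a..b} x *\<^sub>R f x s) \<le> y * (2 + (1 + 2 * m\<^sup>2) / y\<^sup>2)"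
      using bound by (intro AE_I2) auto
    show "AE p in lborel \<Otimes>\<^sub>M M2. p \<notin> {a..b} \<times> UNIV \<longrightarrow> (case p of (x, s) => indicator {a..b} x *\<^sub>R f x s) = 0"
      by (intro AE_I2) (auto simp: indicator_def)
  qed
  have "(LINT x:{a..b}|lborel. poisson x y) = (LINT x|lborel. (LINT s|M2. indicator {a..b} x *\<^sub>R f x s))"
    unfolding set_lebesgue_integral_def by (simp add: pois)
  also have "\<dots> = (LINT s|M2. (LINT x|lborel. indicator {a..b} x *\<^sub>R f x s))"
    using P.Fubini_integral[OF int] by simp
  also have "\<dots> = (LINT s|M2. complex_of_real ((1 + s\<^sup>2) * (arctan ((b - s) / y) - arctan ((a - s) / y))) * g s)"
  proof (rule Bochner_Integration.integral_cong[OF refl])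
    fix s :: real
    have pos: "(s - x)\<^sup>2 + y\<^sup>2 > 0" for x using y by (simp add: add_nonneg_pos)
    have "(LINT x|lborel. indicator {a..b} x *\<^sub>R (y * (1 + s\<^sup>2) / ((s - x)\<^sup>2 + y\<^sup>2)))
        = (1 + s\<^sup>2) * arctan ((b - s) / y) - (1 + s\<^sup>2) * arctan ((a - s) / y)"
    proof (rule integral_FTC_atLeastAtMost[OF ab])
      fix x :: real
      have "((\<lambda>x. arctan ((x - s) / y)) has_real_derivative (inverse (1 + ((x - s) / y)\<^sup>2) * (1 / y))) (at x within {a..b})"
        using y by (auto intro!: derivative_eq_intros simp: field_simps)
      then have "((\<lambda>x. (1 + s\<^sup>2) * arctan ((x - s) / y)) has_real_derivative (1 + s\<^sup>2) * (inverse (1 + ((x - s) / y)\<^sup>2) * (1 / y))) (at x within {a..b})"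
        by (rule DERIV_cmult)
      moreover have "inverse (1 + ((x - s) / y)\<^sup>2) * (1 / y) = y / ((s - x)\<^sup>2 + y\<^sup>2)"
        using y pos[of x] by (simp add: power2_commute[of x s] power_divide divide_simps add.commute) (simp add: power2_eq_square)
      ultimately have d: "((\<lambda>x. (1 + s\<^sup>2) * arctan ((x - s) / y)) has_vector_derivative (1 + s\<^sup>2) * (y / ((s - x)\<^sup>2 + y\<^sup>2))) (at x within {a..b})"
        unfolding has_real_derivative_iff_has_vector_derivative by (simp only:)
      have e: "(1 + s\<^sup>2) * (y / ((s - x)\<^sup>2 + y\<^sup>2)) = y * (1 + s\<^sup>2) / ((s - x)\<^sup>2 + y\<^sup>2)" by (simp only: times_divide_eq_right mult.commute)
      show "((\<lambda>x. (1 + s\<^sup>2) * arctan ((x - s) / y)) has_vector_derivative y * (1 + s\<^sup>2) / ((s - x)\<^sup>2 + y\<^sup>2)) (at x within {a..b})"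
        using d unfolding e .
    next
      show "continuous_on {a..b} (\<lambda>x. y * (1 + s\<^sup>2) / ((s - x)\<^sup>2 + y\<^sup>2))"
        by (intro continuous_intros ballI) (metis less_irrefl pos)
    qed
    moreover have "(LINT x|lborel. indicator {a..b} x *\<^sub>R f x s) = complex_of_real (LINT x|lborel. indicator {a..b} x *\<^sub>R (y * (1 + s\<^sup>2) / ((s - x)\<^sup>2 + y\<^sup>2))) * g s"
    proof -
      have "(LINT x|lborel. indicator {a..b} x *\<^sub>R f x s) = (LINT x|lborel. complex_of_real (indicator {a..b} x *\<^sub>R (y * (1 + s\<^sup>2) / ((s - x)\<^sup>2 + y\<^sup>2))) * g s)"
        by (rule Bochner_Integration.integral_cong[OF refl]) (simp add: f_def scaleR_conv_of_real)
      then show ?thesis by (simp only: integral_mult_left_zero integral_complex_of_real)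
    qed
    ultimately show "(LINT x|lborel. indicator {a..b} x *\<^sub>R f x s) = complex_of_real ((1 + s\<^sup>2) * (arctan ((b - s) / y) - arctan ((a - s) / y))) * g s"
      by (simp only: right_diff_distrib)
  qed
  also have "\<dots> = (LINT s|\<nu>. (1 / (1 + s\<^sup>2)) *\<^sub>R (complex_of_real ((1 + s\<^sup>2) * (arctan ((b - s) / y) - arctan ((a - s) / y))) * g s))"
    unfolding M2_def by (subst integral_density) auto
  also have "\<dots> = (LINT s|\<nu>. complex_of_real (arctan ((b - s) / y) - arctan ((a - s) / y)) * g s)"
  proof (rule Bochner_Integration.integral_cong[OF refl])
    fix s :: real
    have "1 + s\<^sup>2 \<noteq> 0" by (metis add_nonneg_eq_0_iff zero_le_one zero_le_power2 zero_neq_one)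
    then have "(1 / (1 + s\<^sup>2)) * ((1 + s\<^sup>2) * (arctan ((b - s) / y) - arctan ((a - s) / y))) = arctan ((b - s) / y) - arctan ((a - s) / y)" by simp
    then show "(1 / (1 + s\<^sup>2)) *\<^sub>R (complex_of_real ((1 + s\<^sup>2) * (arctan ((b - s) / y) - arctan ((a - s) / y))) * g s)
      = complex_of_real (arctan ((b - s) / y) - arctan ((a - s) / y)) * g s"
      unfolding scaleR_of_real_times by (simp only:)
  qed
  finally show "(LINT x:{a..b}|lborel. poisson x y) = (LINT s|\<nu>. complex_of_real (arctan ((b - s) / y) - arctan ((a - s) / y)) * g s)" .
qed

lemma arctan_div_limit:
  assumes y: "\<And>n. y n > 0" "y \<longlonglongrightarrow> 0" and u: "u \<noteq> 0"
  shows "(\<lambda>n. arctan (u / y n)) \<longlonglongrightarrow> (if u > 0 then pi/2 else - pi/2)"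
proof -
  have i: "filterlim (\<lambda>n. inverse (y n)) at_top sequentially"
    using y by (intro filterlim_inverse_at_top) (auto intro: always_eventually)
  show ?thesis
  proof (cases "u > 0")
    case True
    then have "filterlim (\<lambda>n. u / y n) at_top sequentially"
      unfolding divide_inverse
      by (intro filterlim_tendsto_pos_mult_at_top[OF tendsto_const _ i])
    from filterlim_compose[OF tendsto_arctan_at_top this] True show ?thesis by simp
  next
    case False
    then have "filterlim (\<lambda>n. u / y n) at_bot sequentially"
      unfolding divide_inverse
      using u by (intro filterlim_tendsto_neg_mult_at_bot[OF tendsto_const _ i]) auto
    from filterlim_compose[OF tendsto_arctan_at_bot this] False show ?thesis by simp
  qed
qed

text \<open>A majorant independent of \<open>y\<close>. For \<open>s\<close> near the interval the
  difference is at most \<open>pi\<close>. Farther out the mean value theorem and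
  \<open>y \<le> 1\<close> give a bound by \<open>(b - a) / w^2\<close>, where
  \<open>w = \<bar>s\<bar> - m\<close> is at least 1, and \<open>1 / w^2\<close> is comparable with
  \<open>1 / (1 + s^2)\<close>.\<close>

lemma arctan_diff_bound:
  assumes ab: "a \<le> b" and y: "0 < y" "y \<le> 1" and m: "m = max \<bar>a\<bar> \<bar>b\<bar>"
  shows "\<bar>arctan ((b - s) / y) - arctan ((a - s) / y)\<bar> \<le> (pi * (1 + (m + 1)\<^sup>2) + (b - a) * (3 + 2 * m\<^sup>2)) * (1 / (1 + s\<^sup>2))"
proof -
  have s0: "1 + s\<^sup>2 > 0" by (simp add: add_pos_nonneg)
  have m0: "m \<ge> 0" by (simp add: m)
  show ?thesis
  proof (cases "\<bar>s\<bar> \<le> m + 1")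
    case True
    then have "s\<^sup>2 \<le> (m + 1)\<^sup>2" by (metis abs_ge_zero power2_abs power_mono)
    then have "pi * (1 + s\<^sup>2) \<le> pi * (1 + (m + 1)\<^sup>2)" by simp
    moreover have "\<bar>arctan ((b - s) / y) - arctan ((a - s) / y)\<bar> \<le> pi"
      using arctan_lbound[of "(b - s) / y"] arctan_ubound[of "(b - s) / y"] arctan_lbound[of "(a - s) / y"] arctan_ubound[of "(a - s) / y"]
      by linarith
    moreover have "0 \<le> (b - a) * (3 + 2 * m\<^sup>2)" using ab by simp
    ultimately have "\<bar>arctan ((b - s) / y) - arctan ((a - s) / y)\<bar> * (1 + s\<^sup>2) \<le> pi * (1 + (m + 1)\<^sup>2) + (b - a) * (3 + 2 * m\<^sup>2)"
      using mult_right_mono[of _ pi "1 + s\<^sup>2"] s0 by (smt (verit))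
    then show ?thesis using s0 by (simp add: pos_le_divide_eq)
  next
    case False
    define w where "w = \<bar>s\<bar> - m"
    have w: "w \<ge> 1" using False by (simp add: w_def)
    have w2: "w\<^sup>2 \<ge> 1" using w by (simp add: one_le_power)
    have "\<exists>z. arctan ((b - s) / y) - arctan ((a - s) / y) = (b - a) * (y / ((s - z)\<^sup>2 + y\<^sup>2)) \<and> a \<le> z \<and> z \<le> b"
    proof (cases "a = b")
      case False
      then have "a < b" using ab by simp
      moreover have "((\<lambda>x. arctan ((x - s) / y)) has_real_derivative y / ((s - x)\<^sup>2 + y\<^sup>2)) (at x)" for x
      proof -
        have pos: "(s - x)\<^sup>2 + y\<^sup>2 > 0" using y by (simp add: add_nonneg_pos)
        have "((\<lambda>x. arctan ((x - s) / y)) has_real_derivative (inverse (1 + ((x - s) / y)\<^sup>2) * (1 / y))) (at x)"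
          using y by (auto intro!: derivative_eq_intros simp: field_simps)
        moreover have "inverse (1 + ((x - s) / y)\<^sup>2) * (1 / y) = y / ((s - x)\<^sup>2 + y\<^sup>2)"
          using y pos by (simp add: power2_commute[of x s] power_divide divide_simps add.commute) (simp add: power2_eq_square)
        ultimately show ?thesis by simp
      qed
      ultimately show ?thesis using MVT2[of a b "\<lambda>x. arctan ((x - s) / y)" "\<lambda>x. y / ((s - x)\<^sup>2 + y\<^sup>2)"] by auto
    qed auto
    then obtain z where z: "arctan ((b - s) / y) - arctan ((a - s) / y) = (b - a) * (y / ((s - z)\<^sup>2 + y\<^sup>2))" "a \<le> z" "z \<le> b" by blast
    have "\<bar>z\<bar> \<le> m" using z by (auto simp: m)
    then have "w \<le> \<bar>s - z\<bar>" unfolding w_def by linarith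
    then have ws: "w\<^sup>2 \<le> (s - z)\<^sup>2" using w by (metis order_trans power2_abs power_mono zero_le_one)
    have "y / ((s - z)\<^sup>2 + y\<^sup>2) \<le> 1 / w\<^sup>2"
      using y ws w2 by (intro frac_le) (auto intro: add_increasing2)
    also have "1 / w\<^sup>2 \<le> (3 + 2 * m\<^sup>2) * (1 / (1 + s\<^sup>2))"
    proof -
      have "s\<^sup>2 = (w + m)\<^sup>2" by (simp add: w_def)
      also have "\<dots> \<le> 2 * w\<^sup>2 + 2 * m\<^sup>2" using zero_le_power2[of "w - m"] by (simp add: power2_eq_square algebra_simps)
      finally have "1 + s\<^sup>2 \<le> (3 + 2 * m\<^sup>2) * w\<^sup>2" using w2 mult_left_mono[OF w2, of "2 * m\<^sup>2"] by (simp add: algebra_simps)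
      then show ?thesis using w2 s0 by (simp add: divide_simps)
    qed
    finally have "(b - a) * (y / ((s - z)\<^sup>2 + y\<^sup>2)) \<le> (b - a) * ((3 + 2 * m\<^sup>2) * (1 / (1 + s\<^sup>2)))"
      using ab by (intro mult_left_mono) auto
    moreover have "0 \<le> (b - a) * (y / ((s - z)\<^sup>2 + y\<^sup>2))" using ab y by simp
    moreover have "0 \<le> pi * (1 + (m + 1)\<^sup>2) * (1 / (1 + s\<^sup>2))" by simp
    ultimately show ?thesis unfolding z(1) distrib_right mult.assoc by linarith
  qed
qed

lemma stieltjes_limit:
  assumes y: "\<And>n. 0 < y n" "\<And>n. y n \<le> 1" "y \<longlonglongrightarrow> 0" and ab: "a \<le> b"
    and atoms: "emeasure \<nu> {a} = 0" "emeasure \<nu> {b} = 0"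
  shows "(\<lambda>n. LINT x:{a..b}|lborel. poisson x (y n)) \<longlonglongrightarrow> pi * (LINT s:{a<..<b}|\<nu>. g s)"
proof -
  define m where "m = max \<bar>a\<bar> \<bar>b\<bar>"
  have "(\<lambda>n. LINT s|\<nu>. complex_of_real (arctan ((b - s) / y n) - arctan ((a - s) / y n)) * g s)
      \<longlonglongrightarrow> (LINT s|\<nu>. pi * (indicator {a<..<b} s *\<^sub>R g s))"
  proof (rule integral_dominated_convergence[where w = "\<lambda>s. (pi * (1 + (m + 1)\<^sup>2) + (b - a) * (3 + 2 * m\<^sup>2)) * (1 / (1 + s\<^sup>2))"])
    show "integrable \<nu> (\<lambda>s. (pi * (1 + (m + 1)\<^sup>2) + (b - a) * (3 + 2 * m\<^sup>2)) * (1 / (1 + s\<^sup>2)))"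
      using fin by (rule integrable_mult_right)
    show "(\<lambda>s. complex_of_real (arctan ((b - s) / y n) - arctan ((a - s) / y n)) * g s) \<in> borel_measurable \<nu>" for n
      by measurable
    show "AE s in \<nu>. norm (complex_of_real (arctan ((b - s) / y n) - arctan ((a - s) / y n)) * g s)
        \<le> (pi * (1 + (m + 1)\<^sup>2) + (b - a) * (3 + 2 * m\<^sup>2)) * (1 / (1 + s\<^sup>2))" for n
    proof (rule AE_I2)
      fix s
      show "norm (complex_of_real (arctan ((b - s) / y n) - arctan ((a - s) / y n)) * g s)
        \<le> (pi * (1 + (m + 1)\<^sup>2) + (b - a) * (3 + 2 * m\<^sup>2)) * (1 / (1 + s\<^sup>2))"
        unfolding norm_mult norm_of_real
        using mult_mono[OF arctan_diff_bound[OF ab y(1,2) m_def, of s n] g1[of s] order_trans[OF abs_ge_zero arctan_diff_bound[OF ab y(1,2) m_def, of s n]]]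
        by simp
    qed
    \<comment> \<open>At an end point the limit would be half of the value inside, so only atom-free
      end points give the plain indicator of the open interval.\<close>
    have "AE s in \<nu>. s \<noteq> a \<and> s \<noteq> b"
    proof (rule AE_I[of _ _ "{a, b}"])
      show "emeasure \<nu> {a, b} = 0"
        using emeasure_subadditive[of "{a}" \<nu> "{b}"] atoms by (simp add: insert_commute)
    qed auto
    then show "AE s in \<nu>. (\<lambda>n. complex_of_real (arctan ((b - s) / y n) - arctan ((a - s) / y n)) * g s)
        \<longlonglongrightarrow> pi * (indicator {a<..<b} s *\<^sub>R g s)"
    proof eventually_elim
      case (elim s)
      have "(\<lambda>n. complex_of_real (arctan ((b - s) / y n) - arctan ((a - s) / y n)) * g s)
         \<longlonglongrightarrow> complex_of_real ((if b - s > 0 then pi/2 else - pi/2) - (if a - s > 0 then pi/2 else - pi/2)) * g s"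
        by (intro tendsto_intros arctan_div_limit y) (use elim in auto)
      then show ?case using elim ab by (auto simp: indicator_def split: if_splits)
    qed
  qed measurable
  moreover have "(LINT s|\<nu>. pi * (indicator {a<..<b} s *\<^sub>R g s)) = pi * (LINT s:{a<..<b}|\<nu>. g s)"
    unfolding set_lebesgue_integral_def by (rule integral_mult_right_zero)
  ultimately show ?thesis unfolding poisson_integral(1)[OF ab y(1)] by simp
qed

theorem stieltjes_inversion:
  fixes S :: "real => complex"
  assumes y: "\<And>n. 0 < y n" "\<And>n. y n \<le> 1" "y \<longlonglongrightarrow> 0"
    and S: "continuous_on {c..d} S"
    and lim: "uniform_limit {c..d} (\<lambda>n x. poisson x (y n)) (\<lambda>x. pi * S x) sequentially"
    and atoms: "\<And>t. t \<in> {c..d} ==> emeasure \<nu> {t} = 0"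
    and B: "B \<in> sets borel" "B \<subseteq> {c<..<d}"
  shows "set_integrable lborel B S" "(LINT t:B|\<nu>. g t) = (LINT t:B|lborel. S t)"
proof -
  have Si: "set_integrable lborel {c..d} S" by (rule borel_integrable_atLeastAtMost'[OF S])
  then have Si': "set_integrable lborel A S" if "A \<in> sets borel" "A \<subseteq> {c..d}" for A
    using that by (auto intro: set_integrable_subset)
  show "set_integrable lborel B S" by (rule Si') (use B in auto)
  have gi: "set_integrable \<nu> {c<..<d} g"
  proof -
    have "emeasure \<nu> {c<..<d} < \<infinity>"
      by (rule emeasure_bounded_finite[of _ "max \<bar>c\<bar> \<bar>d\<bar>"]) auto
    then show ?thesis unfolding set_integrable_def
      by (intro integrableI_bounded_set[where A = "{c<..<d}" and B = 1]) (auto simp: g1)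
  qed
  have main: "(LINT s:{a<..<b}|\<nu>. g s) = (LINT t:{a<..<b}|lborel. S t)" if ab: "c \<le> a" "a \<le> b" "b \<le> d" for a b
  proof -
    have l1: "(\<lambda>n. LINT x:{a..b}|lborel. poisson x (y n)) \<longlonglongrightarrow> pi * (LINT s:{a<..<b}|\<nu>. g s)"
      by (rule stieltjes_limit[OF y ab(2)]) (use atoms ab in auto)
    have "bounded (S ` {c..d})" by (intro compact_imp_bounded compact_continuous_image S) auto
    then obtain K where K: "\<And>x. x \<in> {c..d} ==> cmod (S x) \<le> K" unfolding bounded_iff by blast
    have "\<forall>\<^sub>F n in sequentially. \<forall>x\<in>{c..d}. dist (poisson x (y n)) (pi * S x) < 1"
      using lim by (auto dest: uniform_limitD[where e = 1])
    \<comment> \<open>Uniform closeness holds from some index on; the sequence is shifted by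
      \<open>N\<close> so that one majorant serves all terms.\<close>
    then obtain N where N: "\<And>n x. n \<ge> N ==> x \<in> {c..d} ==> dist (poisson x (y n)) (pi * S x) < 1"
      unfolding eventually_sequentially by blast
    have "(\<lambda>n. LINT x|lborel. indicator {a..b} x *\<^sub>R poisson x (y (n + N))) \<longlonglongrightarrow> (LINT x|lborel. indicator {a..b} x *\<^sub>R (pi * S x))"
    proof (rule integral_dominated_convergence[where w = "\<lambda>x. indicator {a..b} x * (1 + pi * K)"])
      show "(\<lambda>x. indicator {a..b} x *\<^sub>R (pi * S x)) \<in> borel_measurable lborel"
        using Si'[of "{a..b}"] ab unfolding set_integrable_def
        by (auto dest!: borel_measurable_integrable intro: borel_measurable_times simp: mult_scaleR_right[symmetric] simp del: mult_scaleR_right)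
      show "(\<lambda>x. indicator {a..b} x *\<^sub>R poisson x (y (n + N))) \<in> borel_measurable lborel" for n
        using poisson_integral(2)[OF order_refl y(1)] by measurable
      show "integrable lborel (\<lambda>x. indicator {a..b} x * (1 + pi * K))" by (intro integrable_mult_left) (use ab in simp)
      show "AE x in lborel. (\<lambda>n. indicator {a..b} x *\<^sub>R poisson x (y (n + N))) \<longlonglongrightarrow> indicator {a..b} x *\<^sub>R (pi * S x)"
      proof (rule AE_I2)
        fix x
        show "(\<lambda>n. indicator {a..b} x *\<^sub>R poisson x (y (n + N))) \<longlonglongrightarrow> indicator {a..b} x *\<^sub>R (pi * S x)"
        proof (cases "x \<in> {a..b}")
          case True
          then have "(\<lambda>n. poisson x (y n)) \<longlonglongrightarrow> pi * S x" using tendsto_uniform_limitI[OF lim] ab by auto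
          then show ?thesis using True LIMSEQ_ignore_initial_segment by auto
        qed simp
      qed
      show "AE x in lborel. norm (indicator {a..b} x *\<^sub>R poisson x (y (n + N))) \<le> indicator {a..b} x * (1 + pi * K)" for n
      proof (rule AE_I2)
        fix x
        show "norm (indicator {a..b} x *\<^sub>R poisson x (y (n + N))) \<le> indicator {a..b} x * (1 + pi * K)"
        proof (cases "x \<in> {a..b}")
          case True
          then have x: "x \<in> {c..d}" using ab by auto
          have "cmod (poisson x (y (n + N))) \<le> dist (poisson x (y (n + N))) (pi * S x) + cmod (pi * S x)"
            by (metis add.commute dist_norm norm_triangle_sub)
          also have "\<dots> \<le> 1 + pi * K"
            using N[of "n + N", OF _ x] K[OF x] by (intro add_mono) (auto simp: norm_mult)
          finally show ?thesis using True by simp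
        qed simp
      qed
    qed
    then have "(\<lambda>n. LINT x:{a..b}|lborel. poisson x (y n)) \<longlonglongrightarrow> (LINT x|lborel. indicator {a..b} x *\<^sub>R (pi * S x))"
      unfolding set_lebesgue_integral_def by (rule LIMSEQ_offset)
    also have "(LINT x|lborel. indicator {a..b} x *\<^sub>R (pi * S x)) = pi * (LINT x:{a..b}|lborel. S x)"
    proof -
      have e: "indicator {a..b} x *\<^sub>R (pi * S x) = pi * (indicator {a..b} x *\<^sub>R S x)" for x by simp
      show ?thesis unfolding set_lebesgue_integral_def e by (rule integral_mult_right_zero)
    qed
    also have "(LINT x:{a..b}|lborel. S x) = (LINT x:{a<..<b}|lborel. S x)"
    proof (rule set_integral_cong_set)
      have sub: "{a<..<b} \<subseteq> {c..d}" using ab by auto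
      show "set_borel_measurable lborel {a..b} S" "set_borel_measurable lborel {a<..<b} S"
        using Si'[of "{a..b}"] Si'[OF _ sub] ab unfolding set_integrable_def set_borel_measurable_def by auto
      have "AE x in lborel. x \<noteq> a" "AE x in lborel. x \<noteq> b" by (rule AE_lborel_singleton)+
      then show "AE x in lborel. (x \<in> {a<..<b}) = (x \<in> {a..b})" by eventually_elim auto
    qed
    finally have "pi * (LINT s:{a<..<b}|\<nu>. g s) = pi * (LINT x:{a<..<b}|lborel. S x)"
      using l1 LIMSEQ_unique by blast
    then show ?thesis by simp
  qed
  have "(LINT t:B \<inter> {c<..<d}|\<nu>. g t) = (LINT t:B \<inter> {c<..<d}|lborel. S t)"
  proof (rule set_integral_eq_on_borel[OF _ _ _ gi Si'])
    fix a b
    \<comment> \<open>The upper end is written so that it never falls below the lower one; an empty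
      intersection becomes a degenerate interval to which \<open>main\<close> still applies.\<close>
    have "(LINT s:{max a c<..<max (max a c) (min b d)}|\<nu>. g s) = (LINT t:{max a c<..<max (max a c) (min b d)}|lborel. S t)"
      if "max a c \<le> d"
      by (rule main) (use that in auto)
    moreover have "{a<..<b} \<inter> {c<..<d} = {max a c<..<max (max a c) (min b d)}" by auto
    moreover have "{a<..<b} \<inter> {c<..<d} = {}" if "\<not> max a c \<le> d" using that by auto
    ultimately show "(LINT t:{a<..<b} \<inter> {c<..<d}|\<nu>. g t) = (LINT t:{a<..<b} \<inter> {c<..<d}|lborel. S t)"
      by (cases "max a c \<le> d") (auto simp: set_lebesgue_integral_def)
  next
    show "(LINT t:{c<..<d}|\<nu>. g t) = (LINT t:{c<..<d}|lborel. S t)"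
      using main[of c d] by (cases "c \<le> d") (auto simp: set_lebesgue_integral_def)
  qed (use B in auto)
  moreover have "B \<inter> {c<..<d} = B" using B by auto
  ultimately show "(LINT t:B|\<nu>. g t) = (LINT t:B|lborel. S t)" by simp
qed

end

section \<open>Weyl solutions\<close>

abbreviation ip :: "complex^2 => complex^2 => complex" where
  "ip u h \<equiv> u $ 1 * cnj (h $ 1) + u $ 2 * cnj (h $ 2)"

definition sqint :: "(real => complex^2) => bool" where
  "sqint F \<longleftrightarrow> (\<lambda>x. (norm (F x))\<^sup>2) absolutely_integrable_on {0..}"

lemma ip_self: "ip u u = complex_of_real ((norm u)\<^sup>2)"
  by (simp only: norm_sq2 of_real_add complex_norm_square)

text \<open>The free weight \<open>t\<close> lets \<open>atom_lower\<close> balance the two norms,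
  as optimising it would in the Cauchy-Schwarz inequality.\<close>

lemma norm_ip_le: "2 * cmod (ip u h) \<le> t * (norm u)\<^sup>2 + (norm h)\<^sup>2 / t" if "t > 0"
proof -
  have am: "2 * (a * b) \<le> t * a\<^sup>2 + b\<^sup>2 / t" for a b :: real
  proof -
    have "0 \<le> (t * a - b)\<^sup>2 / t" using that by simp
    also have "\<dots> = t * a\<^sup>2 + b\<^sup>2 / t - 2 * (a * b)" using that by (simp add: power2_eq_square field_simps)
    finally show ?thesis by simp
  qed
  have "cmod (ip u h) \<le> cmod (u $ 1) * cmod (h $ 1) + cmod (u $ 2) * cmod (h $ 2)"
    by (metis complex_mod_cnj norm_mult norm_triangle_ineq)
  then have "2 * cmod (ip u h) \<le> t * ((cmod (u $ 1))\<^sup>2 + (cmod (u $ 2))\<^sup>2) + ((cmod (h $ 1))\<^sup>2 + (cmod (h $ 2))\<^sup>2) / t"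
    using am[of "cmod (u $ 1)" "cmod (h $ 1)"] am[of "cmod (u $ 2)" "cmod (h $ 2)"]
    by (simp add: distrib_left add_divide_distrib)
  then show ?thesis by (simp add: norm_sq2)
qed

lemma isol_continuous: "isol q l F G ==> continuous_on {0..} F" "isol q l F G ==> continuous_on {0..} G"
  by (auto simp: isol_def dest: ipair_continuous_on)

lemma ip_integrable:
  assumes "continuous_on {0..} F" "continuous_on {0..} H" "sqint F" "sqint H"
  shows "(\<lambda>x. ip (F x) (H x)) absolutely_integrable_on {0..}"
proof (rule measurable_bounded_by_integrable_imp_absolutely_integrable)
  show "(\<lambda>x. ip (F x) (H x)) \<in> borel_measurable (lebesgue_on {0..})"
    by (intro continuous_imp_measurable_on_sets_lebesgue continuous_intros assms) auto
  have "(\<lambda>x. (norm (F x))\<^sup>2 + (norm (H x))\<^sup>2) absolutely_integrable_on {0..}"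
    using assms by (intro set_integral_add(1)) (auto simp: sqint_def)
  then show "(\<lambda>x. (norm (F x))\<^sup>2 + (norm (H x))\<^sup>2) integrable_on {0..}"
    by (rule set_lebesgue_integral_eq_integral(1))
  show "norm (ip (F x) (H x)) \<le> (norm (F x))\<^sup>2 + (norm (H x))\<^sup>2" for x
  proof -
    have "2 * cmod (ip (F x) (H x)) \<le> (norm (F x))\<^sup>2 + (norm (H x))\<^sup>2" using norm_ip_le[of 1 "F x" "H x"] by simp
    then show ?thesis using norm_ge_zero[of "ip (F x) (H x)"] by linarith
  qed
qed auto

lemma tendsto_integral_halfline:
  fixes f :: "real => 'a::euclidean_space"
  assumes "f absolutely_integrable_on {0..}"
  shows "((\<lambda>b. integral {0..b} f) \<longlongrightarrow> integral {0..} f) at_top"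
proof -
  have "((\<lambda>b. LINT x:{0..b}|lebesgue. f x) \<longlongrightarrow> (LINT x:{0..}|lebesgue. f x)) at_top"
    by (rule tendsto_set_lebesgue_integral_at_top) (use assms in auto)
  then have "((\<lambda>b. LINT x:{0..b}|lebesgue. f x) \<longlongrightarrow> integral {0..} f) at_top"
    using set_lebesgue_integral_eq_integral(2)[OF assms] by simp
  then show ?thesis
    by (rule Lim_transform_eventually)
      (auto intro!: always_eventually set_lebesgue_integral_eq_integral(2) set_integrable_subset[OF assms])
qed

text \<open>For an integrable potential, square integrable solutions decay together with their
  derivatives, so only the boundary term at 0 survives.\<close>

lemma green_infinity:
  assumes q: "integrable halfline q" and F: "isol q l F G" "sqint F" and H: "isol q m H K" "sqint H"
  shows "(cnj m - l) * integral {0..} (\<lambda>x. ip (F x) (H x)) = - W (F 0) (G 0) (H 0) (K 0)"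
proof -
  have lF: "(F \<longlongrightarrow> 0) at_top" "(G \<longlongrightarrow> 0) at_top" and lH: "(H \<longlongrightarrow> 0) at_top" "(K \<longlongrightarrow> 0) at_top"
    using isol_L2_tendsto_0[OF q F(1)] isol_L2_tendsto_0[OF q H(1)] F(2) H(2) by (auto simp: sqint_def)
  have ab: "(\<lambda>x. ip (F x) (H x)) absolutely_integrable_on {0..}"
    by (rule ip_integrable[OF isol_continuous(1)[OF F(1)] isol_continuous(1)[OF H(1)] F(2) H(2)])
  have i: "(cnj m - l) * integral {0..X} (\<lambda>x. ip (F x) (H x)) = W (F X) (G X) (H X) (K X) - W (F 0) (G 0) (H 0) (K 0)" if "X \<ge> 0" for X
    using ipair_integral[OF ipair_W[OF F(1) H(1)] order_refl that] by simp
  have "((\<lambda>X. W (F X) (G X) (H X) (K X) - W (F 0) (G 0) (H 0) (K 0)) \<longlongrightarrow> W 0 0 0 0 - W (F 0) (G 0) (H 0) (K 0)) at_top"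
    by (intro tendsto_diff tendsto_W tendsto_const lF lH)
  then have "((\<lambda>X. (cnj m - l) * integral {0..X} (\<lambda>x. ip (F x) (H x))) \<longlongrightarrow> W 0 0 0 0 - W (F 0) (G 0) (H 0) (K 0)) at_top"
    by (rule Lim_transform_eventually) (rule eventually_at_top_linorderI[of 0], rule i[symmetric])
  moreover have "((\<lambda>X. (cnj m - l) * integral {0..X} (\<lambda>x. ip (F x) (H x))) \<longlongrightarrow> (cnj m - l) * integral {0..} (\<lambda>x. ip (F x) (H x))) at_top"
    by (intro tendsto_mult_left tendsto_integral_halfline ab)
  ultimately have "(cnj m - l) * integral {0..} (\<lambda>x. ip (F x) (H x)) = W 0 0 0 0 - W (F 0) (G 0) (H 0) (K 0)"
    using tendsto_unique[OF trivial_limit_at_top_linorder] by blast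
  then show ?thesis by (simp add: W_def)
qed

lemma sqint_integral_zero:
  assumes c: "continuous_on {0..} F" and s: "sqint F" and z: "integral {0..} (\<lambda>x. (norm (F x))\<^sup>2) \<le> 0" and x: "x \<ge> 0"
  shows "F x = 0"
proof -
  have int: "(\<lambda>x. (norm (F x))\<^sup>2) integrable_on {0..}"
    using s unfolding sqint_def by (rule set_lebesgue_integral_eq_integral(1))
  have cx: "continuous_on {0..x+1} (\<lambda>x. (norm (F x))\<^sup>2)" by (intro continuous_intros continuous_on_subset[OF c]) auto
  have i1: "(\<lambda>x. (norm (F x))\<^sup>2) integrable_on {0..x+1}" by (rule integrable_continuous_real[OF cx])
  have "integral {0..x+1} (\<lambda>x. (norm (F x))\<^sup>2) \<le> integral {0..} (\<lambda>x. (norm (F x))\<^sup>2)"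
    by (rule integral_subset_le[OF _ i1 int]) auto
  moreover have "0 \<le> integral {0..x+1} (\<lambda>x. (norm (F x))\<^sup>2)" by (rule integral_nonneg[OF i1]) auto
  ultimately have "integral {0..x+1} (\<lambda>x. (norm (F x))\<^sup>2) = 0" using z by simp
  then have "((\<lambda>x. (norm (F x))\<^sup>2) has_integral 0) (cbox 0 (x+1))" using integrable_integral[OF i1] by (simp add: box_real)
  then have "(norm (F x))\<^sup>2 = 0"
    by (rule has_integral_0_cbox_imp_0[rotated 2]) (use cx x in \<open>auto simp: box_real\<close>)
  then show ?thesis by simp
qed

lemma sqint_lincomb:
  assumes c: "continuous_on {0..} F" "continuous_on {0..} H" and s: "sqint F" "sqint H"
  shows "sqint (\<lambda>x. a *s F x + b *s H x)"
  unfolding sqint_def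
proof (rule measurable_bounded_by_integrable_imp_absolutely_integrable)
  show "(\<lambda>x. (norm (a *s F x + b *s H x))\<^sup>2) \<in> borel_measurable (lebesgue_on {0..})"
    unfolding vector_scalar_mult_def by (intro continuous_imp_measurable_on_sets_lebesgue continuous_intros c) auto
  have "(\<lambda>x. 2 * (cmod a)\<^sup>2 * (norm (F x))\<^sup>2 + 2 * (cmod b)\<^sup>2 * (norm (H x))\<^sup>2) absolutely_integrable_on {0..}"
    using s unfolding sqint_def by (intro set_integral_add(1) set_integrable_mult_right)
  then show "(\<lambda>x. 2 * (cmod a)\<^sup>2 * (norm (F x))\<^sup>2 + 2 * (cmod b)\<^sup>2 * (norm (H x))\<^sup>2) integrable_on {0..}"
    by (rule set_lebesgue_integral_eq_integral(1))
  show "norm ((norm (a *s F x + b *s H x))\<^sup>2) \<le> 2 * (cmod a)\<^sup>2 * (norm (F x))\<^sup>2 + 2 * (cmod b)\<^sup>2 * (norm (H x))\<^sup>2" for x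
  proof -
    have "(norm (a *s F x + b *s H x))\<^sup>2 \<le> (norm (a *s F x) + norm (b *s H x))\<^sup>2"
      by (intro power_mono norm_triangle_ineq) auto
    also have "\<dots> \<le> 2 * (norm (a *s F x))\<^sup>2 + 2 * (norm (b *s H x))\<^sup>2"
      using zero_le_power2[of "norm (a *s F x) - norm (b *s H x)"] by (simp add: power2_eq_square algebra_simps)
    also have "\<dots> = 2 * (cmod a)\<^sup>2 * (norm (F x))\<^sup>2 + 2 * (cmod b)\<^sup>2 * (norm (H x))\<^sup>2"
      by (simp add: norm_scale2 power_mult_distrib)
    finally show ?thesis by simp
  qed
qed auto

text \<open>Green's formula of the solution with itself: the boundary condition kills the Wronskian
  at 0, and \<open>cnj l - l\<close> is nonzero, so the norm is 0.\<close>

lemma weyl_unique: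
  assumes q: "integrable halfline q" and F: "isol q l F G" "sqint F" and l: "Im l \<noteq> 0"
    and bc: "bLp \<alpha> (F 0) (G 0) = 0" and x: "x \<ge> 0"
  shows "F x = 0"
proof (rule sqint_integral_zero[OF isol_continuous(1)[OF F(1)] F(2) _ x])
  have "(cnj l - l) * integral {0..} (\<lambda>x. ip (F x) (F x)) = 0"
    using green_infinity[OF q F F] W_boundary[of "F 0" "G 0" "F 0" "G 0" \<alpha>] bc by simp
  moreover have "cnj l - l \<noteq> 0" using l by (simp add: complex_eq_iff)
  ultimately have "integral {0..} (\<lambda>x. ip (F x) (F x)) = 0" by simp
  moreover have "integral {0..} (\<lambda>x. ip (F x) (F x)) = complex_of_real (integral {0..} (\<lambda>x. (norm (F x))\<^sup>2))"
    unfolding ip_self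
    using integral_linear[OF set_lebesgue_integral_eq_integral(1)[OF F(2)[unfolded sqint_def]] bounded_linear_of_real]
    by (simp add: o_def)
  ultimately show "integral {0..} (\<lambda>x. (norm (F x))\<^sup>2) \<le> 0" by simp
qed

lemma integral_ip_self:
  assumes "sqint F"
  shows "integral {0..} (\<lambda>x. ip (F x) (F x)) = complex_of_real (integral {0..} (\<lambda>x. (norm (F x))\<^sup>2))"
  unfolding ip_self
  using integral_linear[OF set_lebesgue_integral_eq_integral(1)[OF assms[unfolded sqint_def]] bounded_linear_of_real]
  by (simp add: o_def)

lemma L2_sqint: "F \<in> L2 ==> sqint F"
  unfolding L2_def sqint_def using integrable_halfline_iff[of "\<lambda>x. (norm (F x))\<^sup>2"] by auto

lemma eps_column: "column j eps_mat $ 1 = (if j = 2 then 1 else 0)" "column j eps_mat $ 2 = (if j = 1 then 1 else 0)"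
  using exhaust_2[of j] by (auto simp: eps_mat_def column_def)

text \<open>In this form the Weyl matrix is boundary data: the columns of \<Theta> have no
  \<open>bL\<close> part and those of \<Phi> have \<open>bL\<close> part \<open>- axis j 1\<close>,
  so subtracting \<Phi> times \<open>M\<close> leaves exactly \<open>M\<close>.\<close>

lemma weyl_columns:
  assumes q: "integrable halfline q" and w: "weyl_matrix q \<alpha> l M"
  obtains \<Psi> \<Psi>' where "\<And>j::2. isol q l (\<Psi> j) (\<Psi>' j)" "\<And>j. sqint (\<Psi> j)"
    "\<And>j. bL \<alpha> (\<Psi> j 0) (\<Psi>' j 0) = column j M" "\<And>j. bLp \<alpha> (\<Psi> j 0) (\<Psi>' j 0) = column j eps_mat"
proof -
  obtain \<Phi> \<Theta> :: "real => complex^2^2" where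
    \<Phi>: "\<And>j. solution q l (\<lambda>x. column j (\<Phi> x))" "\<And>j. L_bd \<alpha> (\<lambda>x. column j (\<Phi> x)) = - axis j 1" "\<And>j. L_bd_perp \<alpha> (\<lambda>x. column j (\<Phi> x)) = 0"
    and \<Theta>: "\<And>j. solution q l (\<lambda>x. column j (\<Theta> x))" "\<And>j. L_bd \<alpha> (\<lambda>x. column j (\<Theta> x)) = 0" "\<And>j. L_bd_perp \<alpha> (\<lambda>x. column j (\<Theta> x)) = column j eps_mat"
    and L: "\<And>j. (\<lambda>x. column j (\<Theta> x - \<Phi> x ** M)) \<in> L2"
    using w unfolding weyl_matrix_def by blast
  define P where "P j x = column j (\<Phi> x)" for j x
  define T where "T j x = column j (\<Theta> x)" for j x
  have P: "isol q l (P j) (hderiv (P j))" and T: "isol q l (T j) (hderiv (T j))" for j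
    using solution_isol[OF q \<Phi>(1)] solution_isol[OF q \<Theta>(1)] by (simp_all add: P_def[abs_def] T_def[abs_def])
  have Pb: "bL \<alpha> (P j 0) (hderiv (P j) 0) = - axis j 1" "bLp \<alpha> (P j 0) (hderiv (P j) 0) = 0" for j
    using isol_L_bd[OF P, of \<alpha> j] \<Phi>(2,3)[of j] by (simp_all add: P_def[abs_def])
  have Tb: "bL \<alpha> (T j 0) (hderiv (T j) 0) = 0" "bLp \<alpha> (T j 0) (hderiv (T j) 0) = column j eps_mat" for j
    using isol_L_bd[OF T, of \<alpha> j] \<Theta>(2,3)[of j] by (simp_all add: T_def[abs_def])
  define \<Psi> where "\<Psi> j x = T j x - (M $ 1 $ j *s P 1 x + M $ 2 $ j *s P 2 x)" for j x
  define \<Psi>' where "\<Psi>' j x = hderiv (T j) x - (M $ 1 $ j *s hderiv (P 1) x + M $ 2 $ j *s hderiv (P 2) x)" for j x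
  have eq: "\<Psi> j x = column j (\<Theta> x - \<Phi> x ** M)" for j x
    by (simp add: \<Psi>_def T_def P_def vec2_eq_iff column_def matrix_matrix_mult_def UNIV_2 algebra_simps)
  show ?thesis
  proof (rule that)
    show "isol q l (\<Psi> j) (\<Psi>' j)" for j
      unfolding \<Psi>_def[abs_def] \<Psi>'_def[abs_def] by (intro isol_sub isol_lincomb P T)
    show "sqint (\<Psi> j)" for j using L2_sqint[OF L[of j]] unfolding eq[symmetric, of j] .
    show "bL \<alpha> (\<Psi> j 0) (\<Psi>' j 0) = column j M" for j
      unfolding \<Psi>_def \<Psi>'_def bL_lin Pb Tb by (simp add: vec2_eq_iff axis_def column_def)
    show "bLp \<alpha> (\<Psi> j 0) (\<Psi>' j 0) = column j eps_mat" for j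
      unfolding \<Psi>_def \<Psi>'_def bL_lin Pb Tb by (simp add: vec2_eq_iff)
  qed
qed

text \<open>Inverting the two functionals gives \<open>s * f = cnj a * v - u\<close> and
  \<open>s * f' = v + a * u\<close>; both 1 and the modulus of \<open>a\<close> are at most that of
  \<open>s\<close>.\<close>

lemma ell_inverse:
  "cmod f \<le> cmod (ell0 \<alpha> f f') + cmod (ell1 \<alpha> f f')"
  "cmod f' \<le> cmod (ell0 \<alpha> f f') + cmod (ell1 \<alpha> f f')"
proof -
  have "cmod f \<le> cmod (ell0 \<alpha> f f') + cmod (ell1 \<alpha> f f') \<and> cmod f' \<le> cmod (ell0 \<alpha> f f') + cmod (ell1 \<alpha> f f')"
  proof (cases \<alpha>)
    case (Fin a)
    define r where "r = sqrt (1 + (cmod a)\<^sup>2)"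
    define s where "s = complex_of_real r"
    have r1: "r \<ge> 1" by (simp add: r_def)
    have ra: "cmod a \<le> r" unfolding r_def by (rule real_le_rsqrt) simp
    have ss: "s * s = 1 + a * cnj a"
      unfolding s_def r_def by (simp flip: of_real_mult add: complex_norm_square[symmetric])
    have s0: "s \<noteq> 0" using r1 by (simp add: s_def)
    have cs: "cmod s = r" using r1 by (simp add: s_def)
    define u where "u = ell0 \<alpha> f f'"
    define v where "v = ell1 \<alpha> f f'"
    have uv: "u * s = cnj a * f' - f" "v * s = f' + a * f" using s0 by (simp_all add: u_def v_def Fin s_def r_def)
    have "s * (s * f) = s * (cnj a * v - u)"
    proof -
      have "s * (cnj a * v - u) = cnj a * (v * s) - u * s" by (simp add: algebra_simps)
      also have "\<dots> = (1 + a * cnj a) * f" unfolding uv by (simp add: algebra_simps)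
      finally show ?thesis unfolding ss[symmetric] mult.assoc by (rule sym)
    qed
    then have f: "s * f = cnj a * v - u" using s0 mult_left_cancel by blast
    have "s * (s * f') = s * (v + a * u)"
    proof -
      have "s * (v + a * u) = v * s + a * (u * s)" by (simp add: algebra_simps)
      also have "\<dots> = (1 + a * cnj a) * f'" unfolding uv by (simp add: algebra_simps)
      finally show ?thesis unfolding ss[symmetric] mult.assoc by (rule sym)
    qed
    then have f': "s * f' = v + a * u" using s0 mult_left_cancel by blast
    have b: "cmod a * cmod z \<le> r * cmod z" "cmod z \<le> r * cmod z" for z
      using ra r1 mult_right_mono[of 1 r "cmod z"] by (auto intro: mult_right_mono)
    have "r * cmod f \<le> cmod a * cmod v + cmod u"
      using norm_triangle_ineq4[of "cnj a * v" u] f cs by (metis complex_mod_cnj norm_mult)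
    then have 1: "r * cmod f \<le> r * (cmod u + cmod v)" using b[of v] b[of u] by (simp add: algebra_simps)
    have "r * cmod f' \<le> cmod v + cmod a * cmod u"
      using norm_triangle_ineq[of v "a * u"] f' cs by (metis norm_mult)
    then have 2: "r * cmod f' \<le> r * (cmod u + cmod v)" using b[of v] b[of u] by (simp add: algebra_simps)
    show ?thesis using 1 2 r1 by (simp add: u_def v_def mult_le_cancel_left)
  qed simp
  then show "cmod f \<le> cmod (ell0 \<alpha> f f') + cmod (ell1 \<alpha> f f')"
    "cmod f' \<le> cmod (ell0 \<alpha> f f') + cmod (ell1 \<alpha> f f')" by auto
qed

lemma boundary_bound: "norm u + norm v \<le> 4 * (norm (bL \<alpha> u v) + norm (bLp \<alpha> u v))"
proof -
  have n: "cmod (z $ i) \<le> norm z" for z :: "complex^2" and i by (rule Finite_Cartesian_Product.norm_nth_le)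
  have 1: "cmod (u $ 1) \<le> norm (bL \<alpha> u v) + norm (bLp \<alpha> u v)" "cmod (v $ 1) \<le> norm (bL \<alpha> u v) + norm (bLp \<alpha> u v)"
    using ell_inverse[of "u $ 1" "cnj_bparam \<alpha>" "v $ 1"] ell_inverse(2)[of "v $ 1" "cnj_bparam \<alpha>" "u $ 1"]
      n[of "bL \<alpha> u v" 1] n[of "bLp \<alpha> u v" 1] by (simp_all add: bL_def bLp_def)
  have 2: "cmod (u $ 2) \<le> norm (bL \<alpha> u v) + norm (bLp \<alpha> u v)" "cmod (v $ 2) \<le> norm (bL \<alpha> u v) + norm (bLp \<alpha> u v)"
    using ell_inverse[of "u $ 2" \<alpha> "v $ 2"] ell_inverse(2)[of "v $ 2" \<alpha> "u $ 2"]
      n[of "bL \<alpha> u v" 2] n[of "bLp \<alpha> u v" 2] by (simp_all add: bL_def bLp_def)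
  define A where "A = norm (bL \<alpha> u v) + norm (bLp \<alpha> u v)"
  have "norm u \<le> A + A" "norm v \<le> A + A"
    using 1 2 norm_le_sum2[of u] norm_le_sum2[of v] unfolding A_def[symmetric] by (meson add_mono order_trans)+
  then show ?thesis unfolding A_def[symmetric] by simp
qed

text \<open>Continuous dependence on the parameter and on boundary data, through
  \<open>isol_close\<close> with the limit as reference solution. Pointwise convergence is what
  Fatou's lemma asks for.\<close>

lemma isol_tendsto:
  assumes q: "integrable halfline q" and X: "\<And>n. isol q (l n) (X n) (X' n)" and H: "isol q m H K"
    and l: "l \<longlonglongrightarrow> m" and d: "(\<lambda>n. bL \<alpha> (X n 0) (X' n 0)) \<longlonglongrightarrow> bL \<alpha> (H 0) (K 0)"
    "(\<lambda>n. bLp \<alpha> (X n 0) (X' n 0)) \<longlonglongrightarrow> bLp \<alpha> (H 0) (K 0)" and x: "x \<ge> 0"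
  shows "(\<lambda>n. X n x) \<longlonglongrightarrow> H x"
proof -
  have "continuous_on {0..x} H" using isol_continuous(1)[OF H] by (rule continuous_on_subset) auto
  then have "bounded (H ` {0..x})" by (intro compact_imp_bounded compact_continuous_image) auto
  then obtain B where B: "\<And>t. t \<in> {0..x} ==> norm (H t) \<le> B" unfolding bounded_iff by blast
  define E where "E n = norm (X n 0 - H 0) + norm (X' n 0 - K 0) + 2 * cmod (l n - m) * B * x" for n
  define a where "a n = 4 * (norm (bL \<alpha> (X n 0) (X' n 0) - bL \<alpha> (H 0) (K 0)) + norm (bLp \<alpha> (X n 0) (X' n 0) - bLp \<alpha> (H 0) (K 0))) + 2 * cmod (l n - m) * B * x" for n
  have "(\<lambda>n. a n) \<longlonglongrightarrow> 4 * (norm (bL \<alpha> (H 0) (K 0) - bL \<alpha> (H 0) (K 0)) + norm (bLp \<alpha> (H 0) (K 0) - bLp \<alpha> (H 0) (K 0))) + 2 * cmod (m - m) * B * x"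
    unfolding a_def by (intro tendsto_intros d l)
  then have a0: "a \<longlonglongrightarrow> 0" by simp
  have Ea: "E n \<le> a n" for n
    using boundary_bound[of "X n 0 - H 0" "X' n 0 - K 0" \<alpha>] by (simp add: E_def a_def bL_lin)
  \<comment> \<open>A common bound for the parameters makes the Gronwall factor independent of
    \<open>n\<close>.\<close>
  obtain L where L: "\<And>n. cmod (l n) \<le> L"
    using convergent_imp_Bseq[OF convergentI[OF l]] unfolding Bseq_def by blast
  define C where "C = exp (2 * integral {0..x} (\<lambda>t. 1 + 2 * (cmod (q t) + L)))"
  have qi: "(\<lambda>t. cmod (q t)) integrable_on {0..x}"
    using absolutely_integrable_norm[OF integrable_q[OF q order_refl, of x]] by (simp add: o_def set_lebesgue_integral_eq_integral(1))
  have ii: "(\<lambda>t. 1 + 2 * (cmod (q t) + c)) integrable_on {0..x}" for c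
  proof -
    have "(\<lambda>t. 1 + (2 * cmod (q t) + 2 * c)) integrable_on {0..x}"
      by (intro integrable_add integrable_const_ivl integrable_on_mult_right qi)
    then show ?thesis by (simp add: distrib_left)
  qed
  have "norm (X n x - H x) \<le> 2 * a n * C" for n
  proof -
    have "norm (X n x - H x) \<le> 2 * E n * exp (2 * integral {0..x} (\<lambda>t. 1 + 2 * (cmod (q t) + cmod (l n))))"
      using isol_close[OF q X[of n] H x B, of x] x norm_ge_zero[of "X' n x - K x"] unfolding E_def by (smt (verit) atLeastAtMost_iff)
    also have "\<dots> \<le> 2 * a n * C"
    proof (rule mult_mono)
      have "integral {0..x} (\<lambda>t. 1 + 2 * (cmod (q t) + cmod (l n))) \<le> integral {0..x} (\<lambda>t. 1 + 2 * (cmod (q t) + L))"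
        by (rule integral_le[OF ii ii]) (use L in auto)
      then show "exp (2 * integral {0..x} (\<lambda>t. 1 + 2 * (cmod (q t) + cmod (l n)))) \<le> C" by (simp add: C_def)
      have "0 \<le> B" using order_trans[OF norm_ge_zero B[of 0]] x by simp
      then have "0 \<le> E n" using x by (simp add: E_def)
      then show "0 \<le> 2 * a n" using Ea[of n] by linarith
    qed (use Ea in auto)
    finally show ?thesis .
  qed
  then have "\<forall>\<^sub>F n in sequentially. norm (X n x - H x) \<le> 2 * a n * C" by (rule always_eventually[OF allI])
  moreover have "(\<lambda>n. 2 * a n * C) \<longlonglongrightarrow> 0" using tendsto_mult[OF tendsto_mult[OF tendsto_const a0] tendsto_const, of 2 C] by simp
  ultimately have "(\<lambda>n. X n x - H x) \<longlonglongrightarrow> 0" by (rule Lim_null_comparison)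
  then show ?thesis by (simp add: LIM_zero_iff)
qed

text \<open>Pointwise limits may lose mass at infinity, hence the inequality;
  \<open>atom_lower\<close> provides the missing direction.\<close>

lemma fatou_sqint:
  assumes X: "\<And>n. continuous_on {0..} (X n)" "\<And>n. sqint (X n)" and H: "continuous_on {0..} H"
    and lim: "\<And>x. x \<ge> 0 ==> (\<lambda>n. X n x) \<longlonglongrightarrow> H x"
    and s: "(\<lambda>n. integral {0..} (\<lambda>x. (norm (X n x))\<^sup>2)) \<longlonglongrightarrow> S"
  shows "sqint H" "integral {0..} (\<lambda>x. (norm (H x))\<^sup>2) \<le> S"
proof -
  define f where "f F x = indicator {0..} x *\<^sub>R (norm (F x))\<^sup>2" for F :: "real => complex^2" and x :: real
  have f0: "f F x \<ge> 0" for F x by (simp add: f_def)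
  have Xi: "integrable lebesgue (f (X n))" for n
    using X(2)[of n] unfolding sqint_def set_integrable_def f_def[abs_def] .
  have XI: "(LINT x|lebesgue. f (X n) x) = integral {0..} (\<lambda>x. (norm (X n x))\<^sup>2)" for n
    using set_lebesgue_integral_eq_integral(2)[OF X(2)[of n, unfolded sqint_def]]
    unfolding set_lebesgue_integral_def f_def .
  have nn: "(\<integral>\<^sup>+ x. ennreal (f (X n) x) \<partial>lebesgue) = ennreal (integral {0..} (\<lambda>x. (norm (X n x))\<^sup>2))" for n
    using nn_integral_eq_integral[OF Xi] f0 by (simp add: XI)
  have fl: "(\<lambda>n. ennreal (f (X n) x)) \<longlonglongrightarrow> ennreal (f H x)" for x
  proof (cases "x \<ge> 0")
    case True
    have "(\<lambda>n. (norm (X n x))\<^sup>2) \<longlonglongrightarrow> (norm (H x))\<^sup>2" by (intro tendsto_intros lim[OF True])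
    then show ?thesis using True by (intro tendsto_ennrealI) (simp add: f_def)
  qed (simp add: f_def)
  have "(\<integral>\<^sup>+ x. ennreal (f H x) \<partial>lebesgue) = (\<integral>\<^sup>+ x. liminf (\<lambda>n. ennreal (f (X n) x)) \<partial>lebesgue)"
    by (intro nn_integral_cong lim_imp_Liminf[symmetric] fl) simp
  also have "\<dots> \<le> liminf (\<lambda>n. \<integral>\<^sup>+ x. ennreal (f (X n) x) \<partial>lebesgue)"
    using borel_measurable_integrable[OF Xi] by (intro nn_integral_liminf) measurable
  also have "\<dots> = ennreal S"
    unfolding nn by (intro lim_imp_Liminf tendsto_ennrealI s) simp
  finally have le: "(\<integral>\<^sup>+ x. ennreal (f H x) \<partial>lebesgue) \<le> ennreal S" .
  have Hm: "f H \<in> borel_measurable lebesgue"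
  proof -
    have "(\<lambda>x. (norm (H x))\<^sup>2) \<in> borel_measurable (lebesgue_on {0..})"
      by (intro continuous_imp_measurable_on_sets_lebesgue continuous_intros H) auto
    then show ?thesis unfolding f_def[abs_def] by (subst (asm) borel_measurable_restrict_space_iff) auto
  qed
  have Hi: "integrable lebesgue (f H)"
    by (rule integrableI_nonneg[OF Hm]) (use f0 le in \<open>auto intro: le_less_trans\<close>)
  then show sq: "sqint H" unfolding sqint_def set_integrable_def f_def[abs_def] .
  have "ennreal (LINT x|lebesgue. f H x) \<le> ennreal S"
    using le nn_integral_eq_integral[OF Hi] f0 by simp
  moreover have "S \<ge> 0"
    by (rule LIMSEQ_le_const[OF s]) (auto intro!: integral_nonneg set_lebesgue_integral_eq_integral(1) X(2)[unfolded sqint_def])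
  ultimately have "(LINT x|lebesgue. f H x) \<le> S" by (simp add: ennreal_le_iff)
  then show "integral {0..} (\<lambda>x. (norm (H x))\<^sup>2) \<le> S"
    using set_lebesgue_integral_eq_integral(2)[OF sq[unfolded sqint_def]] unfolding set_lebesgue_integral_def f_def by simp
qed

section \<open>The atom at an eigenvalue\<close>

lemma psi_mat_nth [simp]: "psi_mat p $ 1 $ 1 = 1" "psi_mat p $ 1 $ 2 = p" "psi_mat p $ 2 $ 1 = cnj p" "psi_mat p $ 2 $ 2 = 1"
  by (simp_all add: psi_mat_def)

lemma forall_2x2: "(\<forall>(i::2) (j::2). P i j) \<longleftrightarrow> P 1 1 \<and> P 1 2 \<and> P 2 1 \<and> P 2 2"
  by (simp add: forall_2)

lemma psi_mat_cnj: "cnj (psi_mat p $ i $ j) = psi_mat p $ j $ i"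
  using exhaust_2[of i] exhaust_2[of j] by auto

lemma cnj_measurable: "cnj \<in> borel_measurable borel"
  by (intro borel_measurable_continuous_onI continuous_intros)

locale spectral_data =
  fixes q :: "real => complex" and \<alpha> :: bparam and \<nu> :: "real measure" and \<psi> :: "real => complex" and M :: "complex => complex^2^2"
  assumes q: "integrable halfline q"
    and sets_\<nu> [measurable_cong, simp]: "sets \<nu> = sets borel" and \<psi> [measurable]: "\<psi> \<in> borel_measurable borel"
    and \<psi>1: "AE t in \<nu>. cmod (\<psi> t) \<le> 1" and fin: "integrable \<nu> (\<lambda>t. 1 / (1 + t\<^sup>2))"
    and weyl: "weyl_function q \<alpha> M"
    and rep: "\<And>l i j. Im l > 0 ==> M l $ i $ j = mat_Re (M \<i>) $ i $ j +
           (LINT t|\<nu>. (1 / (complex_of_real t - l) - complex_of_real (t / (1 + t\<^sup>2))) * psi_mat (\<psi> t) $ i $ j)"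
begin

text \<open>The bound on \<psi> holds only almost everywhere; this representative satisfies it at
  every point, which makes all entries of the density bounded functions.\<close>

definition \<psi>' where "\<psi>' t = (if cmod (\<psi> t) \<le> 1 then \<psi> t else 0)"

lemma \<psi>'_le: "cmod (\<psi>' t) \<le> 1" by (simp add: \<psi>'_def)

lemma \<psi>'_measurable [measurable]: "\<psi>' \<in> borel_measurable borel" unfolding \<psi>'_def[abs_def] by measurable

definition g where "g i j t = psi_mat (\<psi>' t) $ i $ j"

lemma g_measurable [measurable]: "g i j \<in> borel_measurable borel"
  using exhaust_2[of i] exhaust_2[of j] measurable_compose[OF \<psi>'_measurable cnj_measurable] by (auto simp: g_def[abs_def])

lemma psi_measurable [measurable]: "(\<lambda>t. psi_mat (\<psi> t) $ i $ j) \<in> borel_measurable borel"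
  using exhaust_2[of i] exhaust_2[of j] measurable_compose[OF \<psi> cnj_measurable] by auto

lemma g_le: "cmod (g i j t) \<le> 1"
  using exhaust_2[of i] exhaust_2[of j] \<psi>'_le by (auto simp: g_def)

lemma g_AE: "AE t in \<nu>. psi_mat (\<psi> t) $ i $ j = g i j t"
  using \<psi>1 by eventually_elim (simp add: g_def \<psi>'_def)

lemma hm: "herglotz_measure \<nu> (g i j)"
  by unfold_locales (auto simp: fin g_le)

lemma rep': "Im l > 0 ==> M l $ i $ j = mat_Re (M \<i>) $ i $ j + (LINT t|\<nu>. nker l t * g i j t)"
proof -
  assume l: "Im l > 0"
  have "(LINT t|\<nu>. (1 / (complex_of_real t - l) - complex_of_real (t / (1 + t\<^sup>2))) * psi_mat (\<psi> t) $ i $ j) = (LINT t|\<nu>. nker l t * g i j t)"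
  proof (rule integral_cong_AE)
    show "AE t in \<nu>. (1 / (complex_of_real t - l) - complex_of_real (t / (1 + t\<^sup>2))) * psi_mat (\<psi> t) $ i $ j = nker l t * g i j t"
      using g_AE[of i j] by eventually_elim (simp add: nker_def)
    show "(\<lambda>t. (1 / (complex_of_real t - l) - complex_of_real (t / (1 + t\<^sup>2))) * psi_mat (\<psi> t) $ i $ j) \<in> borel_measurable \<nu>"
      by measurable
    show "(\<lambda>t. nker l t * g i j t) \<in> borel_measurable \<nu>" by measurable
  qed
  then show ?thesis using rep[OF l] by simp
qed

lemma mat_Re_cnj: "cnj (mat_Re A $ j $ i) = mat_Re A $ i $ j"
  by (simp add: mat_Re_def add.commute)

text \<open>The off-diagonal entries are complex, so the imaginary part is replaced by the
  skew-hermitian one. The constant term \<open>mat_Re (M \<i>)\<close> is hermitian and drops out,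
  and so does the real part of the kernel.\<close>

lemma poisson_rep:
  assumes y: "y > 0"
  shows "(M (Complex x y) $ i $ j - cnj (M (Complex x y) $ j $ i)) / (2 * \<i>) = herglotz_measure.poisson \<nu> (g i j) x y"
proof -
  interpret H: herglotz_measure \<nu> "g i j" by (rule hm)
  interpret H': herglotz_measure \<nu> "g j i" by (rule hm)
  let ?l = "Complex x y"
  have "cnj (LINT t|\<nu>. nker ?l t * g j i t) = (LINT t|\<nu>. cnj (nker ?l t) * g i j t)"
    unfolding Bochner_Integration.integral_cnj[symmetric] by (simp add: g_def psi_mat_cnj del: Bochner_Integration.integral_cnj)
  then have "(M ?l $ i $ j - cnj (M ?l $ j $ i)) / (2 * \<i>)
      = ((LINT t|\<nu>. nker ?l t * g i j t) - (LINT t|\<nu>. cnj (nker ?l t) * g i j t)) / (2 * \<i>)"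
    using y by (simp add: rep' mat_Re_cnj)
  also have "\<dots> = (LINT t|\<nu>. (nker ?l t * g i j t - cnj (nker ?l t) * g i j t) / (2 * \<i>))"
  proof -
    have i1: "integrable \<nu> (\<lambda>t. nker ?l t * g i j t)" using H.integrable_nker[of ?l] y by simp
    have "integrable \<nu> (\<lambda>t. cnj (nker ?l t * g j i t))" using H'.integrable_nker[of ?l] y by (intro integrable_cnj) simp
    then have i2: "integrable \<nu> (\<lambda>t. cnj (nker ?l t) * g i j t)" by (simp add: g_def psi_mat_cnj)
    show ?thesis using Bochner_Integration.integral_diff[OF i1 i2] by simp
  qed
  also have "\<dots> = H.poisson x y"
    unfolding H.poisson_def
  proof (rule Bochner_Integration.integral_cong[OF refl])
    fix t
    have "(nker ?l t * g i j t - cnj (nker ?l t) * g i j t) / (2 * \<i>) = ((nker ?l t - cnj (nker ?l t)) / (2 * \<i>)) * g i j t"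
      by (simp add: left_diff_distrib)
    also have "\<dots> = complex_of_real (y / ((t - x)\<^sup>2 + y\<^sup>2)) * g i j t"
      using H.nker_diff_cnj[of y x t] y by (simp only:)
    finally show "(nker ?l t * g i j t - cnj (nker ?l t) * g i j t) / (2 * \<i>) = complex_of_real (y / ((t - x)\<^sup>2 + y\<^sup>2)) * g i j t" .
  qed
  finally show ?thesis .
qed

definition yseq :: "nat => real" where "yseq n = 1 / real (Suc n)"

lemma yseq: "yseq n > 0" "yseq n \<le> 1" "yseq \<longlonglongrightarrow> 0"
  using LIMSEQ_inverse_real_of_nat by (auto simp: yseq_def[abs_def] inverse_eq_divide)

lemma yseq_c: "(\<lambda>n. complex_of_real (yseq n)) \<longlonglongrightarrow> 0"
  using tendsto_of_real[OF yseq(3)] by simp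

lemma Complex_yseq: "(\<lambda>n. Complex x (yseq n)) \<longlonglongrightarrow> complex_of_real x"
proof -
  have e: "Complex x (yseq n) = x + \<i> * yseq n" for n by (simp add: complex_eq_iff)
  have "(\<lambda>n. x + \<i> * complex_of_real (yseq n)) \<longlonglongrightarrow> x + \<i> * 0" by (intro tendsto_intros yseq_c)
  then show ?thesis unfolding e by simp
qed

lemma M_atom: "(\<lambda>n. - \<i> * yseq n * M (Complex x (yseq n)) $ i $ j) \<longlonglongrightarrow> g i j x * measure \<nu> {x}"
proof -
  interpret H: herglotz_measure \<nu> "g i j" by (rule hm)
  have "(\<lambda>n. - \<i> * yseq n * mat_Re (M \<i>) $ i $ j + (- \<i> * yseq n * (LINT t|\<nu>. nker (Complex x (yseq n)) t * g i j t)))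
     \<longlonglongrightarrow> - \<i> * 0 * mat_Re (M \<i>) $ i $ j + g i j x * measure \<nu> {x}"
    by (intro tendsto_add tendsto_mult tendsto_const yseq_c H.atom_limit yseq)
  moreover have "- \<i> * yseq n * mat_Re (M \<i>) $ i $ j + (- \<i> * yseq n * (LINT t|\<nu>. nker (Complex x (yseq n)) t * g i j t))
     = - \<i> * yseq n * M (Complex x (yseq n)) $ i $ j" for n
    using rep'[of "Complex x (yseq n)" i j] yseq(1)[of n] by (simp add: algebra_simps)
  ultimately show ?thesis by simp
qed

lemma emeasure_atom_finite: "emeasure \<nu> {x} < \<infinity>"
proof -
  interpret H: herglotz_measure \<nu> "g 1 1" by (rule hm)
  show ?thesis by (rule H.emeasure_bounded_finite[of _ "\<bar>x\<bar>"]) auto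
qed

text \<open>A point of positive mass lies in no null set, so there an almost everywhere statement
  holds.\<close>

lemma \<psi>'_atom: assumes "measure \<nu> {x} > 0" shows "\<psi>' x = \<psi> x"
proof (rule ccontr)
  assume "\<psi>' x \<noteq> \<psi> x"
  then have n: "\<not> cmod (\<psi> x) \<le> 1" by (auto simp: \<psi>'_def split: if_splits)
  obtain N where N: "N \<in> null_sets \<nu>" "{t \<in> space \<nu>. \<not> cmod (\<psi> t) \<le> 1} \<subseteq> N"
    using \<psi>1 unfolding eventually_ae_filter by blast
  have "x \<in> N" using n N(2) sets_eq_imp_space_eq[OF sets_\<nu>] by auto
  then have "emeasure \<nu> {x} \<le> emeasure \<nu> N" using N(1) by (intro emeasure_mono) auto
  then have "emeasure \<nu> {x} = 0" using N(1) by auto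
  then show False using assms by (simp add: measure_def)
qed

text \<open>The atom at \<open>x\<close> of the matrix measure, applied to the vector
  \<open>d\<close>.\<close>

definition S\<^sub>0 :: "real => complex^2 => complex^2" where
  "S\<^sub>0 x d = vector [g 1 1 x * measure \<nu> {x} * d $ 1 + g 1 2 x * measure \<nu> {x} * d $ 2, g 2 1 x * measure \<nu> {x} * d $ 1 + g 2 2 x * measure \<nu> {x} * d $ 2]"

text \<open>The rescaled Weyl solutions \<open>\<i>y\<Psi>(\<cdot>,x + \<i>y)d\<close> on a sequence \<open>y \<rightarrow> 0\<close>.\<close>

lemma scaled_weyl_solutions:
  obtains X X' where "\<And>n. isol q (Complex x (yseq n)) (X n) (X' n)" "\<And>n. sqint (X n)"
    "\<And>n. bLp \<alpha> (X n 0) (X' n 0) = (\<i> * yseq n) *s vector [d $ 2, d $ 1]"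
    "(\<lambda>n. bL \<alpha> (X n 0) (X' n 0)) \<longlonglongrightarrow> - S\<^sub>0 x d"
    "(\<lambda>n. integral {0..} (\<lambda>t. (norm (X n t))\<^sup>2)) \<longlonglongrightarrow> Re (ip (S\<^sub>0 x d) d)"
proof -
  let ?l = "\<lambda>n. Complex x (yseq n)"
  have wm: "weyl_matrix q \<alpha> (?l n) (M (?l n))" for n
  proof -
    have "?l n \<notin> \<real>" using yseq(1)[of n] by (auto simp: complex_is_Real_iff)
    then show ?thesis using weyl by (simp add: weyl_function_def)
  qed
  have "\<exists>\<Psi> \<Psi>'. (\<forall>j::2. isol q (?l n) (\<Psi> j) (\<Psi>' j)) \<and> (\<forall>j. sqint (\<Psi> j)) \<and>
    (\<forall>j. bL \<alpha> (\<Psi> j 0) (\<Psi>' j 0) = column j (M (?l n))) \<and> (\<forall>j. bLp \<alpha> (\<Psi> j 0) (\<Psi>' j 0) = column j eps_mat)" for n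
    using weyl_columns[OF q wm[of n]] by metis
  then obtain \<Psi> \<Psi>' where \<Psi>: "\<And>n j. isol q (?l n) (\<Psi> n j) (\<Psi>' n j)" "\<And>n j. sqint (\<Psi> n j)"
    "\<And>n j. bL \<alpha> (\<Psi> n j 0) (\<Psi>' n j 0) = column j (M (?l n))" "\<And>n j. bLp \<alpha> (\<Psi> n j 0) (\<Psi>' n j 0) = column j eps_mat"
    by metis
  define X where "X n t = (\<i> * yseq n * d $ 1) *s \<Psi> n 1 t + (\<i> * yseq n * d $ 2) *s \<Psi> n 2 t" for n t
  define X' where "X' n t = (\<i> * yseq n * d $ 1) *s \<Psi>' n 1 t + (\<i> * yseq n * d $ 2) *s \<Psi>' n 2 t" for n t
  have iX: "isol q (?l n) (X n) (X' n)" for n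
    unfolding X_def[abs_def] X'_def[abs_def] by (intro isol_lincomb \<Psi>)
  have sX: "sqint (X n)" for n
    unfolding X_def[abs_def] by (intro sqint_lincomb \<Psi> isol_continuous(1)[OF \<Psi>(1)])
  have Xp: "bLp \<alpha> (X n 0) (X' n 0) = (\<i> * yseq n) *s vector [d $ 2, d $ 1]" for n
    unfolding X_def X'_def bL_lin \<Psi>(4) by (simp add: vec2_eq_iff eps_column)
  define B where "B n = bL \<alpha> (X n 0) (X' n 0)" for n
  have Bn: "B n $ i = (\<i> * yseq n * M (?l n) $ i $ 1) * d $ 1 + (\<i> * yseq n * M (?l n) $ i $ 2) * d $ 2" for n i
    unfolding B_def X_def X'_def bL_lin \<Psi>(3) by (simp add: column_def)
  have mB: "(\<lambda>n. \<i> * yseq n * M (?l n) $ i $ j) \<longlonglongrightarrow> - (g i j x * measure \<nu> {x})" for i j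
    using tendsto_minus[OF M_atom[of x i j]] by simp
  have Bc: "(\<lambda>n. B n $ i) \<longlonglongrightarrow> - (g i 1 x * measure \<nu> {x}) * d $ 1 + - (g i 2 x * measure \<nu> {x}) * d $ 2" for i
    unfolding Bn by (intro tendsto_intros mB)
  have Bl: "B \<longlonglongrightarrow> - S\<^sub>0 x d"
  proof (rule vec_tendstoI)
    fix i show "(\<lambda>n. B n $ i) \<longlonglongrightarrow> (- S\<^sub>0 x d) $ i"
      using Bc[of i] exhaust_2[of i] by (auto simp: S\<^sub>0_def)
  qed
  \<comment> \<open>The perpendicular data carry a factor \<open>y\<close> and so does
    \<open>cnj l - l\<close>; they cancel in Green's formula. Hence the norms of the rescaled
    solutions converge.\<close>
  have I: "integral {0..} (\<lambda>t. (norm (X n t))\<^sup>2) = - Re (ip (B n) d)" for n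
  proof -
    have y: "yseq n > 0" by (rule yseq)
    have "(cnj (?l n) - ?l n) * complex_of_real (integral {0..} (\<lambda>t. (norm (X n t))\<^sup>2)) = - W (X n 0) (X' n 0) (X n 0) (X' n 0)"
      using green_infinity[OF q iX[of n] sX[of n] iX[of n] sX[of n]] unfolding integral_ip_self[OF sX] .
    also have "\<dots> = \<i> * yseq n * (ip (B n) d + cnj (ip (B n) d))"
      unfolding W_boundary[of _ _ _ _ \<alpha>] Xp B_def[symmetric] by (simp add: algebra_simps)
    also have "\<dots> = \<i> * yseq n * (2 * complex_of_real (Re (ip (B n) d)))"
      by (simp only: complex_add_cnj) simp
    also have "cnj (?l n) - ?l n = - (2 * \<i> * yseq n)" by (simp add: complex_eq_iff)
    finally have "(2 * \<i> * yseq n) * complex_of_real (- integral {0..} (\<lambda>t. (norm (X n t))\<^sup>2)) = (2 * \<i> * yseq n) * complex_of_real (Re (ip (B n) d))"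
      by (simp only: of_real_minus mult_minus_left mult_minus_right mult.assoc mult.left_commute)
    moreover have "2 * \<i> * complex_of_real (yseq n) \<noteq> 0" using y by simp
    ultimately have "- integral {0..} (\<lambda>t. (norm (X n t))\<^sup>2) = Re (ip (B n) d)"
      using mult_left_cancel of_real_eq_iff by blast
    then show ?thesis by linarith
  qed
  have "(\<lambda>n. - Re (ip (B n) d)) \<longlonglongrightarrow> - Re (ip (- S\<^sub>0 x d) d)"
    by (intro tendsto_intros Bl)
  moreover have "- Re (ip (- S\<^sub>0 x d) d) = Re (ip (S\<^sub>0 x d) d)" by simp
  ultimately have "(\<lambda>n. integral {0..} (\<lambda>t. (norm (X n t))\<^sup>2)) \<longlonglongrightarrow> Re (ip (S\<^sub>0 x d) d)" unfolding I by (simp only:)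
  with iX sX Xp Bl that show ?thesis unfolding B_def by blast
qed

end

locale jost_spectral = jost_phi q k Fm1 Fpi Fmi Fp1 \<alpha> \<Phi> \<gamma>m1 \<gamma>pi \<gamma>mi \<gamma>p1 + spectral_data q \<alpha> \<nu> \<psi> M
  for q k Fm1 Fpi Fmi Fp1 \<alpha> \<Phi> \<gamma>m1 \<gamma>pi \<gamma>mi \<gamma>p1 \<nu> \<psi> M
begin

lemma \<Phi>c_isol: "isol q (complex_of_real (k\<^sup>2)) (\<Phi>c a b) (hderiv (\<Phi>c a b))"
  using sol_\<Phi>c by (simp add: sol_def)

text \<open>In the limit the perpendicular data vanish and the other data become
  \<open>- S\<^sub>0 (k\<^sup>2) d\<close>. The pointwise limit is therefore a combination of the
  columns with the entries of \<open>S\<^sub>0 (k\<^sup>2) d\<close> as coefficients, and Fatou's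
  lemma bounds its norm.\<close>

lemma atom_upper:
  shows "sqint (\<Phi>c (S\<^sub>0 (k\<^sup>2) d $ 1) (S\<^sub>0 (k\<^sup>2) d $ 2))"
    "integral {0..} (\<lambda>x. (norm (\<Phi>c (S\<^sub>0 (k\<^sup>2) d $ 1) (S\<^sub>0 (k\<^sup>2) d $ 2) x))\<^sup>2) \<le> Re (ip (S\<^sub>0 (k\<^sup>2) d) d)"
proof -
  let ?H = "\<Phi>c (S\<^sub>0 (k\<^sup>2) d $ 1) (S\<^sub>0 (k\<^sup>2) d $ 2)"
  obtain X X' where X: "\<And>n. isol q (Complex (k\<^sup>2) (yseq n)) (X n) (X' n)" "\<And>n. sqint (X n)"
    "\<And>n. bLp \<alpha> (X n 0) (X' n 0) = (\<i> * yseq n) *s vector [d $ 2, d $ 1]"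
    "(\<lambda>n. bL \<alpha> (X n 0) (X' n 0)) \<longlonglongrightarrow> - S\<^sub>0 (k\<^sup>2) d"
    "(\<lambda>n. integral {0..} (\<lambda>t. (norm (X n t))\<^sup>2)) \<longlonglongrightarrow> Re (ip (S\<^sub>0 (k\<^sup>2) d) d)"
    by (rule scaled_weyl_solutions[of "k\<^sup>2" d]) blast
  have l: "(\<lambda>n. X n x) \<longlonglongrightarrow> ?H x" if "x \<ge> 0" for x
  proof (rule isol_tendsto[OF q X(1) \<Phi>c_isol Complex_yseq _ _ that])
    show "(\<lambda>n. bL \<alpha> (X n 0) (X' n 0)) \<longlonglongrightarrow> bL \<alpha> (?H 0) (hderiv ?H 0)"
    proof -
      have "vector [- (S\<^sub>0 (k\<^sup>2) d $ 1), - (S\<^sub>0 (k\<^sup>2) d $ 2)] = - S\<^sub>0 (k\<^sup>2) d" by (simp add: vec2_eq_iff)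
      then show ?thesis using X(4) by (simp add: \<Phi>c_data)
    qed
    have "(\<lambda>n. (\<i> * yseq n) *s vector [d $ 2, d $ 1]) \<longlonglongrightarrow> (0 :: complex^2)"
      by (rule scale_mult_tendsto_0[OF _ tendsto_const]) (use tendsto_mult[OF tendsto_const[of \<i>] yseq_c] in simp)
    then show "(\<lambda>n. bLp \<alpha> (X n 0) (X' n 0)) \<longlonglongrightarrow> bLp \<alpha> (?H 0) (hderiv ?H 0)"
      unfolding X(3) by (simp add: \<Phi>c_data)
  qed
  show "sqint ?H" "integral {0..} (\<lambda>x. (norm (?H x))\<^sup>2) \<le> Re (ip (S\<^sub>0 (k\<^sup>2) d) d)"
    using fatou_sqint[OF isol_continuous(1)[OF X(1)] X(2) isol_continuous(1)[OF \<Phi>c_isol] l X(5)] by auto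
qed

text \<open>Green's formula between a rescaled Weyl solution at \<open>k^2 + \<i> * y\<close> and
  the given square integrable solution at \<open>k^2\<close>: the factor \<open>\<i> * y\<close>
  occurs on both sides, so their inner product is \<open>ip c c\<close> for every \<open>n\<close>.
  The weighted inequality \<open>norm_ip_le\<close> then survives the limit.\<close>

lemma atom_lower:
  assumes sq: "sqint (\<Phi>c a b)" and t: "t > 0" and c: "c = vector [a, b]"
  shows "2 * (norm c)\<^sup>2 \<le> t * Re (ip (S\<^sub>0 (k\<^sup>2) c) c) + integral {0..} (\<lambda>x. (norm (\<Phi>c a b x))\<^sup>2) / t"
proof -
  obtain X X' where X: "\<And>n. isol q (Complex (k\<^sup>2) (yseq n)) (X n) (X' n)" "\<And>n. sqint (X n)"
    "\<And>n. bLp \<alpha> (X n 0) (X' n 0) = (\<i> * yseq n) *s vector [c $ 2, c $ 1]"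
    "(\<lambda>n. integral {0..} (\<lambda>t. (norm (X n t))\<^sup>2)) \<longlonglongrightarrow> Re (ip (S\<^sub>0 (k\<^sup>2) c) c)"
    by (rule scaled_weyl_solutions[of "k\<^sup>2" c]) blast
  let ?P = "\<Phi>c a b"
  let ?N = "integral {0..} (\<lambda>x. (norm (?P x))\<^sup>2)"
  have "2 * (norm c)\<^sup>2 \<le> t * integral {0..} (\<lambda>t. (norm (X n t))\<^sup>2) + ?N / t" for n
  proof -
    let ?l = "Complex (k\<^sup>2) (yseq n)"
    have y: "yseq n > 0" by (rule yseq)
    have "(cnj (complex_of_real (k\<^sup>2)) - ?l) * integral {0..} (\<lambda>x. ip (X n x) (?P x)) = - W (X n 0) (X' n 0) (?P 0) (hderiv ?P 0)"
      by (rule green_infinity[OF q X(1,2) \<Phi>c_isol sq])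
    also have "W (X n 0) (X' n 0) (?P 0) (hderiv ?P 0) = \<i> * yseq n * ip c c"
      unfolding W_boundary[of _ _ _ _ \<alpha>] X(3) \<Phi>c_data by (simp add: c algebra_simps)
    also have "cnj (complex_of_real (k\<^sup>2)) - ?l = - (\<i> * yseq n)" by (simp add: complex_eq_iff)
    finally have "(\<i> * yseq n) * integral {0..} (\<lambda>x. ip (X n x) (?P x)) = (\<i> * yseq n) * ip c c" by (simp only: mult_minus_left neg_equal_iff_equal)
    then have I: "integral {0..} (\<lambda>x. ip (X n x) (?P x)) = ip c c" using y by simp
    have ab: "(\<lambda>x. ip (X n x) (?P x)) integrable_on {0..}"
      by (rule set_lebesgue_integral_eq_integral(1)) (rule ip_integrable[OF isol_continuous(1)[OF X(1)] isol_continuous(1)[OF \<Phi>c_isol] X(2) sq])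
    have i1: "(\<lambda>x. (norm (X n x))\<^sup>2) integrable_on {0..}" and i2: "(\<lambda>x. (norm (?P x))\<^sup>2) integrable_on {0..}"
      using X(2)[of n] sq unfolding sqint_def by (auto intro: set_lebesgue_integral_eq_integral(1))
    have j: "(\<lambda>x. (t * (norm (X n x))\<^sup>2 + (norm (?P x))\<^sup>2 / t) / 2) integrable_on {0..}"
      using integrable_on_divide[OF integrable_add[OF integrable_on_mult_right[OF i1, of t] integrable_on_divide[OF i2, of t]], of 2] .
    have "cmod (integral {0..} (\<lambda>x. ip (X n x) (?P x))) \<le> integral {0..} (\<lambda>x. (t * (norm (X n x))\<^sup>2 + (norm (?P x))\<^sup>2 / t) / 2)"
    proof (rule integral_norm_bound_integral[OF ab j])
      fix x show "norm (ip (X n x) (?P x)) \<le> (t * (norm (X n x))\<^sup>2 + (norm (?P x))\<^sup>2 / t) / 2"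
        using norm_ip_le[OF t, of "X n x" "?P x"] by simp
    qed
    also have "\<dots> = (t * integral {0..} (\<lambda>x. (norm (X n x))\<^sup>2) + ?N / t) / 2"
      by (simp add: Henstock_Kurzweil_Integration.integral_add[OF integrable_on_mult_right[OF i1, of t] integrable_on_divide[OF i2, of t]])
    finally show ?thesis unfolding I ip_self norm_of_real by simp
  qed
  moreover have "(\<lambda>n. t * integral {0..} (\<lambda>t. (norm (X n t))\<^sup>2) + ?N / t) \<longlonglongrightarrow> t * Re (ip (S\<^sub>0 (k\<^sup>2) c) c) + ?N / t"
    by (intro tendsto_intros X(4))
  ultimately show ?thesis by (intro LIMSEQ_le_const) auto
qed

lemma sqint_multiple: assumes "sol F" "sqint F" obtains a where "\<And>x. x \<ge> 0 ==> F x = a *s Fm1 x"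
proof -
  have "(F \<longlongrightarrow> 0) at_top"
    using isol_L2_tendsto_0(1)[OF q _ ] assms by (simp add: sol_def sqint_def)
  then show ?thesis using decay_multiple[OF assms(1)] that by blast
qed

lemma sqint_Fm1: "sqint Fm1"
proof -
  have c: "continuous_on {0..} Fm1" using isol_continuous(1) sol_jost(1) by (auto simp: sol_def)
  obtain R where RS: "(R \<longlongrightarrow> 0) at_top" "\<And>x. Fm1 x = exp (- (complex_of_real k * complex_of_real x)) *s (e_minus + R x)"
    by (rule Fm1_asymptotics) blast
  have "((\<lambda>x. norm (e_minus + R x)) \<longlongrightarrow> norm (e_minus + 0)) at_top" by (intro tendsto_intros RS)
  then have "\<forall>\<^sub>F x in at_top. norm (e_minus + R x) < norm (e_minus + 0) + 1" by (rule order_tendstoD) simp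
  then have ev: "\<forall>\<^sub>F x in at_top. \<bar>(norm (Fm1 x))\<^sup>2\<bar> \<le> (norm e_minus + 1)\<^sup>2 * exp (- (2 * k) * x)"
  proof eventually_elim
    case (elim x)
    have "norm (Fm1 x) = exp (- (k * x)) * norm (e_minus + R x)" unfolding RS(2) norm_scale2 by (simp add: norm_exp_eq_Re)
    also have "\<dots> \<le> exp (- (k * x)) * (norm e_minus + 1)" using elim by (intro mult_left_mono) auto
    finally have "(norm (Fm1 x))\<^sup>2 \<le> (exp (- (k * x)) * (norm e_minus + 1))\<^sup>2" by (intro power_mono) auto
    also have "\<dots> = (norm e_minus + 1)\<^sup>2 * exp (- (2 * k) * x)"
      by (simp add: power_mult_distrib power2_eq_square[of "exp _"] flip: exp_add)
    finally show ?case by simp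
  qed
  show ?thesis unfolding sqint_def
    by (rule exp_decay_integrable[OF _ _ ev]) (use k in \<open>auto intro!: continuous_intros c\<close>)
qed

context
  assumes eig: "\<gamma>p1 1 = 0"
begin

text \<open>Both estimates for the atom are applied to the coefficient vector \<open>c\<close> of
  the eigenfunction \<open>D *s Fm1\<close>. As \<open>c\<close> turns out to be an eigenvector of
  the atom, they become the two inequalities between \<open>\<nu>0 * N'\<close> and
  \<open>r^2\<close>.\<close>

lemma eigenvalue_residue:
  defines "N \<equiv> integral {0..} (\<lambda>x. (norm (Fm1 x))\<^sup>2)"
  shows "N > 0" "measure \<nu> {k\<^sup>2} = (cmod (\<gamma>pi 1))\<^sup>2 / ((cmod D)\<^sup>2 * N)" "\<psi> (k\<^sup>2) = - \<gamma>mi 2 / \<gamma>mi 1"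
proof -
  define \<nu>0 where "\<nu>0 = measure \<nu> {k\<^sup>2}"
  define p where "p = \<psi>' (k\<^sup>2)"
  define r where "r = cmod (\<gamma>mi 1)"
  have S: "S\<^sub>0 (k\<^sup>2) d = vector [\<nu>0 * (d $ 1 + p * d $ 2), \<nu>0 * (cnj p * d $ 1 + d $ 2)]" for d
    by (simp add: S\<^sub>0_def g_def \<nu>0_def p_def vec2_eq_iff algebra_simps)
  have r: "r > 0" "cmod (\<gamma>mi 2) = r" "cmod (\<gamma>pi 1) = r"
    using osc_nonzero[OF eig] osc_symmetry(2)[OF eig] osc_cmod[OF eig] by (simp_all add: r_def)
  have mi2: "\<gamma>mi 2 \<noteq> 0" using r by auto
  let ?e = "\<Phi>c (\<gamma>mi 2) (- \<gamma>mi 1)"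
  define c :: "complex^2" where "c = vector [\<gamma>mi 2, - \<gamma>mi 1]"
  have nc: "(norm c)\<^sup>2 = 2 * r\<^sup>2" by (simp add: c_def norm_sq2 r) (simp add: r_def)
  have e: "?e x = D *s Fm1 x + 0 *s Fm1 x" if "x \<ge> 0" for x using eigenfunction[OF eig that] by simp
  have c1: "continuous_on {0..} Fm1" using isol_continuous(1) sol_jost(1) by (auto simp: sol_def)
  have sqe: "sqint ?e"
  proof -
    have "sqint (\<lambda>x. D *s Fm1 x + 0 *s Fm1 x)" by (intro sqint_lincomb c1 sqint_Fm1)
    then show ?thesis unfolding sqint_def
      by (rule absolutely_integrable_spike[OF _ negligible_empty]) (simp add: e)
  qed
  define N' where "N' = integral {0..} (\<lambda>x. (norm (?e x))\<^sup>2)"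
  have "N' = integral {0..} (\<lambda>x. (cmod D)\<^sup>2 * (norm (Fm1 x))\<^sup>2)"
    unfolding N'_def by (rule Henstock_Kurzweil_Integration.integral_cong) (simp add: e norm_scale2 power_mult_distrib)
  then have N'N: "N' = (cmod D)\<^sup>2 * N" by (simp add: N_def)
  have "N \<ge> 0" unfolding N_def
    by (intro integral_nonneg set_lebesgue_integral_eq_integral(1)) (use sqint_Fm1 in \<open>auto simp: sqint_def\<close>)
  moreover have "N \<noteq> 0"
  proof
    assume "N = 0"
    then have "1 *s Fm1 x = 0" if "x \<ge> 0" for x
      using sqint_integral_zero[OF c1 sqint_Fm1 _ that] by (simp add: N_def)
    then show False using Fm1_nonzero[of 1] by simp
  qed
  ultimately show N: "N > 0" by simp
  have N'0: "N' > 0" using N'N N D_nonzero[OF eig] by simp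
  define s where "s = Re (ip (S\<^sub>0 (k\<^sup>2) c) c)"
  \<comment> \<open>The weight \<open>t = N' / (2 * r^2)\<close> makes the last term half of the
    left side.\<close>
  have "2 * (2 * r\<^sup>2) \<le> (N' / (2 * r\<^sup>2)) * s + N' / (N' / (2 * r\<^sup>2))"
    using atom_lower[OF sqe _ c_def, of "N' / (2 * r\<^sup>2)"] r N'0 unfolding N'_def[symmetric] s_def[symmetric] nc by simp
  then have "2 * r\<^sup>2 \<le> (N' / (2 * r\<^sup>2)) * s" using N'0 r by simp
  then have low: "2 * r\<^sup>2 * (2 * r\<^sup>2) \<le> N' * s" using r by (simp add: field_simps)
  have \<nu>0: "\<nu>0 > 0"
  proof (rule ccontr)
    assume "\<not> \<nu>0 > 0"
    then have "\<nu>0 = 0" by (simp add: \<nu>0_def measure_nonneg antisym_conv1 zero_less_measure_iff)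
    then have "s = 0" by (simp add: s_def S)
    moreover have "2 * r\<^sup>2 * (2 * r\<^sup>2) > 0" using r by simp
    ultimately show False using low by simp
  qed
  \<comment> \<open>By \<open>atom_upper\<close>, the first column of the atom yields a square
    integrable combination of the columns of \<Phi>. It is a multiple of \<open>Fm1\<close>, so its
    \<open>Fmi\<close> coefficient vanishes; positivity of the mass makes this an equation for
    \<open>p\<close>.\<close>
  have "\<gamma>mi 1 + cnj p * \<gamma>mi 2 = 0"
  proof -
    define d :: "complex^2" where "d = vector [1, 0]"
    have "sqint (\<Phi>c \<nu>0 (\<nu>0 * cnj p))" using atom_upper(1)[of d] by (simp add: S d_def)
    then obtain a where a: "\<And>x. x \<ge> 0 ==> \<Phi>c \<nu>0 (\<nu>0 * cnj p) x = a *s Fm1 x"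
      using sqint_multiple[OF sol_\<Phi>c] by metis
    have "has_coeffs Fm1 Fpi Fmi Fp1 (\<Phi>c \<nu>0 (\<nu>0 * cnj p)) a 0 0 0" using a by (simp add: has_coeffs_def)
    from coeffs_unique(3)[OF coeffs_\<Phi>c[OF cf cf] this]
    have "\<nu>0 * (\<gamma>mi 1 + cnj p * \<gamma>mi 2) = 0" by (simp add: algebra_simps)
    then show ?thesis using \<nu>0 by simp
  qed
  then have "cnj (\<gamma>mi 1) + p * cnj (\<gamma>mi 2) = 0" by (metis complex_cnj_add complex_cnj_cnj complex_cnj_mult complex_cnj_zero)
  then have "\<gamma>mi 1 * \<gamma>mi 2 * (cnj (\<gamma>mi 1) + p * cnj (\<gamma>mi 2)) = 0" by simp
  moreover have rr: "\<gamma>mi 1 * cnj (\<gamma>mi 1) = complex_of_real (r\<^sup>2)" "\<gamma>mi 2 * cnj (\<gamma>mi 2) = complex_of_real (r\<^sup>2)"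
    unfolding complex_norm_square[symmetric] r(2) by (simp_all add: r_def)
  moreover have "\<gamma>mi 1 * \<gamma>mi 2 * (cnj (\<gamma>mi 1) + p * cnj (\<gamma>mi 2)) = (\<gamma>mi 1 * cnj (\<gamma>mi 1)) * \<gamma>mi 2 + p * \<gamma>mi 1 * (\<gamma>mi 2 * cnj (\<gamma>mi 2))"
    by (simp add: algebra_simps)
  then have "\<gamma>mi 1 * \<gamma>mi 2 * (cnj (\<gamma>mi 1) + p * cnj (\<gamma>mi 2)) = complex_of_real (r\<^sup>2) * (\<gamma>mi 2 + p * \<gamma>mi 1)"
    unfolding rr by (simp add: algebra_simps)
  ultimately have pm: "\<gamma>mi 2 + p * \<gamma>mi 1 = 0" using r by simp
  then have p: "p = - \<gamma>mi 2 / \<gamma>mi 1" using osc_nonzero[OF eig] by (simp add: field_simps eq_neg_iff_add_eq_0)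
  show "\<psi> (k\<^sup>2) = - \<gamma>mi 2 / \<gamma>mi 1"
    using \<psi>'_atom[of "k\<^sup>2"] \<nu>0 p by (simp add: p_def \<nu>0_def)
  \<comment> \<open>Since \<open>p\<close> has modulus 1, the matrix \<open>psi_mat p\<close> has
    eigenvalues 0 and 2, and \<open>c\<close> belongs to the eigenvalue 2.\<close>
  have Sc: "S\<^sub>0 (k\<^sup>2) c = (2 * \<nu>0) *s c"
  proof -
    have "p * \<gamma>mi 1 = - \<gamma>mi 2" using pm by (simp add: eq_neg_iff_add_eq_0 add.commute)
    moreover have "cnj p * \<gamma>mi 2 = - \<gamma>mi 1" using \<open>\<gamma>mi 1 + cnj p * \<gamma>mi 2 = 0\<close> by (simp add: eq_neg_iff_add_eq_0 add.commute)
    ultimately show ?thesis by (simp add: S c_def vec2_eq_iff algebra_simps)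
  qed
  have s: "s = 4 * \<nu>0 * r\<^sup>2"
  proof -
    have "ip (S\<^sub>0 (k\<^sup>2) c) c = 2 * \<nu>0 * ip c c" unfolding Sc by (simp add: algebra_simps)
    then show ?thesis unfolding s_def ip_self nc by simp
  qed
  have up: "4 * \<nu>0\<^sup>2 * N' \<le> s"
  proof -
    have eq: "\<Phi>c (S\<^sub>0 (k\<^sup>2) c $ 1) (S\<^sub>0 (k\<^sup>2) c $ 2) x = complex_of_real (2 * \<nu>0) *s ?e x" for x
      unfolding Sc by (simp add: \<Phi>c_def c_def vec2_eq_iff algebra_simps)
    have "integral {0..} (\<lambda>x. (norm (\<Phi>c (S\<^sub>0 (k\<^sup>2) c $ 1) (S\<^sub>0 (k\<^sup>2) c $ 2) x))\<^sup>2) = integral {0..} (\<lambda>x. 4 * \<nu>0\<^sup>2 * (norm (?e x))\<^sup>2)"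
      unfolding eq norm_scale2 norm_of_real by (simp add: power_mult_distrib)
    then show ?thesis using atom_upper(2)[of c] by (simp add: s_def N'_def)
  qed
  have "\<nu>0 * N' \<le> r\<^sup>2"
  proof -
    have "(4 * \<nu>0) * (\<nu>0 * N') \<le> (4 * \<nu>0) * r\<^sup>2" using up unfolding s by (simp add: power2_eq_square algebra_simps)
    then show ?thesis using \<nu>0 by (simp add: mult_le_cancel_left_pos)
  qed
  moreover have "r\<^sup>2 \<le> \<nu>0 * N'"
  proof -
    have "(4 * r\<^sup>2) * r\<^sup>2 \<le> (4 * r\<^sup>2) * (\<nu>0 * N')" using low unfolding s by (simp add: algebra_simps)
    then show ?thesis using r by (simp add: mult_le_cancel_left_pos)
  qed
  ultimately have "\<nu>0 * N' = r\<^sup>2" by simp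
  then show "measure \<nu> {k\<^sup>2} = (cmod (\<gamma>pi 1))\<^sup>2 / ((cmod D)\<^sup>2 * N)"
    using N'0 unfolding N'N[symmetric] \<nu>0_def[symmetric] r(3) by (simp add: nonzero_eq_divide_eq)
qed

end

end

section \<open>Decaying solutions depending on the spectral parameter\<close>

text \<open>The integral operator halves the weighted supremum norm given by \<rho>, so the iterates
  decrease like powers of 1/2. Each is jointly continuous in \<kappa> and \<open>x\<close> by
  dominated convergence, and the bound \<open>R\<close> on \<rho> makes the series uniform.
  Continuity of the kernel is asked away from \<open>t = x\<close> only, because a Volterra kernel
  may jump there.\<close>

lemma neumann_series:
  fixes N :: "complex => real => real => complex^2 => complex^2" and m :: "real => real => real"
  defines "\<mu> \<equiv> lebesgue_on {0::real..}"
  assumes lin: "\<And>\<kappa> x t. \<kappa> \<in> P ==> x \<ge> 0 ==> t \<ge> 0 ==> linear (N \<kappa> x t)"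
    and bound: "\<And>\<kappa> x t z. \<kappa> \<in> P ==> x \<ge> 0 ==> t \<ge> 0 ==> norm (N \<kappa> x t z) \<le> m x t * norm z"
    and m0: "\<And>x t. m x t \<ge> 0" and \<rho>0: "\<And>x. \<rho> x \<ge> 0" and \<rho>m: "\<And>x. x \<ge> 0 ==> \<rho> x \<le> R"
    and int: "\<And>x. x \<ge> 0 ==> integrable \<mu> (\<lambda>t. m x t * \<rho> t)"
    and half: "\<And>x. x \<ge> 0 ==> (LINT t|\<mu>. m x t * \<rho> t) \<le> \<rho> x / 2"
    and H: "integrable \<mu> H" and dom: "\<And>x t. x \<ge> 0 ==> t \<ge> 0 ==> m x t * \<rho> t \<le> H t"
    and meas: "\<And>\<kappa> x Y. \<kappa> \<in> P ==> x \<ge> 0 ==> continuous_on {0..} Y ==> (\<lambda>t. N \<kappa> x t (Y t)) \<in> borel_measurable \<mu>"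
    and cont: "\<And>\<kappa> x t \<kappa>s xs zs z. \<kappa> \<in> P ==> x \<ge> 0 ==> t \<ge> 0 ==> t \<noteq> x ==> (\<And>n. \<kappa>s n \<in> P) ==> (\<And>n. xs n \<ge> 0) ==>
        \<kappa>s \<longlonglongrightarrow> \<kappa> ==> xs \<longlonglongrightarrow> x ==> zs \<longlonglongrightarrow> z ==> (\<lambda>n. N (\<kappa>s n) (xs n) t (zs n)) \<longlonglongrightarrow> N \<kappa> x t z"
    and y0: "\<And>x. x \<ge> 0 ==> norm y0 \<le> B * \<rho> x"
  obtains Y where "continuous_on (P \<times> {0..}) (\<lambda>(\<kappa>, x). Y \<kappa> x)"
    "\<And>\<kappa> x. \<kappa> \<in> P ==> x \<ge> 0 ==> norm (Y \<kappa> x) \<le> 2 * B * \<rho> x"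
    "\<And>\<kappa> x. \<kappa> \<in> P ==> x \<ge> 0 ==> integrable \<mu> (\<lambda>t. N \<kappa> x t (Y \<kappa> t))"
    "\<And>\<kappa> x. \<kappa> \<in> P ==> x \<ge> 0 ==> Y \<kappa> x = y0 + (LINT t|\<mu>. N \<kappa> x t (Y \<kappa> t))"
proof -
  have sp: "space \<mu> = {0..}" by (simp add: \<mu>_def space_restrict_space)
  \<comment> \<open>A negative \<open>B\<close> is compatible with the bound on \<open>y0\<close>
    only if the weight vanishes; replacing \<open>B\<close> by its absolute value covers this case
    too.\<close>
  have B0: "B \<ge> 0 \<or> (\<forall>x\<ge>0. \<rho> x = 0)"
    using y0 \<rho>0 norm_ge_zero[of y0] by (metis order_trans zero_le_mult_iff order.antisym)
  define C where "C = \<bar>B\<bar>"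
  have C0: "C \<ge> 0" by (simp add: C_def)
  have BC: "B * \<rho> x = C * \<rho> x" if "x \<ge> 0" for x using B0 that by (auto simp: C_def)
  define y where "y n = rec_nat (\<lambda>\<kappa> x. y0) (\<lambda>n f \<kappa> x. LINT t|\<mu>. N \<kappa> x t (f \<kappa> t)) n" for n
  have y_0: "y 0 \<kappa> x = y0" and y_Suc: "y (Suc n) \<kappa> x = (LINT t|\<mu>. N \<kappa> x t (y n \<kappa> t))" for n \<kappa> x
    by (simp_all add: y_def)
  have slice: "continuous_on {0..} (Z \<kappa>)" if "continuous_on (P \<times> {0..}) (\<lambda>(\<kappa>, x). Z \<kappa> x)" "\<kappa> \<in> P" for Z :: "complex => real => complex^2" and \<kappa>
  proof -
    have "continuous_on {0..} (\<lambda>x. (\<lambda>(\<kappa>, x). Z \<kappa> x) (\<kappa>, x))"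
      by (rule continuous_on_compose2[OF that(1)]) (use that(2) in \<open>auto intro!: continuous_intros\<close>)
    then show ?thesis by simp
  qed
  have Nint: "integrable \<mu> (\<lambda>t. N \<kappa> x t (Z t))"
    and Nbd: "norm (LINT t|\<mu>. N \<kappa> x t (Z t)) \<le> c * \<rho> x / 2"
    if \<kappa>: "\<kappa> \<in> P" and x: "x \<ge> 0" and Z: "continuous_on {0..} Z" and c: "c \<ge> 0" and Zb: "\<And>t. t \<ge> 0 ==> norm (Z t) \<le> c * \<rho> t" for \<kappa> x Z c
  proof -
    have b: "norm (N \<kappa> x t (Z t)) \<le> c * (m x t * \<rho> t)" if t: "t \<ge> 0" for t
    proof -
      have "norm (N \<kappa> x t (Z t)) \<le> m x t * norm (Z t)" by (rule bound[OF \<kappa> x t])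
      also have "\<dots> \<le> m x t * (c * \<rho> t)" by (rule mult_left_mono[OF Zb[OF t] m0])
      finally show ?thesis by (simp add: mult.left_commute)
    qed
    have ci: "integrable \<mu> (\<lambda>t. c * (m x t * \<rho> t))" by (intro integrable_mult_right int x)
    show i: "integrable \<mu> (\<lambda>t. N \<kappa> x t (Z t))"
      by (rule Bochner_Integration.integrable_bound[OF ci meas[OF \<kappa> x Z]])
        (intro AE_I2, use b in \<open>auto simp: sp intro: order_trans[OF _ abs_ge_self]\<close>)
    have "norm (LINT t|\<mu>. N \<kappa> x t (Z t)) \<le> (LINT t|\<mu>. c * (m x t * \<rho> t))"
      by (rule Bochner_Integration.integral_norm_bound_integral[OF i ci]) (use b in \<open>auto simp: sp\<close>)
    also have "\<dots> = c * (LINT t|\<mu>. m x t * \<rho> t)" by (rule integral_mult_right_zero)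
    also have "\<dots> \<le> c * (\<rho> x / 2)" by (rule mult_left_mono[OF half[OF x] c])
    finally show "norm (LINT t|\<mu>. N \<kappa> x t (Z t)) \<le> c * \<rho> x / 2" by simp
  qed
  have Ncont: "continuous_on (P \<times> {0..}) (\<lambda>(\<kappa>, x). LINT t|\<mu>. N \<kappa> x t (Z \<kappa> t))"
    if Zc: "continuous_on (P \<times> {0..}) (\<lambda>(\<kappa>, x). Z \<kappa> x)" and c: "c \<ge> 0"
      and Zb: "\<And>\<kappa> t. \<kappa> \<in> P ==> t \<ge> 0 ==> norm (Z \<kappa> t) \<le> c * \<rho> t" for Z c
    unfolding continuous_on_sequentially
  proof (intro allI ballI impI)
    fix ps :: "nat => complex \<times> real" and p :: "complex \<times> real" assume p: "p \<in> P \<times> {0..}" and ps: "(\<forall>n. ps n \<in> P \<times> {0..}) \<and> ps \<longlonglongrightarrow> p"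
    obtain \<kappa> x where px: "p = (\<kappa>, x)" "\<kappa> \<in> P" "x \<ge> 0" using p by auto
    have ks: "\<And>n. fst (ps n) \<in> P" "\<And>n. snd (ps n) \<ge> 0" "(\<lambda>n. fst (ps n)) \<longlonglongrightarrow> \<kappa>" "(\<lambda>n. snd (ps n)) \<longlonglongrightarrow> x"
      using ps tendsto_fst[of ps p] tendsto_snd[of ps p] px by (auto simp: mem_Times_iff)
    have "(\<lambda>n. LINT t|\<mu>. N (fst (ps n)) (snd (ps n)) t (Z (fst (ps n)) t)) \<longlonglongrightarrow> (LINT t|\<mu>. N \<kappa> x t (Z \<kappa> t))"
    proof (rule integral_dominated_convergence[where w = "\<lambda>t. c * H t"])
      show "(\<lambda>t. N \<kappa> x t (Z \<kappa> t)) \<in> borel_measurable \<mu>" by (rule meas[OF px(2,3) slice[OF Zc px(2)]])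
      show "(\<lambda>t. N (fst (ps n)) (snd (ps n)) t (Z (fst (ps n)) t)) \<in> borel_measurable \<mu>" for n
        by (rule meas[OF ks(1,2) slice[OF Zc ks(1)]])
      show "integrable \<mu> (\<lambda>t. c * H t)" by (intro integrable_mult_right H)
      show "AE t in \<mu>. norm (N (fst (ps n)) (snd (ps n)) t (Z (fst (ps n)) t)) \<le> c * H t" for n
      proof (rule AE_I2)
        fix t assume "t \<in> space \<mu>"
        then have t: "t \<ge> 0" by (simp add: sp)
        have "norm (N (fst (ps n)) (snd (ps n)) t (Z (fst (ps n)) t)) \<le> m (snd (ps n)) t * norm (Z (fst (ps n)) t)"
          by (rule bound[OF ks(1,2) t])
        also have "\<dots> \<le> m (snd (ps n)) t * (c * \<rho> t)" by (rule mult_left_mono[OF Zb[OF ks(1) t] m0])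
        also have "\<dots> = c * (m (snd (ps n)) t * \<rho> t)" by simp
        also have "\<dots> \<le> c * H t" by (rule mult_left_mono[OF dom[OF ks(2) t] c])
        finally show "norm (N (fst (ps n)) (snd (ps n)) t (Z (fst (ps n)) t)) \<le> c * H t" .
      qed
      have "AE t in lebesgue. t \<noteq> x"
        by (rule AE_I[of _ _ "{x}"]) auto
      then have "AE t in \<mu>. t \<noteq> x" unfolding \<mu>_def by (subst AE_restrict_space_iff) auto
      moreover have "AE t in \<mu>. t \<ge> 0" using AE_space by (rule AE_mp) (simp add: sp)
      ultimately show "AE t in \<mu>. (\<lambda>n. N (fst (ps n)) (snd (ps n)) t (Z (fst (ps n)) t)) \<longlonglongrightarrow> N \<kappa> x t (Z \<kappa> t)"
      proof eventually_elim
        case (elim t)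
        have "(\<lambda>n. (\<lambda>(\<kappa>, x). Z \<kappa> x) (fst (ps n), t)) \<longlonglongrightarrow> (\<lambda>(\<kappa>, x). Z \<kappa> x) (\<kappa>, t)"
          by (rule continuous_on_tendsto_compose[OF Zc]) (use ks px elim in \<open>auto intro!: tendsto_Pair\<close>)
        then show ?case using elim by (intro cont[OF px(2,3) elim(2) elim(1) ks]) simp
      qed
    qed
    then show "((\<lambda>(\<kappa>, x). LINT t|\<mu>. N \<kappa> x t (Z \<kappa> t)) \<circ> ps) \<longlonglongrightarrow> (case p of (\<kappa>, x) => LINT t|\<mu>. N \<kappa> x t (Z \<kappa> t))"
      by (simp add: o_def case_prod_unfold px)
  qed
  have yn: "continuous_on (P \<times> {0..}) (\<lambda>(\<kappa>, x). y n \<kappa> x) \<and> (\<forall>\<kappa>\<in>P. \<forall>x\<ge>0. norm (y n \<kappa> x) \<le> (C / 2 ^ n) * \<rho> x)" for n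
  proof (induction n)
    case 0
    then show ?case using y0 BC by (auto simp: y_0)
  next
    case (Suc n)
    then have c: "continuous_on (P \<times> {0..}) (\<lambda>(\<kappa>, x). y n \<kappa> x)" and b: "\<And>\<kappa> x. \<kappa> \<in> P ==> x \<ge> 0 ==> norm (y n \<kappa> x) \<le> (C / 2 ^ n) * \<rho> x"
      by auto
    have Cn: "C / 2 ^ n \<ge> 0" using C0 by simp
    have "norm (y (Suc n) \<kappa> x) \<le> (C / 2 ^ Suc n) * \<rho> x" if "\<kappa> \<in> P" "x \<ge> 0" for \<kappa> x
      using Nbd[OF that slice[OF c that(1)] Cn b[OF that(1)]] by (simp add: y_Suc field_simps)
    then show ?case using Ncont[OF c Cn b] by (auto simp: y_Suc)
  qed
  have yb: "norm (y n \<kappa> x) \<le> (C / 2 ^ n) * \<rho> x" if "\<kappa> \<in> P" "x \<ge> 0" for n \<kappa> x using yn that by blast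
  have yc: "continuous_on (P \<times> {0..}) (\<lambda>(\<kappa>, x). y n \<kappa> x)" for n using yn by blast
  define Y where "Y \<kappa> x = (\<Sum>n. y n \<kappa> x)" for \<kappa> x
  have geo: "summable (\<lambda>n. C / 2 ^ n * r)" "(\<Sum>n. C / 2 ^ n * r) = 2 * C * r" for r :: real
    using sums_mult[OF geometric_sums[of "1/2 :: real"], of "C * r"]
    by (auto simp: power_one_over field_simps sums_iff)
  have sm: "summable (\<lambda>n. norm (y n \<kappa> x))" if "\<kappa> \<in> P" "x \<ge> 0" for \<kappa> x
    by (rule summable_comparison_test[OF _ geo(1)[of "\<rho> x"]]) (use yb[OF that] in auto)
  have Yb: "norm (Y \<kappa> x) \<le> 2 * C * \<rho> x" if "\<kappa> \<in> P" "x \<ge> 0" for \<kappa> x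
  proof -
    have "norm (Y \<kappa> x) \<le> (\<Sum>n. norm (y n \<kappa> x))" unfolding Y_def by (rule summable_norm[OF sm[OF that]])
    also have "\<dots> \<le> (\<Sum>n. C / 2 ^ n * \<rho> x)" by (rule suminf_le[OF yb[OF that] sm[OF that] geo(1)])
    finally show ?thesis unfolding geo(2) .
  qed
  have ul: "uniform_limit (P \<times> {0..}) (\<lambda>n p. \<Sum>i<n. y i (fst p) (snd p)) (\<lambda>p. \<Sum>i. y i (fst p) (snd p)) sequentially"
  proof (rule Weierstrass_m_test[OF _ geo(1)[of R]])
    fix n p assume p: "p \<in> P \<times> {0::real..}"
    then have "norm (y n (fst p) (snd p)) \<le> (C / 2 ^ n) * \<rho> (snd p)" by (intro yb) auto
    also have "\<dots> \<le> (C / 2 ^ n) * R" using p C0 by (intro mult_left_mono \<rho>m) auto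
    finally show "norm (y n (fst p) (snd p)) \<le> C / 2 ^ n * R" .
  qed
  have Yc: "continuous_on (P \<times> {0..}) (\<lambda>(\<kappa>, x). Y \<kappa> x)"
    unfolding Y_def case_prod_unfold
    by (rule uniform_limit_theorem[OF _ ul]) (use yc in \<open>auto intro!: always_eventually continuous_on_sum simp: case_prod_unfold\<close>)
  have C2: "2 * C \<ge> 0" using C0 by simp
  have Yi: "integrable \<mu> (\<lambda>t. N \<kappa> x t (Y \<kappa> t))" if "\<kappa> \<in> P" "x \<ge> 0" for \<kappa> x
    by (rule Nint[OF that slice[OF Yc that(1)] C2 Yb[OF that(1)]])
  have Yeq: "Y \<kappa> x = y0 + (LINT t|\<mu>. N \<kappa> x t (Y \<kappa> t))" if \<kappa>: "\<kappa> \<in> P" and x: "x \<ge> 0" for \<kappa> x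
  proof -
    have part: "(LINT t|\<mu>. N \<kappa> x t (\<Sum>i<n. y i \<kappa> t)) = (\<Sum>i<n. y (Suc i) \<kappa> x)" for n
    proof -
      have "(LINT t|\<mu>. N \<kappa> x t (\<Sum>i<n. y i \<kappa> t)) = (LINT t|\<mu>. (\<Sum>i<n. N \<kappa> x t (y i \<kappa> t)))"
        by (rule Bochner_Integration.integral_cong[OF refl]) (use lin[OF \<kappa> x] in \<open>auto simp: sp linear_sum\<close>)
      also have "\<dots> = (\<Sum>i<n. LINT t|\<mu>. N \<kappa> x t (y i \<kappa> t))"
      proof (rule Bochner_Integration.integral_sum)
        fix i
        have "C / 2 ^ i \<ge> 0" using C0 by simp
        from Nint[OF \<kappa> x slice[OF yc \<kappa>] this yb[OF \<kappa>]] show "integrable \<mu> (\<lambda>t. N \<kappa> x t (y i \<kappa> t))" .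
      qed
      finally show ?thesis by (simp add: y_Suc)
    qed
    have "(\<lambda>n. LINT t|\<mu>. N \<kappa> x t (\<Sum>i<n. y i \<kappa> t)) \<longlonglongrightarrow> (LINT t|\<mu>. N \<kappa> x t (Y \<kappa> t))"
    proof (rule integral_dominated_convergence[where w = "\<lambda>t. 2 * C * H t"])
      show "(\<lambda>t. N \<kappa> x t (Y \<kappa> t)) \<in> borel_measurable \<mu>" by (rule meas[OF \<kappa> x slice[OF Yc \<kappa>]])
      show "(\<lambda>t. N \<kappa> x t (\<Sum>i<n. y i \<kappa> t)) \<in> borel_measurable \<mu>" for n
        by (intro meas[OF \<kappa> x] continuous_on_sum slice[OF yc \<kappa>])
      show "integrable \<mu> (\<lambda>t. 2 * C * H t)" by (intro integrable_mult_right H)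
      show "AE t in \<mu>. (\<lambda>n. N \<kappa> x t (\<Sum>i<n. y i \<kappa> t)) \<longlonglongrightarrow> N \<kappa> x t (Y \<kappa> t)"
      proof (rule AE_I2)
        fix t assume "t \<in> space \<mu>"
        then have t: "t \<ge> 0" by (simp add: sp)
        have "(\<lambda>n. \<Sum>i<n. y i \<kappa> t) \<longlonglongrightarrow> Y \<kappa> t"
          unfolding Y_def by (rule summable_LIMSEQ[OF summable_norm_cancel[OF sm[OF \<kappa> t]]])
        then show "(\<lambda>n. N \<kappa> x t (\<Sum>i<n. y i \<kappa> t)) \<longlonglongrightarrow> N \<kappa> x t (Y \<kappa> t)"
          by (rule bounded_linear.tendsto[OF linear_conv_bounded_linear[THEN iffD1, OF lin[OF \<kappa> x t]]])
      qed
      show "AE t in \<mu>. norm (N \<kappa> x t (\<Sum>i<n. y i \<kappa> t)) \<le> 2 * C * H t" for n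
      proof (rule AE_I2)
        fix t assume "t \<in> space \<mu>"
        then have t: "t \<ge> 0" by (simp add: sp)
        have "norm (\<Sum>i<n. y i \<kappa> t) \<le> (\<Sum>i<n. norm (y i \<kappa> t))" by (rule norm_sum)
        also have "\<dots> \<le> (\<Sum>i<n. C / 2 ^ i * \<rho> t)" by (intro sum_mono yb \<kappa> t)
        also have "\<dots> \<le> (\<Sum>i. C / 2 ^ i * \<rho> t)" by (rule sum_le_suminf[OF geo(1)]) (use C0 \<rho>0 in auto)
        finally have s: "norm (\<Sum>i<n. y i \<kappa> t) \<le> 2 * C * \<rho> t" unfolding geo(2) .
        have "norm (N \<kappa> x t (\<Sum>i<n. y i \<kappa> t)) \<le> m x t * norm (\<Sum>i<n. y i \<kappa> t)" by (rule bound[OF \<kappa> x t])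
        also have "\<dots> \<le> m x t * (2 * C * \<rho> t)" by (rule mult_left_mono[OF s m0])
        also have "\<dots> = 2 * C * (m x t * \<rho> t)" by simp
        also have "\<dots> \<le> 2 * C * H t" by (rule mult_left_mono[OF dom[OF x t] C2])
        finally show "norm (N \<kappa> x t (\<Sum>i<n. y i \<kappa> t)) \<le> 2 * C * H t" .
      qed
    qed
    then have "(\<lambda>n. \<Sum>i<n. y (Suc i) \<kappa> x) \<longlonglongrightarrow> (LINT t|\<mu>. N \<kappa> x t (Y \<kappa> t))" unfolding part .
    then have "(\<lambda>i. y (Suc i) \<kappa> x) sums (LINT t|\<mu>. N \<kappa> x t (Y \<kappa> t))" by (simp add: sums_def)
    then have "(\<lambda>i. y i \<kappa> x) sums ((LINT t|\<mu>. N \<kappa> x t (Y \<kappa> t)) + y 0 \<kappa> x)" by (rule sums_Suc)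
    then show ?thesis unfolding Y_def by (simp add: sums_iff y_0 add.commute)
  qed
  show ?thesis
  proof (rule that[OF Yc _ Yi Yeq])
    fix \<kappa> x assume \<kappa>: "\<kappa> \<in> P" and x: "(0::real) \<le> x"
    have "2 * B * \<rho> x = 2 * C * \<rho> x" using BC[OF x] by (simp only: mult.assoc)
    then show "norm (Y \<kappa> x) \<le> 2 * B * \<rho> x" using Yb[OF \<kappa> x] by (simp only:)
  qed
qed

section \<open>Tail integrals and variation of constants\<close>

abbreviation "\<mu> \<equiv> lebesgue_on {0::real..}"

lemma space_\<mu> [simp]: "space \<mu> = {0..}" by (simp add: space_restrict_space)

lemma integrable_\<mu>_iff: "integrable \<mu> f \<longleftrightarrow> (f :: real => 'a::euclidean_space) absolutely_integrable_on {0..}"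
  by (simp add: integrable_restrict_space set_integrable_def)

lemma integral_\<mu>: "integrable \<mu> f ==> (LINT t|\<mu>. f t) = integral {0..} (f :: real => 'a::euclidean_space)"
  by (rule lebesgue_integral_eq_integral) auto

lemma borel_measurable_\<mu>: "f \<in> borel_measurable borel ==> f \<in> borel_measurable \<mu>"
  by (intro measurable_restrict_space1 measurable_completion) simp

lemma continuous_measurable_\<mu>:
  fixes f :: "real => 'a::euclidean_space" shows "continuous_on {0..} f ==> f \<in> borel_measurable \<mu>"
  by (rule continuous_imp_measurable_on_sets_lebesgue) auto

text \<open>The term \<open>d\<close> regularises the tail integral: if \<open>h\<close> is not
  integrable at infinity, taking \<open>d\<close> as the indicator of \<open>t > x0\<close> gives
  the integral from \<open>x\<close> to \<open>x0\<close>. It cancels in differences and does not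
  affect the derivative.\<close>

lemma tail_ipair:
  fixes h d :: "real => complex"
  assumes int: "\<And>x. x \<ge> 0 ==> integrable \<mu> (\<lambda>t. ((if t > x then 1 else 0) - d t) * h t)"
  shows "ipair (\<lambda>x. LINT t|\<mu>. ((if t > x then 1 else 0) - d t) * h t) (\<lambda>t. - h t)"
  unfolding ipair_def
proof (intro allI impI)
  fix b :: real assume b: "0 \<le> b"
  define f where "f t = (if t \<in> {0<..b} then - h t else 0)" for t
  have eq: "((if t > b then 1 else 0) - d t) * h t - ((if t > 0 then 1 else 0) - d t) * h t = f t" if "t \<ge> 0" for t
    using b that by (simp add: f_def algebra_simps)
  have "integrable \<mu> (\<lambda>t. ((if t > b then 1 else 0) - d t) * h t - ((if t > 0 then 1 else 0) - d t) * h t)"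
    using int[OF b] int[OF order_refl] by (rule Bochner_Integration.integrable_diff)
  then have fi: "integrable \<mu> f"
    by (rule Bochner_Integration.integrable_cong[OF refl, THEN iffD1, rotated]) (use eq in auto)
  have "(LINT t|\<mu>. ((if t > b then 1 else 0) - d t) * h t) - (LINT t|\<mu>. ((if t > 0 then 1 else 0) - d t) * h t) = (LINT t|\<mu>. f t)"
    unfolding Bochner_Integration.integral_diff[OF int[OF b] int[OF order_refl], symmetric]
    by (rule Bochner_Integration.integral_cong[OF refl]) (use eq in auto)
  also have "\<dots> = integral {0..} f" by (rule integral_\<mu>[OF fi])
  finally have I: "integral {0..} f = (LINT t|\<mu>. ((if t > b then 1 else 0) - d t) * h t) - (LINT t|\<mu>. ((if t > 0 then 1 else 0) - d t) * h t)" by simp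
  have fa: "f absolutely_integrable_on {0..}" using fi integrable_\<mu>_iff by blast
  then have "f absolutely_integrable_on {0..b}" by (rule set_integrable_subset) (use b in auto)
  then have ha: "(\<lambda>t. - h t) absolutely_integrable_on {0..b}"
    by (rule absolutely_integrable_spike[of _ _ "{0}"]) (auto simp: f_def)
  have "(f has_integral integral {0..} f) {0..}"
    using set_lebesgue_integral_eq_integral(1)[OF fa] by (rule integrable_integral)
  then have "((\<lambda>t. - h t) has_integral integral {0..} f) {0<..b}"
    unfolding f_def by (subst (asm) has_integral_restrict) auto
  then have "((\<lambda>t. - h t) has_integral integral {0..} f) {0..b}"
    by (rule has_integral_spike_set_eq[THEN iffD1, rotated 2]) (auto intro: negligible_subset[of "{0}"])
  then show "(\<lambda>t. - h t) absolutely_integrable_on {0..b} \<and>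
     ((\<lambda>t. - h t) has_integral (LINT t|\<mu>. ((if t > b then 1 else 0) - d t) * h t) - (LINT t|\<mu>. ((if t > 0 then 1 else 0) - d t) * h t)) {0..b}"
    using ha I by simp
qed

lemma ipair_exp_complex: "ipair (\<lambda>x. exp (w * complex_of_real x)) (\<lambda>x. w * exp (w * complex_of_real x))"
proof (rule ipair_C1)
  fix x :: real
  have "((\<lambda>z. exp (w * z)) has_field_derivative w * exp (w * of_real x)) (at (of_real x))"
    by (auto intro!: derivative_eq_intros)
  then show "((\<lambda>x. exp (w * complex_of_real x)) has_vector_derivative w * exp (w * complex_of_real x)) (at x within {0..})"
    by (rule has_vector_derivative_real_field)
qed (intro continuous_intros)

text \<open>No choice of end point is made for the antiderivatives \<open>p\<close>, \<open>s\<close>.\<close>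

lemma variation_of_constants:
  fixes p s r :: "real => complex" and \<omega> :: complex
  assumes p: "ipair p (\<lambda>t. - (exp (\<omega> * complex_of_real t) * r t))" and s: "ipair s (\<lambda>t. - (exp (- (\<omega> * complex_of_real t)) * r t))"
    and w0: "\<omega> \<noteq> 0"
  defines "w \<equiv> \<lambda>x::real. (exp (- (\<omega> * x)) * p x - exp (\<omega> * x) * s x) / (2 * \<omega>)"
    and "w1 \<equiv> \<lambda>x::real. - (exp (- (\<omega> * x)) * p x + exp (\<omega> * x) * s x) / 2"
  shows "ipair w w1" "ipair w1 (\<lambda>x. \<omega>\<^sup>2 * w x + r x)"
proof -
  have e: "ipair (\<lambda>x. exp (\<omega> * complex_of_real x)) (\<lambda>x. \<omega> * exp (\<omega> * complex_of_real x))" by (rule ipair_exp_complex)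
  have e': "ipair (\<lambda>x. exp (- (\<omega> * complex_of_real x))) (\<lambda>x. - \<omega> * exp (- (\<omega> * complex_of_real x)))"
    using ipair_exp_complex[of "- \<omega>"] by simp
  have ee: "exp (- (\<omega> * complex_of_real x)) * (exp (\<omega> * complex_of_real x) * z) = z" for x z
    by (simp add: mult.assoc[symmetric] flip: exp_add)
  have ee': "exp (\<omega> * complex_of_real x) * (exp (- (\<omega> * complex_of_real x)) * z) = z" for x z
    by (simp add: mult.assoc[symmetric] flip: exp_add)
  have A: "ipair (\<lambda>x. exp (- (\<omega> * complex_of_real x)) * p x) (\<lambda>x. - \<omega> * exp (- (\<omega> * complex_of_real x)) * p x - r x)"
    by (rule ipair_cong'[OF ipair_mult[OF e' p]]) (simp_all add: ee)
  have B: "ipair (\<lambda>x. exp (\<omega> * complex_of_real x) * s x) (\<lambda>x. \<omega> * exp (\<omega> * complex_of_real x) * s x - r x)"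
    by (rule ipair_cong'[OF ipair_mult[OF e s]]) (simp_all add: ee')
  have "ipair (\<lambda>x. (1 / (2 * \<omega>)) * (exp (- (\<omega> * complex_of_real x)) * p x - exp (\<omega> * complex_of_real x) * s x))
     (\<lambda>x. (1 / (2 * \<omega>)) * ((- \<omega> * exp (- (\<omega> * complex_of_real x)) * p x - r x) - (\<omega> * exp (\<omega> * complex_of_real x) * s x - r x)))"
    by (intro ipair_cmult ipair_diff' A B)
  then show "ipair w w1"
    by (rule ipair_cong') (use w0 in \<open>simp_all add: w_def w1_def field_simps\<close>)
  have "ipair (\<lambda>x. (- 1 / 2) * (exp (- (\<omega> * complex_of_real x)) * p x + exp (\<omega> * complex_of_real x) * s x))
     (\<lambda>x. (- 1 / 2) * ((- \<omega> * exp (- (\<omega> * complex_of_real x)) * p x - r x) + (\<omega> * exp (\<omega> * complex_of_real x) * s x - r x)))"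
    by (intro ipair_cmult ipair_add A B)
  then show "ipair w1 (\<lambda>x. \<omega>\<^sup>2 * w x + r x)"
    by (rule ipair_cong') (use w0 in \<open>simp_all add: w_def w1_def field_simps power2_eq_square\<close>)
qed

text \<open>The matrix \<open>eps_mat\<close> times \<open>Q\<close> in the basis
  \<open>e_plus\<close>, \<open>e_minus\<close>.\<close>

definition Rq :: "(real => complex) => real => complex^2 => complex^2" where
  "Rq q t z = vector [Re (q t) * z $ 1 - \<i> * Im (q t) * z $ 2, Re (q t) * z $ 2 - \<i> * Im (q t) * z $ 1]"

lemma Rq_nth [simp]: "Rq q t z $ 1 = Re (q t) * z $ 1 - \<i> * Im (q t) * z $ 2"
  "Rq q t z $ 2 = Re (q t) * z $ 2 - \<i> * Im (q t) * z $ 1"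
  by (simp_all add: Rq_def)

lemma Rq_bound: "cmod (Rq q t z $ i) \<le> 2 * cmod (q t) * norm z"
proof -
  have n: "cmod (z $ i) \<le> norm z" for i by (rule Finite_Cartesian_Product.norm_nth_le)
  have "cmod (complex_of_real a * z $ i - \<i> * complex_of_real b * z $ j) \<le> 2 * cmod (q t) * norm z"
    if "\<bar>a\<bar> \<le> cmod (q t)" "\<bar>b\<bar> \<le> cmod (q t)" for a b i j
  proof -
    have "cmod (complex_of_real a * z $ i - \<i> * complex_of_real b * z $ j) \<le> \<bar>a\<bar> * cmod (z $ i) + \<bar>b\<bar> * cmod (z $ j)"
      by (rule order_trans[OF norm_triangle_ineq4]) (simp add: norm_mult)
    also have "\<dots> \<le> cmod (q t) * norm z + cmod (q t) * norm z" by (intro add_mono mult_mono n that) auto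
    finally show ?thesis by (simp add: algebra_simps)
  qed
  then show ?thesis using exhaust_2[of i] abs_Re_le_cmod[of "q t"] abs_Im_le_cmod[of "q t"] by auto
qed

text \<open>\<open>exp (\<eta> * s) * sinh (\<omega> * s) / \<omega>\<close>: the Green function for
  integration from infinity, conjugated by the exponential that normalises the unknown.\<close>

definition Kn :: "complex => complex => real => complex" where
  "Kn \<omega> \<eta> s = (exp ((\<omega> + \<eta>) * s) - exp ((- \<omega> + \<eta>) * s)) / (2 * \<omega>)"

text \<open>
  With \<open>F = u e_plus + v e_minus\<close>, the equation reads \<open>u'' = - \<kappa>\<^sup>2 u + r\<^sub>1\<close>, \<open>v'' = \<kappa>\<^sup>2 v + r\<^sub>2\<close>, where
  \<open>r = Rq q t (u, v)\<close> and \<open>l = \<kappa>\<^sup>2\<close>. The locale treats both \<open>\<sigma> = -1\<close> and \<open>\<sigma> = \<i>\<close>: the unknown is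
  \<open>(u, v) / exp (\<sigma>\<kappa>x)\<close>. For \<open>\<sigma> = \<i>\<close> the second component uses, to the right of \<open>x0\<close>, the decaying Green
  function instead of integration from infinity (this is the effect of the term with \<open>c\<close>).
\<close>

locale levinson =
  fixes q :: "real => complex" and k0 k1 x0 :: real and \<sigma> c :: complex and y0 :: "complex^2" and P :: "complex set"
  assumes q: "integrable halfline q" and k0: "k0 > 0" and k1: "k1 \<ge> 0" and x0: "x0 \<ge> 0"
    and P: "\<And>\<kappa>. \<kappa> \<in> P ==> k0 \<le> Re \<kappa> \<and> Re \<kappa> \<le> k1 \<and> 0 \<le> Im \<kappa> \<and> Im \<kappa> < Re \<kappa>"
    and small: "16 / k0 * integral {x0<..} (\<lambda>t. cmod (q t)) \<le> 1"
    and sig: "(\<sigma> = -1 \<and> c = 0 \<and> y0 = vector [0, 1]) \<or> (\<sigma> = \<i> \<and> c = 1 \<and> y0 = vector [1, 0])"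
begin

lemma P0: "\<kappa> \<in> P ==> \<kappa> \<noteq> 0" "\<kappa> \<in> P ==> k0 \<le> cmod \<kappa>"
  using P[of \<kappa>] k0 complex_Re_le_cmod[of \<kappa>] by auto

text \<open>Characteristic exponents of the free equations of the two components: the squares are
  \<open>- \<kappa>^2\<close> and \<open>\<kappa>^2\<close>.\<close>

definition "om i \<kappa> = (if i = (1::2) then \<i> * \<kappa> else \<kappa>)"
definition "cc i = (if i = (1::2) then 0 else c)"

lemma om0: "\<kappa> \<in> P ==> om i \<kappa> \<noteq> 0" "\<kappa> \<in> P ==> cmod (om i \<kappa>) = cmod \<kappa>"
  using P0 by (auto simp: om_def norm_mult)

lemma sigma_om: "\<sigma>\<^sup>2 * \<kappa>\<^sup>2 * y0 $ i = (om i \<kappa>)\<^sup>2 * y0 $ i"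
  using sig exhaust_2[of i] by (auto simp: om_def power_mult_distrib)

text \<open>This is where the sector \<open>0 \<le> Im \<kappa> < Re \<kappa>\<close> matters. The
  only exponent with positive real part is \<open>\<kappa> + \<i> * \<kappa>\<close>, in the second
  component for \<open>\<sigma> = \<i>\<close>.\<close>

lemma Re_exponents:
  assumes "\<kappa> \<in> P"
  shows "Re (- om i \<kappa> + \<sigma> * \<kappa>) \<le> 0" "cc i = 0 ==> Re (om i \<kappa> + \<sigma> * \<kappa>) \<le> 0"
    "cc i \<noteq> 0 ==> 0 < Re (om i \<kappa> + \<sigma> * \<kappa>) \<and> cc i = 1" "Re (om i \<kappa> + \<sigma> * \<kappa>) \<le> k1"
  using P[OF assms] k0 sig exhaust_2[of i] by (auto simp: om_def cc_def)

text \<open>If \<open>cc i = 1\<close>, the subtracted term cancels the growing exponential for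
  \<open>t > x\<close>, \<open>t > x0\<close>, and for \<open>x0 < t < x\<close> it leaves the same
  exponential at a negative argument, where it decays. Up to \<open>x0\<close> the growth is bounded
  and nothing is subtracted.\<close>

definition kk :: "2 => complex => real => real => complex" where
  "kk i \<kappa> x t = (if t > x then Kn (om i \<kappa>) (\<sigma> * \<kappa>) (t - x) else 0)
     - (if t > x0 then cc i * exp ((om i \<kappa> + \<sigma> * \<kappa>) * (t - x)) / (2 * om i \<kappa>) else 0)"

definition "C0 = exp (k1 * x0) / k0"
text \<open>Up to \<open>x0\<close> the kernel is of Volterra type and its growing exponential is at
  most \<open>exp (k1 * x0)\<close>; beyond \<open>x0\<close> only exponentials bounded by 1
  remain.\<close>

definition "cm x t = (if t \<le> x0 then (if x \<le> t then C0 else 0) else 1 / k0)"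

lemma C0: "C0 > 0" "1 / k0 \<le> C0"
  using k0 k1 x0 by (simp_all add: C0_def divide_right_mono)

lemma kk_bound:
  assumes \<kappa>: "\<kappa> \<in> P" and x: "x \<ge> 0"
  shows "cmod (kk i \<kappa> x t) \<le> cm x t"
proof -
  define s where "s = t - x"
  define a where "a = om i \<kappa> + \<sigma> * \<kappa>"
  define b where "b = - om i \<kappa> + \<sigma> * \<kappa>"
  note R = Re_exponents[OF \<kappa>, of i, folded a_def b_def]
  have n: "cmod (exp (z * complex_of_real s)) = exp (Re z * s)" for z :: complex by (simp add: norm_exp_eq_Re)
  have d: "cmod (2 * om i \<kappa>) = 2 * cmod \<kappa>" by (simp add: norm_mult om0[OF \<kappa>])
  have \<kappa>0: "cmod \<kappa> > 0" "k0 \<le> cmod \<kappa>" using P0[OF \<kappa>] by auto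
  have fin: "cmod (z / (2 * om i \<kappa>)) \<le> B / k0" if "cmod z \<le> 2 * B" "B \<ge> 0" for z B
  proof -
    have "cmod (z / (2 * om i \<kappa>)) \<le> 2 * B / (2 * cmod \<kappa>)" unfolding norm_divide d using \<kappa>0 that by (intro divide_right_mono) auto
    also have "\<dots> \<le> B / k0" using \<kappa>0 k0 that by (simp add: frac_le)
    finally show ?thesis .
  qed
  have kk: "kk i \<kappa> x t = (if t > x then (exp (a * s) - exp (b * s)) / (2 * om i \<kappa>) else 0) - (if t > x0 then cc i * exp (a * s) / (2 * om i \<kappa>) else 0)"
    by (simp add: kk_def Kn_def a_def b_def s_def)
  have eb: "cmod (exp (b * s)) \<le> 1" if "t > x" using R(1) that by (simp add: n s_def mult_nonpos_nonneg)
  show ?thesis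
  proof (cases "t \<le> x0")
    case True
    show ?thesis
    proof (cases "t > x")
      case t: True
      have "Re a * s \<le> k1 * x0"
      proof -
        have "Re a * s \<le> k1 * s" using R(4) t by (intro mult_right_mono) (auto simp: s_def)
        also have "\<dots> \<le> k1 * x0" using k1 True x t by (intro mult_left_mono) (auto simp: s_def)
        finally show ?thesis .
      qed
      then have "cmod (exp (a * s)) \<le> exp (k1 * x0)" by (simp add: n)
      moreover have "1 \<le> exp (k1 * x0)" using k1 x0 by simp
      ultimately have "cmod (exp (a * s) - exp (b * s)) \<le> 2 * exp (k1 * x0)"
        using norm_triangle_ineq4[of "exp (a * s)" "exp (b * s)"] eb[OF t] by linarith
      from fin[OF this] show ?thesis using t True by (simp add: kk cm_def C0_def)
    next
      case False
      then show ?thesis using True C0 by (simp add: kk cm_def)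
    qed
  next
    case False
    then have t0: "t > x0" by simp
    have "cmod (kk i \<kappa> x t) \<le> 1 / k0"
    proof (cases "cc i = 0")
      case True
      show ?thesis
      proof (cases "t > x")
        case t: True
        have "cmod (exp (a * s)) \<le> 1" using R(2)[OF True] t by (simp add: n s_def mult_nonpos_nonneg)
        then have "cmod (exp (a * s) - exp (b * s)) \<le> 2 * 1"
          using norm_triangle_ineq4[of "exp (a * s)" "exp (b * s)"] eb[OF t] by linarith
        from fin[OF this] show ?thesis using t True by (simp add: kk)
      next
        case False then show ?thesis using True k0 by (simp add: kk)
      qed
    next
      case nz: False
      then have c1: "cc i = 1" and a0: "0 < Re a" using R(3) by auto
      show ?thesis
      proof (cases "t > x")
        case t: True
        have "kk i \<kappa> x t = - exp (b * s) / (2 * om i \<kappa>)" using t t0 c1 by (simp add: kk diff_divide_distrib)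
        moreover have "cmod (- exp (b * s)) \<le> 2 * 1" using eb[OF t] unfolding norm_minus_cancel by linarith
        from fin[OF this] have "cmod (- exp (b * s) / (2 * om i \<kappa>)) \<le> 1 / k0" by simp
        ultimately show ?thesis by simp
      next
        case False
        then have "cmod (exp (a * s)) \<le> 1" using a0 by (simp add: n s_def mult_nonneg_nonpos)
        then have "cmod (- exp (a * s)) \<le> 2 * 1" unfolding norm_minus_cancel by linarith
        from fin[OF this] have "cmod (- exp (a * s) / (2 * om i \<kappa>)) \<le> 1 / k0" by simp
        moreover have "kk i \<kappa> x t = - exp (a * s) / (2 * om i \<kappa>)" using False t0 c1 by (simp add: kk)
        ultimately show ?thesis by simp
      qed
    qed
    then show ?thesis using False by (simp add: cm_def)
  qed
qed

definition N :: "complex => real => real => complex^2 => complex^2" where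
  "N \<kappa> x t z = (\<chi> i. kk i \<kappa> x t * Rq q t z $ i)"

lemma N_nth [simp]: "N \<kappa> x t z $ i = kk i \<kappa> x t * Rq q t z $ i"
  by (simp add: N_def)

text \<open>The 4 is 2 from \<open>Rq_bound\<close> times 2 from estimating the norm by the two
  components.\<close>

definition "m x t = 4 * cm x t * cmod (q t)"
definition "Mq x = integral {0..x} (\<lambda>t. cmod (q t))"
text \<open>On the Volterra part \<rho> satisfies
  \<open>\<rho>' = - 16 * C0 * cmod q * \<rho>\<close>, so there \<open>m x t * \<rho> t\<close>
  integrates to \<open>(\<rho> x - 1) / 4\<close>. To the right of \<open>x0\<close> the weight is 1
  and the small tail contributes at most 1/4. Together this is below
  \<open>\<rho> x / 2\<close>.\<close>

definition "\<rho> x = exp (16 * C0 * (Mq x0 - Mq (min x x0)))"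

lemma qn: "a \<ge> 0 ==> (\<lambda>t. cmod (q t)) absolutely_integrable_on {a..b}"
  using absolutely_integrable_norm[OF integrable_q[OF q]] by (simp add: o_def)

lemma qn_tail: "(\<lambda>t. cmod (q t)) absolutely_integrable_on {0..}" "(\<lambda>t. cmod (q t)) absolutely_integrable_on {x0<..}"
proof -
  show *: "(\<lambda>t. cmod (q t)) absolutely_integrable_on {0..}"
  proof -
    have "q absolutely_integrable_on {0..}" using q integrable_halfline_iff[of q] by simp
    from absolutely_integrable_norm[OF this] show ?thesis by (simp add: o_def)
  qed
  show "(\<lambda>t. cmod (q t)) absolutely_integrable_on {x0<..}"
    by (rule set_integrable_subset[OF *]) (use x0 in auto)
qed

lemma ipair_Mq: "ipair Mq (\<lambda>t. cmod (q t))"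
  unfolding Mq_def[abs_def] by (rule ipair_from_integrable) (simp add: qn)

lemma Mq_mono: "0 \<le> x ==> x \<le> y ==> Mq x \<le> Mq y"
  using has_integral_nonneg[OF ipair_diff[OF ipair_Mq, of x y]] by simp

lemma rho: "\<rho> x \<ge> 0" "x \<ge> 0 ==> \<rho> x \<le> \<rho> 0" "x \<ge> 0 ==> 1 \<le> \<rho> x" "t \<ge> x0 ==> \<rho> t = 1"
proof -
  show "\<rho> x \<ge> 0" by (simp add: \<rho>_def)
  show "\<rho> x \<le> \<rho> 0" if "x \<ge> 0"
    using Mq_mono[of 0 "min x x0"] that x0 C0 by (simp add: \<rho>_def)
  show "1 \<le> \<rho> x" if "x \<ge> 0"
    using Mq_mono[of "min x x0" x0] that x0 C0 by (simp add: \<rho>_def)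
  show "\<rho> t = 1" if "t \<ge> x0" using that by (simp add: \<rho>_def min_absorb2)
qed

lemma m_rho_integral:
  assumes x: "x \<ge> 0"
  shows "((\<lambda>t. m x t * \<rho> t) has_integral (\<rho> x - 1) / 4 + 4 / k0 * integral {x0<..} (\<lambda>t. cmod (q t))) {0..}"
proof -
  have E: "ipair (\<lambda>t. exp (16 * C0 * (Mq x0 - Mq t))) (\<lambda>t. exp (16 * C0 * (Mq x0 - Mq t)) * (16 * C0 * (0 - cmod (q t))))"
    by (rule ipair_exp[OF ipair_linear[OF ipair_diff'[OF ipair_const ipair_Mq] bounded_linear_mult_right]])
  have 1: "((\<lambda>t. 4 * C0 * cmod (q t) * \<rho> t) has_integral (\<rho> x - 1) / 4) {x..x0}"
  proof (cases "x \<le> x0")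
    case True
    have "((\<lambda>t. (- 1 / 4) * (exp (16 * C0 * (Mq x0 - Mq t)) * (16 * C0 * (0 - cmod (q t))))) has_integral
        (- 1 / 4) * (exp (16 * C0 * (Mq x0 - Mq x0)) - exp (16 * C0 * (Mq x0 - Mq x)))) {x..x0}"
      by (rule has_integral_mult_right[OF ipair_diff[OF E x True]])
    then have "((\<lambda>t. 4 * C0 * cmod (q t) * exp (16 * C0 * (Mq x0 - Mq t))) has_integral (\<rho> x - 1) / 4) {x..x0}"
      using True by (simp add: \<rho>_def min_absorb1 algebra_simps diff_divide_distrib)
    then show ?thesis
      by (rule has_integral_eq[rotated]) (simp add: \<rho>_def min_absorb1)
  next
    case False
    then show ?thesis using rho(4)[of x] by simp
  qed
  have 2: "((\<lambda>t. 4 / k0 * cmod (q t)) has_integral 4 / k0 * integral {x0<..} (\<lambda>t. cmod (q t))) {x0<..}"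
    by (intro has_integral_mult_right integrable_integral set_lebesgue_integral_eq_integral(1) qn_tail)
  have i1: "((\<lambda>t. if t \<in> {x..x0} then 4 * C0 * cmod (q t) * \<rho> t else 0) has_integral (\<rho> x - 1) / 4) {0..}"
    by (subst has_integral_restrict) (use 1 x in auto)
  have i2: "((\<lambda>t. if t \<in> {x0<..} then 4 / k0 * cmod (q t) else 0) has_integral 4 / k0 * integral {x0<..} (\<lambda>t. cmod (q t))) {0..}"
    by (subst has_integral_restrict) (use 2 x0 in auto)
  show ?thesis
    by (rule has_integral_eq[OF _ has_integral_add[OF i1 i2]])
      (auto simp: m_def cm_def rho(4))
qed

lemma m_nonneg: "m x t \<ge> 0" using C0 k0 by (simp add: m_def cm_def)

lemma m_rho_integrable: "x \<ge> 0 ==> integrable \<mu> (\<lambda>t. m x t * \<rho> t)"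
  unfolding integrable_\<mu>_iff using m_rho_integral[of x] m_nonneg rho(1)
  by (intro nonnegative_absolutely_integrable_1) auto

lemma Kn_continuous:
  assumes "\<omega> \<noteq> 0" "ws \<longlonglongrightarrow> \<omega>" "es \<longlonglongrightarrow> \<eta>" "ss \<longlonglongrightarrow> s"
  shows "(\<lambda>n. Kn (ws n) (es n) (ss n)) \<longlonglongrightarrow> Kn \<omega> \<eta> s"
  unfolding Kn_def using assms by (intro tendsto_intros) auto

lemma om_tendsto: "\<kappa>s \<longlonglongrightarrow> \<kappa> ==> (\<lambda>n. om i (\<kappa>s n)) \<longlonglongrightarrow> om i \<kappa>"
  by (auto simp: om_def intro!: tendsto_intros)

lemma kk_continuous:
  assumes \<kappa>: "\<kappa> \<in> P" and t: "t \<noteq> x" and l: "\<kappa>s \<longlonglongrightarrow> \<kappa>" "xs \<longlonglongrightarrow> x"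
  shows "(\<lambda>n. kk i (\<kappa>s n) (xs n) t) \<longlonglongrightarrow> kk i \<kappa> x t"
proof -
  have "\<forall>\<^sub>F n in sequentially. (t > xs n) = (t > x)"
  proof (cases "t > x")
    case True
    then show ?thesis using order_tendstoD(2)[OF l(2), of t] by (auto elim: eventually_mono)
  next
    case False
    then have "x > t" using t by simp
    then show ?thesis using order_tendstoD(1)[OF l(2), of t] by (auto elim: eventually_mono)
  qed
  moreover have "(\<lambda>n. (if t > x then Kn (om i (\<kappa>s n)) (\<sigma> * \<kappa>s n) (t - xs n) else 0)
     - (if t > x0 then cc i * exp ((om i (\<kappa>s n) + \<sigma> * \<kappa>s n) * (t - xs n)) / (2 * om i (\<kappa>s n)) else 0)) \<longlonglongrightarrow> kk i \<kappa> x t"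
  proof -
    have "(\<lambda>n. if t > x then Kn (om i (\<kappa>s n)) (\<sigma> * \<kappa>s n) (t - xs n) else 0) \<longlonglongrightarrow> (if t > x then Kn (om i \<kappa>) (\<sigma> * \<kappa>) (t - x) else 0)"
      using om0(1)[OF \<kappa>] by (auto intro!: Kn_continuous om_tendsto tendsto_intros l)
    moreover have "(\<lambda>n. if t > x0 then cc i * exp ((om i (\<kappa>s n) + \<sigma> * \<kappa>s n) * complex_of_real (t - xs n)) / (2 * om i (\<kappa>s n)) else 0)
       \<longlonglongrightarrow> (if t > x0 then cc i * exp ((om i \<kappa> + \<sigma> * \<kappa>) * complex_of_real (t - x)) / (2 * om i \<kappa>) else 0)"
      using om0(1)[OF \<kappa>] by (cases "t > x0") (auto intro!: tendsto_intros om_tendsto l)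
    ultimately show ?thesis unfolding kk_def by (rule tendsto_diff)
  qed
  ultimately show ?thesis
    by (elim Lim_transform_eventually) (auto simp: kk_def elim: eventually_mono)
qed

lemma kk_measurable: "(\<lambda>t. kk i \<kappa> x t) \<in> borel_measurable \<mu>"
  by (rule borel_measurable_\<mu>) (unfold kk_def Kn_def, measurable)

lemma q_measurable: "q \<in> borel_measurable \<mu>"
  using q integrable_halfline_iff[of q] integrable_\<mu>_iff[of q] by (auto dest: borel_measurable_integrable)

lemma Rq_measurable:
  assumes "continuous_on {0..} Y"
  shows "(\<lambda>t. Rq q t (Y t) $ i) \<in> borel_measurable \<mu>"
proof -
  have [measurable]: "q \<in> borel_measurable \<mu>" by (rule q_measurable)
  have [measurable]: "(\<lambda>t. Y t $ j) \<in> borel_measurable \<mu>" for j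
    by (intro continuous_measurable_\<mu> continuous_intros assms)
  show ?thesis using exhaust_2[of i] by (elim disjE; simp; measurable)
qed

lemma vec2_measurable:
  assumes "\<And>i. (\<lambda>t. f t $ i :: complex) \<in> borel_measurable A"
  shows "(f :: real => complex^2) \<in> borel_measurable A"
proof -
  have "(\<lambda>t. axis j (f t $ j) :: complex^2) \<in> borel_measurable A" for j
    by (rule measurable_compose[OF assms borel_measurable_continuous_onI])
      (simp add: linear_continuous_on bounded_linear_axis)
  then have "(\<lambda>t. axis 1 (f t $ 1) + axis 2 (f t $ 2) :: complex^2) \<in> borel_measurable A" by (intro borel_measurable_add)
  moreover have "(\<lambda>t. axis 1 (f t $ 1) + axis 2 (f t $ 2) :: complex^2) = f" by (auto simp: vec2_eq_iff axis_def)
  ultimately show ?thesis by simp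
qed

lemma normalized_solution:
  obtains Y where "continuous_on (P \<times> {0..}) (\<lambda>(\<kappa>, x). Y \<kappa> x)"
    "\<And>\<kappa> x. \<kappa> \<in> P ==> x \<ge> 0 ==> norm (Y \<kappa> x) \<le> 2 * \<rho> x"
    "\<And>\<kappa> x. \<kappa> \<in> P ==> x \<ge> 0 ==> integrable \<mu> (\<lambda>t. N \<kappa> x t (Y \<kappa> t))"
    "\<And>\<kappa> x. \<kappa> \<in> P ==> x \<ge> 0 ==> Y \<kappa> x = y0 + (LINT t|\<mu>. N \<kappa> x t (Y \<kappa> t))"
proof (rule neumann_series[of P N m \<rho> "\<rho> 0" "\<lambda>t. 4 * C0 * \<rho> 0 * cmod (q t)" y0 1])
  show "linear (N \<kappa> x t)" for \<kappa> x t
    by (rule linearI) (auto simp: vec2_eq_iff algebra_simps scaleR_conv_of_real[where 'a = complex])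
  show "norm (N \<kappa> x t z) \<le> m x t * norm z" if "\<kappa> \<in> P" "0 \<le> x" "0 \<le> t" for \<kappa> x t z
  proof -
    have "cmod (N \<kappa> x t z $ i) \<le> cm x t * (2 * cmod (q t) * norm z)" for i
      unfolding N_nth norm_mult
      by (rule mult_mono[OF kk_bound[OF that(1,2)] Rq_bound]) (use C0 k0 in \<open>auto simp: cm_def\<close>)
    from this[of 1] this[of 2] show ?thesis using norm_le_sum2[of "N \<kappa> x t z"] by (simp add: m_def)
  qed
  show "(LINT t|\<mu>. m x t * \<rho> t) \<le> \<rho> x / 2" if "0 \<le> x" for x
  proof -
    define I where "I = integral {x0<..} (\<lambda>t. cmod (q t))"
    have "4 / k0 * I = (16 / k0 * I) / 4" by simp
    then have "4 / k0 * I \<le> 1 / 4" using small by (simp add: I_def)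
    moreover have "(\<rho> x - 1) / 4 + J \<le> \<rho> x / 2" if "J \<le> 1 / 4" for J
      using rho(3)[OF \<open>0 \<le> x\<close>] that by (simp add: field_simps)
    ultimately show ?thesis
      unfolding integral_\<mu>[OF m_rho_integrable[OF that]] integral_unique[OF m_rho_integral[OF that]] I_def[symmetric]
      by blast
  qed
  show "m x t * \<rho> t \<le> 4 * C0 * \<rho> 0 * cmod (q t)" if "0 \<le> x" "0 \<le> t" for x t
  proof -
    have "cm x t \<le> C0" using C0 by (auto simp: cm_def)
    then have "m x t \<le> 4 * C0 * cmod (q t)" unfolding m_def by (intro mult_right_mono mult_left_mono) auto
    then have "m x t * \<rho> t \<le> (4 * C0 * cmod (q t)) * \<rho> 0"
      using rho(1,2) that C0 by (intro mult_mono) auto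
    then show ?thesis by (simp add: algebra_simps)
  qed
  show "integrable \<mu> (\<lambda>t. 4 * C0 * \<rho> 0 * cmod (q t))"
    using qn_tail(1) by (intro integrable_mult_right) (simp add: integrable_\<mu>_iff)
  show "(\<lambda>t. N \<kappa> x t (Y t)) \<in> borel_measurable \<mu>" if "continuous_on {0..} Y" for \<kappa> x Y
    by (rule vec2_measurable) (simp only: N_nth, intro borel_measurable_times kk_measurable Rq_measurable that)
  show "(\<lambda>n. N (\<kappa>s n) (xs n) t (zs n)) \<longlonglongrightarrow> N \<kappa> x t z"
    if "\<kappa> \<in> P" "t \<noteq> x" "\<kappa>s \<longlonglongrightarrow> \<kappa>" "xs \<longlonglongrightarrow> x" "zs \<longlonglongrightarrow> z" for \<kappa> x t \<kappa>s xs zs z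
  proof (rule vec_tendstoI)
    fix i
    have "(\<lambda>n. Rq q t (zs n) $ i) \<longlonglongrightarrow> Rq q t z $ i"
      using exhaust_2[of i] by (elim disjE; simp; intro tendsto_intros that)
    then show "(\<lambda>n. N (\<kappa>s n) (xs n) t (zs n) $ i) \<longlonglongrightarrow> N \<kappa> x t z $ i"
      unfolding N_nth by (intro tendsto_mult kk_continuous that)
  qed
  show "norm y0 \<le> 1 * \<rho> x" if "0 \<le> x" for x
  proof -
    have "norm y0 \<le> 1" using sig norm_le_sum2[of y0] by auto
    then show ?thesis using rho(3)[OF that] by simp
  qed
  show "\<rho> x \<ge> 0" "m x t \<ge> 0" for x t using rho(1) m_nonneg by auto
  show "\<rho> x \<le> \<rho> 0" if "0 \<le> x" for x using rho(2) that .
  show "integrable \<mu> (\<lambda>t. m x t * \<rho> t)" if "0 \<le> x" for x using m_rho_integrable that .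
qed (use that in auto)

end

section \<open>From the fixed point to solutions of the system\<close>

context levinson begin

context
  fixes Y
  assumes Yc: "continuous_on (P \<times> {0..}) (\<lambda>(\<kappa>, x). Y \<kappa> x)"
    and Yb: "\<And>\<kappa> x. \<kappa> \<in> P ==> x \<ge> 0 ==> norm (Y \<kappa> x) \<le> 2 * \<rho> x"
    and Yi: "\<And>\<kappa> x. \<kappa> \<in> P ==> x \<ge> 0 ==> integrable \<mu> (\<lambda>t. N \<kappa> x t (Y \<kappa> t))"
    and Ye: "\<And>\<kappa> x. \<kappa> \<in> P ==> x \<ge> 0 ==> Y \<kappa> x = y0 + (LINT t|\<mu>. N \<kappa> x t (Y \<kappa> t))"
begin

lemma Y_slice: assumes "\<kappa> \<in> P" shows "continuous_on {0..} (Y \<kappa>)"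
proof -
  have "continuous_on {0..} (\<lambda>x. (\<lambda>(\<kappa>, x). Y \<kappa> x) (\<kappa>, x))"
    by (rule continuous_on_compose2[OF Yc]) (use assms in \<open>auto intro!: continuous_intros\<close>)
  then show ?thesis by simp
qed

lemma Y_param: assumes "x \<ge> 0" shows "continuous_on P (\<lambda>\<kappa>. Y \<kappa> x)"
proof -
  have "continuous_on P (\<lambda>\<kappa>. (\<lambda>(\<kappa>, x). Y \<kappa> x) (\<kappa>, x))"
    by (rule continuous_on_compose2[OF Yc]) (use assms in \<open>auto intro!: continuous_intros\<close>)
  then show ?thesis by simp
qed

definition rr where "rr i \<kappa> t = exp (\<sigma> * \<kappa> * complex_of_real t) * Rq q t (Y \<kappa> t) $ i"

definition "dd i t = (if t > x0 then cc i else 0)"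

abbreviation (input) "ppi i \<kappa> x t \<equiv> ((if t > x then 1 else 0) - dd i t) * (exp (om i \<kappa> * complex_of_real t) * rr i \<kappa> t)"
abbreviation (input) "ssi i \<kappa> x t \<equiv> ((if t > x then 1 else 0) - 0) * (exp (- (om i \<kappa> * complex_of_real t)) * rr i \<kappa> t)"

text \<open>\<open>pp\<close> and \<open>ss\<close> are the coefficients of the two exponentials in
  variation of constants. The integrand of \<open>pp\<close> may grow; in that case
  \<open>dd\<close> replaces integration from infinity by integration from
  \<open>x0\<close>.\<close>

definition pp where "pp i \<kappa> x = (LINT t|\<mu>. ppi i \<kappa> x t)"
definition ss where "ss i \<kappa> x = (LINT t|\<mu>. ssi i \<kappa> x t)"

definition "B x = exp (k1 * max x x0)"

lemma coefficient_bounds: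
  assumes \<kappa>: "\<kappa> \<in> P" and t: "t \<ge> 0" and x: "x \<ge> 0"
  shows "cmod (((if t > x then 1 else 0) - dd i t) * exp ((om i \<kappa> + \<sigma> * \<kappa>) * complex_of_real t)) \<le> B x"
    and "cmod (exp ((- om i \<kappa> + \<sigma> * \<kappa>) * complex_of_real t)) \<le> 1"
proof -
  note R = Re_exponents[OF \<kappa>, of i]
  have n: "cmod (exp (z * complex_of_real t)) = exp (Re z * t)" for z :: complex by (simp add: norm_exp_eq_Re)
  show "cmod (exp ((- om i \<kappa> + \<sigma> * \<kappa>) * complex_of_real t)) \<le> 1"
    unfolding n using mult_nonpos_nonneg[OF R(1) t] by simp
  have B1: "1 \<le> B x" using k1 x by (simp add: B_def)
  show "cmod (((if t > x then 1 else 0) - dd i t) * exp ((om i \<kappa> + \<sigma> * \<kappa>) * complex_of_real t)) \<le> B x"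
  proof (cases "cc i = 0")
    case True
    have "exp (Re (om i \<kappa> + \<sigma> * \<kappa>) * t) \<le> 1" using mult_nonpos_nonneg[OF R(2)[OF True] t] by simp
    then have "cmod (exp ((om i \<kappa> + \<sigma> * \<kappa>) * complex_of_real t)) \<le> B x" unfolding n using B1 by (rule order_trans)
    then show ?thesis using True B1 by (simp add: dd_def)
  next
    case False
    then have c1: "cc i = 1" using R(3) by blast
    show ?thesis
    proof (cases "t \<le> max x x0")
      case True
      have "Re (om i \<kappa> + \<sigma> * \<kappa>) * t \<le> k1 * max x x0"
        using mult_mono[OF R(4) True k1 t] .
      then have "cmod (exp ((om i \<kappa> + \<sigma> * \<kappa>) * complex_of_real t)) \<le> B x" unfolding n B_def by simp
      then show ?thesis using B1 by (simp add: dd_def c1)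
    next
      case False
      then have "t > x" "t > x0" by auto
      then show ?thesis using B1 by (simp add: dd_def c1)
    qed
  qed
qed

lemma Rq_Y_bound: assumes "\<kappa> \<in> P" "t \<ge> 0" shows "cmod (Rq q t (Y \<kappa> t) $ i) \<le> 4 * \<rho> 0 * cmod (q t)"
proof -
  have "norm (Y \<kappa> t) \<le> 2 * \<rho> 0" using Yb[OF assms] rho(2)[OF assms(2)] by simp
  then have "2 * cmod (q t) * norm (Y \<kappa> t) \<le> 2 * cmod (q t) * (2 * \<rho> 0)" by (intro mult_left_mono) auto
  then show ?thesis using Rq_bound[of q t "Y \<kappa> t" i] by (simp add: algebra_simps)
qed

lemma integrable_q_multiple: "integrable \<mu> (\<lambda>t. C * cmod (q t))"
  using qn_tail(1) by (intro integrable_mult_right) (simp add: integrable_\<mu>_iff)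

lemma pp_integrand:
  assumes \<kappa>: "\<kappa> \<in> P" and x: "x \<ge> 0"
  shows "(\<lambda>t. ppi i \<kappa> x t) \<in> borel_measurable \<mu>"
    and "t \<ge> 0 ==> cmod (ppi i \<kappa> x t) \<le> B x * (4 * \<rho> 0) * cmod (q t)"
    and "integrable \<mu> (\<lambda>t. ppi i \<kappa> x t)"
proof -
  have eq: "ppi i \<kappa> x t
     = (((if t > x then 1 else 0) - dd i t) * exp ((om i \<kappa> + \<sigma> * \<kappa>) * complex_of_real t)) * Rq q t (Y \<kappa> t) $ i" for t
    by (simp add: rr_def distrib_right exp_add)
  show m: "(\<lambda>t. ppi i \<kappa> x t) \<in> borel_measurable \<mu>"
    unfolding eq
    by (intro borel_measurable_times Rq_measurable[OF Y_slice[OF \<kappa>]] borel_measurable_\<mu>) (unfold dd_def, measurable)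
  show b: "cmod (ppi i \<kappa> x t) \<le> B x * (4 * \<rho> 0) * cmod (q t)"
    if t: "t \<ge> 0" for t
  proof -
    have "B x * (4 * \<rho> 0 * cmod (q t)) = B x * (4 * \<rho> 0) * cmod (q t)" by simp
    then show ?thesis
      unfolding eq norm_mult[of _ "Rq q t (Y \<kappa> t) $ i"]
      using mult_mono[OF coefficient_bounds(1)[OF \<kappa> t x, of i] Rq_Y_bound[OF \<kappa> t, of i]] by (simp add: B_def)
  qed
  show "integrable \<mu> (\<lambda>t. ppi i \<kappa> x t)"
    by (rule Bochner_Integration.integrable_bound[OF integrable_q_multiple m], rule AE_I2)
      (rule order_trans[OF b abs_ge_self[THEN order_trans[OF _ order_refl]], unfolded real_norm_def[symmetric]], simp)
qed

lemma ss_integrand: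
  assumes \<kappa>: "\<kappa> \<in> P" and x: "x \<ge> 0"
  shows "(\<lambda>t. ssi i \<kappa> x t) \<in> borel_measurable \<mu>"
    and "t \<ge> 0 ==> cmod (ssi i \<kappa> x t) \<le> 4 * \<rho> 0 * cmod (q t)"
    and "integrable \<mu> (\<lambda>t. ssi i \<kappa> x t)"
proof -
  have eq: "ssi i \<kappa> x t
     = ((if t > x then 1 else 0) * exp ((- om i \<kappa> + \<sigma> * \<kappa>) * complex_of_real t)) * Rq q t (Y \<kappa> t) $ i" for t
  proof -
    have "exp ((- om i \<kappa> + \<sigma> * \<kappa>) * complex_of_real t) = exp (- (om i \<kappa> * complex_of_real t)) * exp (\<sigma> * \<kappa> * complex_of_real t)"
      by (simp add: algebra_simps flip: exp_add)
    then show ?thesis by (simp add: rr_def)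
  qed
  show m: "(\<lambda>t. ssi i \<kappa> x t) \<in> borel_measurable \<mu>"
    unfolding eq
    by (intro borel_measurable_times Rq_measurable[OF Y_slice[OF \<kappa>]] borel_measurable_\<mu>) measurable
  show b: "cmod (ssi i \<kappa> x t) \<le> 4 * \<rho> 0 * cmod (q t)"
    if t: "t \<ge> 0" for t
  proof -
    have "cmod ((if t > x then 1 else 0) * exp ((- om i \<kappa> + \<sigma> * \<kappa>) * complex_of_real t)) \<le> 1"
      using coefficient_bounds(2)[OF \<kappa> t x, of i] by simp
    from mult_mono[OF this Rq_Y_bound[OF \<kappa> t, of i]] show ?thesis
      unfolding eq norm_mult[of _ "Rq q t (Y \<kappa> t) $ i"] by simp
  qed
  show "integrable \<mu> (\<lambda>t. ssi i \<kappa> x t)"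
    by (rule Bochner_Integration.integrable_bound[OF integrable_q_multiple m], rule AE_I2)
      (rule order_trans[OF b abs_ge_self[THEN order_trans[OF _ order_refl]], unfolded real_norm_def[symmetric]], simp)
qed

definition ww where "ww i \<kappa> x = (exp (- (om i \<kappa> * complex_of_real x)) * pp i \<kappa> x - exp (om i \<kappa> * complex_of_real x) * ss i \<kappa> x) / (2 * om i \<kappa>)"
definition ww1 where "ww1 i \<kappa> x = - (exp (- (om i \<kappa> * complex_of_real x)) * pp i \<kappa> x + exp (om i \<kappa> * complex_of_real x) * ss i \<kappa> x) / 2"

lemma ww_ode:
  assumes "\<kappa> \<in> P"
  shows "ipair (ww i \<kappa>) (ww1 i \<kappa>)" "ipair (ww1 i \<kappa>) (\<lambda>x. (om i \<kappa>)\<^sup>2 * ww i \<kappa> x + rr i \<kappa> x)"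
proof -
  have p: "ipair (pp i \<kappa>) (\<lambda>t. - (exp (om i \<kappa> * complex_of_real t) * rr i \<kappa> t))"
    unfolding pp_def[abs_def] by (rule tail_ipair) (rule pp_integrand[OF assms])
  have s: "ipair (ss i \<kappa>) (\<lambda>t. - (exp (- (om i \<kappa> * complex_of_real t)) * rr i \<kappa> t))"
    unfolding ss_def[abs_def] by (rule tail_ipair) (rule ss_integrand[OF assms])
  show "ipair (ww i \<kappa>) (ww1 i \<kappa>)" "ipair (ww1 i \<kappa>) (\<lambda>x. (om i \<kappa>)\<^sup>2 * ww i \<kappa> x + rr i \<kappa> x)"
    unfolding ww_def[abs_def] ww1_def[abs_def] using variation_of_constants[OF p s om0(1)[OF assms]] by auto
qed

definition uu where "uu i \<kappa> x = exp (\<sigma> * \<kappa> * complex_of_real x) * Y \<kappa> x $ i"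
definition gg where "gg i \<kappa> x = \<sigma> * \<kappa> * exp (\<sigma> * \<kappa> * complex_of_real x) * y0 $ i + ww1 i \<kappa> x"

text \<open>The kernel splits into two products of a function of \<open>x\<close> and a function of
  \<open>t\<close>. This turns the fixed point equation into a formula of variation of constants, so
  the differential equation follows without differentiating under the integral.\<close>

lemma uu_eq:
  assumes \<kappa>: "\<kappa> \<in> P" and x: "x \<ge> 0"
  shows "uu i \<kappa> x = exp (\<sigma> * \<kappa> * complex_of_real x) * y0 $ i + ww i \<kappa> x"
proof -
  have "Y \<kappa> x $ i = y0 $ i + (LINT t|\<mu>. N \<kappa> x t (Y \<kappa> t)) $ i" using Ye[OF \<kappa> x] by simp
  also have "(LINT t|\<mu>. N \<kappa> x t (Y \<kappa> t)) $ i = (LINT t|\<mu>. kk i \<kappa> x t * Rq q t (Y \<kappa> t) $ i)"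
    using integral_bounded_linear[OF bounded_linear_vec_nth Yi[OF \<kappa> x], of i] by simp
  finally have "uu i \<kappa> x = exp (\<sigma> * \<kappa> * complex_of_real x) * y0 $ i + exp (\<sigma> * \<kappa> * complex_of_real x) * (LINT t|\<mu>. kk i \<kappa> x t * Rq q t (Y \<kappa> t) $ i)"
    by (simp add: uu_def distrib_left)
  also have "exp (\<sigma> * \<kappa> * complex_of_real x) * (LINT t|\<mu>. kk i \<kappa> x t * Rq q t (Y \<kappa> t) $ i) = (LINT t|\<mu>. exp (\<sigma> * \<kappa> * complex_of_real x) * (kk i \<kappa> x t * Rq q t (Y \<kappa> t) $ i))"
    by (rule integral_mult_right_zero[symmetric])
  also have "\<dots> = (LINT t|\<mu>. (exp (- (om i \<kappa> * complex_of_real x)) / (2 * om i \<kappa>)) * (ppi i \<kappa> x t)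
      - (exp (om i \<kappa> * complex_of_real x) / (2 * om i \<kappa>)) * (ssi i \<kappa> x t))"
  proof (rule Bochner_Integration.integral_cong[OF refl])
    fix t
    define X where "X = complex_of_real x"
    define T where "T = complex_of_real t"
    define w where "w = om i \<kappa>"
    define e where "e = \<sigma> * \<kappa>"
    have w0: "w \<noteq> 0" using om0[OF \<kappa>] by (simp add: w_def)
    have 1: "exp (e * X) * exp ((w + e) * (T - X)) = exp (- (w * X)) * (exp (w * T) * exp (e * T))"
      "exp (e * X) * exp ((- w + e) * (T - X)) = exp (w * X) * (exp (- (w * T)) * exp (e * T))"
      by (simp_all add: algebra_simps flip: exp_add)
    have Kn': "exp (e * X) * Kn w e (t - x) = (exp (- (w * X)) * (exp (w * T) * exp (e * T)) - exp (w * X) * (exp (- (w * T)) * exp (e * T))) / (2 * w)"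
      unfolding Kn_def 1[symmetric] by (simp add: T_def X_def right_diff_distrib)
    have "exp (e * X) * kk i \<kappa> x t = (if t > x then exp (e * X) * Kn w e (t - x) else 0) - dd i t * (exp (e * X) * exp ((w + e) * (T - X))) / (2 * w)"
      by (simp add: kk_def dd_def right_diff_distrib w_def e_def T_def X_def)
    also have "\<dots> = ((if t > x then 1 else 0) - dd i t) * (exp (- (w * X)) * (exp (w * T) * exp (e * T))) / (2 * w)
       - (if t > x then 1 else 0) * (exp (w * X) * (exp (- (w * T)) * exp (e * T))) / (2 * w)"
      unfolding Kn' 1 by (simp add: left_diff_distrib diff_divide_distrib)
    finally have k: "exp (e * X) * kk i \<kappa> x t = ((if t > x then 1 else 0) - dd i t) * (exp (- (w * X)) * (exp (w * T) * exp (e * T))) / (2 * w)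
       - (if t > x then 1 else 0) * (exp (w * X) * (exp (- (w * T)) * exp (e * T))) / (2 * w)" .
    show "exp (\<sigma> * \<kappa> * complex_of_real x) * (kk i \<kappa> x t * Rq q t (Y \<kappa> t) $ i)
      = (exp (- (om i \<kappa> * complex_of_real x)) / (2 * om i \<kappa>)) * (ppi i \<kappa> x t)
      - (exp (om i \<kappa> * complex_of_real x) / (2 * om i \<kappa>)) * (ssi i \<kappa> x t)"
      unfolding rr_def w_def[symmetric] e_def[symmetric] X_def[symmetric] T_def[symmetric] mult.assoc[symmetric, of "exp (e * X)"] k
      by (cases "t > x") (simp_all add: left_diff_distrib right_diff_distrib diff_divide_distrib mult_ac)
  qed
  also have "\<dots> = ww i \<kappa> x"
    unfolding ww_def pp_def ss_def
    using pp_integrand(3)[OF \<kappa> x, of i] ss_integrand(3)[OF \<kappa> x, of i]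
    by (subst Bochner_Integration.integral_diff) (auto simp: diff_divide_distrib)
  finally show ?thesis .
qed

lemma uu_ode:
  assumes \<kappa>: "\<kappa> \<in> P"
  shows "ipair (uu i \<kappa>) (gg i \<kappa>)" "ipair (gg i \<kappa>) (\<lambda>x. (om i \<kappa>)\<^sup>2 * uu i \<kappa> x + rr i \<kappa> x)"
proof -
  have e: "ipair (\<lambda>x. y0 $ i * exp (\<sigma> * \<kappa> * complex_of_real x)) (\<lambda>x. y0 $ i * (\<sigma> * \<kappa> * exp (\<sigma> * \<kappa> * complex_of_real x)))"
    by (rule ipair_cmult[OF ipair_exp_complex])
  have e1: "ipair (\<lambda>x. \<sigma> * \<kappa> * y0 $ i * exp (\<sigma> * \<kappa> * complex_of_real x)) (\<lambda>x. \<sigma> * \<kappa> * y0 $ i * (\<sigma> * \<kappa> * exp (\<sigma> * \<kappa> * complex_of_real x)))"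
    by (rule ipair_cmult[OF ipair_exp_complex])
  show "ipair (uu i \<kappa>) (gg i \<kappa>)"
    by (rule ipair_cong'[OF ipair_add[OF e ww_ode(1)[OF \<kappa>]]]) (auto simp: uu_eq[OF \<kappa>] gg_def)
  have sq: "\<sigma> * \<kappa> * y0 $ i * (\<sigma> * \<kappa> * z) = (om i \<kappa>)\<^sup>2 * (z * y0 $ i)" for z
    using sigma_om[of \<kappa> i] by (simp add: power2_eq_square algebra_simps)
  show "ipair (gg i \<kappa>) (\<lambda>x. (om i \<kappa>)\<^sup>2 * uu i \<kappa> x + rr i \<kappa> x)"
    by (rule ipair_cong'[OF ipair_add[OF e1 ww_ode(2)[OF \<kappa>]]])
      (simp_all add: uu_eq[OF \<kappa>] gg_def sq distrib_left)
qed

definition FF where "FF \<kappa> x = (vector [uu 1 \<kappa> x + uu 2 \<kappa> x, uu 1 \<kappa> x - uu 2 \<kappa> x] :: complex^2)"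
definition GG where "GG \<kappa> x = (vector [gg 1 \<kappa> x + gg 2 \<kappa> x, gg 1 \<kappa> x - gg 2 \<kappa> x] :: complex^2)"

lemma isol_FF: assumes \<kappa>: "\<kappa> \<in> P" shows "isol q (\<kappa>\<^sup>2) (FF \<kappa>) (GG \<kappa>)"
proof -
  have 1: "ipair (FF \<kappa>) (GG \<kappa>)"
    by (rule ipair_vec2) (auto simp: FF_def GG_def intro!: ipair_add ipair_diff' uu_ode[OF \<kappa>])
  have r: "rr 1 \<kappa> x = Re (q x) * uu 1 \<kappa> x - \<i> * Im (q x) * uu 2 \<kappa> x" "rr 2 \<kappa> x = Re (q x) * uu 2 \<kappa> x - \<i> * Im (q x) * uu 1 \<kappa> x" for x
    by (simp_all add: rr_def uu_def algebra_simps)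
  have o: "(om 1 \<kappa>)\<^sup>2 = - (\<kappa>\<^sup>2)" "(om 2 \<kappa>)\<^sup>2 = \<kappa>\<^sup>2" by (simp_all add: om_def power_mult_distrib)
  have qq: "q x = Re (q x) + \<i> * Im (q x)" "cnj (q x) = Re (q x) - \<i> * Im (q x)" for x
    by (simp_all add: complex_eq_iff)
  have 2: "ipair (GG \<kappa>) (rhs q (\<kappa>\<^sup>2) (FF \<kappa>))"
  proof (rule ipair_vec2)
    show "ipair (\<lambda>x. GG \<kappa> x $ 1) (\<lambda>x. rhs q (\<kappa>\<^sup>2) (FF \<kappa>) x $ 1)"
      by (rule ipair_cong'[OF ipair_add[OF uu_ode(2)[OF \<kappa>, of 1] uu_ode(2)[OF \<kappa>, of 2]]])
        (simp add: GG_def, simp add: FF_def o r qq(2) algebra_simps)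
    show "ipair (\<lambda>x. GG \<kappa> x $ 2) (\<lambda>x. rhs q (\<kappa>\<^sup>2) (FF \<kappa>) x $ 2)"
    proof (rule ipair_cong'[OF ipair_diff'[OF uu_ode(2)[OF \<kappa>, of 1] uu_ode(2)[OF \<kappa>, of 2]]])
      fix x
      show "rhs q (\<kappa>\<^sup>2) (FF \<kappa>) x $ 2 = (om 1 \<kappa>)\<^sup>2 * uu 1 \<kappa> x + rr 1 \<kappa> x - ((om 2 \<kappa>)\<^sup>2 * uu 2 \<kappa> x + rr 2 \<kappa> x)"
        unfolding rhs_nth o r by (subst qq(1)) (simp add: FF_def algebra_simps)
    qed (simp add: GG_def)
  qed
  show ?thesis using 1 2 by (simp add: isol_def)
qed

lemma FF_exp: "FF \<kappa> x = exp (\<sigma> * \<kappa> * complex_of_real x) *s vector [Y \<kappa> x $ 1 + Y \<kappa> x $ 2, Y \<kappa> x $ 1 - Y \<kappa> x $ 2]"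
  by (simp add: FF_def uu_def vec2_eq_iff algebra_simps)

lemma sqint_FF: assumes \<kappa>: "\<kappa> \<in> P" and R: "Re (\<sigma> * \<kappa>) < 0" shows "sqint (FF \<kappa>)"
proof -
  have c: "continuous_on {0..} (FF \<kappa>)" by (rule isol_continuous(1)[OF isol_FF[OF \<kappa>]])
  have "\<forall>\<^sub>F x in at_top. \<bar>(norm (FF \<kappa> x))\<^sup>2\<bar> \<le> (8 * \<rho> 0)\<^sup>2 * exp (- (- 2 * Re (\<sigma> * \<kappa>)) * x)"
  proof (rule eventually_at_top_linorderI[of 0])
    fix x :: real assume x: "0 \<le> x"
    have n: "cmod (Y \<kappa> x $ i) \<le> 2 * \<rho> 0" for i
      using Finite_Cartesian_Product.norm_nth_le[of "Y \<kappa> x" i] Yb[OF \<kappa> x] rho(2)[OF x] by simp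
    have "norm (vector [Y \<kappa> x $ 1 + Y \<kappa> x $ 2, Y \<kappa> x $ 1 - Y \<kappa> x $ 2] :: complex^2) \<le> 8 * \<rho> 0"
      using norm_le_sum2[of "vector [Y \<kappa> x $ 1 + Y \<kappa> x $ 2, Y \<kappa> x $ 1 - Y \<kappa> x $ 2]"] n[of 1] n[of 2]
        norm_triangle_ineq[of "Y \<kappa> x $ 1" "Y \<kappa> x $ 2"] norm_triangle_ineq4[of "Y \<kappa> x $ 1" "Y \<kappa> x $ 2"] by simp
    then have "norm (FF \<kappa> x) \<le> exp (Re (\<sigma> * \<kappa>) * x) * (8 * \<rho> 0)"
      unfolding FF_exp norm_scale2 by (simp only: norm_exp_eq_Re) (simp add: mult_left_mono)
    then have "(norm (FF \<kappa> x))\<^sup>2 \<le> (exp (Re (\<sigma> * \<kappa>) * x) * (8 * \<rho> 0))\<^sup>2" by (rule power_mono) simp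
    also have "\<dots> = (8 * \<rho> 0)\<^sup>2 * exp (- (- 2 * Re (\<sigma> * \<kappa>)) * x)"
    proof -
      have "(exp (Re (\<sigma> * \<kappa>) * x))\<^sup>2 = exp (2 * (Re (\<sigma> * \<kappa>) * x))" by (rule exp_double[symmetric])
      then show ?thesis unfolding power_mult_distrib by (simp add: mult.assoc)
    qed
    finally show "\<bar>(norm (FF \<kappa> x))\<^sup>2\<bar> \<le> (8 * \<rho> 0)\<^sup>2 * exp (- (- 2 * Re (\<sigma> * \<kappa>)) * x)" by simp
  qed
  then show ?thesis unfolding sqint_def
    by (rule exp_decay_integrable[rotated 2]) (use R in \<open>auto intro!: continuous_intros c\<close>)
qed

text \<open>For fixed \<open>t\<close> the Volterra part of the kernel vanishes once
  \<open>x\<close> exceeds \<open>t\<close>, and the remaining term decays as \<open>x\<close> grows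
  because its exponent has positive real part; a multiple of \<open>cmod q\<close>
  dominates.\<close>

lemma Y_at_infinity: assumes \<kappa>: "\<kappa> \<in> P" shows "(Y \<kappa> \<longlongrightarrow> y0) at_top"
proof -
  have Yr: "norm (N \<kappa> x t (Y \<kappa> t)) \<le> 16 * C0 * \<rho> 0 * cmod (q t)" if "x \<ge> 0" "t \<ge> 0" for x t
  proof -
    have "cm x t \<le> C0" using C0 by (auto simp: cm_def)
    then have k: "cmod (kk i \<kappa> x t) \<le> C0" for i using kk_bound[OF \<kappa> that(1)] order_trans by blast
    have "cmod (N \<kappa> x t (Y \<kappa> t) $ i) \<le> C0 * (4 * \<rho> 0 * cmod (q t))" for i
      unfolding N_nth norm_mult by (rule mult_mono[OF k Rq_Y_bound[OF \<kappa> that(2)]]) (use C0 in auto)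
    from this[of 1] this[of 2] have "norm (N \<kappa> x t (Y \<kappa> t)) \<le> C0 * (4 * \<rho> 0 * cmod (q t)) + C0 * (4 * \<rho> 0 * cmod (q t))"
      using norm_le_sum2[of "N \<kappa> x t (Y \<kappa> t)"] by (meson add_mono order_trans)
    also have "\<dots> \<le> 16 * C0 * \<rho> 0 * cmod (q t)"
    proof -
      have "0 \<le> C0 * \<rho> 0 * cmod (q t)" using C0 rho(1)[of 0] by simp
      then show ?thesis by (simp add: algebra_simps)
    qed
    finally show ?thesis .
  qed
  \<comment> \<open>\<open>max x 0\<close> keeps the kernel estimates valid for every real
    argument.\<close>
  have "((\<lambda>x. LINT t|\<mu>. N \<kappa> (max x 0) t (Y \<kappa> t)) \<longlongrightarrow> (LINT t|\<mu>. 0)) at_top"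
  proof (rule integral_dominated_convergence_at_top[where w = "\<lambda>t. 16 * C0 * \<rho> 0 * cmod (q t)"])
    show "(\<lambda>t. N \<kappa> (max x 0) t (Y \<kappa> t)) \<in> borel_measurable \<mu>" for x
      by (rule borel_measurable_integrable[OF Yi[OF \<kappa>]]) simp
    show "\<forall>\<^sub>F x in at_top. AE t in \<mu>. norm (N \<kappa> (max x 0) t (Y \<kappa> t)) \<le> 16 * C0 * \<rho> 0 * cmod (q t)"
      by (intro always_eventually allI AE_I2 Yr) auto
    show "AE t in \<mu>. ((\<lambda>x. N \<kappa> (max x 0) t (Y \<kappa> t)) \<longlongrightarrow> 0) at_top"
    proof (rule AE_I2)
      fix t assume t: "t \<in> space \<mu>"
      have kl: "((\<lambda>x. kk i \<kappa> (max x 0) t) \<longlongrightarrow> 0) at_top" for i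
      proof -
        have ev: "\<forall>\<^sub>F x in at_top. - (if t > x0 then cc i * exp ((om i \<kappa> + \<sigma> * \<kappa>) * complex_of_real (t - x)) / (2 * om i \<kappa>) else 0) = kk i \<kappa> (max x 0) t"
        proof (rule eventually_at_top_linorderI[of "max t 0"])
          fix x assume x: "max t 0 \<le> x"
          then have "max x 0 = x" "\<not> t > x" by auto
          then show "- (if t > x0 then cc i * exp ((om i \<kappa> + \<sigma> * \<kappa>) * complex_of_real (t - x)) / (2 * om i \<kappa>) else 0) = kk i \<kappa> (max x 0) t"
            by (simp add: kk_def)
        qed
        have "((\<lambda>x. - (if t > x0 then cc i * exp ((om i \<kappa> + \<sigma> * \<kappa>) * complex_of_real (t - x)) / (2 * om i \<kappa>) else 0)) \<longlongrightarrow> 0) at_top"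
        proof (cases "t > x0 \<and> cc i \<noteq> 0")
          case True
          then have R: "0 < Re (om i \<kappa> + \<sigma> * \<kappa>)" using Re_exponents(3)[OF \<kappa>] by blast
          have "((\<lambda>x. exp (Re (om i \<kappa> + \<sigma> * \<kappa>) * (t - x))) \<longlongrightarrow> 0) at_top"
          proof (rule filterlim_compose[OF exp_at_bot])
            have "filterlim (\<lambda>x. t - x) at_bot at_top"
              unfolding filterlim_at_bot
            proof
              fix Z show "\<forall>\<^sub>F x in at_top. t - x \<le> Z" by (rule eventually_at_top_linorderI[of "t - Z"]) simp
            qed
            then show "filterlim (\<lambda>x. Re (om i \<kappa> + \<sigma> * \<kappa>) * (t - x)) at_bot at_top"
              by (rule filterlim_tendsto_pos_mult_at_bot[OF tendsto_const R])
          qed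
          then have "((\<lambda>x. cmod (exp ((om i \<kappa> + \<sigma> * \<kappa>) * complex_of_real (t - x)))) \<longlongrightarrow> 0) at_top"
            by (simp add: norm_exp_eq_Re)
          then have "((\<lambda>x. exp ((om i \<kappa> + \<sigma> * \<kappa>) * complex_of_real (t - x))) \<longlongrightarrow> 0) at_top" by (rule tendsto_norm_zero_cancel)
          from tendsto_mult[OF tendsto_const[of "- (cc i / (2 * om i \<kappa>))"] this] show ?thesis using True by simp
        next
          case False
          then show ?thesis by (cases "t > x0") auto
        qed
        then show ?thesis using ev by (rule Lim_transform_eventually)
      qed
      show "((\<lambda>x. N \<kappa> (max x 0) t (Y \<kappa> t)) \<longlongrightarrow> 0) at_top"
      proof (rule vec_tendstoI)
        fix i show "((\<lambda>x. N \<kappa> (max x 0) t (Y \<kappa> t) $ i) \<longlongrightarrow> 0 $ i) at_top"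
          unfolding N_nth using tendsto_mult[OF kl[of i] tendsto_const[of "Rq q t (Y \<kappa> t) $ i"]] by simp
      qed
    qed
    show "integrable \<mu> (\<lambda>t. 16 * C0 * \<rho> 0 * cmod (q t))" by (rule integrable_q_multiple)
  qed simp
  then have "((\<lambda>x. y0 + (LINT t|\<mu>. N \<kappa> (max x 0) t (Y \<kappa> t))) \<longlongrightarrow> y0 + 0) at_top"
    by (intro tendsto_intros) simp
  moreover have "\<forall>\<^sub>F x in at_top. y0 + (LINT t|\<mu>. N \<kappa> (max x 0) t (Y \<kappa> t)) = Y \<kappa> x"
    by (rule eventually_at_top_linorderI[of 0]) (simp add: Ye[OF \<kappa>])
  ultimately show ?thesis by (simp add: Lim_transform_eventually)
qed

lemma param_integral_continuous:
  fixes f :: "complex => real => complex"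
  assumes m: "\<And>\<kappa>. \<kappa> \<in> P ==> f \<kappa> \<in> borel_measurable \<mu>" and b: "\<And>\<kappa> t. \<kappa> \<in> P ==> t \<ge> 0 ==> cmod (f \<kappa> t) \<le> C * cmod (q t)"
    and c: "\<And>t. t \<ge> 0 ==> continuous_on P (\<lambda>\<kappa>. f \<kappa> t)"
  shows "continuous_on P (\<lambda>\<kappa>. LINT t|\<mu>. f \<kappa> t)"
  unfolding continuous_on_sequentially
proof (intro allI ballI impI)
  fix \<kappa>s \<kappa> assume \<kappa>: "\<kappa> \<in> P" and s: "(\<forall>n. \<kappa>s n \<in> P) \<and> \<kappa>s \<longlonglongrightarrow> \<kappa>"
  have "(\<lambda>n. LINT t|\<mu>. f (\<kappa>s n) t) \<longlonglongrightarrow> (LINT t|\<mu>. f \<kappa> t)"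
  proof (rule integral_dominated_convergence[where w = "\<lambda>t. C * cmod (q t)"])
    show "AE t in \<mu>. (\<lambda>n. f (\<kappa>s n) t) \<longlonglongrightarrow> f \<kappa> t"
    proof (rule AE_I2)
      fix t assume "t \<in> space \<mu>"
      then show "(\<lambda>n. f (\<kappa>s n) t) \<longlonglongrightarrow> f \<kappa> t"
        using continuous_on_tendsto_compose[OF c, of t \<kappa>s \<kappa> sequentially] s \<kappa> by auto
    qed
    show "AE t in \<mu>. norm (f (\<kappa>s n) t) \<le> C * cmod (q t)" for n
      using s b by (intro AE_I2) auto
  qed (use s \<kappa> m integrable_q_multiple in auto)
  then show "((\<lambda>\<kappa>. LINT t|\<mu>. f \<kappa> t) \<circ> \<kappa>s) \<longlonglongrightarrow> (LINT t|\<mu>. f \<kappa> t)" by (simp add: o_def)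
qed

lemma rr_continuous: "t \<ge> 0 ==> continuous_on P (\<lambda>\<kappa>. rr i \<kappa> t)"
  using exhaust_2[of i] unfolding rr_def by (elim disjE; simp; intro continuous_intros Y_param)

lemma om_continuous: "continuous_on P (om i)"
  using exhaust_2[of i] by (elim disjE; simp add: om_def[abs_def]; intro continuous_intros)

lemma gg_continuous: "continuous_on P (\<lambda>\<kappa>. gg i \<kappa> 0)"
proof -
  have p: "continuous_on P (\<lambda>\<kappa>. pp i \<kappa> 0)"
    unfolding pp_def
    by (rule param_integral_continuous[where C = "B 0 * (4 * \<rho> 0)"], rule pp_integrand(1)[OF _ order_refl], assumption,
        rule pp_integrand(2)[OF _ order_refl], assumption, assumption)
      (intro continuous_intros rr_continuous om_continuous)
  have s: "continuous_on P (\<lambda>\<kappa>. ss i \<kappa> 0)"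
    unfolding ss_def
    by (rule param_integral_continuous[where C = "4 * \<rho> 0"], rule ss_integrand(1)[OF _ order_refl], assumption,
        rule ss_integrand(2)[OF _ order_refl], assumption, assumption)
      (intro continuous_intros rr_continuous om_continuous)
  show ?thesis unfolding gg_def ww1_def by (simp, intro continuous_intros p s) simp
qed

lemma FF_GG_continuous: "continuous_on P (\<lambda>\<kappa>. FF \<kappa> 0)" "continuous_on P (\<lambda>\<kappa>. GG \<kappa> 0)"
proof -
  have u: "continuous_on P (\<lambda>\<kappa>. uu i \<kappa> 0)" for i
    unfolding uu_def by (simp, intro continuous_intros Y_param) simp
  have v: "continuous_on P (\<lambda>\<kappa>. vector [f \<kappa>, g \<kappa>] :: complex^2)" if "continuous_on P f" "continuous_on P g" for f g
  proof -
    have "(\<lambda>\<kappa>. vector [f \<kappa>, g \<kappa>] :: complex^2) = (\<lambda>\<kappa>. \<chi> i. if i = 1 then f \<kappa> else g \<kappa>)"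
      by (auto simp: vec2_eq_iff)
    moreover have "continuous_on P (\<lambda>\<kappa>. \<chi> i::2. if i = 1 then f \<kappa> else g \<kappa>)"
    proof (rule continuous_on_vec_lambda)
      fix i :: 2 show "continuous_on P (\<lambda>\<kappa>. if i = 1 then f \<kappa> else g \<kappa>)" using that by (cases "i = 1") auto
    qed
    ultimately show ?thesis by (simp only:)
  qed
  show "continuous_on P (\<lambda>\<kappa>. FF \<kappa> 0)" "continuous_on P (\<lambda>\<kappa>. GG \<kappa> 0)"
    unfolding FF_def GG_def by (intro v continuous_intros u gg_continuous)+
qed

end

lemma levinson_solution:
  obtains F G where "\<And>\<kappa>. \<kappa> \<in> P ==> isol q (\<kappa>\<^sup>2) (F \<kappa>) (G \<kappa>)"
    "continuous_on P (\<lambda>\<kappa>. F \<kappa> 0)" "continuous_on P (\<lambda>\<kappa>. G \<kappa> 0)"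
    "\<And>\<kappa>. \<kappa> \<in> P ==> Re (\<sigma> * \<kappa>) < 0 ==> sqint (F \<kappa>)"
    "\<And>\<kappa>. \<kappa> \<in> P ==> \<exists>Z. (Z \<longlongrightarrow> vector [y0 $ 1 + y0 $ 2, y0 $ 1 - y0 $ 2]) at_top \<and>
       (\<forall>x. F \<kappa> x = exp (\<sigma> * \<kappa> * complex_of_real x) *s Z x)"
proof -
  obtain Y where Y: "continuous_on (P \<times> {0..}) (\<lambda>(\<kappa>, x). Y \<kappa> x)"
    "\<And>\<kappa> x. \<kappa> \<in> P ==> x \<ge> 0 ==> norm (Y \<kappa> x) \<le> 2 * \<rho> x"
    "\<And>\<kappa> x. \<kappa> \<in> P ==> x \<ge> 0 ==> integrable \<mu> (\<lambda>t. N \<kappa> x t (Y \<kappa> t))"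
    "\<And>\<kappa> x. \<kappa> \<in> P ==> x \<ge> 0 ==> Y \<kappa> x = y0 + (LINT t|\<mu>. N \<kappa> x t (Y \<kappa> t))"
    by (rule normalized_solution) blast
  show ?thesis
  proof (rule that[of "FF Y" "GG Y"])
    show "\<exists>Z. (Z \<longlongrightarrow> vector [y0 $ 1 + y0 $ 2, y0 $ 1 - y0 $ 2]) at_top \<and>
       (\<forall>x. FF Y \<kappa> x = exp (\<sigma> * \<kappa> * complex_of_real x) *s Z x)" if "\<kappa> \<in> P" for \<kappa>
    proof (intro exI conjI allI)
      show "FF Y \<kappa> x = exp (\<sigma> * \<kappa> * complex_of_real x) *s vector [Y \<kappa> x $ 1 + Y \<kappa> x $ 2, Y \<kappa> x $ 1 - Y \<kappa> x $ 2]" for x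
        by (rule FF_exp[OF Y])
      have l: "(Y \<kappa> \<longlongrightarrow> y0) at_top" by (rule Y_at_infinity[OF Y that])
      show "((\<lambda>x. vector [Y \<kappa> x $ 1 + Y \<kappa> x $ 2, Y \<kappa> x $ 1 - Y \<kappa> x $ 2]) \<longlongrightarrow> (vector [y0 $ 1 + y0 $ 2, y0 $ 1 - y0 $ 2] :: complex^2)) at_top"
      proof (rule vec_tendstoI)
        fix i :: 2
        show "((\<lambda>x. vector [Y \<kappa> x $ 1 + Y \<kappa> x $ 2, Y \<kappa> x $ 1 - Y \<kappa> x $ 2] $ i) \<longlongrightarrow> (vector [y0 $ 1 + y0 $ 2, y0 $ 1 - y0 $ 2] :: complex^2) $ i) at_top"
          using exhaust_2[of i] by (elim disjE; simp; intro tendsto_intros l)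
      qed
    qed
  qed (use isol_FF[OF Y] FF_GG_continuous[OF Y] sqint_FF[OF Y] in auto)
qed

end

section \<open>The spectral density\<close>

lemma small_tail:
  fixes f :: "real => real"
  assumes f: "f absolutely_integrable_on {0..}" and e: "e > 0"
  obtains x where "x \<ge> 0" "integral {x<..} f \<le> e"
proof -
  have "\<forall>\<^sub>F b in at_top. dist (integral {0..b} f) (integral {0..} f) < e"
    using tendstoD[OF tendsto_integral_halfline[OF f] e] .
  then obtain b0 where b0: "\<And>b. b \<ge> b0 ==> dist (integral {0..b} f) (integral {0..} f) < e"
    unfolding eventually_at_top_linorder by blast
  define b where "b = max b0 0"
  have i: "f integrable_on {0..b}" "f integrable_on {b<..}"
    by (rule set_lebesgue_integral_eq_integral(1), rule set_integrable_subset[OF f]; auto simp: b_def)+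
  have n: "negligible ({0..b} \<inter> {b<..})" by (rule negligible_subset[of "{}"]) auto
  have "{0..b} \<union> {b<..} = {0..}" by (auto simp: b_def)
  then have "integral {0..} f = integral {0..b} f + integral {b<..} f"
    using integral_Un[OF i n] by simp
  then have "integral {b<..} f \<le> e" using b0[of b] by (auto simp: b_def dist_real_def abs_if split: if_splits)
  then show ?thesis using that[of b] by (auto simp: b_def)
qed

text \<open>It contains its real diameter, which is where boundary values are taken. The radius
  \<open>k^2 / 2\<close> keeps the real part of \<open>l\<close> positive, so the principal root
  lies in the sector required by \<open>levinson\<close>, with real part between
  \<open>k / 2\<close> and \<open>2 * k\<close>.\<close>

definition "half_disc k = {l. 0 \<le> Im l \<and> cmod (l - complex_of_real (k\<^sup>2)) \<le> k\<^sup>2 / 2}"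

lemma csqrt_half_disc:
  assumes k: "k > 0" and l: "l \<in> half_disc k"
  shows "k / 2 \<le> Re (csqrt l)" "Re (csqrt l) \<le> 2 * k" "0 \<le> Im (csqrt l)" "Im (csqrt l) < Re (csqrt l)"
    "Im l > 0 ==> Im (csqrt l) > 0"
proof -
  define z where "z = csqrt l"
  have z2: "z\<^sup>2 = l" by (simp add: z_def)
  have n: "cmod (l - complex_of_real (k\<^sup>2)) \<le> k\<^sup>2 / 2" "0 \<le> Im l" using l by (auto simp: half_disc_def)
  have "\<bar>Re (l - complex_of_real (k\<^sup>2))\<bar> \<le> k\<^sup>2 / 2" using abs_Re_le_cmod n(1) by (rule order_trans)
  then have Re_l: "k\<^sup>2 / 2 \<le> Re l" "Re l \<le> 3 * k\<^sup>2 / 2" unfolding abs_le_iff by (simp_all add: field_simps)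
  have k2: "k\<^sup>2 > 0" using k by simp
  have R: "Re l = (Re z)\<^sup>2 - (Im z)\<^sup>2" "Im l = 2 * Re z * Im z" unfolding z2[symmetric] by (simp_all add: power2_eq_square)
  have p: "0 \<le> Re z" using csqrt_principal[of l] by (auto simp: z_def)
  have "0 < (Re z)\<^sup>2" using R(1) Re_l(1) k2 zero_le_power2[of "Im z"] by linarith
  then have p: "0 < Re z" using p by (cases "Re z = 0") auto
  show "0 \<le> Im (csqrt l)" using R(2) n(2) p unfolding z_def[symmetric] by (simp add: zero_le_mult_iff)
  show "Im l > 0 ==> Im (csqrt l) > 0" using R(2) p unfolding z_def[symmetric] by (simp add: zero_less_mult_iff)
  have "(Im z)\<^sup>2 < (Re z)\<^sup>2" using R(1) Re_l(1) k2 by linarith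
  then show "Im (csqrt l) < Re (csqrt l)" unfolding z_def[symmetric] using p by (simp add: power2_less_imp_less)
  have "(k / 2)\<^sup>2 \<le> (Re z)\<^sup>2"
  proof -
    have "k\<^sup>2 / 4 \<le> (Re z)\<^sup>2" using R(1) Re_l(1) k2 zero_le_power2[of "Im z"] by linarith
    then show ?thesis by (simp add: power_divide)
  qed
  then show "k / 2 \<le> Re (csqrt l)" unfolding z_def[symmetric] by (rule power2_le_imp_le) (use p in simp)
  have "cmod l \<le> 3 * k\<^sup>2 / 2"
    using norm_triangle_ineq[of "l - complex_of_real (k\<^sup>2)" "complex_of_real (k\<^sup>2)"] n(1)
    by (simp add: norm_power field_simps)
  moreover have "(cmod z)\<^sup>2 = cmod l" using z2 by (simp flip: norm_power)
  moreover have "(2 * k)\<^sup>2 = 4 * k\<^sup>2" by (simp add: power_mult_distrib)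
  ultimately have "(cmod z)\<^sup>2 \<le> (2 * k)\<^sup>2" using k2 by linarith
  then have "cmod z \<le> 2 * k" by (rule power2_le_imp_le) (use k in simp)
  then show "Re (csqrt l) \<le> 2 * k" unfolding z_def[symmetric] using complex_Re_le_cmod order_trans by blast
qed

lemma csqrt_continuous_half_disc: "k > 0 ==> continuous_on (half_disc k) csqrt"
proof (rule continuous_on_subset[OF continuous_on_csqrt], rule subsetI)
  fix l assume k: "k > 0" and l: "l \<in> half_disc k"
  have "l \<notin> \<real>\<^sub>\<le>\<^sub>0"
  proof
    assume "l \<in> \<real>\<^sub>\<le>\<^sub>0"
    then have "Re l \<le> 0" "Im l = 0" by (auto simp: complex_nonpos_Reals_iff)
    moreover have "\<bar>Re (l - complex_of_real (k\<^sup>2))\<bar> \<le> k\<^sup>2 / 2"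
      using abs_Re_le_cmod[of "l - complex_of_real (k\<^sup>2)"] l by (auto simp: half_disc_def)
    moreover have "k\<^sup>2 > 0" using k by simp
    ultimately show False unfolding abs_le_iff by simp
  qed
  then show "l \<in> - \<real>\<^sub>\<le>\<^sub>0" by simp
qed

text \<open>The integral equation is solved in terms of the root of \<open>l\<close>. For
  \<open>\<sigma> = \<i>\<close> square integrability is lost on the real diameter, but continuity
  of the data at 0 is not.\<close>

lemma decaying_family:
  assumes q: "integrable halfline q" and k: "k > 0"
    and sig: "\<sigma> = -1 \<and> v = e_minus \<or> \<sigma> = \<i> \<and> v = e_plus"
  obtains J J' where "\<And>l. l \<in> half_disc k ==> isol q l (J l) (J' l)"
    "continuous_on (half_disc k) (\<lambda>l. J l 0)" "continuous_on (half_disc k) (\<lambda>l. J' l 0)"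
    "\<And>l. l \<in> half_disc k ==> Im l > 0 ==> sqint (J l)"
    "\<exists>R. (R \<longlongrightarrow> 0) at_top \<and> (\<forall>x::real. J (complex_of_real (k\<^sup>2)) x = exp (\<sigma> * k * x) *s (v + R x))"
proof -
  define P where "P = csqrt ` half_disc k"
  have "(\<lambda>t. cmod (q t)) absolutely_integrable_on {0..}"
    using q unfolding integrable_halfline_iff by (rule absolutely_integrable_norm[unfolded o_def])
  \<comment> \<open>With \<open>k / 2\<close> as lower bound for the real parts, the smallness
    condition reads \<open>32 / k\<close> times the tail at most 1.\<close>
  then obtain x0 where x0: "x0 \<ge> 0" "integral {x0<..} (\<lambda>t. cmod (q t)) \<le> k / 32"
    by (rule small_tail[of _ "k / 32"]) (use k in auto)
  define y0 :: "complex^2" where "y0 = (if \<sigma> = -1 then vector [0, 1] else vector [1, 0])"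
  have s: "16 / (k / 2) * integral {x0<..} (\<lambda>t. cmod (q t)) \<le> 1"
    using x0(2) k by (simp add: field_simps)
  have ni: "\<i> \<noteq> -1" by (simp add: complex_eq_iff)
  have L: "levinson q (k / 2) (2 * k) x0 \<sigma> (if \<sigma> = -1 then 0 else 1) y0 P"
    by unfold_locales
      (use q k x0(1) s sig csqrt_half_disc[OF k] ni in \<open>auto simp: P_def y0_def\<close>)
  have v: "vector [y0 $ 1 + y0 $ 2, y0 $ 1 - y0 $ 2] = v"
    using sig ni by (auto simp: y0_def e_minus_def e_plus_def)
  obtain F G where FG: "\<And>\<kappa>. \<kappa> \<in> P ==> isol q (\<kappa>\<^sup>2) (F \<kappa>) (G \<kappa>)"
    "continuous_on P (\<lambda>\<kappa>. F \<kappa> 0)" "continuous_on P (\<lambda>\<kappa>. G \<kappa> 0)"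
    "\<And>\<kappa>. \<kappa> \<in> P ==> Re (\<sigma> * \<kappa>) < 0 ==> sqint (F \<kappa>)"
    "\<And>\<kappa>. \<kappa> \<in> P ==> \<exists>Z. (Z \<longlongrightarrow> v) at_top \<and> (\<forall>x. F \<kappa> x = exp (\<sigma> * \<kappa> * complex_of_real x) *s Z x)"
    by (rule levinson.levinson_solution[OF L, unfolded v]) blast
  have P: "csqrt l \<in> P" if "l \<in> half_disc k" for l using that by (simp add: P_def)
  have cc: "continuous_on (half_disc k) (\<lambda>l. h (csqrt l))" if "continuous_on P h" for h :: "complex => complex^2"
    by (rule continuous_on_compose2[OF that csqrt_continuous_half_disc[OF k]]) (simp add: P_def)
  show ?thesis
  proof (rule that[of "\<lambda>l. F (csqrt l)" "\<lambda>l. G (csqrt l)"])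
    show "isol q l (F (csqrt l)) (G (csqrt l))" if "l \<in> half_disc k" for l using FG(1)[OF P[OF that]] by simp
    show "continuous_on (half_disc k) (\<lambda>l. F (csqrt l) 0)" "continuous_on (half_disc k) (\<lambda>l. G (csqrt l) 0)"
      by (rule cc[OF FG(2)] cc[OF FG(3)])+
    show "sqint (F (csqrt l))" if l: "l \<in> half_disc k" "Im l > 0" for l
    proof (rule FG(4)[OF P[OF l(1)]])
      show "Re (\<sigma> * csqrt l) < 0" using sig csqrt_half_disc(1,5)[OF k l(1)] l(2) k by (elim disjE conjE; simp del: csqrt.simps)
    qed
    have kk: "complex_of_real (k\<^sup>2) \<in> half_disc k" by (simp add: half_disc_def)
    have ck: "csqrt (complex_of_real (k\<^sup>2)) = complex_of_real k"
      using k by (simp add: of_real_sqrt[symmetric] real_sqrt_abs)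
    obtain Z where Z: "(Z \<longlongrightarrow> v) at_top" "\<And>x. F (complex_of_real k) x = exp (\<sigma> * complex_of_real k * complex_of_real x) *s Z x"
      using FG(5)[OF P[OF kk]] unfolding ck by blast
    show "\<exists>R. (R \<longlongrightarrow> 0) at_top \<and> (\<forall>x::real. F (csqrt (complex_of_real (k\<^sup>2))) x = exp (\<sigma> * k * x) *s (v + R x))"
      unfolding ck using Z tendsto_diff[OF Z(1) tendsto_const[of v]]
      by (intro exI[of _ "\<lambda>x. Z x - v"]) simp
  qed
qed

lemma bL_continuous:
  assumes "continuous_on S f" "continuous_on S g"
  shows "continuous_on S (\<lambda>x. bL \<alpha> (f x) (g x) $ i)" "continuous_on S (\<lambda>x. bLp \<alpha> (f x) (g x) $ i)"
proof -
  have e: "continuous_on S (\<lambda>x. ell0 \<beta> (f x $ i) (g x $ i))" "continuous_on S (\<lambda>x. ell1 \<beta> (f x $ i) (g x $ i))" for \<beta> i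
    by (cases \<beta>; simp add: divide_inverse; intro continuous_intros assms)+
  show "continuous_on S (\<lambda>x. bL \<alpha> (f x) (g x) $ i)" "continuous_on S (\<lambda>x. bLp \<alpha> (f x) (g x) $ i)"
    using exhaust_2[of i] e by (auto simp: bL_def bLp_def)
qed

context jost_spectral begin

context
  assumes nz: "\<gamma>p1 1 \<noteq> 0"
begin

text \<open>At the real point the two families are identified with the given Jost solutions: the
  first is \<open>Fm1\<close> itself, the second is \<open>Fpi\<close> up to the usual multiple of
  \<open>Fm1\<close>.\<close>

lemma decaying_pair:
  obtains A A' B B' where
    "\<And>l. l \<in> half_disc k ==> isol q l (A l) (A' l)" "\<And>l. l \<in> half_disc k ==> isol q l (B l) (B' l)"
    "continuous_on (half_disc k) (\<lambda>l. A l 0)" "continuous_on (half_disc k) (\<lambda>l. A' l 0)"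
    "continuous_on (half_disc k) (\<lambda>l. B l 0)" "continuous_on (half_disc k) (\<lambda>l. B' l 0)"
    "\<And>l. l \<in> half_disc k ==> Im l > 0 ==> sqint (A l)" "\<And>l. l \<in> half_disc k ==> Im l > 0 ==> sqint (B l)"
    "\<And>x. x \<ge> 0 ==> A (complex_of_real (k\<^sup>2)) x = Fm1 x"
    "\<exists>c. \<forall>x\<ge>0. B (complex_of_real (k\<^sup>2)) x = Fpi x + c *s Fm1 x"
proof -
  have kk: "complex_of_real (k\<^sup>2) \<in> half_disc k" by (simp add: half_disc_def)
  obtain A A' where A: "\<And>l. l \<in> half_disc k ==> isol q l (A l) (A' l)"
    "continuous_on (half_disc k) (\<lambda>l. A l 0)" "continuous_on (half_disc k) (\<lambda>l. A' l 0)"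
    "\<And>l. l \<in> half_disc k ==> Im l > 0 ==> sqint (A l)"
    "\<exists>R. (R \<longlongrightarrow> 0) at_top \<and> (\<forall>x::real. A (complex_of_real (k\<^sup>2)) x = exp ((-1) * complex_of_real k * x) *s (e_minus + R x))"
    by (rule decaying_family[OF q k, of "-1" e_minus]) blast+
  obtain B B' where B: "\<And>l. l \<in> half_disc k ==> isol q l (B l) (B' l)"
    "continuous_on (half_disc k) (\<lambda>l. B l 0)" "continuous_on (half_disc k) (\<lambda>l. B' l 0)"
    "\<And>l. l \<in> half_disc k ==> Im l > 0 ==> sqint (B l)"
    "\<exists>R. (R \<longlongrightarrow> 0) at_top \<and> (\<forall>x::real. B (complex_of_real (k\<^sup>2)) x = exp (\<i> * k * x) *s (e_plus + R x))"
    by (rule decaying_family[OF q k, of \<i> e_plus]) blast+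
  obtain R where R: "(R \<longlongrightarrow> 0) at_top"
    "\<And>x::real. A (complex_of_real (k\<^sup>2)) x = exp (- (complex_of_real k * complex_of_real x)) *s (e_minus + R x)"
    using A(5) by (auto simp del: vector_add_ldistrib)
  have "((\<lambda>x. exp (- (complex_of_real k * complex_of_real x)) *s (e_minus + R x)) \<longlongrightarrow> 0) at_top"
    by (rule scale_mult_tendsto_0[OF exp_mk_tendsto_0 tendsto_add[OF tendsto_const R(1)]])
  then have "(A (complex_of_real (k\<^sup>2)) \<longlongrightarrow> 0) at_top" unfolding R(2)[symmetric] .
  then obtain a where a: "\<And>x. x \<ge> 0 ==> A (complex_of_real (k\<^sup>2)) x = a *s Fm1 x"
    by (rule decay_multiple[OF solI[OF A(1)[OF kk]]]) blast
  have "e_minus = a *s e_minus" by (rule Fm1_multiple_unique[OF R(2) R(1) a])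
  then have a1: "a = 1" by (auto simp: e_minus_def vec2_eq_iff)
  obtain S where S: "(S \<longlongrightarrow> 0) at_top"
    "\<And>x::real. B (complex_of_real (k\<^sup>2)) x = exp (\<i> * k * x) *s (e_plus + S x)"
    using B(5) by auto
  obtain c where c: "\<And>x. x \<ge> 0 ==> B (complex_of_real (k\<^sup>2)) x = Fpi x + c *s Fm1 x"
    by (rule jost_osc_diff[OF jost_sols(2) solI[OF B(1)[OF kk]] S(2) S(1)]) auto
  show ?thesis
  proof (rule that[OF A(1) B(1) A(2,3) B(2,3) A(4) B(4)])
    show "A (complex_of_real (k\<^sup>2)) x = Fm1 x" if "x \<ge> 0" for x using a[OF that] a1 by simp
    show "\<exists>c. \<forall>x\<ge>0. B (complex_of_real (k\<^sup>2)) x = Fpi x + c *s Fm1 x" using c by blast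
  qed
qed

lemma spectral_density:
  "has_spectral_density_at \<nu> \<psi> (k\<^sup>2) (1 / (8 * pi * k) * ((cmod (\<gamma>p1 1))\<^sup>2 / (cmod \<xi>i)\<^sup>2)) (cnj (\<gamma>p1 1) / \<gamma>p1 1)"
proof -
  let ?l = "complex_of_real (k\<^sup>2)"
  let ?E = "\<lambda>j. column j eps_mat"
  obtain A A' B B' where A: "\<And>l. l \<in> half_disc k ==> isol q l (A l) (A' l)" and B: "\<And>l. l \<in> half_disc k ==> isol q l (B l) (B' l)"
    and c: "continuous_on (half_disc k) (\<lambda>l. A l 0)" "continuous_on (half_disc k) (\<lambda>l. A' l 0)"
      "continuous_on (half_disc k) (\<lambda>l. B l 0)" "continuous_on (half_disc k) (\<lambda>l. B' l 0)"
    and sA: "\<And>l. l \<in> half_disc k ==> Im l > 0 ==> sqint (A l)" and sB: "\<And>l. l \<in> half_disc k ==> Im l > 0 ==> sqint (B l)"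
    and Ak: "\<And>x. x \<ge> 0 ==> A ?l x = Fm1 x" and Bk: "\<exists>c. \<forall>x\<ge>0. B ?l x = Fpi x + c *s Fm1 x"
    by (rule decaying_pair) blast
  define pA where "pA l = bLp \<alpha> (A l 0) (A' l 0)" for l
  define pB where "pB l = bLp \<alpha> (B l 0) (B' l 0)" for l
  define dA where "dA l = bL \<alpha> (A l 0) (A' l 0)" for l
  define dB where "dB l = bL \<alpha> (B l 0) (B' l 0)" for l
  \<comment> \<open>Cramer's rule: \<open>c1\<close> and \<open>c2\<close> combine the two families
    so that the perpendicular data become the columns of \<open>eps_mat\<close>, and
    \<open>N\<close> is then the continuous extension of the Weyl matrix.\<close>
  define \<Delta> where "\<Delta> l = pA l $ 1 * pB l $ 2 - pB l $ 1 * pA l $ 2" for l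
  define c1 where "c1 j l = (?E j $ 1 * pB l $ 2 - pB l $ 1 * ?E j $ 2) / \<Delta> l" for j l
  define c2 where "c2 j l = (pA l $ 1 * ?E j $ 2 - ?E j $ 1 * pA l $ 2) / \<Delta> l" for j l
  define N where "N j l = c1 j l *s dA l + c2 j l *s dB l" for j l
  define T where "T i j l = (N j l $ i - cnj (N i l $ j)) / (2 * \<i>)" for i j l
  have kk: "?l \<in> half_disc k" by (simp add: half_disc_def)
  have pc: "continuous_on (half_disc k) (\<lambda>l. pA l $ i)" "continuous_on (half_disc k) (\<lambda>l. pB l $ i)"
    "continuous_on (half_disc k) (\<lambda>l. dA l $ i)" "continuous_on (half_disc k) (\<lambda>l. dB l $ i)" for i
    unfolding pA_def pB_def dA_def dB_def by (intro bL_continuous c)+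
  have \<Delta>c: "continuous_on (half_disc k) \<Delta>" unfolding \<Delta>_def[abs_def] by (intro continuous_intros pc)
  have crm: "c1 j l *s pA l + c2 j l *s pB l = ?E j" if "\<Delta> l \<noteq> 0" for j l
    using that unfolding vec2_eq_iff c1_def c2_def
    by (simp add: add_divide_distrib[symmetric] divide_eq_eq) (simp add: \<Delta>_def algebra_simps)
  have AB: "isol q l (\<lambda>x. c1 j l *s A l x + c2 j l *s B l x) (\<lambda>x. c1 j l *s A' l x + c2 j l *s B' l x)"
    if "l \<in> half_disc k" for j l by (rule isol_lincomb[OF A[OF that] B[OF that]])
  have data: "bL \<alpha> (c1 j l *s A l 0 + c2 j l *s B l 0) (c1 j l *s A' l 0 + c2 j l *s B' l 0) = N j l"
    "bLp \<alpha> (c1 j l *s A l 0 + c2 j l *s B l 0) (c1 j l *s A' l 0 + c2 j l *s B' l 0) = c1 j l *s pA l + c2 j l *s pB l" for j l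
    by (simp_all add: bL_lin N_def dA_def dB_def pA_def pB_def)
  have MN: "M l $ i $ j = N j l $ i" if l: "l \<in> half_disc k" "Im l > 0" "\<Delta> l \<noteq> 0" for l i j
  proof -
    have "l \<notin> \<real>" using l(2) by (auto simp: complex_is_Real_iff)
    then have w: "weyl_matrix q \<alpha> l (M l)" using weyl by (simp add: weyl_function_def)
    obtain \<Psi> \<Psi>' where \<Psi>: "\<And>j::2. isol q l (\<Psi> j) (\<Psi>' j)" "\<And>j. sqint (\<Psi> j)"
      "\<And>j. bL \<alpha> (\<Psi> j 0) (\<Psi>' j 0) = column j (M l)" "\<And>j. bLp \<alpha> (\<Psi> j 0) (\<Psi>' j 0) = ?E j"
      by (rule weyl_columns[OF q w]) blast
    define X where "X x = 1 *s \<Psi> j x + (-1) *s (c1 j l *s A l x + c2 j l *s B l x)" for x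
    define X' where "X' x = 1 *s \<Psi>' j x + (-1) *s (c1 j l *s A' l x + c2 j l *s B' l x)" for x
    have iX: "isol q l X X'" unfolding X_def[abs_def] X'_def[abs_def] by (rule isol_lincomb[OF \<Psi>(1) AB[OF l(1)]])
    have sX: "sqint X" unfolding X_def[abs_def]
      by (intro sqint_lincomb \<Psi>(2) sA sB l isol_continuous(1)[OF \<Psi>(1)] isol_continuous(1)[OF A[OF l(1)]] isol_continuous(1)[OF B[OF l(1)]] isol_continuous(1)[OF AB[OF l(1)]])
    have "bLp \<alpha> (X 0) (X' 0) = 0"
      unfolding X_def X'_def bL_lin(2,6) \<Psi>(4) using crm[OF l(3), of j] by (simp add: pA_def pB_def)
    from weyl_unique[OF q iX sX _ this] l(2) have X0: "X x = 0" if "x \<ge> 0" for x using that by simp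
    have "X' 0 = 0"
      using isol_deriv(2)[OF iX order_refl] isol_deriv(2)[OF isol_cong[OF isol_zero, of X "\<lambda>x. 0" q l] order_refl] X0 by simp
    then have "bL \<alpha> (X 0) (X' 0) = bL \<alpha> (0 *s 0) (0 *s 0)" using X0[of 0] by simp
    then have "bL \<alpha> (X 0) (X' 0) = 0" unfolding bL_lin(5) by simp
    then have "column j (M l) = N j l"
      unfolding X_def X'_def bL_lin(1,5) \<Psi>(3) N_def dA_def dB_def vec_eq_iff
      by (simp add: algebra_simps eq_neg_iff_add_eq_0)
    then have "column j (M l) $ i = N j l $ i" by simp
    then show ?thesis by (simp add: column_def)
  qed
  obtain a where a: "\<And>x. x \<ge> 0 ==> B ?l x = Fpi x + a *s Fm1 x" using Bk by blast
  have sA: "sol (A ?l)" and sB: "sol (B ?l)" by (rule solI[OF A[OF kk]], rule solI[OF B[OF kk]])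
  have hA: "hderiv (A ?l) 0 = A' ?l 0" and hB: "hderiv (B ?l) 0 = B' ?l 0"
    by (rule isol_deriv(2)[OF A[OF kk] order_refl], rule isol_deriv(2)[OF B[OF kk] order_refl])
  have wA: "w (A ?l) K = w Fm1 K" "w K (A ?l) = w K Fm1" for K by (rule w_cong[OF sol_jost(1) Ak], assumption)+
  have wB: "w (B ?l) K = w Fpi K + a * w Fm1 K" "w K (B ?l) = w K Fpi + cnj a * w K Fm1" for K
    using w_cong[OF sol_lincomb[OF sol_jost(2) sol_jost(1), of 1 a], of "B ?l" K] a w_lincomb(1)[OF sol_jost(2) sol_jost(1), of 1 a K]
      w_lincomb(2)[OF sol_jost(2) sol_jost(1), of K 1 a] by simp_all
  note wv = w_vals[OF jost_sols(2-4)]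
  \<comment> \<open>Perpendicular data are pairings with the columns of \<Phi>, and for
    \<open>Fm1\<close> these are growing coefficients.\<close>
  have pA0: "pA ?l $ 1 = 4 * k * cnj (\<gamma>p1 2)" "pA ?l $ 2 = 4 * k * cnj (\<gamma>p1 1)"
  proof -
    have f: "w Fm1 (\<Phi> j) = 4 * k * cnj (\<gamma>p1 j)" for j
      using w_cnj[of "\<Phi> j" Fm1] unfolding w_\<Phi>_Fm1 by simp
    show "pA ?l $ 1 = 4 * k * cnj (\<gamma>p1 2)" "pA ?l $ 2 = 4 * k * cnj (\<gamma>p1 1)"
      using w_\<Phi>[of "A ?l"] unfolding wA f hA pA_def[symmetric] by simp_all
  qed
  \<comment> \<open>With the data of \<open>Fm1\<close> inserted, the determinant is the pairing of
    the oscillating family with \<xi>; hence it is nonzero exactly because \<open>\<xi>i\<close>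
    is.\<close>
  have \<Delta>0: "\<Delta> ?l = 16 * \<i> * k\<^sup>2 * cnj \<xi>i"
  proof -
    have "\<Delta> ?l = 4 * k * w (B ?l) \<xi>"
      using w_\<Phi>[of "B ?l"] unfolding \<Delta>_def pA0 \<xi>_def w_\<Phi>c hB pB_def[symmetric] by (simp add: algebra_simps)
    moreover have "w \<xi> (B ?l) = 4 * \<i> * k * \<xi>i"
      unfolding wB w_\<xi>[OF jost_sols(2)] by (simp add: \<xi>_def w_\<Phi>c w_\<Phi>_Fm1)
    then have "w (B ?l) \<xi> = 4 * \<i> * k * cnj \<xi>i" using w_cnj[of \<xi> "B ?l"] by simp
    ultimately show ?thesis by (simp add: power2_eq_square)
  qed
  have x0: "\<xi>i \<noteq> 0" by (rule \<xi>i_nonzero[OF nz])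
  then have \<Delta>nz: "\<Delta> ?l \<noteq> 0" unfolding \<Delta>0 using k by simp
  have c20: "c2 1 ?l = cnj (\<gamma>p1 2) / (4 * \<i> * k * cnj \<xi>i)" "c2 2 ?l = - (cnj (\<gamma>p1 1) / (4 * \<i> * k * cnj \<xi>i))"
    using k x0 unfolding c2_def \<Delta>0 pA0 by (simp_all add: eps_column field_simps power2_eq_square)
  \<comment> \<open>The skew-hermitian part of the boundary values is the Wronskian of two limiting
    Weyl solutions. All pairings with \<open>Fm1\<close> vanish in it, so only the oscillating part,
    with coefficients \<open>c2\<close>, contributes.\<close>
  have T0: "T i j ?l = 4 * \<i> * k * (c2 j ?l * cnj (c2 i ?l)) / (2 * \<i>)" for i j
  proof -
    let ?u = "\<lambda>j. c1 j ?l *s A ?l 0 + c2 j ?l *s B ?l 0" and ?v = "\<lambda>j. c1 j ?l *s A' ?l 0 + c2 j ?l *s B' ?l 0"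
    have "W (?u j) (?v j) (?u i) (?v i) = N j ?l $ i - cnj (N i ?l $ j)"
      unfolding W_boundary[of _ _ _ _ \<alpha>] data crm[OF \<Delta>nz] using exhaust_2[of i] exhaust_2[of j]
      by (auto simp: eps_column)
    moreover have "W (?u j) (?v j) (?u i) (?v i) = 4 * \<i> * k * (c2 j ?l * cnj (c2 i ?l))"
    proof -
      have "W (A ?l 0) (A' ?l 0) (A ?l 0) (A' ?l 0) = 0" "W (A ?l 0) (A' ?l 0) (B ?l 0) (B' ?l 0) = 0"
        "W (B ?l 0) (B' ?l 0) (A ?l 0) (A' ?l 0) = 0" "W (B ?l 0) (B' ?l 0) (B ?l 0) (B' ?l 0) = 4 * \<i> * k"
        unfolding hA[symmetric] hB[symmetric] w_def[symmetric] wA wB by (simp_all add: wv)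
      then show ?thesis by (simp add: W_lin)
    qed
    ultimately show ?thesis by (simp add: T_def)
  qed
  obtain \<delta> where \<delta>: "0 < \<delta>" "\<delta> \<le> k\<^sup>2 / 2" "\<And>l. l \<in> half_disc k ==> dist l ?l \<le> \<delta> ==> \<Delta> l \<noteq> 0"
  proof -
    obtain d where d: "d > 0" "\<And>l. l \<in> half_disc k ==> dist l ?l < d ==> dist (\<Delta> l) (\<Delta> ?l) < cmod (\<Delta> ?l)"
      using \<Delta>c \<Delta>nz kk unfolding continuous_on_iff by (meson zero_less_norm_iff)
    show ?thesis
      by (rule that[of "min (d / 2) (k\<^sup>2 / 2)"]) (use d k in \<open>force simp: dist_norm\<close>)+
  qed
  define K where "K = {l. 0 \<le> Im l} \<inter> cball ?l \<delta>"
  have Kc: "compact K" unfolding K_def by (intro closed_Int_compact closed_halfspace_Im_ge compact_cball)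
  have KH: "K \<subseteq> half_disc k" using \<delta>(2) by (auto simp: K_def half_disc_def dist_norm norm_minus_commute)
  have K\<Delta>: "\<Delta> l \<noteq> 0" if "l \<in> K" for l using \<delta>(3)[of l] that KH by (auto simp: K_def dist_commute)
  note pK = pc[THEN continuous_on_subset[OF _ KH]]
  have cK: "continuous_on K (c1 j)" "continuous_on K (c2 j)" for j
    unfolding c1_def c2_def
    by (rule continuous_on_divide[OF _ continuous_on_subset[OF \<Delta>c KH]],
        intro continuous_on_diff continuous_on_mult continuous_on_const pK, use K\<Delta> in blast)+
  have Nc: "continuous_on K (\<lambda>l. N j l $ i)" for i j
    unfolding N_def vector_add_component vector_smult_component
    by (intro continuous_on_add continuous_on_mult cK pK)
  have Tc: "continuous_on K (T i j)" for i j
    unfolding T_def[abs_def] by (intro continuous_intros Nc) simp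
  define a0 where "a0 = k\<^sup>2 - \<delta> / 2"
  define b0 where "b0 = k\<^sup>2 + \<delta> / 2"
  \<comment> \<open>The factor keeps \<open>y n\<close> below both 1 and
    \<open>\<delta> / 2\<close>, so that the points above the interval stay in
    \<open>K\<close>.\<close>
  define y where "y n = \<delta> / 2 * yseq n / (1 + \<delta>)" for n
  have y: "y n > 0" "y n \<le> 1" "y n \<le> \<delta> / 2" "y \<longlonglongrightarrow> 0" for n
  proof -
    have h: "0 < yseq n" "yseq n \<le> 1" by (rule yseq)+
    show "y n > 0" using h(1) \<delta>(1) by (simp add: y_def)
    have "\<delta> / 2 * yseq n \<le> \<delta> / 2 * 1" using h \<delta>(1) by (intro mult_left_mono) auto
    then have e: "y n \<le> \<delta> / 2 / (1 + \<delta>)" unfolding y_def using \<delta>(1) by (intro divide_right_mono) auto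
    moreover have "\<delta> / 2 / (1 + \<delta>) \<le> 1" "\<delta> / 2 / (1 + \<delta>) \<le> \<delta> / 2" using \<delta>(1) by (simp_all add: field_simps)
    ultimately show "y n \<le> 1" "y n \<le> \<delta> / 2" by linarith+
    show "y \<longlonglongrightarrow> 0" unfolding y_def[abs_def]
      using tendsto_mult[OF tendsto_const[of "\<delta> / 2 / (1 + \<delta>)"] yseq(3)] by (simp add: mult.commute)
  qed
  have inK: "Complex x h \<in> K" if x: "x \<in> {a0..b0}" and h: "0 \<le> h" "h \<le> \<delta> / 2" for x h
  proof -
    have "cmod (Complex x h - ?l) \<le> \<bar>Re (Complex x h - ?l)\<bar> + \<bar>Im (Complex x h - ?l)\<bar>" by (rule cmod_le)
    also have "\<dots> = \<bar>x - k\<^sup>2\<bar> + \<bar>h\<bar>" by simp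
    also have "\<dots> \<le> \<delta>" using x h unfolding a0_def b0_def atLeastAtMost_iff by arith
    finally show ?thesis using h by (simp add: K_def dist_norm norm_minus_commute)
  qed
  have inK0: "complex_of_real x \<in> K" if "x \<in> {a0..b0}" for x
    using inK[OF that, of 0] \<delta>(1) by (simp add: complex_of_real_def)
  define S :: "real => complex^2^2" where "S t = (\<chi> i j. T i j (complex_of_real t) / pi)" for t
  have Sij: "S t $ i $ j = T i j (complex_of_real t) / pi" for t i j by (simp add: S_def)
  have SijC: "continuous_on {a0..b0} (\<lambda>t. S t $ i $ j)" for i j
    unfolding Sij by (intro continuous_intros continuous_on_compose2[OF Tc]) (use inK0 in auto)
  \<comment> \<open>The boundary values of the Weyl matrix are finite, so its product with
    \<open>y\<close> tends to 0. The first diagonal entry suffices because \<open>psi_mat\<close>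
    has 1 there.\<close>
  have atoms: "emeasure \<nu> {t} = 0" if t: "t \<in> {a0..b0}" for t
  proof -
    have ys: "\<forall>\<^sub>F n in sequentially. yseq n < \<delta> / 2" using order_tendstoD(2)[OF yseq(3), of "\<delta> / 2"] \<delta>(1) by simp
    have ev: "\<forall>\<^sub>F n in sequentially. - \<i> * yseq n * M (Complex t (yseq n)) $ 1 $ 1 = - \<i> * yseq n * N 1 (Complex t (yseq n)) $ 1"
      using ys
    proof eventually_elim
      case (elim n)
      have i: "Complex t (yseq n) \<in> K" using inK[OF t] yseq(1)[of n] elim by simp
      have "M (Complex t (yseq n)) $ 1 $ 1 = N 1 (Complex t (yseq n)) $ 1"
        by (rule MN) (use i KH K\<Delta>[OF i] yseq(1)[of n] in auto)
      then show ?case by simp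
    qed
    have "(\<lambda>n. N 1 (Complex t (yseq n)) $ 1) \<longlonglongrightarrow> N 1 (complex_of_real t) $ 1"
    proof (rule continuous_on_tendsto_compose[OF Nc Complex_yseq inK0[OF t]])
      show "\<forall>\<^sub>F n in sequentially. Complex t (yseq n) \<in> K" using ys by eventually_elim (use inK[OF t] yseq(1) in \<open>auto intro: less_imp_le\<close>)
    qed
    from tendsto_mult[OF tendsto_mult[OF tendsto_const[of "- \<i>"] yseq_c] this]
    have "(\<lambda>n. - \<i> * yseq n * N 1 (Complex t (yseq n)) $ 1) \<longlonglongrightarrow> 0" by simp
    then have "(\<lambda>n. - \<i> * yseq n * M (Complex t (yseq n)) $ 1 $ 1) \<longlonglongrightarrow> 0"
      by (rule Lim_transform_eventually) (use ev in \<open>auto elim: eventually_mono\<close>)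
    from LIMSEQ_unique[OF M_atom this] have "measure \<nu> {t} = 0" by (simp add: g_def)
    then show ?thesis using emeasure_atom_finite[of t] by (auto simp: measure_def enn2real_eq_0_iff)
  qed
  have P: "herglotz_measure.poisson \<nu> (g i j) x (y n) = T i j (Complex x (y n))" if "x \<in> {a0..b0}" for i j x n
  proof -
    have i: "Complex x (y n) \<in> K" using inK[OF that] y(1)[of n] y(3)[of n] by simp
    have MN': "M (Complex x (y n)) $ i $ j = N j (Complex x (y n)) $ i" for i j
      by (rule MN) (use i KH K\<Delta>[OF i] y(1)[of n] in auto)
    show ?thesis using poisson_rep[OF y(1), of x n i j] by (simp add: T_def MN')
  qed
  have lim: "uniform_limit {a0..b0} (\<lambda>n x. herglotz_measure.poisson \<nu> (g i j) x (y n)) (\<lambda>x. pi * S x $ i $ j) sequentially" for i j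
  proof (rule uniform_limitI)
    fix e :: real assume e: "e > 0"
    have "uniformly_continuous_on K (T i j)" by (rule compact_uniformly_continuous[OF Tc Kc])
    then obtain d where d: "d > 0" "\<And>u v. u \<in> K ==> v \<in> K ==> dist v u < d ==> dist (T i j v) (T i j u) < e"
      unfolding uniformly_continuous_on_def using e by metis
    have "\<forall>\<^sub>F n in sequentially. y n < d" by (rule order_tendstoD(2)[OF y(4) d(1)])
    then show "\<forall>\<^sub>F n in sequentially. \<forall>x\<in>{a0..b0}. dist (herglotz_measure.poisson \<nu> (g i j) x (y n)) (pi * S x $ i $ j) < e"
    proof eventually_elim
      case (elim n)
      show ?case
      proof
        fix x assume x: "x \<in> {a0..b0}"
        have "Complex x (y n) - complex_of_real x = \<i> * y n" by (simp add: complex_eq_iff)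
        then have "dist (Complex x (y n)) (complex_of_real x) < d" using elim y(1)[of n] by (simp add: dist_norm norm_mult)
        then have "dist (T i j (Complex x (y n))) (T i j (complex_of_real x)) < e"
          by (intro d(2) inK0[OF x] inK[OF x]) (use y(1,3)[of n] in auto)
        then show "dist (herglotz_measure.poisson \<nu> (g i j) x (y n)) (pi * S x $ i $ j) < e"
          unfolding P[OF x] Sij by simp
      qed
    qed
  qed
  have gA: "(LINT t:C|\<nu>. psi_mat (\<psi> t) $ i $ j) = (LINT t:C|\<nu>. g i j t)" if "C \<in> sets borel" for C i j
    unfolding set_lebesgue_integral_def using that
    by (intro integral_cong_AE) (use g_AE[of i j] in \<open>auto elim: eventually_mono\<close>)
  show ?thesis
    unfolding has_spectral_density_at_def
  proof (intro exI conjI ballI impI allI)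
    show "open {a0<..<b0}" "k\<^sup>2 \<in> {a0<..<b0}" using \<delta>(1) by (auto simp: a0_def b0_def)
    show "continuous_on {a0<..<b0} S"
      unfolding S_def[abs_def] by (intro continuous_on_vec_lambda continuous_on_subset[OF SijC[unfolded Sij]]) auto
    fix C i j assume C: "C \<in> sets borel" "bounded C \<and> C \<subseteq> {a0<..<b0}"
    note si = herglotz_measure.stieltjes_inversion[OF hm y(1,2,4) SijC lim atoms C(1) conjunct2[OF C(2)]]
    show "set_integrable lborel C (\<lambda>t. S t $ i $ j)" by (rule si(1))
    show "(LINT t:C|\<nu>. psi_mat (\<psi> t) $ i $ j) = (LINT t:C|lborel. S t $ i $ j)"
      unfolding gA[OF C(1)] by (rule si(2))
  next
    have n: "complex_of_real ((cmod z)\<^sup>2) = z * cnj z" for z by (rule complex_norm_square)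
    have ps: "\<gamma>p1 2 = - cnj (\<gamma>p1 1)" by (rule p1_symmetry)
    define d where "d = 1 / (8 * pi * k) * ((cmod (\<gamma>p1 1))\<^sup>2 / (cmod \<xi>i)\<^sup>2)"
    have d: "complex_of_real d = \<gamma>p1 1 * cnj (\<gamma>p1 1) / (8 * pi * k * (\<xi>i * cnj \<xi>i))"
      unfolding d_def of_real_mult of_real_divide n by simp
    \<comment> \<open>\<open>T0\<close> gives \<open>2 * k\<close> times a product of two
      coefficients, each with a factor \<open>1 / (4 * k)\<close>, and inversion divides by
      \<open>pi\<close>; this makes \<open>1 / (8 * pi * k)\<close>. The phases of the coefficients
      combine to the claimed \<psi>.\<close>
    have "S (k\<^sup>2) = d *\<^sub>R psi_mat (cnj (\<gamma>p1 1) / \<gamma>p1 1)"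
      unfolding vec_eq_iff forall_2x2 Sij T0 c20 ps vector_scaleR_component
      unfolding scaleR_conv_of_real d
      using nz x0 k by (simp add: field_simps power2_eq_square)
    then show "S (k\<^sup>2) = (1 / (8 * pi * k) * ((cmod (\<gamma>p1 1))\<^sup>2 / (cmod \<xi>i)\<^sup>2)) *\<^sub>R psi_mat (cnj (\<gamma>p1 1) / \<gamma>p1 1)"
      unfolding d_def .
  qed
qed

end
end

section \<open>The operator and its adjoint\<close>

lemma L2_mult_integrable:
  fixes f g :: "real => complex"
  assumes "f \<in> L2" "g \<in> L2"
  shows "integrable halfline (\<lambda>x. f x * cnj (g x))"
proof (rule Bochner_Integration.integrable_bound[of _ "\<lambda>x. (norm (f x))\<^sup>2 + (norm (g x))\<^sup>2"])
  show "integrable halfline (\<lambda>x. (norm (f x))\<^sup>2 + (norm (g x))\<^sup>2)"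
    using assms unfolding L2_def by auto
  have "(\<lambda>x. cnj (g x)) \<in> borel_measurable halfline"
    using assms(2) measurable_compose[OF _ cnj_measurable] unfolding L2_def by blast
  then show "(\<lambda>x. f x * cnj (g x)) \<in> borel_measurable halfline"
    using assms(1) unfolding L2_def by (intro borel_measurable_times) auto
  show "AE x in halfline. norm (f x * cnj (g x)) \<le> norm ((norm (f x))\<^sup>2 + (norm (g x))\<^sup>2)"
  proof (rule AE_I2)
    fix x
    have "2 * (norm (f x) * norm (g x)) \<le> (norm (f x))\<^sup>2 + (norm (g x))\<^sup>2"
      using sum_squares_bound[of "norm (f x)" "norm (g x)"] by (simp add: mult.assoc)
    moreover have "0 \<le> norm (f x) * norm (g x)" by simp
    ultimately show "norm (f x * cnj (g x)) \<le> norm ((norm (f x))\<^sup>2 + (norm (g x))\<^sup>2)"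
      unfolding norm_mult complex_mod_cnj real_norm_def by linarith
  qed
qed

lemma L2_cmult: fixes f :: "real => complex" shows "f \<in> L2 ==> (\<lambda>x. c * f x) \<in> L2"
  unfolding L2_def by (auto simp: norm_mult power_mult_distrib)

lemma L2_add:
  fixes f g :: "real => complex"
  assumes "f \<in> L2" "g \<in> L2" shows "(\<lambda>x. f x + g x) \<in> L2"
proof -
  have m: "f \<in> borel_measurable halfline" "g \<in> borel_measurable halfline" using assms by (auto simp: L2_def)
  have "integrable halfline (\<lambda>x. (norm (f x + g x))\<^sup>2)"
  proof (rule Bochner_Integration.integrable_bound[of _ "\<lambda>x. 2 * (norm (f x))\<^sup>2 + 2 * (norm (g x))\<^sup>2"])
    show "integrable halfline (\<lambda>x. 2 * (norm (f x))\<^sup>2 + 2 * (norm (g x))\<^sup>2)"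
      using assms unfolding L2_def by auto
    show "(\<lambda>x. (norm (f x + g x))\<^sup>2) \<in> borel_measurable halfline" using m by measurable
    show "AE x in halfline. norm ((norm (f x + g x))\<^sup>2) \<le> norm (2 * (norm (f x))\<^sup>2 + 2 * (norm (g x))\<^sup>2)"
    proof (rule AE_I2)
      fix x
      have "(norm (f x + g x))\<^sup>2 \<le> (norm (f x) + norm (g x))\<^sup>2" by (rule power_mono[OF norm_triangle_ineq]) simp
      also have "\<dots> \<le> 2 * (norm (f x))\<^sup>2 + 2 * (norm (g x))\<^sup>2"
        using sum_squares_bound[of "norm (f x)" "norm (g x)"] by (simp add: power2_sum)
      finally show "norm ((norm (f x + g x))\<^sup>2) \<le> norm (2 * (norm (f x))\<^sup>2 + 2 * (norm (g x))\<^sup>2)" by simp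
    qed
  qed
  then show ?thesis using m by (simp add: L2_def)
qed

lemma continuous_measurable_halfline:
  fixes f :: "real => 'a::euclidean_space"
  assumes "continuous_on {0..} f" shows "f \<in> borel_measurable halfline"
  by (rule continuous_imp_measurable_on_sets_lebesgue) (use assms in \<open>auto intro: continuous_on_subset\<close>)

lemma L2_continuous:
  fixes f :: "real => 'a::euclidean_space"
  assumes "continuous_on {0..} f" "(\<lambda>x. (norm (f x))\<^sup>2) absolutely_integrable_on {0..}"
  shows "f \<in> L2"
  using assms continuous_measurable_halfline[OF assms(1)] by (simp add: L2_def integrable_halfline_iff)

lemma L2_compact_support:
  fixes f :: "real => 'a::euclidean_space"
  assumes "continuous_on {0..} f" "\<And>x. x \<ge> b ==> f x = 0"
  shows "f \<in> L2"
proof (rule L2_continuous[OF assms(1)])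
  have "\<forall>\<^sub>F x in at_top. \<bar>(norm (f x))\<^sup>2\<bar> \<le> 0 * exp (- 1 * x)"
    using eventually_ge_at_top[of b] by eventually_elim (simp add: assms(2))
  then show "(\<lambda>x. (norm (f x))\<^sup>2) absolutely_integrable_on {0..}"
    by (rule exp_decay_integrable[rotated 2]) (use assms in \<open>auto intro!: continuous_intros\<close>)
qed

lemma L2_locally_integrable:
  fixes f :: "real => complex"
  assumes "f \<in> L2" shows "f absolutely_integrable_on {0..b}"
proof -
  \<comment> \<open>A cutoff equal to 1 on \<open>{0..b}\<close> with compact support is in
    \<open>L2\<close>, and products of two such functions are integrable.\<close>
  define g where "g x = complex_of_real (min 1 (max 0 (\<bar>b\<bar> + 1 - x)))" for x
  have "g \<in> L2"
    by (rule L2_compact_support[of _ "\<bar>b\<bar> + 1"]) (auto simp: g_def[abs_def] intro!: continuous_intros)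
  then have "(\<lambda>x. f x * cnj (g x)) absolutely_integrable_on {0..}"
    using L2_mult_integrable[OF assms] integrable_halfline_iff by blast
  then have "(\<lambda>x. f x * cnj (g x)) absolutely_integrable_on {0..b}" by (rule set_integrable_subset) auto
  then show ?thesis
    by (rule absolutely_integrable_spike[of _ _ "{}"]) (auto simp: g_def)
qed

lemma L2_unit_average:
  fixes u :: "real => complex"
  assumes u: "u \<in> L2"
  shows "((\<lambda>x. integral {x..x+1} (\<lambda>t. norm (u t))) \<longlongrightarrow> 0) at_top"
proof (rule tendstoI)
  fix e :: real assume e: "e > 0"
  have u2: "(\<lambda>x. (norm (u x))\<^sup>2) absolutely_integrable_on {0..}"
    using u unfolding L2_def by (simp add: integrable_halfline_iff)
  have ui: "(\<lambda>t. norm (u t)) absolutely_integrable_on {0..b}" for b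
    using L2_locally_integrable[OF u] by (rule absolutely_integrable_norm[unfolded o_def])
  have "\<forall>\<^sub>F x in at_top. dist (integral {x..x+1} (\<lambda>x. (norm (u x))\<^sup>2)) 0 < e * e"
    by (rule tendstoD[OF tail_integral_tendsto_0[OF u2]]) (use e in simp)
  then show "\<forall>\<^sub>F x in at_top. dist (integral {x..x+1} (\<lambda>t. norm (u t))) 0 < e"
    using eventually_ge_at_top[of 0]
  proof eventually_elim
    case (elim x)
    have i1: "(\<lambda>t. norm (u t)) integrable_on {x..x+1}"
      by (rule set_lebesgue_integral_eq_integral(1), rule set_integrable_subset[OF ui[of "x + 1"]]) (use elim in auto)
    have i2: "(\<lambda>t. (norm (u t))\<^sup>2) integrable_on {x..x+1}"
      by (rule set_lebesgue_integral_eq_integral(1), rule set_integrable_subset[OF u2]) (use elim in auto)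
    have "norm (u t) \<le> e / 2 + (1 / (2 * e)) * (norm (u t))\<^sup>2" for t
    proof -
      have "0 \<le> (norm (u t) - e)\<^sup>2" by simp
      then have "2 * e * norm (u t) \<le> (norm (u t))\<^sup>2 + e * e" by (simp add: power2_diff power2_eq_square algebra_simps)
      then show ?thesis using e by (simp add: field_simps)
    qed
    then have "integral {x..x+1} (\<lambda>t. norm (u t)) \<le> integral {x..x+1} (\<lambda>t. e / 2 + (1 / (2 * e)) * (norm (u t))\<^sup>2)"
      by (intro integral_le i1 integrable_add integrable_const_ivl integrable_on_mult_right i2) auto
    also have "\<dots> = e / 2 + (1 / (2 * e)) * integral {x..x+1} (\<lambda>t. (norm (u t))\<^sup>2)"
      by (subst integral_add[OF integrable_const_ivl integrable_on_mult_right[OF i2]]) simp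
    also have "\<dots> < e / 2 + (1 / (2 * e)) * (e * e)"
      using elim(1) e by (intro add_strict_left_mono mult_strict_left_mono) auto
    also have "\<dots> = e" using e by (simp add: field_simps)
    finally have "integral {x..x+1} (\<lambda>t. norm (u t)) < e" .
    moreover have "0 \<le> integral {x..x+1} (\<lambda>t. norm (u t))" by (rule integral_nonneg[OF i1]) simp
    ultimately show ?case by simp
  qed
qed

text \<open>\<open>tendsto_0_of_averages\<close> with the image \<open>u\<close> as source. It
  removes the boundary term at infinity from Green's formula on the domain of the operator.\<close>

lemma L2_domain_decay:
  fixes f u :: "real => complex"
  assumes q: "integrable halfline q" and f: "f \<in> L2" "ipair f f'" and u: "u \<in> L2" "ipair f' (\<lambda>x. q x * f x - u x)"
  shows "(f \<longlongrightarrow> 0) at_top" "(f' \<longlongrightarrow> 0) at_top"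
proof -
  have qn: "(\<lambda>t. norm (q t)) absolutely_integrable_on {0..}"
    using q unfolding integrable_halfline_iff by (rule absolutely_integrable_norm[unfolded o_def])
  have un: "(\<lambda>t. norm (u t)) absolutely_integrable_on {0..b}" for b
    using L2_locally_integrable[OF u(1)] by (rule absolutely_integrable_norm[unfolded o_def])
  have 1: "(\<lambda>t. norm (q t)) integrable_on {x..x+1}" if "x \<ge> 0" for x
    by (rule set_lebesgue_integral_eq_integral(1), rule set_integrable_subset[OF qn]) (use that in auto)
  have 2: "(\<lambda>t. norm (u t)) integrable_on {x..x+1}" if "x \<ge> 0" for x
    by (rule set_lebesgue_integral_eq_integral(1), rule set_integrable_subset[OF un[of "x + 1"]]) (use that in auto)
  have 3: "norm (q t * f t - u t) \<le> norm (q t) * norm (f t) + norm (u t)" for t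
    using norm_triangle_ineq4[of "q t * f t" "u t"] by (simp add: norm_mult)
  show "(f \<longlongrightarrow> 0) at_top" "(f' \<longlongrightarrow> 0) at_top"
    by (rule tendsto_0_of_averages[OF f(2) u(2) 1 2 norm_ge_zero norm_ge_zero 3 tail_integral_tendsto_0[OF qn]
          L2_unit_average[OF u(1)] L2_unit_average[OF f(1)]], assumption+)+
qed

lemma green_halfline:
  fixes f u g h :: "real => complex"
  assumes L2: "f \<in> L2" "u \<in> L2" "g \<in> L2" "h \<in> L2"
    and f: "ipair f f'" "ipair f' (\<lambda>x. q x * f x - u x)" and g: "ipair g g'" "ipair g' (\<lambda>x. cnj (q x) * g x - h x)"
    and E0: "f 0 * cnj (g' 0) - f' 0 * cnj (g 0) = 0"
    and E: "((\<lambda>x. f x * cnj (g' x) - f' x * cnj (g x)) \<longlongrightarrow> 0) at_top"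
  shows "L2_inner u g = L2_inner f h"
proof -
  define e where "e x = u x * cnj (g x) - f x * cnj (h x)" for x
  have "ipair (\<lambda>x. f x * cnj (g' x) - f' x * cnj (g x))
    (\<lambda>x. (f' x * cnj (g' x) + f x * cnj (cnj (q x) * g x - h x)) - ((q x * f x - u x) * cnj (g x) + f' x * cnj (g' x)))"
    by (intro ipair_diff' ipair_mult ipair_cnj f g)
  then have P: "ipair (\<lambda>x. f x * cnj (g' x) - f' x * cnj (g x)) e"
    by (rule ipair_cong') (simp_all add: e_def algebra_simps)
  have i: "integrable halfline (\<lambda>x. u x * cnj (g x))" "integrable halfline (\<lambda>x. f x * cnj (h x))"
    using L2 by (auto intro: L2_mult_integrable)
  then have ei: "e absolutely_integrable_on {0..}" unfolding integrable_halfline_iff[symmetric] e_def by simp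
  have "((\<lambda>b. integral {0..b} e) \<longlongrightarrow> 0) at_top"
  proof (rule Lim_transform_eventually[OF E])
    show "\<forall>\<^sub>F b in at_top. f b * cnj (g' b) - f' b * cnj (g b) = integral {0..b} e"
      using eventually_ge_at_top[of 0] by eventually_elim (use ipair_integral[OF P order_refl] E0 in simp)
  qed
  then have "integral {0..} e = 0"
    using tendsto_unique[OF _ tendsto_integral_halfline[OF ei]] by simp
  then have "(LINT x|halfline. e x) = 0" using integral_halfline_eq[OF ei] by simp
  then show ?thesis unfolding L2_inner_def using i by (simp add: e_def)
qed

lemma boundary_form_zero:
  assumes "ell1 \<alpha> f f' = 0" "ell1 (cnj_bparam \<alpha>) g g' = 0"
  shows "f * cnj g' - f' * cnj g = 0"
  using ell_wronskian[of f "cnj g'" f' "cnj g" \<alpha>] ell_cnj(2)[of \<alpha> g g'] assms by simp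

lemma H_op_elem:
  assumes q: "integrable halfline q" and fu: "(f, u) \<in> H_op q \<alpha>"
  shows "f \<in> L2" "u \<in> L2" "ipair f (hderiv f)" "ipair (hderiv f) (\<lambda>x. q x * f x - u x)"
    "ell1 \<alpha> (f 0) (hderiv f 0) = 0"
    "AE x in halfline. (hderiv f has_vector_derivative (q x * f x - u x)) (at x)"
proof -
  have fu': "f \<in> L2" "u \<in> L2" "regular f" "ell_perp \<alpha> f = 0"
    "AE x in halfline. \<exists>f2. (hderiv f has_vector_derivative f2) (at x) \<and> u x = - f2 + q x * f x"
    using fu by (auto simp: H_op_def)
  then show "f \<in> L2" "u \<in> L2" by auto
  show ae: "AE x in halfline. (hderiv f has_vector_derivative (q x * f x - u x)) (at x)"
    using fu'(5) by eventually_elim auto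
  have "(\<lambda>x. f x * q x - u x) absolutely_integrable_on {0..b}" for b
  proof (intro set_integral_diff(1) continuous_times_absolutely_integrable L2_locally_integrable[OF fu'(2)])
    show "continuous_on {0..b} f" by (rule continuous_on_subset[OF regular_continuous_on[OF fu'(3)]]) auto
    show "q absolutely_integrable_on {0..b}" by (rule integrable_q[OF q]) simp
  qed
  then have i: "(\<lambda>x. q x * f x - u x) absolutely_integrable_on {0..b}" for b by (simp add: mult.commute)
  show "ipair f (hderiv f)" "ipair (hderiv f) (\<lambda>x. q x * f x - u x)" using regular_ipair[OF fu'(3) i ae] by auto
  have "(f has_vector_derivative hderiv f 0) (at 0 within {0..})"
    using fu'(3) unfolding regular_def hderiv_def by (auto simp: vector_derivative_works)
  from ell_eq(2)[OF this] fu'(4) show "ell1 \<alpha> (f 0) (hderiv f 0) = 0" by simp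
qed

lemma solution_AE:
  assumes "solution q l F"
  shows "AE x in halfline. (hderiv F has_vector_derivative rhs q l F x) (at x)"
  using assms[unfolded solution_def, THEN conjunct2]
proof eventually_elim
  case (elim x)
  then obtain F2 where F2: "(hderiv F has_vector_derivative F2) (at x)" "- (eps_mat *v F2) + Q_mat q x *v F x = l *s F x" by blast
  have "F2 = rhs q l F x"
    using F2(2) by (auto simp: vec2_eq_iff matrix_vector_mult_def sum_2 eps_mat_def Q_mat_def algebra_simps)
  then show ?case using F2(1) by simp
qed

section \<open>Closure properties of absolute continuity\<close>

lemma division_of_interval_bounds:
  fixes \<D> :: "real set set"
  assumes "\<D> division_of \<Union>\<D>" "\<Union>\<D> \<subseteq> {0..b}" "I \<in> \<D>"
  obtains c d where "I = {c..d}" "c \<le> d" "0 \<le> c" "d \<le> b"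
proof -
  obtain c d where cd: "I = cbox c d" "I \<noteq> {}" using division_ofD(3,4)[OF assms(1,3)] by blast
  then have "c \<le> d" by auto
  moreover have "I \<subseteq> {0..b}" using assms(2,3) by blast
  ultimately show ?thesis using cd by (intro that[of c d]) auto
qed

text \<open>All closure properties below reduce to bounding increments by those of two known
  functions. The constant may depend on the interval, as it does for products.\<close>

lemma lac_dominated:
  fixes f :: "real => 'a::real_normed_vector" and g :: "real => 'b::real_normed_vector" and h :: "real => 'c::real_normed_vector"
  assumes f: "locally_absolutely_continuous f" and g: "locally_absolutely_continuous g"
    and C: "\<And>b. b \<ge> 0 ==> \<exists>C. \<forall>s\<in>{0..b}. \<forall>t\<in>{0..b}. norm (h t - h s) \<le> C * (norm (f t - f s) + norm (g t - g s))"
  shows "locally_absolutely_continuous h"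
  unfolding locally_absolutely_continuous_def absolutely_continuous_on_interval_def
proof (intro allI impI)
  fix b e :: real assume b: "0 \<le> b" and e: "0 < e"
  obtain C0 where C0: "\<And>s t. s \<in> {0..b} ==> t \<in> {0..b} ==> norm (h t - h s) \<le> C0 * (norm (f t - f s) + norm (g t - g s))"
    using C[OF b] by blast
  \<comment> \<open>The given constant may be zero or negative; this one is positive and can be
    divided by.\<close>
  define C where "C = \<bar>C0\<bar> + 1"
  have Cp: "C > 0" by (simp add: C_def)
  have C: "norm (h t - h s) \<le> C * norm (f t - f s) + C * norm (g t - g s)" if "s \<in> {0..b}" "t \<in> {0..b}" for s t
  proof -
    have "C0 * (norm (f t - f s) + norm (g t - g s)) \<le> C * (norm (f t - f s) + norm (g t - g s))"
      by (rule mult_right_mono) (auto simp: C_def)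
    then show ?thesis using C0[OF that] by (simp add: distrib_left)
  qed
  have e': "e / (2 * C) > 0" using e Cp by simp
  obtain d1 where d1: "d1 > 0" "\<And>\<D>. \<D> division_of \<Union>\<D> ==> \<Union>\<D> \<subseteq> {0..b} ==> (\<Sum>I\<in>\<D>. measure lborel I) < d1 ==>
     (\<Sum>I\<in>\<D>. norm (f (Sup I) - f (Inf I))) < e / (2 * C)"
    using f[unfolded locally_absolutely_continuous_def, THEN spec, THEN mp, OF b, unfolded absolutely_continuous_on_interval_def, THEN spec, THEN mp, OF e'] by blast
  obtain d2 where d2: "d2 > 0" "\<And>\<D>. \<D> division_of \<Union>\<D> ==> \<Union>\<D> \<subseteq> {0..b} ==> (\<Sum>I\<in>\<D>. measure lborel I) < d2 ==>
     (\<Sum>I\<in>\<D>. norm (g (Sup I) - g (Inf I))) < e / (2 * C)"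
    using g[unfolded locally_absolutely_continuous_def, THEN spec, THEN mp, OF b, unfolded absolutely_continuous_on_interval_def, THEN spec, THEN mp, OF e'] by blast
  show "\<exists>d>0. \<forall>\<D>. \<D> division_of \<Union>\<D> \<and> \<Union>\<D> \<subseteq> {0..b} \<and> (\<Sum>I\<in>\<D>. measure lborel I) < d \<longrightarrow>
      (\<Sum>I\<in>\<D>. norm (h (Sup I) - h (Inf I))) < e"
  proof (intro exI[of _ "min d1 d2"] conjI allI impI)
    fix \<D> assume D: "\<D> division_of \<Union>\<D> \<and> \<Union>\<D> \<subseteq> {0..b} \<and> (\<Sum>I\<in>\<D>. measure lborel I) < min d1 d2"
    have "(\<Sum>I\<in>\<D>. norm (h (Sup I) - h (Inf I))) \<le> (\<Sum>I\<in>\<D>. C * norm (f (Sup I) - f (Inf I)) + C * norm (g (Sup I) - g (Inf I)))"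
    proof (rule sum_mono)
      fix I assume I: "I \<in> \<D>"
      obtain c d where "I = {c..d}" "c \<le> d" "0 \<le> c" "d \<le> b"
        by (rule division_of_interval_bounds[OF conjunct1[OF D] conjunct1[OF conjunct2[OF D]] I])
      then show "norm (h (Sup I) - h (Inf I)) \<le> C * norm (f (Sup I) - f (Inf I)) + C * norm (g (Sup I) - g (Inf I))"
        using C[of c d] by simp
    qed
    also have "\<dots> = C * (\<Sum>I\<in>\<D>. norm (f (Sup I) - f (Inf I))) + C * (\<Sum>I\<in>\<D>. norm (g (Sup I) - g (Inf I)))"
      by (simp add: sum.distrib sum_distrib_left)
    also have "\<dots> < C * (e / (2 * C)) + C * (e / (2 * C))"
      using D d1(2) d2(2) Cp by (intro add_strict_mono mult_strict_left_mono) auto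
    also have "\<dots> = e" using Cp by simp
    finally show "(\<Sum>I\<in>\<D>. norm (h (Sup I) - h (Inf I))) < e" .
  qed (use d1 d2 in simp)
qed

lemma lac_cong:
  assumes "locally_absolutely_continuous f" "\<And>x. x \<ge> 0 ==> h x = f x"
  shows "locally_absolutely_continuous h"
  by (rule lac_dominated[OF assms(1,1)], rule exI[of _ 1]) (use assms(2) in auto)

lemma lac_component:
  fixes f :: "real => complex^2"
  assumes "locally_absolutely_continuous f" shows "locally_absolutely_continuous (\<lambda>x. f x $ i)"
proof (rule lac_dominated[OF assms assms], intro exI ballI)
  fix s t
  have "norm (f t $ i - f s $ i) \<le> norm (f t - f s)"
    using Finite_Cartesian_Product.norm_nth_le[of "f t - f s" i] by simp
  also have "\<dots> \<le> 1 * (norm (f t - f s) + norm (f t - f s))" by simp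
  finally  show "norm (f t $ i - f s $ i) \<le> 1 * (norm (f t - f s) + norm (f t - f s))" .
qed

lemma lac_add:
  assumes "locally_absolutely_continuous f" "locally_absolutely_continuous g"
  shows "locally_absolutely_continuous (\<lambda>x. f x + g x)"
proof (rule lac_dominated[OF assms], intro exI ballI)
  fix s t show "norm (f t + g t - (f s + g s)) \<le> 1 * (norm (f t - f s) + norm (g t - g s))"
    using norm_triangle_ineq[of "f t - f s" "g t - g s"] by (simp add: algebra_simps)
qed

lemma lac_mult:
  fixes f g :: "real => complex"
  assumes ac: "locally_absolutely_continuous f" "locally_absolutely_continuous g"
    and c: "continuous_on {0..} f" "continuous_on {0..} g"
  shows "locally_absolutely_continuous (\<lambda>x. f x * g x)"
proof (rule lac_dominated[OF ac])
  fix b :: real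
  have "bounded (f ` {0..b})" "bounded (g ` {0..b})"
    by (intro compact_imp_bounded compact_continuous_image continuous_on_subset[OF c(1)] continuous_on_subset[OF c(2)]; auto)+
  then obtain A B where A: "\<And>x. x \<in> {0..b} ==> norm (f x) \<le> A" and B: "\<And>x. x \<in> {0..b} ==> norm (g x) \<le> B"
    unfolding bounded_iff by (metis image_eqI)
  show "\<exists>C. \<forall>s\<in>{0..b}. \<forall>t\<in>{0..b}. norm (f t * g t - f s * g s) \<le> C * (norm (f t - f s) + norm (g t - g s))"
  proof (intro exI ballI)
    fix s t assume st: "s \<in> {0..b}" "t \<in> {0..b}"
    have "0 \<le> max A B" using A[OF st(1)] norm_ge_zero[of "f s"] by linarith
    have "norm (f t * g t - f s * g s) = norm ((f t - f s) * g t + f s * (g t - g s))" by (simp add: algebra_simps)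
    also have "\<dots> \<le> norm (f t - f s) * norm (g t) + norm (f s) * norm (g t - g s)"
      using norm_triangle_ineq[of "(f t - f s) * g t" "f s * (g t - g s)"] by (simp add: norm_mult)
    also have "\<dots> \<le> norm (f t - f s) * max A B + max A B * norm (g t - g s)"
      using A[OF st(1)] B[OF st(2)] \<open>0 \<le> max A B\<close> by (intro add_mono mult_mono) auto
    finally show "norm (f t * g t - f s * g s) \<le> max A B * (norm (f t - f s) + norm (g t - g s))"
      by (simp add: algebra_simps)
  qed
qed

lemma lac_id: "locally_absolutely_continuous (\<lambda>x::real. x)"
  unfolding locally_absolutely_continuous_def absolutely_continuous_on_interval_def
proof (intro allI impI)
  fix b e :: real assume b: "0 \<le> b" and e: "0 < e"
  show "\<exists>d>0. \<forall>\<D>. \<D> division_of \<Union>\<D> \<and> \<Union>\<D> \<subseteq> {0..b} \<and> (\<Sum>I\<in>\<D>. measure lborel I) < d \<longrightarrow>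
      (\<Sum>I\<in>\<D>. norm (Sup I - Inf I)) < e"
  proof (intro exI[of _ e] conjI allI impI)
    fix \<D> assume D: "\<D> division_of \<Union>\<D> \<and> \<Union>\<D> \<subseteq> {0..b} \<and> (\<Sum>I\<in>\<D>. measure lborel I) < e"
    have "(\<Sum>I\<in>\<D>. norm (Sup I - Inf I)) = (\<Sum>I\<in>\<D>. measure lborel I)"
    proof (rule sum.cong[OF refl])
      fix I assume I: "I \<in> \<D>"
      obtain c d where "I = {c..d}" "c \<le> d" "0 \<le> c" "d \<le> b"
        by (rule division_of_interval_bounds[OF conjunct1[OF D] conjunct1[OF conjunct2[OF D]] I])
      then show "norm (Sup I - Inf I) = measure lborel I" by simp
    qed
    then show "(\<Sum>I\<in>\<D>. norm (Sup I - Inf I)) < e" using D by simp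
  qed (use e in simp)
qed

text \<open>A continuous derivative is bounded on \<open>{0..b}\<close>, so the increments are
  dominated by those of the identity.\<close>

lemma lac_C1:
  fixes f g :: "real => complex"
  assumes f: "ipair f g" and c: "continuous_on {0..} g"
  shows "locally_absolutely_continuous f"
proof (rule lac_dominated[OF lac_id lac_id])
  fix b :: real
  have "bounded (g ` {0..b})"
    by (intro compact_imp_bounded compact_continuous_image continuous_on_subset[OF c]) auto
  then obtain B where B: "\<And>x. x \<in> {0..b} ==> norm (g x) \<le> B" unfolding bounded_iff by (metis image_eqI)
  have *: "norm (f t - f s) \<le> B * (t - s)" if "s \<in> {0..b}" "t \<in> {0..b}" "s \<le> t" for s t
  proof -
    have "norm (f t - f s) \<le> B * measure lborel {s..t}"
    proof (rule has_integral_bound_real[where S = "{}" and f = g])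
      show "(g has_integral f t - f s) {s..t}" by (rule ipair_diff[OF f]) (use that in auto)
      show "0 \<le> B" using B[OF that(1)] norm_ge_zero order_trans by blast
    qed (use B that in auto)
    then show ?thesis using that(3) by simp
  qed
  show "\<exists>C. \<forall>s\<in>{0..b}. \<forall>t\<in>{0..b}. norm (f t - f s) \<le> C * (norm (t - s) + norm (t - s))"
  proof (intro exI ballI)
    fix s t assume st: "s \<in> {0..b}" "t \<in> {0..b}"
    show "norm (f t - f s) \<le> (B / 2) * (norm (t - s) + norm (t - s))"
    proof -
      have "norm (f t - f s) \<le> B * norm (t - s)"
      proof (cases "s \<le> t")
        case True then show ?thesis using *[OF st] by simp
      next
        case False then show ?thesis using *[OF st(2,1)] by (simp add: norm_minus_commute)
      qed
      also have "\<dots> = (B / 2) * (norm (t - s) + norm (t - s))" by simp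
      finally show ?thesis .
    qed
  qed
qed

section \<open>Eigenvalues of the hermitisation\<close>

lemma ipair_deriv_zero:
  assumes f: "ipair f g" "continuous_on {0..} g" and z: "\<And>x. 0 \<le> x ==> x < b ==> f x = 0" and x: "0 \<le> x" "x < b"
  shows "g x = 0"
proof -
  have "(f has_vector_derivative g x) (at x within {0..})" by (rule ipair_has_vector_derivative[OF f x(1)])
  moreover have "(f has_vector_derivative 0) (at x within {0..})"
  proof (rule has_vector_derivative_transform_within[where f = "\<lambda>x. 0" and d = "b - x"])
    fix y assume "y \<in> {0..}" "dist y x < b - x"
    then show "0 = f y" using z[of y] by (simp add: dist_real_def abs_if split: if_splits)
  qed (use x in auto)
  ultimately show ?thesis using hderiv_eq[OF _ x(1)] by metis
qed

context jost_phi begin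

abbreviation (input) "lam \<equiv> complex_of_real (k\<^sup>2)"

lemma sol_ipair: assumes "sol F"
  shows "ipair (\<lambda>x. F x $ i) (\<lambda>x. hderiv F x $ i)" "ipair (\<lambda>x. hderiv F x $ i) (\<lambda>x. rhs q lam F x $ i)"
    "continuous_on {0..} F" "continuous_on {0..} (hderiv F)"
  using assms unfolding sol_def isol_def by (auto intro: ipair_component ipair_continuous_on simp del: rhs_nth)

text \<open>Unique continuation from one component: where the second component vanishes, its
  equation gives \<open>lam\<close> times the first, so this vanishes too, and all Cauchy data at 0
  are 0.\<close>

lemma second_component_zero:
  assumes K: "sol K" and b: "b > 0" and z: "\<And>x. 0 \<le> x ==> x < b ==> K x $ 2 = 0" and x: "x \<ge> 0"
  shows "K x = 0"
proof -
  note i = sol_ipair[OF K]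
  have c: "continuous_on {0..} (\<lambda>x. hderiv K x $ i)" "continuous_on {0..} (\<lambda>x. K x $ i)" for i
    by (intro continuous_intros i(3,4))+
  have z': "hderiv K x $ 2 = 0" if "0 \<le> x" "x < b" for x
    by (rule ipair_deriv_zero[OF i(1) c(1) z that])
  \<comment> \<open>The second equation is available in integrated form and yields that the
    primitive of \<open>K x $ 1\<close> vanishes; its derivative is \<open>K x $ 1\<close> by
    continuity.\<close>
  have int: "ipair (\<lambda>x. integral {0..x} (\<lambda>x. K x $ 1)) (\<lambda>x. K x $ 1)"
    by (rule ipair_from_integrable, rule absolutely_integrable_continuous_real, rule continuous_on_subset[OF c(2)]) auto
  have z1: "K x $ 1 = 0" if "0 \<le> x" "x < b" for x
  proof (rule ipair_deriv_zero[OF int c(2) _ that])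
    fix y assume y: "0 \<le> y" "y < b"
    have "((\<lambda>x. rhs q lam K x $ 2) has_integral 0) {0..y}"
      using ipair_diff[OF i(2)[of 2] order_refl y(1)] z'[OF y] z'[of 0] b by simp
    then have "((\<lambda>x. - lam * K x $ 1) has_integral 0) {0..y}"
      by (rule has_integral_eq[rotated]) (use z y in auto)
    then have "((\<lambda>x. (- 1 / lam) * (- lam * K x $ 1)) has_integral (- 1 / lam) * 0) {0..y}" by (rule has_integral_mult_right)
    then show "integral {0..y} (\<lambda>x. K x $ 1) = 0" using k by (simp add: integral_unique)
  qed
  have z1': "hderiv K x $ 1 = 0" if "0 \<le> x" "x < b" for x
    by (rule ipair_deriv_zero[OF i(1) c(1) z1 that])
  have "K 0 = 0" "hderiv K 0 = 0" using b z[of 0] z1[of 0] z'[of 0] z1'[of 0] by (auto simp: vec2_eq_iff)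
  then show ?thesis using isol_unique(1)[OF q K[unfolded sol_def] isol_zero _ _ x] by simp
qed

text \<open>The coefficients with respect to the four Jost solutions of the solution whose value and derivative
  at \<open>x\<close> are \<open>u\<close> and \<open>v\<close>.\<close>

definition "kP u v x = W u v (Fm1 x) (hderiv Fm1 x) / (- 4 * complex_of_real k)"
definition "kF u v x = (W u v (Fpi x) (hderiv Fpi x) - kP u v x * w Fp1 Fpi) / (4 * \<i> * k)"
definition "kH u v x = (W u v (Fmi x) (hderiv Fmi x) - kP u v x * w Fp1 Fmi) / (- 4 * \<i> * k)"
definition "km u v x = (W u v (Fp1 x) (hderiv Fp1 x) - kF u v x * w Fpi Fp1 - kH u v x * w Fmi Fp1 - kP u v x * w Fp1 Fp1) / (4 * complex_of_real k)"

definition "co a b c d x = a *s Fm1 x + b *s Fpi x + c *s Fmi x + d *s Fp1 x"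
definition "co' a b c d x = a *s hderiv Fm1 x + b *s hderiv Fpi x + c *s hderiv Fmi x + d *s hderiv Fp1 x"

lemma W_co:
  assumes "x \<ge> 0" "sol H"
  shows "W (co a b c d x) (co' a b c d x) (H x) (hderiv H x) = a * w Fm1 H + b * w Fpi H + c * w Fmi H + d * w Fp1 H"
  unfolding co_def co'_def by (simp add: W_lin(1,2) w_const assms)

text \<open>Triangular elimination: pairing with \<open>Fm1\<close> gives the growing coefficient,
  which is subtracted in the pairings with the oscillating solutions, and all three are subtracted
  in the pairing with \<open>Fp1\<close>.\<close>

lemma co_coeffs:
  assumes "x \<ge> 0"
  shows "kP (co a b c d x) (co' a b c d x) x = d" "kF (co a b c d x) (co' a b c d x) x = b"
    "kH (co a b c d x) (co' a b c d x) x = c" "km (co a b c d x) (co' a b c d x) x = a"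
proof -
  note v = w_vals[OF jost_sols(2-4)] Fp1_Fm1
  show P: "kP (co a b c d x) (co' a b c d x) x = d" using k by (simp add: kP_def W_co assms v)
  show F: "kF (co a b c d x) (co' a b c d x) x = b" using k by (simp add: kF_def P W_co assms v)
  show H: "kH (co a b c d x) (co' a b c d x) x = c" using k by (simp add: kH_def P W_co assms v)
  show "km (co a b c d x) (co' a b c d x) x = a" using k by (simp add: km_def P F H W_co assms v)
qed

lemma co_surj:
  assumes x: "x \<ge> 0"
  obtains a b c d where "u = co a b c d x" "v = co' a b c d x"
proof -
  define S :: "(complex^2) \<times> (complex^2) => (complex^2) \<times> (complex^2)" where
    "S p = (co (fst p $ 1) (fst p $ 2) (snd p $ 1) (snd p $ 2) x, co' (fst p $ 1) (fst p $ 2) (snd p $ 1) (snd p $ 2) x)" for p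
  have l: "linear S"
    by (rule linearI) (auto simp: S_def co_def co'_def vec2_eq_iff algebra_simps)
  have "p = 0" if "S p = 0" for p
  proof -
    have 0: "co (fst p $ 1) (fst p $ 2) (snd p $ 1) (snd p $ 2) x = 0" "co' (fst p $ 1) (fst p $ 2) (snd p $ 1) (snd p $ 2) x = 0"
      using that by (auto simp: S_def zero_prod_def)
    have W0: "W 0 0 h h' = 0" for h h' by (simp add: W_def)
    have "fst p $ 1 = 0" "fst p $ 2 = 0" "snd p $ 1 = 0" "snd p $ 2 = 0"
      using co_coeffs[OF x, of "fst p $ 1" "fst p $ 2" "snd p $ 1" "snd p $ 2"] unfolding 0 kP_def kF_def kH_def km_def W0 by simp_all
    then show "p = 0" by (simp add: prod_eq_iff vec2_eq_iff)
  qed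
  then have "inj S" using linear_injective_0[OF l] by blast
  then have "surj S" by (rule linear_injective_imp_surjective[OF l _ refl])
  then obtain p where "(u, v) = S p" by blast
  then show ?thesis by (intro that) (auto simp: S_def)
qed

lemma co_expansion:
  assumes "x \<ge> 0"
  shows "co (km u v x) (kF u v x) (kH u v x) (kP u v x) x = u" "co' (km u v x) (kF u v x) (kH u v x) (kP u v x) x = v"
proof -
  obtain a b c d where uv: "u = co a b c d x" "v = co' a b c d x" by (rule co_surj[OF assms])
  show "co (km u v x) (kF u v x) (kH u v x) (kP u v x) x = u" "co' (km u v x) (kF u v x) (kH u v x) (kP u v x) x = v"
    unfolding uv co_coeffs[OF assms] by auto
qed

section \<open>Compactly supported solutions of an inhomogeneous system\<close>

context
  fixes n :: "real => complex" and b :: real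
  assumes n: "continuous_on {0..} n" and b: "b > 0" and nb: "\<And>x. x \<ge> b ==> n x = 0"
    and orth: "\<And>i. integral {0..b} (\<lambda>x. n x * cnj (\<Phi> i x $ 2)) = 0"
begin

text \<open>The source sits in the first equation only. The second one stays homogeneous, which puts
  \<open>tf x $ 2\<close> into the domain of \<open>H_op\<close> with image
  \<open>lam * tf x $ 1\<close>, while \<open>n\<close> appears on the adjoint side.\<close>

definition "sv x = (vector [- n x, 0] :: complex^2)"
text \<open>\<open>bP\<close>, \<open>bF\<close>, \<open>bH\<close> and \<open>bm\<close> are the
  coordinates of the jump \<open>(0, sv x)\<close> in the four Jost solutions, that is the
  derivatives of the coefficients in variation of constants.\<close>

definition "bP x = kP 0 (sv x) x"
definition "bF x = kF 0 (sv x) x"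
definition "bH x = kH 0 (sv x) x"
definition "bm x = km 0 (sv x) x"

lemma W_sv: "W 0 (sv x) h h' = - n x * cnj (h $ 2)"
  by (simp add: W_def sv_def)

lemma beta_continuous: "continuous_on {0..} bP" "continuous_on {0..} bF" "continuous_on {0..} bH" "continuous_on {0..} bm"
proof -
  have c: "continuous_on {0..} (\<lambda>x. - n x * cnj (Z x $ 2))" if "sol Z" for Z
    by (intro continuous_intros n sol_ipair(3)[OF that])
  have k0: "complex_of_real k \<noteq> 0" using k by simp
  show P: "continuous_on {0..} bP" unfolding bP_def[abs_def] kP_def W_sv
    by (intro continuous_on_divide c sol_jost continuous_on_const) (use k in auto)
  show F: "continuous_on {0..} bF" unfolding bF_def[abs_def] kF_def W_sv bP_def[symmetric]
    by (intro continuous_on_divide continuous_on_diff continuous_on_mult P c sol_jost continuous_on_const) (use k in auto)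
  show H: "continuous_on {0..} bH" unfolding bH_def[abs_def] kH_def W_sv bP_def[symmetric]
    by (intro continuous_on_divide continuous_on_diff continuous_on_mult P c sol_jost continuous_on_const) (use k in auto)
  show "continuous_on {0..} bm" unfolding bm_def[abs_def] km_def W_sv bP_def[symmetric] bF_def[symmetric] bH_def[symmetric]
    by (intro continuous_on_divide continuous_on_diff continuous_on_mult P F H c sol_jost continuous_on_const) (use k in auto)
qed

lemma beta_support: assumes "x \<ge> b" shows "bP x = 0" "bF x = 0" "bH x = 0" "bm x = 0"
proof -
  have s: "W 0 (sv x) h h' = 0" for h h' using nb[OF assms] by (simp add: W_sv)
  show "bP x = 0" "bF x = 0" "bH x = 0" "bm x = 0"
    by (simp_all add: bP_def bF_def bH_def bm_def kP_def kF_def kH_def km_def s)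
qed

lemma beta_sum:
  assumes "x \<ge> 0"
  shows "co (bm x) (bF x) (bH x) (bP x) x = 0" "co' (bm x) (bF x) (bH x) (bP x) x = sv x"
  unfolding bm_def bF_def bH_def bP_def using co_expansion[OF assms] by auto

text \<open>Normalised at \<open>b\<close>, where the source ends, so the coefficients vanish from
  there on. What remains to be arranged is the boundary condition at 0.\<close>

definition "prim \<beta> x = integral {0..x} \<beta> - integral {0..b} (\<beta> :: real => complex)"

lemma prim:
  assumes "continuous_on {0..} \<beta>" and s: "\<And>x. x \<ge> b ==> \<beta> x = 0"
  shows "ipair (prim \<beta>) \<beta>" "\<And>x. x \<ge> b ==> prim \<beta> x = 0" "prim \<beta> 0 = - integral {0..b} \<beta>"
proof -
  have "ipair (\<lambda>x. integral {0..x} \<beta>) \<beta>"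
    by (rule ipair_from_integrable, rule absolutely_integrable_continuous_real, rule continuous_on_subset[OF assms(1)]) auto
  from ipair_diff'[OF this ipair_const[of "integral {0..b} \<beta>"]] show P: "ipair (prim \<beta>) \<beta>"
    by (rule ipair_cong') (auto simp: prim_def)
  show "prim \<beta> x = 0" if "x \<ge> b" for x
  proof -
    have "(\<beta> has_integral prim \<beta> x - prim \<beta> b) {b..x}" by (rule ipair_diff[OF P]) (use b that in auto)
    moreover have "(\<beta> has_integral 0) {b..x}" by (rule has_integral_is_0) (use s in auto)
    ultimately have "prim \<beta> x - prim \<beta> b = 0" by (rule has_integral_unique)
    then show ?thesis by (simp add: prim_def)
  qed
  show "prim \<beta> 0 = - integral {0..b} \<beta>" by (simp add: prim_def)
qed

definition "tf x = co (prim bm x) (prim bF x) (prim bH x) (prim bP x) x"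
definition "tf' x = co' (prim bm x) (prim bF x) (prim bH x) (prim bP x) x"

lemmas prims = prim[OF beta_continuous(1) beta_support(1)] prim[OF beta_continuous(2) beta_support(2)]
  prim[OF beta_continuous(3) beta_support(3)] prim[OF beta_continuous(4) beta_support(4)]

lemma tf_support: "x \<ge> b ==> tf x = 0" "x \<ge> b ==> tf' x = 0"
  by (simp_all add: tf_def tf'_def co_def co'_def prims vec2_eq_iff)

abbreviation (input) "pd i x \<equiv> prim bm x * hderiv Fm1 x $ i + prim bF x * hderiv Fpi x $ i + prim bH x * hderiv Fmi x $ i + prim bP x * hderiv Fp1 x $ i"
abbreviation (input) "dG i x \<equiv> (bm x * Fm1 x $ i + prim bm x * hderiv Fm1 x $ i) + (bF x * Fpi x $ i + prim bF x * hderiv Fpi x $ i) + (bH x * Fmi x $ i + prim bH x * hderiv Fmi x $ i) + (bP x * Fp1 x $ i + prim bP x * hderiv Fp1 x $ i)"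
abbreviation (input) "dG1 i x \<equiv> (bm x * hderiv Fm1 x $ i + prim bm x * rhs q lam Fm1 x $ i) + (bF x * hderiv Fpi x $ i + prim bF x * rhs q lam Fpi x $ i) + (bH x * hderiv Fmi x $ i + prim bH x * rhs q lam Fmi x $ i) + (bP x * hderiv Fp1 x $ i + prim bP x * rhs q lam Fp1 x $ i)"
abbreviation (input) "dG2 i x \<equiv> (prim bm x * rhs q lam Fm1 x $ i + bm x * hderiv Fm1 x $ i) + (prim bF x * rhs q lam Fpi x $ i + bF x * hderiv Fpi x $ i) + (prim bH x * rhs q lam Fmi x $ i + bH x * hderiv Fmi x $ i) + (prim bP x * rhs q lam Fp1 x $ i + bP x * hderiv Fp1 x $ i)"

lemma tf_ipair:
  "ipair (\<lambda>x. tf x $ i) (\<lambda>x. tf' x $ i)"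
  "ipair (\<lambda>x. tf' x $ i) (\<lambda>x. sv x $ i + rhs q lam tf x $ i)"
proof -
  have z: "sol Z ==> ipair (\<lambda>x. Z x $ i) (\<lambda>x. hderiv Z x $ i)" "sol Z ==> ipair (\<lambda>x. hderiv Z x $ i) (\<lambda>x. rhs q lam Z x $ i)" for Z
    by (rule sol_ipair; assumption)+
  have "ipair (\<lambda>x. prim bm x * Fm1 x $ i + prim bF x * Fpi x $ i + prim bH x * Fmi x $ i + prim bP x * Fp1 x $ i)
    (\<lambda>x. dG i x)"
    by (intro ipair_add ipair_mult prims z sol_jost)
  then show "ipair (\<lambda>x. tf x $ i) (\<lambda>x. tf' x $ i)"
  proof (rule ipair_cong')
    fix x :: real assume x: "x \<ge> 0"
    have "co (bm x) (bF x) (bH x) (bP x) x $ i = 0" using beta_sum(1)[OF x] by simp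
    then show "tf' x $ i = dG i x"
      by (simp add: tf'_def co_def co'_def algebra_simps)
  qed (simp add: tf_def co_def)
  have "ipair (\<lambda>x. pd i x)
    (\<lambda>x. dG1 i x)"
    by (intro ipair_add ipair_mult prims z sol_jost)
  then show "ipair (\<lambda>x. tf' x $ i) (\<lambda>x. sv x $ i + rhs q lam tf x $ i)"
  proof (rule ipair_cong')
    fix x :: real assume x: "x \<ge> 0"
    have "co' (bm x) (bF x) (bH x) (bP x) x $ i = sv x $ i" using beta_sum(2)[OF x] by simp
    then show "sv x $ i + rhs q lam tf x $ i = dG1 i x"
      using exhaust_2[of i] by (auto simp: tf_def co_def co'_def algebra_simps)
  qed (simp add: tf'_def co'_def)
qed

lemma tf_continuous: "continuous_on {0..} (\<lambda>x. tf x $ i)" "continuous_on {0..} (\<lambda>x. tf' x $ i)"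
  by (rule ipair_continuous_on[OF tf_ipair(1)] ipair_continuous_on[OF tf_ipair(2)])+

lemma tf_deriv: "x \<ge> 0 ==> ((\<lambda>x. tf x $ i) has_vector_derivative tf' x $ i) (at x within {0..})"
  by (rule ipair_has_vector_derivative[OF tf_ipair(1) tf_continuous(2)])

lemma tf_hderiv: "x \<ge> 0 ==> hderiv (\<lambda>x. tf x $ i) x = tf' x $ i"
  by (rule hderiv_eq[OF tf_deriv])

lemma tf_regular: "regular (\<lambda>x. tf x $ i)"
  unfolding regular_def
proof (intro conjI allI impI)
  fix x :: real assume "x \<ge> 0"
  then show "(\<lambda>x. tf x $ i) differentiable at x within {0..}" by (rule differentiableI_vector[OF tf_deriv])
next
  show "locally_absolutely_continuous (\<lambda>x. tf x $ i)" by (rule lac_C1[OF tf_ipair(1) tf_continuous(2)])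
  have z: "locally_absolutely_continuous (\<lambda>x. hderiv Z x $ i)" if "solution q lam Z" for Z
    using that by (auto simp: solution_def regular_def intro: lac_component)
  have c: "continuous_on {0..} (\<lambda>x. hderiv Z x $ i)" if "sol Z" for Z by (intro continuous_intros sol_ipair(4) that)
  have s: "solution q lam Fm1" "solution q lam Fpi" "solution q lam Fmi" "solution q lam Fp1"
    using jost_sols by (auto simp: jost_solution_def)
  have "locally_absolutely_continuous (\<lambda>x. pd i x)"
    by (intro lac_add lac_mult lac_C1[OF prims(1)] lac_C1[OF prims(4)] lac_C1[OF prims(7)] lac_C1[OF prims(10)] beta_continuous
        ipair_continuous_on[OF prims(1)] ipair_continuous_on[OF prims(4)] ipair_continuous_on[OF prims(7)] ipair_continuous_on[OF prims(10)] z c s sol_jost)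
  then show "locally_absolutely_continuous (hderiv (\<lambda>x. tf x $ i))"
    by (rule lac_cong) (simp add: tf_hderiv, simp add: tf'_def co'_def)
qed

lemma tf_AE: "AE x in halfline. (hderiv (\<lambda>x. tf x $ i) has_vector_derivative (sv x $ i + rhs q lam tf x $ i)) (at x)"
proof -
  have s: "solution q lam Fm1" "solution q lam Fpi" "solution q lam Fmi" "solution q lam Fp1"
    using jost_sols by (auto simp: jost_solution_def)
  have pos: "AE x in halfline. x > 0" by (rule AE_I2) (simp add: space_restrict_space)
  show ?thesis
    using s[THEN solution_AE] pos
  proof eventually_elim
    case (elim x)
    have p: "(prim \<beta> has_vector_derivative \<beta> x) (at x)" if "ipair (prim \<beta>) \<beta>" "continuous_on {0..} \<beta>" for \<beta>
    proof -
      have "at x within {0..} = at x" by (rule at_within_interior) (use elim(5) in simp)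
      then show ?thesis using ipair_has_vector_derivative[OF that less_imp_le[OF elim(5)]] by (simp only:)
    qed
    have h: "((\<lambda>x. hderiv Z x $ i) has_vector_derivative rhs q lam Z x $ i) (at x)" if "(hderiv Z has_vector_derivative rhs q lam Z x) (at x)" for Z
      by (rule bounded_linear.has_vector_derivative[OF bounded_linear_vec_nth that])
    have "((\<lambda>x. pd i x)
      has_vector_derivative
       dG2 i x) (at x)"
      by (intro has_vector_derivative_add has_vector_derivative_mult p prims beta_continuous h elim)
    moreover have "dG2 i x
       = sv x $ i + rhs q lam tf x $ i"
    proof -
      have "co' (bm x) (bF x) (bH x) (bP x) x $ i = sv x $ i" using beta_sum(2)[of x] elim(5) by simp
      then show ?thesis using exhaust_2[of i] by (auto simp: tf_def co_def co'_def algebra_simps)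
    qed
    ultimately have d: "((\<lambda>x. pd i x)
      has_vector_derivative sv x $ i + rhs q lam tf x $ i) (at x)" by (simp only:)
    show ?case
      by (rule has_vector_derivative_transform_within_open[OF d open_greaterThan[of 0]])
        (use elim(5) in \<open>auto simp: tf_hderiv tf'_def co'_def\<close>)
  qed
qed

text \<open>At 0 the coefficients are minus the integrals of the densities, so the Wronskian with a
  column of \<Phi> is the integral of \<open>n\<close> against the second component of that column.
  The assumed orthogonality is thus the boundary condition.\<close>

lemma tf_boundary: "bLp \<alpha> (tf 0) (tf' 0) = 0"
proof -
  have W0: "W (tf 0) (tf' 0) (\<Phi> j 0) (hderiv (\<Phi> j) 0) = 0" for j
  proof -
    let ?w = "\<lambda>Z. w Z (\<Phi> j)"
    have h: "(\<beta> has_integral - prim \<beta> 0) {0..b}" if "ipair (prim \<beta>) \<beta>" "prim \<beta> b = 0" for \<beta>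
      using ipair_diff[OF that(1) order_refl less_imp_le[OF b]] that(2) by simp
    have "((\<lambda>x. bm x * ?w Fm1 + bF x * ?w Fpi + bH x * ?w Fmi + bP x * ?w Fp1) has_integral
      (- prim bm 0 * ?w Fm1 + - prim bF 0 * ?w Fpi + - prim bH 0 * ?w Fmi + - prim bP 0 * ?w Fp1)) {0..b}"
      by (intro has_integral_add has_integral_mult_left h prims order_refl)
    moreover have "bm x * ?w Fm1 + bF x * ?w Fpi + bH x * ?w Fmi + bP x * ?w Fp1 = - (n x * cnj (\<Phi> j x $ 2))" if "x \<in> {0..b}" for x
      using W_co[of x "\<Phi> j" "bm x" "bF x" "bH x" "bP x"] beta_sum[of x] that by (simp add: sol_\<Phi> W_sv)
    ultimately have hi: "((\<lambda>x. - (n x * cnj (\<Phi> j x $ 2))) has_integral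
      (- prim bm 0 * ?w Fm1 + - prim bF 0 * ?w Fpi + - prim bH 0 * ?w Fmi + - prim bP 0 * ?w Fp1)) {0..b}"
      by (rule has_integral_eq[rotated])
    have "- prim bm 0 * ?w Fm1 + - prim bF 0 * ?w Fpi + - prim bH 0 * ?w Fmi + - prim bP 0 * ?w Fp1 = 0"
      by (rule trans[OF integral_unique[OF hi, symmetric]]) (simp add: orth)
    then show ?thesis unfolding tf_def tf'_def W_co[OF order_refl sol_\<Phi>] by (simp add: algebra_simps add_eq_0_iff)
  qed
  have "bLp \<alpha> (tf 0) (tf' 0) $ 2 = 0" "bLp \<alpha> (tf 0) (tf' 0) $ 1 = 0"
    using W0[of 1] W0[of 2] unfolding W_boundary[of _ _ _ _ \<alpha>] \<Phi>_data by (simp_all add: axis_def)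
  then show ?thesis by (simp add: vec2_eq_iff)
qed

lemma tf_L2: "(\<lambda>x. tf x $ i) \<in> L2"
  by (rule L2_compact_support[OF tf_continuous(1), of b]) (simp add: tf_support)

lemma tf_H_op: "((\<lambda>x. tf x $ 2), (\<lambda>x. lam * tf x $ 1)) \<in> H_op q \<alpha>"
proof -
  have "ell1 \<alpha> (tf 0 $ 2) (tf' 0 $ 2) = 0" using tf_boundary by (simp add: bLp_def vec2_eq_iff)
  then have "ell_perp \<alpha> (\<lambda>x. tf x $ 2) = 0" using ell_eq(2)[OF tf_deriv[OF order_refl, of 2], of \<alpha>] by simp
  moreover have "AE x in halfline. \<exists>f2. (hderiv (\<lambda>x. tf x $ 2) has_vector_derivative f2) (at x) \<and> lam * tf x $ 1 = - f2 + q x * tf x $ 2"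
    using tf_AE[of 2] by eventually_elim (auto simp: sv_def)
  ultimately show ?thesis by (simp add: H_op_def tf_L2 L2_cmult tf_regular)
qed

text \<open>The adjoint relation is tested with \<open>tf $ 2\<close>; Green's formula, through the
  equation of \<open>F $ 2\<close>, is tested with \<open>tf $ 1\<close>. The two identities differ
  by the inner product of \<open>F $ 2\<close> with \<open>n\<close>.\<close>

lemma eigenfunction_orthogonal:
  fixes F :: "real => complex^2"
  assumes F: "((\<lambda>x. F x $ 2), (\<lambda>x. lam * F x $ 1)) \<in> H_op q \<alpha>" "((\<lambda>x. F x $ 1), (\<lambda>x. lam * F x $ 2)) \<in> adjoint_op (H_op q \<alpha>)"
  shows "L2_inner (\<lambda>x. F x $ 2) n = 0"
proof -
  note e = H_op_elem[OF q F(1)]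
  have nL: "n \<in> L2" by (rule L2_compact_support[OF n nb])
  have F1: "(\<lambda>x. F x $ 1) \<in> L2" using F(2) by (simp add: adjoint_op_def)
  have A: "L2_inner (\<lambda>x. lam * tf x $ 1) (\<lambda>x. F x $ 1) = L2_inner (\<lambda>x. tf x $ 2) (\<lambda>x. lam * F x $ 2)"
    using F(2) tf_H_op unfolding adjoint_op_def by blast
  have B: "L2_inner (\<lambda>x. lam * F x $ 1) (\<lambda>x. tf x $ 1) = L2_inner (\<lambda>x. F x $ 2) (\<lambda>x. lam * tf x $ 2 + n x)"
  proof (rule green_halfline[OF e(1,2) tf_L2 _ e(3,4) tf_ipair(1)])
    show "(\<lambda>x. lam * tf x $ 2 + n x) \<in> L2" by (intro L2_add L2_cmult tf_L2 nL)
    show "ipair (\<lambda>x. tf' x $ 1) (\<lambda>x. cnj (q x) * tf x $ 1 - (lam * tf x $ 2 + n x))"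
      by (rule ipair_cong'[OF tf_ipair(2)[of 1]]) (simp_all add: sv_def)
    show "F 0 $ 2 * cnj (tf' 0 $ 1) - hderiv (\<lambda>x. F x $ 2) 0 * cnj (tf 0 $ 1) = 0"
      by (rule boundary_form_zero[OF e(5)]) (use tf_boundary in \<open>simp add: bLp_def vec2_eq_iff\<close>)
    show "((\<lambda>x. F x $ 2 * cnj (tf' x $ 1) - hderiv (\<lambda>x. F x $ 2) x * cnj (tf x $ 1)) \<longlongrightarrow> 0) at_top"
      by (rule tendsto_eventually) (use eventually_ge_at_top[of b] in \<open>eventually_elim, simp add: tf_support\<close>)
  qed
  have I: "integrable halfline (\<lambda>x. F x $ 1 * cnj (tf x $ 1))" "integrable halfline (\<lambda>x. F x $ 2 * cnj (tf x $ 2))" "integrable halfline (\<lambda>x. F x $ 2 * cnj (n x))"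
    by (intro L2_mult_integrable e(1) F1 tf_L2 nL)+
  have "lam * L2_inner (\<lambda>x. F x $ 1) (\<lambda>x. tf x $ 1) = lam * L2_inner (\<lambda>x. F x $ 2) (\<lambda>x. tf x $ 2) + L2_inner (\<lambda>x. F x $ 2) n"
  proof -
    have "F x $ 2 * cnj (lam * tf x $ 2 + n x) = lam * (F x $ 2 * cnj (tf x $ 2)) + F x $ 2 * cnj (n x)" for x
      by (simp add: algebra_simps)
    then show ?thesis using B I(2,3) by (simp add: L2_inner_def mult.assoc)
  qed
  moreover have "lam * cnj (L2_inner (\<lambda>x. tf x $ 1) (\<lambda>x. F x $ 1)) = lam * cnj (L2_inner (\<lambda>x. tf x $ 2) (\<lambda>x. F x $ 2))"
    using arg_cong[OF A, of cnj] by (simp add: L2_inner_def mult.assoc mult.left_commute[of _ "(complex_of_real k)\<^sup>2"])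
  moreover have "cnj (L2_inner u v) = L2_inner v u" for u v
    using integral_bounded_linear'[OF bounded_linear_cnj bounded_linear_cnj, of halfline "\<lambda>x. u x * cnj (v x)"]
    by (simp add: L2_inner_def mult.commute)
  ultimately show ?thesis by simp
qed

end
end

lemma weighted_square_zero:
  fixes g :: "real => complex"
  assumes g: "continuous_on {0..b} g" and i: "integral {0..b} (\<lambda>x. complex_of_real (max 0 (b - x)) * (g x * cnj (g x))) = 0"
    and x: "0 \<le> x" "x < b"
  shows "g x = 0"
proof -
  have c: "continuous_on (cbox 0 b) (\<lambda>x. max 0 (b - x) * (norm (g x))\<^sup>2)"
    by (intro continuous_intros) (use g in simp)
  have eq: "complex_of_real (max 0 (b - x)) * (g x * cnj (g x)) = complex_of_real (max 0 (b - x) * (norm (g x))\<^sup>2)" for x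
    unfolding complex_norm_square[symmetric] by simp
  have h: "((\<lambda>x. max 0 (b - x) * (norm (g x))\<^sup>2) has_integral integral {0..b} (\<lambda>x. max 0 (b - x) * (norm (g x))\<^sup>2)) {0..b}"
    using integrable_continuous[OF c] by (simp add: integrable_integral)
  have "((\<lambda>x. complex_of_real (max 0 (b - x) * (norm (g x))\<^sup>2)) has_integral complex_of_real (integral {0..b} (\<lambda>x. max 0 (b - x) * (norm (g x))\<^sup>2))) {0..b}"
    using has_integral_linear[OF h bounded_linear_of_real] by (simp add: o_def)
  from trans[OF sym[OF integral_unique[OF this]] i[unfolded eq]]
  have "integral {0..b} (\<lambda>x. max 0 (b - x) * (norm (g x))\<^sup>2) = 0" by (simp only: of_real_eq_0_iff)
  then have "max 0 (b - x) * (norm (g x))\<^sup>2 = 0"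
    using has_integral_0_cbox_imp_0[OF c _ _ _, of x] h x by (auto simp: box_real)
  then show ?thesis using x by simp
qed

lemma L2_inner_compact_support:
  assumes "f \<in> L2" "n \<in> L2" "\<And>x. x \<ge> b ==> n x = 0" "b \<ge> 0"
  shows "L2_inner f n = integral {0..b} (\<lambda>x. f x * cnj (n x))"
proof -
  have "(\<lambda>x. f x * cnj (n x)) absolutely_integrable_on {0..}"
    using L2_mult_integrable[OF assms(1,2)] integrable_halfline_iff by blast
  then have "L2_inner f n = integral {0..} (\<lambda>x. f x * cnj (n x))"
    unfolding L2_inner_def by (rule integral_halfline_eq)
  also have "\<dots> = integral {0..b} (\<lambda>x. f x * cnj (n x))"
    by (rule integral_spike_set; rule negligible_subset[of "{}"]) (use assms(3) in \<open>auto simp: not_le\<close>)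
  finally show ?thesis .
qed

context jost_phi begin

lemma \<Phi>c_zero_iff: assumes "b > 0" "\<And>x. 0 \<le> x ==> x < b ==> \<Phi>c c d x $ 2 = 0" shows "c = 0" "d = 0"
  using \<Phi>c_zero[of c d] second_component_zero[OF sol_\<Phi>c assms] by auto

text \<open>\<open>F $ 2\<close> is projected onto the span of the second components of the columns
  in an \<open>L2\<close> space with weight \<eta> on \<open>{0..b}\<close>. The weighted residual
  is an admissible source \<open>n\<close>, so its product with \<open>F $ 2\<close> integrates to 0
  and the residual vanishes. Unique continuation makes the Gram map \<open>T\<close>
  injective.\<close>

lemma eigenfunction_local:
  fixes F :: "real => complex^2"
  assumes F: "((\<lambda>x. F x $ 2), (\<lambda>x. lam * F x $ 1)) \<in> H_op q \<alpha>" "((\<lambda>x. F x $ 1), (\<lambda>x. lam * F x $ 2)) \<in> adjoint_op (H_op q \<alpha>)"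
    and b: "b > 0"
  obtains c d where "\<And>x. 0 \<le> x ==> x < b ==> F x $ 2 = \<Phi>c c d x $ 2"
proof -
  \<comment> \<open>The weight vanishes from \<open>b\<close> on, so the weighted residual is
    continuous on the half-line with the required support.\<close>
  define \<eta> where "\<eta> x = complex_of_real (max 0 (b - x))" for x
  define K where "K i j = integral {0..b} (\<lambda>x. \<eta> x * \<Phi> j x $ 2 * cnj (\<Phi> i x $ 2))" for i j
  define T :: "complex^2 => complex^2" where "T c = vector [c $ 1 * K 1 1 + c $ 2 * K 1 2, c $ 1 * K 2 1 + c $ 2 * K 2 2]" for c
  have \<eta>c: "continuous_on A \<eta>" for A unfolding \<eta>_def[abs_def] by (intro continuous_intros)
  have \<eta>cnj: "cnj (\<eta> x) = \<eta> x" for x by (simp add: \<eta>_def)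
  have \<Phi>C: "continuous_on {0..b} (\<lambda>x. \<Phi> j x $ 2)" for j
    by (intro continuous_intros continuous_on_subset[OF sol_ipair(3)[OF sol_\<Phi>]]) auto
  have \<Phi>cC: "continuous_on {0..b} (\<lambda>x. \<Phi>c c d x $ 2)" for c d
    by (intro continuous_intros continuous_on_subset[OF sol_ipair(3)[OF sol_\<Phi>c]]) auto
  have FC: "continuous_on {0..} (\<lambda>x. F x $ 2)" by (rule ipair_continuous_on[OF H_op_elem(3)[OF q F(1)]])
  have FC': "continuous_on {0..b} (\<lambda>x. F x $ 2)" by (rule continuous_on_subset[OF FC]) auto
  have ints: "(\<lambda>x. \<eta> x * \<Phi> j x $ 2 * cnj (\<Phi> i x $ 2)) integrable_on {0..b}" for i j
    by (intro integrable_continuous_real continuous_intros \<eta>c \<Phi>C)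
  have TK: "integral {0..b} (\<lambda>x. \<eta> x * \<Phi>c (c $ 1) (c $ 2) x $ 2 * cnj (\<Phi> i x $ 2)) = T c $ i" for c i
  proof -
    have "((\<lambda>x. c $ 1 * (\<eta> x * \<Phi> 1 x $ 2 * cnj (\<Phi> i x $ 2)) + c $ 2 * (\<eta> x * \<Phi> 2 x $ 2 * cnj (\<Phi> i x $ 2))) has_integral
      c $ 1 * K i 1 + c $ 2 * K i 2) {0..b}"
      unfolding K_def by (intro has_integral_add has_integral_mult_right integrable_integral ints)
    then have "integral {0..b} (\<lambda>x. c $ 1 * (\<eta> x * \<Phi> 1 x $ 2 * cnj (\<Phi> i x $ 2)) + c $ 2 * (\<eta> x * \<Phi> 2 x $ 2 * cnj (\<Phi> i x $ 2))) = T c $ i"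
      using exhaust_2[of i] by (auto simp: T_def integral_unique)
    then show ?thesis by (simp add: \<Phi>c_def algebra_simps)
  qed
  have pair: "integral {0..b} (\<lambda>x. g x * cnj (\<Phi>c c d x $ 2)) = cnj c * integral {0..b} (\<lambda>x. g x * cnj (\<Phi> 1 x $ 2)) + cnj d * integral {0..b} (\<lambda>x. g x * cnj (\<Phi> 2 x $ 2))"
    if "continuous_on {0..b} g" for g c d
  proof -
    have i: "(\<lambda>x. g x * cnj (\<Phi> i x $ 2)) integrable_on {0..b}" for i
      by (intro integrable_continuous_real continuous_intros that \<Phi>C)
    have "((\<lambda>x. cnj c * (g x * cnj (\<Phi> 1 x $ 2)) + cnj d * (g x * cnj (\<Phi> 2 x $ 2))) has_integral
      cnj c * integral {0..b} (\<lambda>x. g x * cnj (\<Phi> 1 x $ 2)) + cnj d * integral {0..b} (\<lambda>x. g x * cnj (\<Phi> 2 x $ 2))) {0..b}"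
      by (intro has_integral_add has_integral_mult_right integrable_integral i)
    from integral_unique[OF this] show ?thesis by (simp add: \<Phi>c_def algebra_simps)
  qed
  have l: "linear T" by (rule linearI) (auto simp: T_def vec2_eq_iff algebra_simps)
  have "c = 0" if "T c = 0" for c
  proof -
    have "integral {0..b} (\<lambda>x. \<eta> x * \<Phi>c (c $ 1) (c $ 2) x $ 2 * cnj (\<Phi>c (c $ 1) (c $ 2) x $ 2)) = 0"
      by (subst pair) (auto simp: TK that intro!: continuous_intros \<eta>c \<Phi>cC)
    then have z: "integral {0..b} (\<lambda>x. complex_of_real (max 0 (b - x)) * (\<Phi>c (c $ 1) (c $ 2) x $ 2 * cnj (\<Phi>c (c $ 1) (c $ 2) x $ 2))) = 0"
      unfolding \<eta>_def mult.assoc .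
    note \<Phi>c_zero_iff[OF b weighted_square_zero[OF \<Phi>cC z]]
    then show "c = 0" by (simp add: vec2_eq_iff)
  qed
  then have "inj T" using linear_injective_0[OF l] by blast
  then have sT: "surj T" by (rule linear_injective_imp_surjective[OF l _ refl])
  define t where "t = (\<chi> i. integral {0..b} (\<lambda>x. \<eta> x * F x $ 2 * cnj (\<Phi> i x $ 2)))"
  obtain c where c: "T c = t" using sT by (metis surjD)
  define r where "r x = F x $ 2 - \<Phi>c (c $ 1) (c $ 2) x $ 2" for x
  define n where "n x = \<eta> x * r x" for x
  have rC: "continuous_on {0..b} r" unfolding r_def[abs_def] by (intro continuous_intros FC' \<Phi>cC)
  have nC: "continuous_on {0..} n" unfolding n_def[abs_def] r_def
    by (intro continuous_intros \<eta>c FC sol_ipair(3)[OF sol_\<Phi>c])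
  have nb: "n x = 0" if "x \<ge> b" for x using that by (simp add: n_def \<eta>_def)
  have orth: "integral {0..b} (\<lambda>x. n x * cnj (\<Phi> i x $ 2)) = 0" for i
  proof -
    have "integral {0..b} (\<lambda>x. \<eta> x * F x $ 2 * cnj (\<Phi> i x $ 2) - \<eta> x * \<Phi>c (c $ 1) (c $ 2) x $ 2 * cnj (\<Phi> i x $ 2)) = t $ i - T c $ i"
      unfolding TK[symmetric] t_def
      by (subst Henstock_Kurzweil_Integration.integral_diff) (auto intro!: integrable_continuous_real continuous_intros \<eta>c FC' \<Phi>C \<Phi>cC)
    then show ?thesis unfolding c by (simp add: n_def r_def algebra_simps)
  qed
  have "L2_inner (\<lambda>x. F x $ 2) n = 0" by (rule eigenfunction_orthogonal[OF nC b nb orth F])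
  then have 1: "integral {0..b} (\<lambda>x. F x $ 2 * cnj (n x)) = 0"
    using L2_inner_compact_support[OF H_op_elem(1)[OF q F(1)] L2_compact_support[OF nC nb] nb] b by simp
  have "integral {0..b} (\<lambda>x. n x * cnj (\<Phi>c (c $ 1) (c $ 2) x $ 2)) = 0"
    by (subst pair) (auto simp: orth intro: continuous_on_subset[OF nC])
  then have 2: "integral {0..b} (\<lambda>x. \<Phi>c (c $ 1) (c $ 2) x $ 2 * cnj (n x)) = 0"
    using integral_cnj[of "{0..b}" "\<lambda>x. n x * cnj (\<Phi>c (c $ 1) (c $ 2) x $ 2)"] by (simp add: mult.commute)
  have nC': "continuous_on {0..b} n" by (rule continuous_on_subset[OF nC]) auto
  have "integral {0..b} (\<lambda>x. F x $ 2 * cnj (n x) - \<Phi>c (c $ 1) (c $ 2) x $ 2 * cnj (n x)) = 0"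
    by (subst Henstock_Kurzweil_Integration.integral_diff) (auto simp: 1 2 intro!: integrable_continuous_real continuous_intros nC' FC' \<Phi>cC)
  then have "integral {0..b} (\<lambda>x. complex_of_real (max 0 (b - x)) * (r x * cnj (r x))) = 0"
    by (simp add: n_def r_def \<eta>_def algebra_simps)
  from weighted_square_zero[OF rC this] show ?thesis by (intro that[of "c $ 1" "c $ 2"]) (simp add: r_def)
qed

lemma eigenvalue_imp_p1_zero:
  assumes "op_eigenvalue (hermitisation (H_op q \<alpha>)) lam"
  shows "\<gamma>p1 1 = 0"
proof -
  obtain F :: "real => complex^2" where F: "((\<lambda>x. F x $ 2), (\<lambda>x. lam * F x $ 1)) \<in> H_op q \<alpha>" "((\<lambda>x. F x $ 1), (\<lambda>x. lam * F x $ 2)) \<in> adjoint_op (H_op q \<alpha>)"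
    "\<not> (AE x in halfline. F x = 0)"
    using assms by (auto simp: op_eigenvalue_def hermitisation_def)
  obtain c d where cd: "\<And>x. 0 \<le> x ==> x < 1 ==> F x $ 2 = \<Phi>c c d x $ 2"
    by (rule eigenfunction_local[OF F(1,2), of 1]) auto
  have F2: "F x $ 2 = \<Phi>c c d x $ 2" if x: "x \<ge> 0" for x
  proof -
    obtain c' d' where cd': "\<And>y. 0 \<le> y ==> y < x + 1 ==> F y $ 2 = \<Phi>c c' d' y $ 2"
      by (rule eigenfunction_local[OF F(1,2), of "x + 1"]) (use x in auto)
    \<comment> \<open>Every interval brings its own coefficients; they agree because the second
      component on \<open>{0..<1}\<close> determines them.\<close>
    have "\<Phi>c (c' - c) (d' - d) y $ 2 = 0" if "0 \<le> y" "y < 1" for y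
      using cd[OF that] cd'[of y] that x by (simp add: \<Phi>c_def algebra_simps)
    from \<Phi>c_zero_iff[OF zero_less_one this] have "c' - c = 0" "d' - d = 0" by auto
    then show ?thesis using cd'[of x] x by simp
  qed
  note e = H_op_elem[OF q F(1)]
  have h: "hderiv (\<lambda>x. F x $ 2) x = hderiv (\<Phi>c c d) x $ 2" if x: "x \<ge> 0" for x
  proof -
    have "((\<lambda>x. \<Phi>c c d x $ 2) has_vector_derivative hderiv (\<Phi>c c d) x $ 2) (at x within {0..})"
      by (rule ipair_has_vector_derivative[OF sol_ipair(1)[OF sol_\<Phi>c] _ x]) (intro continuous_intros sol_ipair(4)[OF sol_\<Phi>c])
    then have "((\<lambda>x. F x $ 2) has_vector_derivative hderiv (\<Phi>c c d) x $ 2) (at x within {0..})"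
      by (rule has_vector_derivative_transform_within[where d = 1]) (use x F2 in auto)
    then show ?thesis by (rule hderiv_eq[OF _ x])
  qed
  have pos: "AE x in halfline. x > 0" by (rule AE_I2) (simp add: space_restrict_space)
  \<comment> \<open>The first component is recovered as \<open>(q * F2 - F2'') / lam\<close>, at the
    points where these second derivatives exist.\<close>
  have ae: "AE x in halfline. F x = \<Phi>c c d x"
    using e(6) \<Phi>(1)[of 1, THEN solution_AE] \<Phi>(1)[of 2, THEN solution_AE] pos
  proof eventually_elim
    case (elim x)
    have p: "((\<lambda>x. hderiv (\<Phi> j) x $ 2) has_vector_derivative rhs q lam (\<Phi> j) x $ 2) (at x)" if "(hderiv (\<Phi> j) has_vector_derivative rhs q lam (\<Phi> j) x) (at x)" for j
      by (rule bounded_linear.has_vector_derivative[OF bounded_linear_vec_nth that])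
    have "((\<lambda>x. c * hderiv (\<Phi> 1) x $ 2 + d * hderiv (\<Phi> 2) x $ 2) has_vector_derivative c * rhs q lam (\<Phi> 1) x $ 2 + d * rhs q lam (\<Phi> 2) x $ 2) (at x)"
      by (intro has_vector_derivative_add has_vector_derivative_mult_right p elim)
    then have "(hderiv (\<lambda>x. F x $ 2) has_vector_derivative c * rhs q lam (\<Phi> 1) x $ 2 + d * rhs q lam (\<Phi> 2) x $ 2) (at x)"
      by (rule has_vector_derivative_transform_within_open[OF _ open_greaterThan[of 0]]) (use elim(4) in \<open>auto simp: h hderiv_\<Phi>c\<close>)
    from vector_derivative_unique_at[OF this elim(1)]
    have "q x * \<Phi>c c d x $ 2 - lam * \<Phi>c c d x $ 1 = q x * F x $ 2 - lam * F x $ 1"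
      by (simp add: \<Phi>c_def algebra_simps)
    then show ?case using F2[of x] elim(4) k by (simp add: vec2_eq_iff)
  qed
  have \<Phi>cC: "continuous_on {0..} (\<Phi>c c d)" by (rule sol_ipair(3)[OF sol_\<Phi>c])
  have m: "(\<lambda>x. (norm (\<Phi>c c d x))\<^sup>2) \<in> borel_measurable halfline"
    by (rule continuous_measurable_halfline) (intro continuous_intros \<Phi>cC)
  have F1: "(\<lambda>x. F x $ 1) \<in> L2" using F(2) by (simp add: adjoint_op_def)
  have i: "integrable halfline (\<lambda>x. (norm (F x $ 1))\<^sup>2 + (norm (F x $ 2))\<^sup>2)"
    using F1 e(1) unfolding L2_def by auto
  then have "integrable halfline (\<lambda>x. (norm (\<Phi>c c d x))\<^sup>2)"
  proof (subst integrable_cong_AE[OF m borel_measurable_integrable[OF i]])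
    show "AE x in halfline. (norm (\<Phi>c c d x))\<^sup>2 = (norm (F x $ 1))\<^sup>2 + (norm (F x $ 2))\<^sup>2"
      using ae by eventually_elim (simp add: norm_sq2[symmetric])
  qed
  then have "(\<Phi>c c d \<longlongrightarrow> 0) at_top"
    unfolding integrable_halfline_iff by (rule isol_L2_tendsto_0(1)[OF q sol_\<Phi>c[unfolded sol_def]])
  moreover have "c \<noteq> 0 \<or> d \<noteq> 0"
  proof (rule ccontr)
    assume "\<not> (c \<noteq> 0 \<or> d \<noteq> 0)"
    then have "AE x in halfline. F x = 0" using ae by (simp add: \<Phi>c_def[abs_def])
    then show False using F(3) by simp
  qed
  ultimately show ?thesis by (rule decaying_bc_solution)
qed

end

context jost_spectral begin

lemma p1_zero_imp_eigenvalue: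
  assumes eig: "\<gamma>p1 1 = 0"
  shows "op_eigenvalue (hermitisation (H_op q \<alpha>)) lam"
proof -
  have s: "solution q lam Fm1" using jost_sols(1) by (simp add: jost_solution_def)
  have reg: "regular Fm1" using s by (simp add: solution_def)
  note i = sol_ipair[OF sol_jost(1)]
  have d: "((\<lambda>x. Fm1 x $ j) has_vector_derivative hderiv Fm1 x $ j) (at x within {0..})" if "x \<ge> 0" for x j
    by (rule ipair_has_vector_derivative[OF i(1) _ that]) (intro continuous_intros i(4))
  have h: "hderiv (\<lambda>x. Fm1 x $ j) x = hderiv Fm1 x $ j" if "x \<ge> 0" for x j by (rule hderiv_eq[OF d[OF that] that])
  have c: "continuous_on {0..} (\<lambda>x. Fm1 x $ j)" "continuous_on {0..} (\<lambda>x. hderiv Fm1 x $ j)" for j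
    by (intro continuous_intros i(3,4))+
  have L: "(\<lambda>x. Fm1 x $ j) \<in> L2" for j
  proof -
    have "Fm1 \<in> L2" by (rule L2_continuous[OF i(3)]) (use sqint_Fm1 in \<open>simp add: sqint_def\<close>)
    then have "integrable halfline (\<lambda>x. (norm (Fm1 x))\<^sup>2)" by (simp add: L2_def)
    then have "integrable halfline (\<lambda>x. (norm (Fm1 x $ j))\<^sup>2)"
    proof (rule Bochner_Integration.integrable_bound)
      show "(\<lambda>x. (norm (Fm1 x $ j))\<^sup>2) \<in> borel_measurable halfline"
        by (rule continuous_measurable_halfline) (intro continuous_intros c)
      show "AE x in halfline. norm ((norm (Fm1 x $ j))\<^sup>2) \<le> norm ((norm (Fm1 x))\<^sup>2)"
        by (rule AE_I2) (simp add: power_mono Finite_Cartesian_Product.norm_nth_le)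
    qed
    then show ?thesis using continuous_measurable_halfline[OF c(1)] by (simp add: L2_def)
  qed
  \<comment> \<open>\<open>D *s Fm1\<close> is a combination of the columns of \<Phi>, which satisfy
    the condition, and \<open>D\<close> is nonzero.\<close>
  have bc: "bLp \<alpha> (Fm1 0) (hderiv Fm1 0) = 0"
  proof -
    have eq: "\<Phi>c (\<gamma>mi 2) (- \<gamma>mi 1) x = D *s Fm1 x" if "x \<ge> 0" for x using eigenfunction[OF eig that] .
    have "sol (\<lambda>x. D *s Fm1 x + 0 *s Fm1 x)" by (intro sol_lincomb sol_jost)
    then have "hderiv (\<Phi>c (\<gamma>mi 2) (- \<gamma>mi 1)) 0 = hderiv (\<lambda>x. D *s Fm1 x + 0 *s Fm1 x) 0"
      by (rule sol_hderiv_cong) (use eq in auto)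
    also have "\<dots> = D *s hderiv Fm1 0" by (subst hderiv_lincomb) auto
    finally have "D *s bLp \<alpha> (Fm1 0) (hderiv Fm1 0) = 0"
      using \<Phi>c_data(2)[of "\<gamma>mi 2" "- \<gamma>mi 1"] eq[of 0] by (simp add: bL_lin)
    then show ?thesis using D_nonzero[OF eig] by (simp add: vec2_eq_iff)
  qed
  have r: "regular (\<lambda>x. Fm1 x $ j)" for j
    unfolding regular_def
  proof (intro conjI allI impI)
    fix x :: real assume "x \<ge> 0"
    then show "(\<lambda>x. Fm1 x $ j) differentiable at x within {0..}" by (rule differentiableI_vector[OF d])
  next
    have "locally_absolutely_continuous Fm1" "locally_absolutely_continuous (hderiv Fm1)" using reg by (auto simp: regular_def)
    then show "locally_absolutely_continuous (\<lambda>x. Fm1 x $ j)" "locally_absolutely_continuous (hderiv (\<lambda>x. Fm1 x $ j))"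
      by (auto intro: lac_component lac_cong[OF lac_component] simp: h)
  qed
  have pos: "AE x in halfline. x > 0" by (rule AE_I2) (simp add: space_restrict_space)
  have "((\<lambda>x. Fm1 x $ 2), (\<lambda>x. lam * Fm1 x $ 1)) \<in> H_op q \<alpha>"
  proof -
    have "ell1 \<alpha> (Fm1 0 $ 2) (hderiv Fm1 0 $ 2) = 0" using bc by (simp add: bLp_def vec2_eq_iff)
    then have "ell_perp \<alpha> (\<lambda>x. Fm1 x $ 2) = 0" using ell_eq(2)[OF d[OF order_refl, of 2], of \<alpha>] by simp
    moreover have "AE x in halfline. \<exists>f2. (hderiv (\<lambda>x. Fm1 x $ 2) has_vector_derivative f2) (at x) \<and> lam * Fm1 x $ 1 = - f2 + q x * Fm1 x $ 2"
      using solution_AE[OF s] pos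
    proof eventually_elim
      case (elim x)
      have "((\<lambda>x. hderiv Fm1 x $ 2) has_vector_derivative rhs q lam Fm1 x $ 2) (at x)"
        by (rule bounded_linear.has_vector_derivative[OF bounded_linear_vec_nth elim(1)])
      then have "(hderiv (\<lambda>x. Fm1 x $ 2) has_vector_derivative rhs q lam Fm1 x $ 2) (at x)"
        by (rule has_vector_derivative_transform_within_open[OF _ open_greaterThan[of 0]]) (use elim(2) in \<open>auto simp: h\<close>)
      then show ?case by (intro exI conjI) auto
    qed
    ultimately show ?thesis by (simp add: H_op_def L L2_cmult r)
  qed
  \<comment> \<open>Membership in the adjoint is Green's formula against an arbitrary domain
    element: both factors decay at infinity, and at 0 the conjugate boundary conditions
    cancel.\<close>
  moreover have "((\<lambda>x. Fm1 x $ 1), (\<lambda>x. lam * Fm1 x $ 2)) \<in> adjoint_op (H_op q \<alpha>)"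
  proof -
    have "L2_inner u (\<lambda>x. Fm1 x $ 1) = L2_inner f (\<lambda>x. lam * Fm1 x $ 2)" if fu: "(f, u) \<in> H_op q \<alpha>" for f u
    proof -
      note e = H_op_elem[OF q fu]
      show ?thesis
      proof (rule green_halfline[OF e(1,2) L L2_cmult[OF L] e(3,4) i(1)])
        show "ipair (\<lambda>x. hderiv Fm1 x $ 1) (\<lambda>x. cnj (q x) * Fm1 x $ 1 - lam * Fm1 x $ 2)"
          using i(2)[of 1] by simp
        show "f 0 * cnj (hderiv Fm1 0 $ 1) - hderiv f 0 * cnj (Fm1 0 $ 1) = 0"
          by (rule boundary_form_zero[OF e(5)]) (use bc in \<open>simp add: bLp_def vec2_eq_iff\<close>)
        note l = L2_domain_decay[OF q e(1,3,2,4)]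
        have "(hderiv Fm1 \<longlongrightarrow> 0) at_top"
          by (rule isol_deriv_tendsto_0[OF q sol_jost(1)[unfolded sol_def] Fm1_tendsto_0])
        note v = tendsto_vec_nth[OF this, of 1] tendsto_vec_nth[OF Fm1_tendsto_0, of 1]
        have "((\<lambda>x. f x * cnj (hderiv Fm1 x $ 1) - hderiv f x * cnj (Fm1 x $ 1)) \<longlongrightarrow> 0 * cnj ((0 :: complex^2) $ 1) - 0 * cnj ((0 :: complex^2) $ 1)) at_top"
          by (intro tendsto_diff tendsto_mult tendsto_cnj l v)
        then show "((\<lambda>x. f x * cnj (hderiv Fm1 x $ 1) - hderiv f x * cnj (Fm1 x $ 1)) \<longlongrightarrow> 0) at_top" by simp
      qed
    qed
    then show ?thesis by (auto simp: adjoint_op_def L L2_cmult)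
  qed
  moreover have "\<not> (AE x in halfline. Fm1 x = 0)"
  proof
    assume "AE x in halfline. Fm1 x = 0"
    then have "(LINT x|halfline. (norm (Fm1 x))\<^sup>2) = (LINT x|halfline. 0)"
      by (intro integral_cong_AE continuous_measurable_halfline continuous_intros i(3)) (auto elim: eventually_mono)
    then have "integral {0..} (\<lambda>x. (norm (Fm1 x))\<^sup>2) = 0"
      using integral_halfline_eq[OF sqint_Fm1[unfolded sqint_def]] by simp
    then show False using eigenvalue_residue(1)[OF eig] by simp
  qed
  ultimately show ?thesis unfolding op_eigenvalue_def hermitisation_def by (intro exI[of _ Fm1]) simp
qed

lemma eigenvalue_iff: "op_eigenvalue (hermitisation (H_op q \<alpha>)) lam \<longleftrightarrow> \<gamma>p1 1 = 0"
  using eigenvalue_imp_p1_zero p1_zero_imp_eigenvalue by blast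

end

section \<open>The scalar Jost solution\<close>

context jost_spectral begin

text \<open>The vector with components \<open>cnj e\<close> and \<open>- e\<close> turns the
  antilinear scalar equation into the linear system. Its leading term is \<open>e_minus\<close>, so
  it is \<open>Fm1\<close>, and its two components have equal modulus; this is the origin of the
  factor 2.\<close>

lemma scalar_jost_norm:
  assumes e: "scalar_jost q k e"
  shows "integral {0..} (\<lambda>x. (norm (Fm1 x))\<^sup>2) = 2 * (L2_norm e)\<^sup>2"
proof -
  have reg: "regular e" and o: "(\<lambda>x. cmod (e x - exp (- k * x))) \<in> o[at_top](\<lambda>x. exp (- k * x))"
    and ae: "AE x in halfline. \<exists>e2. (hderiv e has_vector_derivative e2) (at x) \<and> - e2 + q x * e x = - complex_of_real (k\<^sup>2) * cnj (e x)"
    using e by (auto simp: scalar_jost_def)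
  have ec: "continuous_on {0..} e" by (rule regular_continuous_on[OF reg])
  have ec': "continuous_on {0..b} e" for b by (rule continuous_on_subset[OF ec]) auto
  have "(\<lambda>x. e x * q x + complex_of_real (k\<^sup>2) * cnj (e x)) absolutely_integrable_on {0..b}" for b
    by (intro set_integral_add(1) continuous_times_absolutely_integrable integrable_q[OF q]
        absolutely_integrable_continuous_real continuous_intros ec') simp
  then have r: "(\<lambda>x. q x * e x + complex_of_real (k\<^sup>2) * cnj (e x)) absolutely_integrable_on {0..b}" for b by (simp add: mult.commute)
  have "AE x in halfline. (hderiv e has_vector_derivative (q x * e x + complex_of_real (k\<^sup>2) * cnj (e x))) (at x)"
    using ae
  proof eventually_elim
    case (elim x)
    then obtain e2 where e2: "(hderiv e has_vector_derivative e2) (at x)" "- e2 + q x * e x = - complex_of_real (k\<^sup>2) * cnj (e x)" by blast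
    have "q x * e x + complex_of_real (k\<^sup>2) * cnj (e x) = e2" using e2(2) by (simp add: algebra_simps)
    then show ?case using e2(1) by simp
  qed
  note E = regular_ipair[OF reg r this]
  define G where "G x = (vector [cnj (e x), - e x] :: complex^2)" for x
  define G' where "G' x = (vector [cnj (hderiv e x), - hderiv e x] :: complex^2)" for x
  have "isol q (complex_of_real (k\<^sup>2)) G G'"
    unfolding isol_def
  proof
    show "ipair G G'"
      by (rule ipair_vec2; rule ipair_cong'[OF ipair_cnj[OF E(1)]] ipair_cong'[OF ipair_cmult[OF E(1), of "-1"]]) (simp_all add: G_def G'_def)
    show "ipair G' (rhs q (complex_of_real (k\<^sup>2)) G)"
      by (rule ipair_vec2; rule ipair_cong'[OF ipair_cnj[OF E(2)]] ipair_cong'[OF ipair_cmult[OF E(2), of "-1"]]) (simp_all add: G_def G'_def)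
  qed
  then have sG: "sol G" by (rule solI)
  define z where "z x = exp (- (complex_of_real k * complex_of_real x))" for x
  define t where "t x = (e x - z x) / z x" for x
  have z0: "z x \<noteq> 0" "cnj (z x) = z x" for x by (simp_all add: z_def exp_cnj)
  have ez: "e x = z x * (1 + t x)" for x using z0[of x] by (simp add: t_def field_simps)
  have "((\<lambda>x. cmod (t x)) \<longlongrightarrow> 0) at_top"
  proof -
    have "cmod (t x) = cmod (e x - exp (- k * x)) / exp (- k * x)" for x
    proof -
      have "z x = complex_of_real (exp (- k * x))" by (simp add: z_def exp_of_real[symmetric])
      then show ?thesis by (simp add: t_def norm_divide)
    qed
    then show ?thesis using smalloD_tendsto[OF o] by simp
  qed
  then have t: "(t \<longlongrightarrow> 0) at_top" by (rule tendsto_norm_zero_cancel)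
  define R where "R x = (vector [cnj (t x), - t x] :: complex^2)" for x
  have R: "(R \<longlongrightarrow> 0) at_top"
  proof (rule vec_tendstoI)
    fix i :: 2
    show "((\<lambda>x. R x $ i) \<longlongrightarrow> 0 $ i) at_top"
      using exhaust_2[of i] tendsto_cnj[OF t] tendsto_minus[OF t] by (auto simp: R_def)
  qed
  have GR: "G x = exp (- (complex_of_real k * complex_of_real x)) *s (e_minus + R x)" for x
    unfolding z_def[symmetric] using ez[of x] z0[of x] by (simp add: G_def R_def e_minus_def vec2_eq_iff algebra_simps)
  have "(G \<longlongrightarrow> 0) at_top"
    unfolding GR[abs_def] by (rule scale_mult_tendsto_0[OF exp_mk_tendsto_0 tendsto_add[OF tendsto_const R]])
  then obtain a where a: "\<And>x. x \<ge> 0 ==> G x = a *s Fm1 x" by (rule decay_multiple[OF sG]) blast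
  have "e_minus = a *s e_minus" by (rule Fm1_multiple_unique[OF GR R a])
  then have "a = 1" by (auto simp: e_minus_def vec2_eq_iff)
  then have n: "(norm (Fm1 x))\<^sup>2 = 2 * (norm (e x))\<^sup>2" if "x \<ge> 0" for x
    using a[OF that] unfolding norm_sq2 by (simp add: G_def vec2_eq_iff) (metis complex_mod_cnj norm_minus_cancel mult_2)
  have i: "(\<lambda>x. (norm (e x))\<^sup>2) absolutely_integrable_on {0..}"
  proof -
    have "(\<lambda>x. (1/2) * (norm (Fm1 x))\<^sup>2) absolutely_integrable_on {0..}"
      using sqint_Fm1 unfolding sqint_def by (intro set_integrable_mult_right) auto
    then show ?thesis by (rule absolutely_integrable_spike[of _ _ "{}"]) (auto simp: n)
  qed
  have "integral {0..} (\<lambda>x. (norm (Fm1 x))\<^sup>2) = integral {0..} (\<lambda>x. 2 * (norm (e x))\<^sup>2)"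
    by (rule Henstock_Kurzweil_Integration.integral_cong) (simp add: n)
  also have "\<dots> = 2 * (LINT x|halfline. (norm (e x))\<^sup>2)" unfolding integral_halfline_eq[OF i] by simp
  also have "\<dots> = 2 * (L2_norm e)\<^sup>2" by (simp add: L2_norm_def)
  finally show ?thesis .
qed

end

theorem theorem3p7:
  fixes q :: "real \<Rightarrow> complex" and \<alpha> :: bparam and k :: real
    and \<Phi> :: "2 \<Rightarrow> real \<Rightarrow> complex^2"
    and Fm1 Fpi Fmi Fp1 :: "real \<Rightarrow> complex^2"
    and \<gamma>m1 \<gamma>pi \<gamma>mi \<gamma>p1 :: "2 \<Rightarrow> complex"
    and \<nu> :: "real measure" and \<psi> :: "real \<Rightarrow> complex"
    and e :: "real \<Rightarrow> complex"
  assumes "integrable halfline q"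
    and "k > 0"
    and "\<And>j. solution q (complex_of_real (k\<^sup>2)) (\<Phi> j)"
    and "\<And>j. L_bd \<alpha> (\<Phi> j) = - axis j 1"
    and "\<And>j. L_bd_perp \<alpha> (\<Phi> j) = 0"
    and "jost_choice q k Fm1 Fpi Fmi Fp1"
    and "\<And>j. has_coeffs Fm1 Fpi Fmi Fp1 (\<Phi> j) (\<gamma>m1 j) (\<gamma>pi j) (\<gamma>mi j) (\<gamma>p1 j)"
    and "spectral_pair q \<alpha> \<nu> \<psi>"
    and "scalar_jost q k e"
  shows "(\<forall>F. solution q (complex_of_real (k\<^sup>2)) F \<longrightarrow>
           (\<exists>!(cm1, cpi, cmi, cp1). has_coeffs Fm1 Fpi Fmi Fp1 F cm1 cpi cmi cp1)) \<and>
    (\<not> op_eigenvalue (hermitisation (H_op q \<alpha>)) (complex_of_real (k\<^sup>2)) \<longrightarrow>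
      \<gamma>p1 2 = - cnj (\<gamma>p1 1) \<and> \<gamma>p1 2 \<noteq> 0 \<and>
      (\<forall>Fpi' Fmi' Fp1' \<gamma>m1' \<gamma>pi' \<gamma>mi' \<gamma>p1'.
         jost_choice q k Fm1 Fpi' Fmi' Fp1' \<and>
         (\<forall>j. has_coeffs Fm1 Fpi' Fmi' Fp1' (\<Phi> j) (\<gamma>m1' j) (\<gamma>pi' j) (\<gamma>mi' j) (\<gamma>p1' j)) \<longrightarrow>
         \<gamma>p1' 2 * \<gamma>pi' 1 - \<gamma>p1' 1 * \<gamma>pi' 2 = \<gamma>p1 2 * \<gamma>pi 1 - \<gamma>p1 1 * \<gamma>pi 2) \<and>
      \<gamma>p1 2 * \<gamma>pi 1 - \<gamma>p1 1 * \<gamma>pi 2 \<noteq> 0 \<and>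
      has_spectral_density_at \<nu> \<psi> (k\<^sup>2)
        (1 / (8 * pi * k) * ((cmod (\<gamma>p1 1))\<^sup>2 / (cmod (\<gamma>p1 2 * \<gamma>pi 1 - \<gamma>p1 1 * \<gamma>pi 2))\<^sup>2))
        (cnj (\<gamma>p1 1) / \<gamma>p1 1)) \<and>
    (op_eigenvalue (hermitisation (H_op q \<alpha>)) (complex_of_real (k\<^sup>2)) \<longrightarrow>
      \<gamma>p1 1 = 0 \<and> \<gamma>p1 2 = 0 \<and>
      (\<forall>Fpi' Fmi' Fp1' \<gamma>m1' \<gamma>pi' \<gamma>mi' \<gamma>p1'.
         jost_choice q k Fm1 Fpi' Fmi' Fp1' \<and>
         (\<forall>j. has_coeffs Fm1 Fpi' Fmi' Fp1' (\<Phi> j) (\<gamma>m1' j) (\<gamma>pi' j) (\<gamma>mi' j) (\<gamma>p1' j)) \<longrightarrow>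
         (\<forall>j. \<gamma>pi' j = \<gamma>pi j \<and> \<gamma>mi' j = \<gamma>mi j) \<and>
         \<gamma>m1' 1 * \<gamma>mi' 2 - \<gamma>mi' 1 * \<gamma>m1' 2 = \<gamma>m1 1 * \<gamma>mi 2 - \<gamma>mi 1 * \<gamma>m1 2) \<and>
      cmod (\<gamma>pi 1) = cmod (\<gamma>mi 1) \<and> cmod (\<gamma>mi 1) = cmod (\<gamma>pi 2) \<and>
      cmod (\<gamma>pi 2) = cmod (\<gamma>mi 2) \<and> cmod (\<gamma>mi 2) \<noteq> 0 \<and>
      \<gamma>pi 2 = cnj (\<gamma>mi 1) \<and> \<gamma>mi 2 = cnj (\<gamma>pi 1) \<and>
      \<gamma>m1 1 * \<gamma>mi 2 - \<gamma>mi 1 * \<gamma>m1 2 \<noteq> 0 \<and>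
      measure \<nu> {k\<^sup>2} = 1 / (2 * (L2_norm e)\<^sup>2) *
        ((cmod (\<gamma>pi 1))\<^sup>2 / (cmod (\<gamma>m1 1 * \<gamma>mi 2 - \<gamma>mi 1 * \<gamma>m1 2))\<^sup>2) \<and>
      \<psi> (k\<^sup>2) = - \<gamma>mi 2 / \<gamma>mi 1)"
proof -
  obtain M where M: "weyl_function q \<alpha> M"
    "\<And>l i j. Im l > 0 \<Longrightarrow> M l $ i $ j = mat_Re (M \<i>) $ i $ j +
           (LINT t|\<nu>. (1 / (complex_of_real t - l) - complex_of_real (t / (1 + t\<^sup>2))) * psi_mat (\<psi> t) $ i $ j)"
    using assms(8) unfolding spectral_pair_def by blast
  interpret jost_spectral q k Fm1 Fpi Fmi Fp1 \<alpha> \<Phi> \<gamma>m1 \<gamma>pi \<gamma>mi \<gamma>p1 \<nu> \<psi> M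
  proof unfold_locales
    show "sets \<nu> = sets borel" "\<psi> \<in> borel_measurable borel" "AE t in \<nu>. cmod (\<psi> t) \<le> 1" "integrable \<nu> (\<lambda>t. 1 / (1 + t\<^sup>2))"
      using assms(8) by (auto simp: spectral_pair_def)
  qed (fact assms M)+
  have "\<exists>!(cm1, cpi, cmi, cp1). has_coeffs Fm1 Fpi Fmi Fp1 F cm1 cpi cmi cp1" if F: "solution q (complex_of_real (k\<^sup>2)) F" for F
  proof -
    obtain a b c d where c: "has_coeffs Fm1 Fpi Fmi Fp1 F a b c d" by (rule coeffs_exist[OF sol_solution[OF F]])
    show ?thesis
    proof (rule ex1I[of _ "(a, b, c, d)"])
      fix y assume "case y of (cm1, cpi, cmi, cp1) \<Rightarrow> has_coeffs Fm1 Fpi Fmi Fp1 F cm1 cpi cmi cp1"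
      then show "y = (a, b, c, d)" using coeffs_unique[OF _ c] by (cases y) auto
    qed (use c in simp)
  qed
  moreover have "d 2 * b 1 - d 1 * b 2 = \<xi>i"
    if "jost_choice q k Fm1 A B C" "\<forall>j. has_coeffs Fm1 A B C (\<Phi> j) (a j) (b j) (c j) (d j)" for A B C a b c d
    using \<xi>i_unambiguous[OF that(1)] that(2) by blast
  moreover have "\<gamma>p1 1 \<noteq> 0 \<Longrightarrow> \<gamma>p1 2 \<noteq> 0" using p1_symmetry by simp
  moreover have "(\<forall>j. b j = \<gamma>pi j \<and> c j = \<gamma>mi j) \<and> a 1 * c 2 - c 1 * a 2 = D"
    if "\<gamma>p1 1 = 0" "jost_choice q k Fm1 A B C" "\<forall>j. has_coeffs Fm1 A B C (\<Phi> j) (a j) (b j) (c j) (d j)" for A B C a b c d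
    using osc_unambiguous[OF that(1,2)] D_unambiguous[OF that(1,2)] that(3) by blast
  moreover have "cmod (\<gamma>pi 1) = cmod (\<gamma>mi 1)" "cmod (\<gamma>mi 1) = cmod (\<gamma>pi 2)" "cmod (\<gamma>pi 2) = cmod (\<gamma>mi 2)" "cmod (\<gamma>mi 2) \<noteq> 0"
    if "\<gamma>p1 1 = 0"
    using osc_cmod[OF that] osc_nonzero[OF that] by (simp_all add: osc_symmetry[OF that])
  moreover have "measure \<nu> {k\<^sup>2} = 1 / (2 * (L2_norm e)\<^sup>2) * ((cmod (\<gamma>pi 1))\<^sup>2 / (cmod D)\<^sup>2)" if "\<gamma>p1 1 = 0"
    using eigenvalue_residue(2)[OF that] unfolding scalar_jost_norm[OF assms(9)] by (simp add: mult.commute)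
  moreover note p1_symmetry \<xi>i_nonzero spectral_density p1_zero osc_symmetry D_nonzero eigenvalue_residue(3)
  \<comment> \<open>\<open>eigenvalue_iff\<close> turns the two cases into the alternative whether
    \<open>\<gamma>p1 1\<close> vanishes, for which every claim has been established.\<close>
  ultimately show ?thesis
    unfolding eigenvalue_iff \<xi>i_def[symmetric] D_def[symmetric] by blast
qed

end
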